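(* Let $\Sigma(A,B,C,\mathbf{G})$ be a system node on $(U,X,Y)$ with finite-dimensional input space $U$ and finite-dimensional output space $Y$. Then the following are equivalent: (1) $\Sigma(A,B,C,\mathbf{G})$ is $L^\infty$-BIBO stable. (2) $\Sigma(A,B,C,\mathbf{G})$ is $L^1$-LILO stable. If furthermore $A^*$ generates a $C_0$-semigroup on $X^*$, then (1) and (2) are also equivalent to each of: (3) the dual system node $\Sigma(A^*,C^*,B^*,\overline{\mathbf{G}}(\overline{\,\cdot\,}))$ is $L^\infty$-BIBO stable. (4) the dual system node $\Sigma(A^*,C^*,B^*,\overline{\mathbf{G}}(\overline{\,\cdot\,}))$ is $L^1$-LILO stable.
   Context: All Banach spaces are over $\mathbb{C}$. For $\alpha\in\mathbb{R}$, $\mathbb{C}_\alpha:=\{z\in\mathbb{C}:\mathrm{Re}\,z>\alpha\}$. $\mathcal{L}(X,Y)$ denotes the bounded operators from $X$ to $Y$, $\mathrm{D}(A)$ the domain and $\rho(A)$ the resolvent set of $A$. System node: Let $U,X,Y$ be Banach spaces (input, state and output space). A system node on $(U,X,Y)$ is a collection $\Sigma(A,B,C,\mathbf{G})$ where $A:\mathrm{D}(A)\subset X\to X$ generates a strongly continuous semigroup $\mathbb{T}=(\mathbb{T}(t))_{t\ge0}$ on $X$ with growth bound $\omega(\mathbb{T})$, $B\in\mathcal{L}(U,X_{-1})$, $C\in\mathcal{L}(X_1,Y)$, and $\mathbf{G}:\mathbb{C}_{\omega(\mathbb{T})}\to\mathcal{L}(U,Y)$ is analytic with $\mathbf{G}(\alpha)-\mathbf{G}(\beta)=C[(\alpha\mathbb{I}-A)^{-1}-(\beta\mathbb{I}-A)^{-1}]B$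 for all $\alpha,\beta\in\mathbb{C}_{\omega(\mathbb{T})}$. Here $X_1$ is $\mathrm{D}(A)$ with norm $\|x\|_{X_1}=\|(\beta\mathbb{I}-A)x\|_X$ and $X_{-1}$ is the completion of $X$ in the norm $\|x\|_{X_{-1}}=\|(\beta\mathbb{I}-A)^{-1}x\|_X$, for a fixed $\beta\in\rho(A)$; $A$, its resolvent and $\mathbb{T}$ are extended to $X_{-1}$ where needed (the extension of $\mathbb{T}$ is $\mathbb{T}_{-1}$). The combined observation/feedthrough operator $C\&D:\mathrm{D}(C\&D)\subset X\times U\to Y$ is $C\&D\begin{bmatrix}x\\ u\end{bmatrix}=C[x-(\beta\mathbb{I}-A)^{-1}Bu]+\mathbf{G}(\beta)u$ for some $\beta\in\mathbb{C}_{\omega(\mathbb{T})}$, with $\mathrm{D}(C\&D)=\{\begin{bmatrix}x\\ u\end{bmatrix}\in X\times U: Ax+Bu\in X\}$. Generalised (distributional) solution: a triple $(u,x,y)$ with $u\in L^1_{\mathrm{loc}}([0,\infty),U)$, $x\in C([0,\infty),X_{-1})$ given by $x(t)=\mathbb{T}(t)x_0+\int_0^t\mathbb{T}_{-1}(t-s)Bu(s)\,\mathrm{d}s$ for some $x_0\in X$, and $y$ the $Y$-valued distribution $y(t)=\frac{\mathrm{d}^2}{\mathrm{d}t^2}\left((C\&D)\int_0^t(t-s)\begin{bmatrix}x(s)\\ u(s)\end{bmatrix}\mathrm{d}s\right)$, $t\ge0$ (distributional derivative). $L^\infty$-BIBO stability: there exists $c>0$ such that for every generalised solution $(u,x,y)$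 with $u\in L^\infty_{\mathrm{loc}}([0,\infty),U)$ and $x(0)=0$ one has $y\in L^\infty_{\mathrm{loc}}([0,\infty),Y)$ and $\|y\|_{L^\infty([0,t],Y)}\le c\|u\|_{L^\infty([0,t],U)}$ for all $t>0$. $L^1$-LILO stability: there exists $c>0$ such that for every generalised solution $(u,x,y)$ with $u\in L^1_{\mathrm{loc}}([0,\infty),U)$ and $x(0)=0$ one has $y\in L^1_{\mathrm{loc}}([0,\infty),Y)$ and $\|y\|_{L^1([0,t],Y)}\le c\|u\|_{L^1([0,t],U)}$ for all $t>0$. Dual system node: $X^*$ denotes the dual space of bounded conjugate-linear functionals and $*$ the corresponding Banach space adjoint. If $A^*$ generates a strongly continuous semigroup $\mathbb{T}^*$ on $X^*$, the dual system node of $\Sigma(A,B,C,\mathbf{G})$ is the system node $\Sigma(A^*,C^*,B^*,\overline{\mathbf{G}}(\overline{\,\cdot\,}))$ on $(Y^*,X^*,U^* )$, where $\overline{\mathbf{G}}(\overline{\,\cdot\,})$ is the function $s\mapsto\mathbf{G}(\overline{s})^*\in\mathcal{L}(Y^*,U^* )$, and $(X_1)^*=(X^* )_{-1}$, $(X_{-1})^*=(X^* )_1$ (the spaces on the right being built from $A^*$), so that $C^*\in\mathcal{L}(Y^*,(X^* )_{-1})$ and $B^*\in\mathcal{L}((X^* )_1,U^* )$. *)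

theory Defs
  imports "HOL-Analysis.Analysis" "HOL-Probability.Essential_Supremum"
begin

section \<open>Complex Banach spaces\<close>

class complex_banach = banach +
  fixes scaleC :: "complex \<Rightarrow> 'a \<Rightarrow> 'a"  (infixr \<open>*\<^sub>C\<close> 75)
  assumes scaleC_add_right: "c *\<^sub>C (x + y) = c *\<^sub>C x + c *\<^sub>C y"
    and scaleC_add_left: "(c + d) *\<^sub>C x = c *\<^sub>C x + d *\<^sub>C x"
    and scaleC_scaleC: "c *\<^sub>C d *\<^sub>C x = (c * d) *\<^sub>C x"
    and scaleC_of_real: "of_real r *\<^sub>C x = r *\<^sub>R x"
    and norm_scaleC: "norm (c *\<^sub>C x) = cmod c * norm x"

lemma vector_space_scaleC: "vector_space (scaleC :: complex \<Rightarrow> 'a::complex_banach \<Rightarrow> 'a)"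
proof
  show "1 *\<^sub>C x = x" for x :: 'a
    using scaleC_of_real[of 1 x] by simp
qed (simp_all add: scaleC_add_right scaleC_add_left scaleC_scaleC)

lemma bounded_linear_scaleC: "bounded_linear (\<lambda>x::'a::complex_banach. c *\<^sub>C x)"
proof (rule bounded_linear_intro[of _ "cmod c"])
  show "c *\<^sub>C r *\<^sub>R x = r *\<^sub>R c *\<^sub>C x" for r and x :: 'a
    by (metis scaleC_of_real scaleC_scaleC mult.commute)
qed (simp_all add: scaleC_add_right norm_scaleC)

instantiation complex :: complex_banach
begin

definition scaleC_complex :: "complex \<Rightarrow> complex \<Rightarrow> complex"
  where "scaleC_complex c z = c * z"

instance
  by standard (simp_all add: scaleC_complex_def algebra_simps norm_mult scaleR_conv_of_real)

end

definition finite_dimensional :: "'a::complex_banach itself \<Rightarrow> bool"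
  where "finite_dimensional _ \<longleftrightarrow>
    (\<exists>b::'a set. finite b \<and> module.span scaleC b = UNIV)"


section \<open>Bounded operators\<close>

typedef (overloaded) ('a, 'b) cblinfun (\<open>(_ \<Rightarrow>\<^sub>C\<^sub>L /_)\<close> [22, 21] 21) =
  "{f :: 'a::complex_banach \<Rightarrow> 'b::complex_banach.
      bounded_linear f \<and> (\<forall>c x. f (c *\<^sub>C x) = c *\<^sub>C f x)}"
  morphisms cblinfun_apply Abs_cblinfun
proof
  show "(\<lambda>_. 0) \<in> {f :: 'a \<Rightarrow> 'b. bounded_linear f \<and> (\<forall>c x. f (c *\<^sub>C x) = c *\<^sub>C f x)}"
    by (simp add: linear_0[OF bounded_linear.linear[OF bounded_linear_scaleC]])
qed

declare [[coercion
    "cblinfun_apply :: ('a::complex_banach \<Rightarrow>\<^sub>C\<^sub>L 'b::complex_banach) \<Rightarrow> 'a \<Rightarrow> 'b"]]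

setup_lifting type_definition_cblinfun

lemma cblinfun_eqI: "(\<And>x. cblinfun_apply F x = cblinfun_apply G x) \<Longrightarrow> F = G"
  by transfer auto

lemma bounded_linear_cblinfun_apply: "bounded_linear (cblinfun_apply F)"
  using cblinfun_apply by blast

lemma cblinfun_scaleC: "cblinfun_apply F (c *\<^sub>C x) = c *\<^sub>C cblinfun_apply F x"
  using cblinfun_apply by blast

instantiation cblinfun :: (complex_banach, complex_banach) real_normed_vector
begin

lift_definition norm_cblinfun :: "'a \<Rightarrow>\<^sub>C\<^sub>L 'b \<Rightarrow> real" is onorm .

lift_definition minus_cblinfun :: "'a \<Rightarrow>\<^sub>C\<^sub>L 'b \<Rightarrow> 'a \<Rightarrow>\<^sub>C\<^sub>L 'b \<Rightarrow> 'a \<Rightarrow>\<^sub>C\<^sub>L 'b"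
  is "\<lambda>f g x. f x - g x"
  by (auto simp: bounded_linear_sub linear_diff[OF bounded_linear.linear[OF bounded_linear_scaleC]])

definition dist_cblinfun :: "'a \<Rightarrow>\<^sub>C\<^sub>L 'b \<Rightarrow> 'a \<Rightarrow>\<^sub>C\<^sub>L 'b \<Rightarrow> real"
  where "dist_cblinfun a b = norm (a - b)"

definition
  "(uniformity :: (('a \<Rightarrow>\<^sub>C\<^sub>L 'b) \<times> ('a \<Rightarrow>\<^sub>C\<^sub>L 'b)) filter) = (INF e\<in>{0 <..}. principal {(x, y). dist x y < e})"

definition open_cblinfun :: "('a \<Rightarrow>\<^sub>C\<^sub>L 'b) set \<Rightarrow> bool"
  where "open_cblinfun S = (\<forall>x\<in>S. \<forall>\<^sub>F (x', y) in uniformity. x' = x \<longrightarrow> y \<in> S)"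

lift_definition uminus_cblinfun :: "'a \<Rightarrow>\<^sub>C\<^sub>L 'b \<Rightarrow> 'a \<Rightarrow>\<^sub>C\<^sub>L 'b" is "\<lambda>f x. - f x"
  by (auto simp: bounded_linear_minus linear_neg[OF bounded_linear.linear[OF bounded_linear_scaleC]])

lift_definition zero_cblinfun :: "'a \<Rightarrow>\<^sub>C\<^sub>L 'b" is "\<lambda>x. 0"
  by (auto simp: linear_0[OF bounded_linear.linear[OF bounded_linear_scaleC]])

lift_definition plus_cblinfun :: "'a \<Rightarrow>\<^sub>C\<^sub>L 'b \<Rightarrow> 'a \<Rightarrow>\<^sub>C\<^sub>L 'b \<Rightarrow> 'a \<Rightarrow>\<^sub>C\<^sub>L 'b"
  is "\<lambda>f g x. f x + g x"
  by (auto simp: bounded_linear_add scaleC_add_right)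

lift_definition scaleR_cblinfun :: "real \<Rightarrow> 'a \<Rightarrow>\<^sub>C\<^sub>L 'b \<Rightarrow> 'a \<Rightarrow>\<^sub>C\<^sub>L 'b" is "\<lambda>r f x. r *\<^sub>R f x"
  by (auto simp: linear_scale[OF bounded_linear.linear[OF bounded_linear_scaleC]]
      bounded_linear_compose[OF bounded_linear_scaleR_right])

definition sgn_cblinfun :: "'a \<Rightarrow>\<^sub>C\<^sub>L 'b \<Rightarrow> 'a \<Rightarrow>\<^sub>C\<^sub>L 'b"
  where "sgn_cblinfun x = scaleR (inverse (norm x)) x"

instance
  apply standard
  unfolding dist_cblinfun_def open_cblinfun_def sgn_cblinfun_def uniformity_cblinfun_def
  apply (rule refl | (transfer, force simp: onorm_triangle onorm_scaleR onorm_eq_0 algebra_simps))+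
  done

end

instance cblinfun :: (complex_banach, complex_banach) banach
proof
  fix X :: "nat \<Rightarrow> 'a \<Rightarrow>\<^sub>C\<^sub>L 'b"
  assume X: "Cauchy X"
  define Y where "Y n = Blinfun (cblinfun_apply (X n))" for n
  have Y: "blinfun_apply (Y n) = cblinfun_apply (X n)" for n
    by (simp add: Y_def bounded_linear_Blinfun_apply bounded_linear_cblinfun_apply)
  have nrm: "norm (Y m - Y n) = norm (X m - X n)" for m n
    by (simp add: norm_blinfun.rep_eq norm_cblinfun.rep_eq minus_blinfun.rep_eq
        minus_cblinfun.rep_eq Y)
  have "Cauchy Y"
    using X by (simp add: Cauchy_iff nrm)
  then obtain L where L: "Y \<longlonglongrightarrow> L"
    by (auto simp: Cauchy_convergent_iff convergent_def)
  have ap: "(\<lambda>n. cblinfun_apply (X n) x) \<longlonglongrightarrow> L x" for x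
    using bounded_linear.tendsto[OF blinfun.bounded_linear_left L, of x] by (simp add: Y)
  have hom: "L (c *\<^sub>C x) = c *\<^sub>C L x" for c x
    using LIMSEQ_unique[OF ap[of "c *\<^sub>C x"]
        bounded_linear.tendsto[OF bounded_linear_scaleC ap[of x], of c, folded cblinfun_scaleC]] .
  define M where "M = Abs_cblinfun (blinfun_apply L)"
  have M: "cblinfun_apply M = blinfun_apply L"
    unfolding M_def by (rule Abs_cblinfun_inverse) (simp add: hom bounded_linear_intros)
  have "norm (X n - M) = norm (Y n - L)" for n
    by (simp add: norm_blinfun.rep_eq norm_cblinfun.rep_eq minus_blinfun.rep_eq
        minus_cblinfun.rep_eq Y M)
  then have "X \<longlonglongrightarrow> M"
    using L by (simp add: LIMSEQ_iff)
  then show "convergent X"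
    by (auto simp: convergent_def)
qed

instantiation cblinfun :: (complex_banach, complex_banach) complex_banach
begin

lift_definition scaleC_cblinfun :: "complex \<Rightarrow> 'a \<Rightarrow>\<^sub>C\<^sub>L 'b \<Rightarrow> 'a \<Rightarrow>\<^sub>C\<^sub>L 'b" is "\<lambda>c f x. c *\<^sub>C f x"
  by (auto simp: scaleC_scaleC mult.commute bounded_linear_compose[OF bounded_linear_scaleC])

instance
proof
  fix c d :: complex and r :: real and F G :: "'a \<Rightarrow>\<^sub>C\<^sub>L 'b"
  show "c *\<^sub>C (F + G) = c *\<^sub>C F + c *\<^sub>C G"
    by transfer (simp add: scaleC_add_right)
  show "(c + d) *\<^sub>C F = c *\<^sub>C F + d *\<^sub>C F"
    by transfer (simp add: scaleC_add_left)
  show "c *\<^sub>C d *\<^sub>C F = (c * d) *\<^sub>C F"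
    by transfer (simp add: scaleC_scaleC)
  show "of_real r *\<^sub>C F = r *\<^sub>R F"
    by transfer (simp add: scaleC_of_real)
  have "onorm (\<lambda>x. c *\<^sub>C f x) = onorm (\<lambda>x. cmod c *\<^sub>R f x)" for f :: "'a \<Rightarrow> 'b"
    by (simp add: onorm_def norm_scaleC)
  then show "norm (c *\<^sub>C F) = cmod c * norm F"
    by transfer (simp add: onorm_scaleR)
qed

end


section \<open>The dual space of bounded conjugate-linear functionals, and adjoints\<close>

typedef (overloaded) 'a antidual =
  "{f :: 'a::complex_banach \<Rightarrow> complex.
      bounded_linear f \<and> (\<forall>c x. f (c *\<^sub>C x) = cnj c * f x)}"
  morphisms antidual_apply Abs_antidual
  by (rule exI[of _ "\<lambda>_. 0"]) simp

declare [[coercion "antidual_apply :: 'a::complex_banach antidual \<Rightarrow> 'a \<Rightarrow> complex"]]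

setup_lifting type_definition_antidual

lemma antidual_eqI: "(\<And>x. antidual_apply f x = antidual_apply g x) \<Longrightarrow> f = g"
  by transfer auto

lemma bounded_linear_antidual_apply: "bounded_linear (antidual_apply f)"
  using antidual_apply by blast

lemma antidual_scaleC: "antidual_apply f (c *\<^sub>C x) = cnj c * antidual_apply f x"
  using antidual_apply by blast

instantiation antidual :: (complex_banach) real_normed_vector
begin

lift_definition norm_antidual :: "'a antidual \<Rightarrow> real" is onorm .

lift_definition minus_antidual :: "'a antidual \<Rightarrow> 'a antidual \<Rightarrow> 'a antidual"
  is "\<lambda>f g x. f x - g x"
  by (auto simp: bounded_linear_sub algebra_simps)

definition dist_antidual :: "'a antidual \<Rightarrow> 'a antidual \<Rightarrow> real"
  where "dist_antidual a b = norm (a - b)"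

definition
  "(uniformity :: ('a antidual \<times> 'a antidual) filter) = (INF e\<in>{0 <..}. principal {(x, y). dist x y < e})"

definition open_antidual :: "'a antidual set \<Rightarrow> bool"
  where "open_antidual S = (\<forall>x\<in>S. \<forall>\<^sub>F (x', y) in uniformity. x' = x \<longrightarrow> y \<in> S)"

lift_definition uminus_antidual :: "'a antidual \<Rightarrow> 'a antidual" is "\<lambda>f x. - f x"
  by (auto simp: bounded_linear_minus)

lift_definition zero_antidual :: "'a antidual" is "\<lambda>x. 0"
  by auto

lift_definition plus_antidual :: "'a antidual \<Rightarrow> 'a antidual \<Rightarrow> 'a antidual"
  is "\<lambda>f g x. f x + g x"
  by (auto simp: bounded_linear_add algebra_simps)

lift_definition scaleR_antidual :: "real \<Rightarrow> 'a antidual \<Rightarrow> 'a antidual" is "\<lambda>r f x. r *\<^sub>R f x"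
  by (auto simp: bounded_linear_compose[OF bounded_linear_scaleR_right])

definition sgn_antidual :: "'a antidual \<Rightarrow> 'a antidual"
  where "sgn_antidual x = scaleR (inverse (norm x)) x"

instance
  apply standard
  unfolding dist_antidual_def open_antidual_def sgn_antidual_def uniformity_antidual_def
  apply (rule refl | (transfer, force simp: onorm_triangle onorm_scaleR onorm_eq_0 algebra_simps))+
  done

end

instance antidual :: (complex_banach) banach
proof
  fix X :: "nat \<Rightarrow> 'a antidual"
  assume X: "Cauchy X"
  define Y where "Y n = Blinfun (antidual_apply (X n))" for n
  have Y: "blinfun_apply (Y n) = antidual_apply (X n)" for n
    by (simp add: Y_def bounded_linear_Blinfun_apply bounded_linear_antidual_apply)
  have nrm: "norm (Y m - Y n) = norm (X m - X n)" for m n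
    by (simp add: norm_blinfun.rep_eq norm_antidual.rep_eq minus_blinfun.rep_eq
        minus_antidual.rep_eq Y)
  have "Cauchy Y"
    using X by (simp add: Cauchy_iff nrm)
  then obtain L where L: "Y \<longlonglongrightarrow> L"
    by (auto simp: Cauchy_convergent_iff convergent_def)
  have ap: "(\<lambda>n. antidual_apply (X n) x) \<longlonglongrightarrow> L x" for x
    using bounded_linear.tendsto[OF blinfun.bounded_linear_left L, of x] by (simp add: Y)
  have hom: "L (c *\<^sub>C x) = cnj c * L x" for c x
    using LIMSEQ_unique[OF ap[of "c *\<^sub>C x"]
        tendsto_mult_left[OF ap[of x], of "cnj c", folded antidual_scaleC]] .
  define M where "M = Abs_antidual (blinfun_apply L)"
  have M: "antidual_apply M = blinfun_apply L"
    unfolding M_def by (rule Abs_antidual_inverse) (simp add: hom bounded_linear_intros)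
  have "norm (X n - M) = norm (Y n - L)" for n
    by (simp add: norm_blinfun.rep_eq norm_antidual.rep_eq minus_blinfun.rep_eq
        minus_antidual.rep_eq Y M)
  then have "X \<longlonglongrightarrow> M"
    using L by (simp add: LIMSEQ_iff)
  then show "convergent X"
    by (auto simp: convergent_def)
qed

instantiation antidual :: (complex_banach) complex_banach
begin

lift_definition scaleC_antidual :: "complex \<Rightarrow> 'a antidual \<Rightarrow> 'a antidual" is "\<lambda>c f x. c * f x"
  by (auto simp: algebra_simps bounded_linear_compose[OF bounded_linear_mult_right])

instance
proof
  fix c d :: complex and r :: real and f g :: "'a antidual"
  show "c *\<^sub>C (f + g) = c *\<^sub>C f + c *\<^sub>C g"
    by transfer (simp add: algebra_simps)
  show "(c + d) *\<^sub>C f = c *\<^sub>C f + d *\<^sub>C f"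
    by transfer (simp add: algebra_simps)
  show "c *\<^sub>C d *\<^sub>C f = (c * d) *\<^sub>C f"
    by transfer (simp add: algebra_simps)
  show "of_real r *\<^sub>C f = r *\<^sub>R f"
    by transfer (simp add: scaleR_conv_of_real)
  have "onorm (\<lambda>x. c * f x) = onorm (\<lambda>x. cmod c *\<^sub>R f x)" for f :: "'a \<Rightarrow> complex"
    by (simp add: onorm_def norm_mult)
  then show "norm (c *\<^sub>C f) = cmod c * norm f"
    by transfer (simp add: onorm_scaleR)
qed

end

lift_definition antidual_comp ::
  "'b::complex_banach antidual \<Rightarrow> 'a::complex_banach \<Rightarrow>\<^sub>C\<^sub>L 'b \<Rightarrow> 'a antidual"
  is "\<lambda>f F x. f (F x)"
  by (auto intro: bounded_linear_compose)

lift_definition adjoint ::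
  "'a::complex_banach \<Rightarrow>\<^sub>C\<^sub>L 'b::complex_banach \<Rightarrow> 'b antidual \<Rightarrow>\<^sub>C\<^sub>L 'a antidual"
  is "\<lambda>F f. antidual_comp f F"
proof (intro conjI allI)
  fix F :: "'a \<Rightarrow>\<^sub>C\<^sub>L 'b"
  have nb: "norm (antidual_apply f x) \<le> norm f * norm x" for f :: "'c::complex_banach antidual" and x
    by (simp add: norm_antidual.rep_eq onorm bounded_linear_antidual_apply)
  have nF: "norm (F x) \<le> norm F * norm x" for x
    by (simp add: norm_cblinfun.rep_eq onorm bounded_linear_cblinfun_apply)
  show "bounded_linear (\<lambda>f. antidual_comp f F)"
  proof (rule bounded_linear_intro[of _ "norm F"])
    show "antidual_comp (f + g) F = antidual_comp f F + antidual_comp g F" for f g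
      by (rule antidual_eqI) (simp add: antidual_comp.rep_eq plus_antidual.rep_eq)
    show "antidual_comp (r *\<^sub>R f) F = r *\<^sub>R antidual_comp f F" for r f
      by (rule antidual_eqI) (simp add: antidual_comp.rep_eq scaleR_antidual.rep_eq)
    show "norm (antidual_comp f F) \<le> norm f * norm F" for f
      unfolding norm_antidual.rep_eq[of "antidual_comp f F"]
    proof (rule onorm_bound)
      fix x
      have "norm (antidual_apply (antidual_comp f F) x) \<le> norm f * norm (F x)"
        by (simp add: antidual_comp.rep_eq nb)
      also have "\<dots> \<le> norm f * (norm F * norm x)"
        by (intro mult_left_mono nF) simp
      finally show "norm (antidual_apply (antidual_comp f F) x) \<le> norm f * norm F * norm x"
        by (simp add: mult.assoc)
    qed simp
  qed
  show "antidual_comp (c *\<^sub>C f) F = c *\<^sub>C antidual_comp f F" for c f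
    by (rule antidual_eqI) (simp add: antidual_comp.rep_eq scaleC_antidual.rep_eq)
qed

lemma adjoint_apply: "antidual_apply (cblinfun_apply (adjoint F) f) x = f (F x)"
  by (simp add: adjoint.rep_eq antidual_comp.rep_eq)


section \<open>Unbounded operators and strongly continuous semigroups\<close>

text \<open>An unbounded operator on \<open>'x\<close> is given by its graph. The adjoint is taken only of densely
  defined operators, for which it is again a graph.\<close>

definition adjoint_op ::
  "('x::complex_banach \<times> 'x) set \<Rightarrow> ('x antidual \<times> 'x antidual) set"
  where "adjoint_op A = {(f, g). \<forall>(x, y)\<in>A. antidual_apply f y = antidual_apply g x}"

definition is_resolvent :: "('x::complex_banach \<times> 'x) set \<Rightarrow> complex \<Rightarrow> 'x \<Rightarrow>\<^sub>C\<^sub>L 'x \<Rightarrow> bool"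
  where "is_resolvent A l R \<longleftrightarrow> (\<forall>x z. R z = x \<longleftrightarrow> (x, l *\<^sub>C x - z) \<in> A)"

definition resolvent_set :: "('x::complex_banach \<times> 'x) set \<Rightarrow> complex set"
  where "resolvent_set A = {l. \<exists>R. is_resolvent A l R}"

definition resolvent :: "('x::complex_banach \<times> 'x) set \<Rightarrow> complex \<Rightarrow> 'x \<Rightarrow>\<^sub>C\<^sub>L 'x"
  where "resolvent A l = (THE R. is_resolvent A l R)"

text \<open>Only the values for \<open>t \<ge> 0\<close> of a semigroup \<open>T :: real \<Rightarrow> _\<close> are meaningful.\<close>

definition C0_semigroup :: "(real \<Rightarrow> 'x::complex_banach \<Rightarrow>\<^sub>C\<^sub>L 'x) \<Rightarrow> bool"
  where "C0_semigroup T \<longleftrightarrow>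
    (\<forall>x. T 0 x = x) \<and>
    (\<forall>s\<ge>0. \<forall>t\<ge>0. \<forall>x. T (s + t) x = T s (T t x)) \<and>
    (\<forall>x. ((\<lambda>t. T t x) \<longlongrightarrow> x) (at_right 0))"

definition generator :: "(real \<Rightarrow> 'x::complex_banach \<Rightarrow>\<^sub>C\<^sub>L 'x) \<Rightarrow> ('x \<times> 'x) set"
  where "generator T = {(x, y). ((\<lambda>h. (T h x - x) /\<^sub>R h) \<longlongrightarrow> y) (at_right 0)}"

definition generates_semigroup :: "('x::complex_banach \<times> 'x) set \<Rightarrow> bool"
  where "generates_semigroup A \<longleftrightarrow> (\<exists>T. C0_semigroup T \<and> generator T = A)"

definition semigroup_of :: "('x::complex_banach \<times> 'x) set \<Rightarrow> real \<Rightarrow> 'x \<Rightarrow>\<^sub>C\<^sub>L 'x"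
  where "semigroup_of A = (SOME T. C0_semigroup T \<and> generator T = A)"

text \<open>The growth bound may be \<open>-\<infinity>\<close>.\<close>

definition growth_bound :: "(real \<Rightarrow> 'x::complex_banach \<Rightarrow>\<^sub>C\<^sub>L 'x) \<Rightarrow> ereal"
  where "growth_bound T = Inf {ereal w |w. \<exists>M. \<forall>t\<ge>0. norm (T t) \<le> M * exp (w * t)}"

definition half_plane :: "ereal \<Rightarrow> complex set"
  where "half_plane a = {z. a < ereal (Re z)}"


section \<open>System nodes\<close>

text \<open>The spaces \<open>X\<^sub>1\<close> and \<open>X\<^sub>-\<^sub>1\<close> depend on the operator \<open>A\<close> and so cannot be types
  constructed from the type of \<open>X\<close>. They are represented by arbitrary types \<open>'x1\<close> and \<open>'xm\<close>
  together with embeddings \<open>emb1 : X\<^sub>1 \<rightarrow> X\<close> and \<open>embm : X \<rightarrow> X\<^sub>-\<^sub>1\<close>: the first identifies \<open>'x1\<close>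
  isometrically with the domain of \<open>A\<close> under the norm of \<open>X\<^sub>1\<close>, the second makes \<open>'xm\<close> a
  completion of \<open>X\<close> in the norm of \<open>X\<^sub>-\<^sub>1\<close>. Such types always exist: both may be taken to be
  \<open>'x\<close>, with both embeddings equal to the resolvent at \<open>\<beta>\<close>.\<close>

record (overloaded) ('u, 'x1, 'x, 'xm, 'y) node =
  emb1 :: "'x1::complex_banach \<Rightarrow>\<^sub>C\<^sub>L 'x::complex_banach"
  embm :: "'x \<Rightarrow>\<^sub>C\<^sub>L 'xm::complex_banach"
  opA :: "('x \<times> 'x) set"
  opB :: "'u::complex_banach \<Rightarrow>\<^sub>C\<^sub>L 'xm"
  opC :: "'x1 \<Rightarrow>\<^sub>C\<^sub>L 'y::complex_banach"
  tfG :: "complex \<Rightarrow> 'u \<Rightarrow>\<^sub>C\<^sub>L 'y"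

definition is_X1 :: "('x::complex_banach \<times> 'x) set \<Rightarrow> complex \<Rightarrow> 'x1::complex_banach \<Rightarrow>\<^sub>C\<^sub>L 'x \<Rightarrow> bool"
  where "is_X1 A \<beta> k \<longleftrightarrow>
    range k = Domain A \<and> (\<forall>w y. (k w, y) \<in> A \<longrightarrow> norm w = norm (\<beta> *\<^sub>C k w - y))"

definition is_Xm :: "('x::complex_banach \<times> 'x) set \<Rightarrow> complex \<Rightarrow> 'x \<Rightarrow>\<^sub>C\<^sub>L 'xm::complex_banach \<Rightarrow> bool"
  where "is_Xm A \<beta> j \<longleftrightarrow>
    closure (range j) = UNIV \<and> (\<forall>x. norm (j x) = norm (resolvent A \<beta> x))"

text \<open>The extensions by continuity \<open>A : X \<rightarrow> X\<^sub>-\<^sub>1\<close>, \<open>(\<lambda> - A)\<^sup>-\<^sup>1 : X\<^sub>-\<^sub>1 \<rightarrow> X\<close> and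
  \<open>\<T>\<^sub>-\<^sub>1(t) : X\<^sub>-\<^sub>1 \<rightarrow> X\<^sub>-\<^sub>1\<close>.\<close>

definition A_ext :: "('u::complex_banach, 'x1::complex_banach, 'x::complex_banach,
    'xm::complex_banach, 'y::complex_banach) node \<Rightarrow> 'x \<Rightarrow>\<^sub>C\<^sub>L 'xm"
  where "A_ext S = (THE F :: 'x \<Rightarrow>\<^sub>C\<^sub>L 'xm. \<forall>(x, y)\<in>opA S. F x = embm S y)"

definition R_ext :: "('u::complex_banach, 'x1::complex_banach, 'x::complex_banach,
    'xm::complex_banach, 'y::complex_banach) node \<Rightarrow> complex \<Rightarrow> 'xm \<Rightarrow>\<^sub>C\<^sub>L 'x"
  where "R_ext S l = (THE F :: 'xm \<Rightarrow>\<^sub>C\<^sub>L 'x. \<forall>x. F (embm S x) = resolvent (opA S) l x)"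

definition T_ext :: "('u::complex_banach, 'x1::complex_banach, 'x::complex_banach,
    'xm::complex_banach, 'y::complex_banach) node \<Rightarrow> real \<Rightarrow> 'xm \<Rightarrow>\<^sub>C\<^sub>L 'xm"
  where "T_ext S t = (THE F :: 'xm \<Rightarrow>\<^sub>C\<^sub>L 'xm. \<forall>x. F (embm S x) = embm S (semigroup_of (opA S) t x))"

definition node_half_plane :: "('u::complex_banach, 'x1::complex_banach, 'x::complex_banach,
    'xm::complex_banach, 'y::complex_banach) node \<Rightarrow> complex set"
  where "node_half_plane S = half_plane (growth_bound (semigroup_of (opA S)))"

text \<open>Analyticity in the operator norm (the library's \<open>holomorphic_on\<close> is for scalar-valued
  functions), on open sets.\<close>

definition analytic_vec :: "(complex \<Rightarrow> 'a::complex_banach) \<Rightarrow> complex set \<Rightarrow> bool"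
  where "analytic_vec g D \<longleftrightarrow>
    (\<forall>z\<in>D. \<exists>g'. ((\<lambda>h. inverse h *\<^sub>C (g (z + h) - g z)) \<longlongrightarrow> g') (at 0))"

definition system_node :: "('u::complex_banach, 'x1::complex_banach, 'x::complex_banach,
    'xm::complex_banach, 'y::complex_banach) node \<Rightarrow> bool"
  where "system_node S \<longleftrightarrow>
    generates_semigroup (opA S) \<and>
    (\<exists>\<beta>\<in>resolvent_set (opA S). is_X1 (opA S) \<beta> (emb1 S) \<and> is_Xm (opA S) \<beta> (embm S)) \<and>
    analytic_vec (tfG S) (node_half_plane S) \<and>
    (\<forall>a\<in>node_half_plane S. \<forall>b\<in>node_half_plane S. \<forall>u. \<exists>w.
       emb1 S w = R_ext S a (opB S u) - R_ext S b (opB S u) \<and>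
       tfG S a u - tfG S b u = opC S w)"

text \<open>The graph of \<open>C&D\<close>.\<close>

definition CD :: "('u::complex_banach, 'x1::complex_banach, 'x::complex_banach,
    'xm::complex_banach, 'y::complex_banach) node \<Rightarrow> (('x \<times> 'u) \<times> 'y) set"
  where "CD S = {((x, u), y).
    A_ext S x + opB S u \<in> range (embm S) \<and>
    (\<exists>\<beta>\<in>node_half_plane S. \<exists>w.
       emb1 S w = x - R_ext S \<beta> (opB S u) \<and> y = opC S w + tfG S \<beta> u)}"

text \<open>The dual node lives on \<open>(X\<^sub>-\<^sub>1)\<^sup>* \<rightarrow> X\<^sup>* \<rightarrow> (X\<^sub>1)\<^sup>*\<close>, which realises
  \<open>(X\<^sup>*)\<^sub>1 \<rightarrow> X\<^sup>* \<rightarrow> (X\<^sup>*)\<^sub>-\<^sub>1\<close>.\<close>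

definition dual_node :: "('u::complex_banach, 'x1::complex_banach, 'x::complex_banach,
    'xm::complex_banach, 'y::complex_banach) node \<Rightarrow>
    ('y antidual, 'xm antidual, 'x antidual, 'x1 antidual, 'u antidual) node"
  where "dual_node S =
    \<lparr>emb1 = adjoint (embm S),
     embm = adjoint (emb1 S),
     opA = adjoint_op (opA S),
     opB = adjoint (opC S),
     opC = adjoint (opB S),
     tfG = (\<lambda>s. adjoint (tfG S (cnj s)))\<rparr>"


section \<open>Local Lebesgue spaces on the half-line and distributions\<close>

text \<open>\<open>measurable_on\<close> (almost everywhere limit of continuous functions) is strong Lebesgue
  measurability, also for nonseparable ranges. The library's Bochner integral is restricted to
  separable spaces, so vector-valued integrals are Henstock-Kurzweil integrals \<open>integral\<close>; for
  Bochner integrable functions both integrals exist and agree, and for nonnegative real functions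
  the Henstock-Kurzweil integral is the Lebesgue integral.\<close>

definition L1_loc :: "(real \<Rightarrow> 'a::complex_banach) \<Rightarrow> bool"
  where "L1_loc f \<longleftrightarrow>
    f measurable_on {0..} \<and> (\<forall>t>0. (\<lambda>s. norm (f s)) integrable_on {0..t})"

definition L1_norm :: "real \<Rightarrow> (real \<Rightarrow> 'a::complex_banach) \<Rightarrow> real"
  where "L1_norm t f = integral {0..t} (\<lambda>s. norm (f s))"

definition Linf_norm :: "real \<Rightarrow> (real \<Rightarrow> 'a::complex_banach) \<Rightarrow> ereal"
  where "Linf_norm t f = esssup (lebesgue_on {0..t}) (\<lambda>s. ereal (norm (f s)))"

definition Linf_loc :: "(real \<Rightarrow> 'a::complex_banach) \<Rightarrow> bool"
  where "Linf_loc f \<longleftrightarrow> f measurable_on {0..} \<and> (\<forall>t>0. Linf_norm t f < \<infinity>)"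

definition test_function :: "(real \<Rightarrow> complex) \<Rightarrow> bool"
  where "test_function \<phi> \<longleftrightarrow>
    (\<forall>n. ((\<lambda>f t. vector_derivative f (at t)) ^^ n) \<phi> differentiable_on UNIV) \<and>
    bounded {t. \<phi> t \<noteq> 0}"

text \<open>A \<open>'y\<close>-valued distribution is represented by its action on test functions. Functions on
  \<open>[0, \<infinity>)\<close> are regarded as distributions on the real line supported in \<open>[0, \<infinity>)\<close>; in particular,
  a distributional derivative retains point masses at \<open>0\<close>.\<close>

definition is_regular_distribution ::
  "((real \<Rightarrow> complex) \<Rightarrow> 'y::complex_banach) \<Rightarrow> (real \<Rightarrow> 'y) \<Rightarrow> bool"
  where "is_regular_distribution y f \<longleftrightarrow>
    (\<forall>\<phi>. test_function \<phi> \<longrightarrow> y \<phi> = integral {0..} (\<lambda>t. \<phi> t *\<^sub>C f t))"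

definition is_second_derivative ::
  "((real \<Rightarrow> complex) \<Rightarrow> 'y::complex_banach) \<Rightarrow> (real \<Rightarrow> 'y) \<Rightarrow> bool"
  where "is_second_derivative y f \<longleftrightarrow>
    (\<forall>\<phi>. test_function \<phi> \<longrightarrow> y \<phi> =
       integral {0..} (\<lambda>t. ((\<lambda>f t. vector_derivative f (at t)) ^^ 2) \<phi> t *\<^sub>C f t))"


section \<open>Generalised solutions and stability\<close>

definition generalised_solution :: "('u::complex_banach, 'x1::complex_banach, 'x::complex_banach,
    'xm::complex_banach, 'y::complex_banach) node \<Rightarrow>
    (real \<Rightarrow> 'u) \<Rightarrow> (real \<Rightarrow> 'xm) \<Rightarrow> ((real \<Rightarrow> complex) \<Rightarrow> 'y) \<Rightarrow> bool"
  where "generalised_solution S u x y \<longleftrightarrow>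
    L1_loc u \<and>
    continuous_on {0..} x \<and>
    (\<exists>x0. \<forall>t\<ge>0. x t = embm S (semigroup_of (opA S) t x0) +
        integral {0..t} (\<lambda>s. T_ext S (t - s) (opB S (u s)))) \<and>
    (\<exists>z F.
       (\<forall>t\<ge>0. embm S (z t) = integral {0..t} (\<lambda>s. (t - s) *\<^sub>R x s) \<and>
              ((z t, integral {0..t} (\<lambda>s. (t - s) *\<^sub>R u s)), F t) \<in> CD S) \<and>
       is_second_derivative y F)"

definition BIBO_stable :: "('u::complex_banach, 'x1::complex_banach, 'x::complex_banach,
    'xm::complex_banach, 'y::complex_banach) node \<Rightarrow> bool"
  where "BIBO_stable S \<longleftrightarrow>
    (\<exists>c>0. \<forall>u x y. generalised_solution S u x y \<and> Linf_loc u \<and> x 0 = 0 \<longrightarrow>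
       (\<exists>f. is_regular_distribution y f \<and> Linf_loc f \<and>
            (\<forall>t>0. Linf_norm t f \<le> ereal c * Linf_norm t u)))"

definition LILO_stable :: "('u::complex_banach, 'x1::complex_banach, 'x::complex_banach,
    'xm::complex_banach, 'y::complex_banach) node \<Rightarrow> bool"
  where "LILO_stable S \<longleftrightarrow>
    (\<exists>c>0. \<forall>u x y. generalised_solution S u x y \<and> L1_loc u \<and> x 0 = 0 \<longrightarrow>
       (\<exists>f. is_regular_distribution y f \<and> L1_loc f \<and>
            (\<forall>t>0. L1_norm t f \<le> c * L1_norm t u)))"

end

theory Submission
  imports Defs
begin

text \<open>
  Both kinds of stability are properties of one convolution kernel. Let \<open>R = (\<beta> - A)\<^sup>-\<^sup>1\<close>, let
  \<open>b : U \<rightarrow> X\<close> be \<open>B\<close> followed by the extension of \<open>R\<close> to \<open>X\<^sub>-\<^sub>1\<close>, and let \<open>c : X \<rightarrow> Y\<close> be \<open>R\<close>, as a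
  map to \<open>X\<^sub>1\<close>, followed by \<open>C\<close>; both are bounded. A solution with \<open>x(0) = 0\<close> has as output the second
  distributional derivative of \<open>\<Psi> * u\<close>, where the continuous kernel \<open>\<Psi>\<close> with values in
  \<open>L(U, Y)\<close> is built from \<open>b\<close>, \<open>c\<close> and integrals of the semigroup.

  As \<open>U\<close> and \<open>Y\<close> are finite-dimensional, \<open>\<Psi>\<close> may be treated entrywise. For a scalar kernel \<open>\<psi>\<close>, each
  of the two stability properties is equivalent to \<open>\<psi>''\<close> being a bounded measure. This is expressed by
  the bound \<open>\<integral>\<bar>\<psi>(t) - 2\<psi>(t - h) + \<psi>(t - 2h)\<bar> dt \<le> C h\<^sup>2\<close>, which makes no reference to
  measures. Under this bound the second difference quotients of \<open>\<psi> * u\<close> converge in \<open>L\<^sup>1\<close> on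
  compact intervals, with the required estimates. Conversely, testing \<open>L\<^sup>1\<close> stability on
  approximations of a point mass, and \<open>L\<^sup>\<infinity>\<close> stability on reflected sign functions, gives the bound.

  The kernel of the dual node is the pointwise adjoint of \<open>\<Psi>\<close>, so its entries are the complex
  conjugates of those of the transpose, and the condition on the entries is the same.
\<close>

section \<open>Convolution with an integrable scalar function\<close>

text \<open>The state space may be nonseparable, so vector-valued integrals are reduced to a scalar
  signal times a continuous vector-valued function, and exchanges of integrals to differentiating
  \<open>conv (int0 k) u\<close>. The factor h^2 in the bound comes from one identity: if f is the
  second derivative of \<open>conv \<psi> u\<close>, then \<open>conv (sd h \<psi>) u\<close> equals
  \<open>conv (sd h ramp) f\<close>, and \<open>sd h ramp\<close> is a hat function of mass h^2.
  Conversely the bound makes the difference quotients uniformly bounded operators on L1, so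
  convergence has to be checked only on a dense class, the double primitives. The point \<beta> that
  defines X_1 and X_-1 is any point of the resolvent set, possibly outside the half-plane on which G
  is given; a bounded operator \<open>g\<close> takes the place of G(\<beta>). Two classical
  theorems enter through the semigroups: uniform boundedness yields the exponential bound, and
  Hahn-Banach yields \<open>norm F \<le> norm (adjoint F)\<close>, so that the half-plane of the
  dual node is contained in that of the node, where G is controlled.\<close>

text \<open>The weight \<open>w\<close> replaces the constant of uniform convergence, so that errors
  relative to an unbounded integrable function are allowed. Riemann sums of \<open>f\<close> and
  \<open>g n\<close> are compared directly, which works in every Banach space.\<close>

lemma integrable_weighted_limit:
  fixes f :: "real \<Rightarrow> 'b::banach"
  assumes g: "\<And>n. g n integrable_on {a..b}" and w: "w integrable_on {a..b}"
    and le: "\<And>n x. x \<in> {a..b} \<Longrightarrow> norm (f x - g n x) \<le> w x / (real n + 1)"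
  shows "f integrable_on {a..b}"
proof -
  have w0: "0 \<le> w x" if "x \<in> {a..b}" for x
    using order_trans[OF norm_ge_zero le[OF that, of 0]] by simp
  define W where "W = integral {a..b} w"
  have W0: "0 \<le> W"
    unfolding W_def using w w0 by (rule integral_nonneg)
  define h where "h n = integral {a..b} (g n)" for n
  have diff: "norm (h n - h m) \<le> W / (real n + 1) + W / (real m + 1)" for n m
  proof -
    have "norm (integral {a..b} (\<lambda>x. g n x - g m x))
        \<le> integral {a..b} (\<lambda>x. w x / (real n + 1) + w x / (real m + 1))"
    proof (rule integral_norm_bound_integral)
      show "(\<lambda>x. w x / (real n + 1) + w x / (real m + 1)) integrable_on {a..b}"
        using w by (intro integrable_add) (auto simp: divide_inverse intro: integrable_on_mult_left)
      fix x assume "x \<in> {a..b}"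
      from le[OF this, of n] le[OF this, of m]
      show "norm (g n x - g m x) \<le> w x / (real n + 1) + w x / (real m + 1)"
        using norm_triangle_ineq4[of "f x - g m x" "f x - g n x"] by simp
    qed (use g in \<open>auto intro: integrable_diff\<close>)
    moreover have "integral {a..b} (\<lambda>x. w x / (real n + 1) + w x / (real m + 1))
        = W / (real n + 1) + W / (real m + 1)"
      using w by (subst integral_add) (auto simp: W_def divide_inverse intro: integrable_on_mult_left)
    ultimately show ?thesis
      using g by (simp add: h_def integral_diff)
  qed
  have small: "\<exists>N. \<forall>n\<ge>N. B / (real n + 1) < e" if "0 < e" "0 \<le> B" for B e :: real
  proof -
    obtain N where N: "B / e < real N"
      using reals_Archimedean2 by blast
    have "B / (real n + 1) < e" if "n \<ge> N" for n
    proof -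
      have "B < e * real N"
        using N \<open>0 < e\<close> by (simp add: field_simps)
      also have "\<dots> \<le> e * (real n + 1)"
        using that \<open>0 < e\<close> by (intro mult_left_mono) auto
      finally show ?thesis by (simp add: field_simps)
    qed
    then show ?thesis by blast
  qed
  have "Cauchy h"
  proof (rule metric_CauchyI)
    fix e :: real assume "0 < e"
    then obtain N where N: "\<And>n. n \<ge> N \<Longrightarrow> W / (real n + 1) < e / 2"
      using small[of "e / 2" W] W0 by auto
    have "dist (h m) (h n) < e" if "m \<ge> N" "n \<ge> N" for m n
      unfolding dist_norm using diff[of m n] N[OF that(1)] N[OF that(2)] by linarith
    then show "\<exists>M. \<forall>m\<ge>M. \<forall>n\<ge>M. dist (h m) (h n) < e" by blast
  qed
  then obtain s where s: "h \<longlonglongrightarrow> s"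
    using convergent_eq_Cauchy by blast
  have "(f has_integral s) (cbox a b)"
    unfolding has_integral
  proof (intro allI impI)
    fix e :: real assume e: "0 < e"
    obtain N1 where N1: "\<And>n. n \<ge> N1 \<Longrightarrow> norm (h n - s) < e / 3"
      using LIMSEQ_D[OF s, of "e / 3"] e by auto
    obtain N2 where N2: "\<And>n. n \<ge> N2 \<Longrightarrow> (W + 1) / (real n + 1) < e / 3"
      using small[of "e / 3" "W + 1"] e W0 by auto
    \<comment> \<open>The index is fixed before the gauges, which depend on it; the
      \<open>W + 1\<close> in \<open>N2\<close> anticipates that the Riemann sum of \<open>w\<close>
      is known only up to 1.\<close>
    define n where "n = max N1 N2"
    have gi: "(g n has_integral h n) (cbox a b)"
      using g by (simp add: h_def integrable_integral)
    have wi: "(w has_integral W) (cbox a b)"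
      using w by (simp add: W_def integrable_integral)
    obtain d1 where d1: "gauge d1" "\<And>p. p tagged_division_of cbox a b \<Longrightarrow> d1 fine p \<Longrightarrow>
        norm ((\<Sum>(x,K)\<in>p. measure lborel K *\<^sub>R g n x) - h n) < e / 3"
      using gi[unfolded has_integral, rule_format, of "e / 3"] e by auto
    obtain d2 where d2: "gauge d2" "\<And>p. p tagged_division_of cbox a b \<Longrightarrow> d2 fine p \<Longrightarrow>
        norm ((\<Sum>(x,K)\<in>p. measure lborel K *\<^sub>R w x) - W) < 1"
      using wi[unfolded has_integral, rule_format, of 1] by auto
    have "norm ((\<Sum>(x,K)\<in>p. measure lborel K *\<^sub>R f x) - s) < e"
      if p: "p tagged_division_of cbox a b" and fine: "(\<lambda>x. d1 x \<inter> d2 x) fine p" for p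
    proof -
      have fine12: "d1 fine p" "d2 fine p"
        using fine by (auto simp: fine_Int)
      have tag: "x \<in> {a..b}" "0 \<le> measure lborel K" if "(x, K) \<in> p" for x K
        using tagged_division_ofD(2,3)[OF p that] by auto
      have "norm ((\<Sum>(x,K)\<in>p. measure lborel K *\<^sub>R f x) - (\<Sum>(x,K)\<in>p. measure lborel K *\<^sub>R g n x))
          = norm (\<Sum>(x,K)\<in>p. measure lborel K *\<^sub>R (f x - g n x))"
        by (simp add: sum_subtractf[symmetric] split_def scaleR_diff_right)
      also have "\<dots> \<le> (\<Sum>(x,K)\<in>p. measure lborel K *\<^sub>R w x / (real n + 1))"
      proof (rule sum_norm_le, clarsimp simp del: norm_scaleR)
        fix x K assume xK: "(x, K) \<in> p"
        have "measure lborel K * norm (f x - g n x) \<le> measure lborel K * (w x / (real n + 1))"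
          using le[OF tag(1)[OF xK], of n] tag(2)[OF xK] by (rule mult_left_mono)
        then show "norm (measure lborel K *\<^sub>R (f x - g n x)) \<le> measure lborel K * w x / (real n + 1)"
          by simp
      qed
      also have "\<dots> = (\<Sum>(x,K)\<in>p. measure lborel K *\<^sub>R w x) / (real n + 1)"
        by (simp add: sum_divide_distrib split_def)
      also have "\<dots> \<le> (W + 1) / (real n + 1)"
        using d2(2)[OF p fine12(2)] by (intro divide_right_mono) auto
      also have "\<dots> < e / 3"
        using N2[of n] by (simp add: n_def)
      finally have 1: "norm ((\<Sum>(x,K)\<in>p. measure lborel K *\<^sub>R f x) - (\<Sum>(x,K)\<in>p. measure lborel K *\<^sub>R g n x)) < e / 3" .
      have 2: "norm ((\<Sum>(x,K)\<in>p. measure lborel K *\<^sub>R g n x) - h n) < e / 3"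
        by (rule d1(2)[OF p fine12(1)])
      have 3: "norm (h n - s) < e / 3"
        by (rule N1) (simp add: n_def)
      from norm_add_less[OF norm_add_less[OF 1 2] 3] show ?thesis by simp
    qed
    then show "\<exists>\<gamma>. gauge \<gamma> \<and> (\<forall>p. p tagged_division_of cbox a b \<and> \<gamma> fine p \<longrightarrow>
        norm ((\<Sum>(x,K)\<in>p. measure lborel K *\<^sub>R f x) - s) < e)"
      using gauge_Int[OF d1(1) d2(1)] by blast
  qed
  then show ?thesis by (auto simp: integrable_on_def)
qed

section \<open>Complex scalar multiplication as a bounded bilinear map\<close>

lemma scaleC_simps [simp]:
  "0 *\<^sub>C x = 0" "c *\<^sub>C 0 = 0" "1 *\<^sub>C x = x" "c *\<^sub>C (- x) = - (c *\<^sub>C x)"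
  for x :: "'a::complex_banach"
  using scaleC_of_real[of 0 x] scaleC_of_real[of 1 x]
    linear_0[OF bounded_linear.linear[OF bounded_linear_scaleC]]
    linear_neg[OF bounded_linear.linear[OF bounded_linear_scaleC]]
  by auto

lemma scaleC_diff_right: "c *\<^sub>C (x - y) = c *\<^sub>C x - c *\<^sub>C (y::'a::complex_banach)"
  by (rule linear_diff[OF bounded_linear.linear[OF bounded_linear_scaleC]])

lemma scaleC_scaleR: "c *\<^sub>C (r *\<^sub>R x) = r *\<^sub>R (c *\<^sub>C (x::'a::complex_banach))"
  by (rule linear_scale[OF bounded_linear.linear[OF bounded_linear_scaleC]])

lemma scaleR_scaleC: "(r *\<^sub>R c) *\<^sub>C x = r *\<^sub>R (c *\<^sub>C (x::'a::complex_banach))"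
  by (simp add: scaleR_conv_of_real scaleC_scaleC[symmetric] scaleC_of_real)

lemma bounded_bilinear_scaleC:
  "bounded_bilinear (scaleC :: complex \<Rightarrow> 'a::complex_banach \<Rightarrow> 'a)"
  by (rule bounded_bilinear.intro)
    (auto simp: scaleC_add_left scaleC_add_right scaleC_scaleR scaleR_scaleC norm_scaleC
      intro: exI[of _ 1])

lemmas bounded_linear_scaleC_left = bounded_bilinear.bounded_linear_left[OF bounded_bilinear_scaleC]
lemmas continuous_on_scaleC [continuous_intros] =
  bounded_bilinear.continuous_on[OF bounded_bilinear_scaleC]
lemmas tendsto_scaleC [tendsto_intros] = bounded_bilinear.tendsto[OF bounded_bilinear_scaleC]

lemma scaleC_minus_left [simp]: "(- c) *\<^sub>C x = - (c *\<^sub>C (x::'a::complex_banach))"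
  using linear_neg[OF bounded_linear.linear[OF bounded_linear_scaleC_left]] .

lemma scaleC_diff_left: "(c - d) *\<^sub>C x = c *\<^sub>C x - d *\<^sub>C (x::'a::complex_banach)"
  using linear_diff[OF bounded_linear.linear[OF bounded_linear_scaleC_left]] .

text \<open>On a short interval \<open>k\<close> is nearly constant, so the integrand differs from
  an integrable scalar function times a fixed vector by a small multiple of
  \<open>norm (u s)\<close>. Bisection glues these local approximations, and
  \<open>integrable_weighted_limit\<close> removes the error.\<close>

lemma integrable_scaleC_continuous:
  fixes k :: "real \<Rightarrow> 'e::complex_banach"
  assumes u: "u absolutely_integrable_on {a..b}" and k: "continuous_on {a..b} k"
  shows "(\<lambda>s. u s *\<^sub>C k s) integrable_on {a..b}"
proof (cases "a \<le> b")
  case ab: True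
  have ui: "u integrable_on {a..b}" and nu: "(\<lambda>s. norm (u s)) integrable_on {a..b}"
    using u by (auto simp: absolutely_integrable_on_def)
  have "\<exists>g. g integrable_on {a..b} \<and> (\<forall>x\<in>{a..b}. norm (u x *\<^sub>C k x - g x) \<le> norm (u x) * e)"
    if e: "0 < e" for e
  proof -
    \<comment> \<open>The short intervals around a point may stick out of \<open>{a..b}\<close>,
      hence the guard on the endpoints.\<close>
    define P where "P c d \<longleftrightarrow> (c \<in> {a..b} \<and> d \<in> {a..b} \<longrightarrow>
      (\<exists>g. g integrable_on {c..d} \<and> (\<forall>x\<in>{c..d}. norm (u x *\<^sub>C k x - g x) \<le> norm (u x) * e)))" for c d
    have "P a b"
      using ab
    proof (induction rule: Bolzano)
      case (trans c d f)
      show ?case unfolding P_def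
      proof
        assume cf: "c \<in> {a..b} \<and> f \<in> {a..b}"
        then have "d \<in> {a..b}" using trans(3,4) by auto
        then obtain g1 where
          g1: "g1 integrable_on {c..d} \<and> (\<forall>x\<in>{c..d}. norm (u x *\<^sub>C k x - g1 x) \<le> norm (u x) * e)"
          using trans(1) cf unfolding P_def by fast
        obtain g2 where
          g2: "g2 integrable_on {d..f} \<and> (\<forall>x\<in>{d..f}. norm (u x *\<^sub>C k x - g2 x) \<le> norm (u x) * e)"
          using \<open>d \<in> {a..b}\<close> trans(2) cf unfolding P_def by fast
        let ?g = "\<lambda>x. if x \<le> d then g1 x else g2 x"
        have "?g integrable_on {c..d}"
          by (rule integrable_eq[of g1]) (use g1 in auto)
        \<comment> \<open>At the common endpoint \<open>d\<close> the two pieces may disagree, which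
          is a null set.\<close>
        moreover have "?g integrable_on {d..f}"
          by (rule integrable_spike[OF _ negligible_sing[of d], of g2]) (use g2 in auto)
        ultimately have "?g integrable_on {c..f}"
          by (rule Henstock_Kurzweil_Integration.integrable_combine[OF trans(3,4)])
        moreover have "\<forall>x\<in>{c..f}. norm (u x *\<^sub>C k x - ?g x) \<le> norm (u x) * e"
          using g1 g2 by (auto split: if_splits)
        ultimately show "\<exists>g. g integrable_on {c..f} \<and>
            (\<forall>x\<in>{c..f}. norm (u x *\<^sub>C k x - g x) \<le> norm (u x) * e)" by (intro exI conjI ballI) auto
      qed
    next
      case (local x)
      then have "x \<in> {a..b}" by simp
      then obtain d where d: "d > 0" "\<And>y. y \<in> {a..b} \<Longrightarrow> dist y x < d \<Longrightarrow> dist (k y) (k x) < e"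
        using k e unfolding continuous_on_iff by meson
      have "P c f" if cf: "c \<le> x \<and> x \<le> f \<and> f - c < d" for c f
        unfolding P_def
      proof
        assume in_ab: "c \<in> {a..b} \<and> f \<in> {a..b}"
        have "u integrable_on {c..f}"
          by (rule integrable_on_subinterval[OF ui]) (use in_ab in auto)
        then have "(\<lambda>s. u s *\<^sub>C k x) integrable_on {c..f}"
          using integrable_linear[OF _ bounded_linear_scaleC_left[of "k x"]] by (auto simp: o_def)
        moreover have "norm (u y *\<^sub>C k y - u y *\<^sub>C k x) \<le> norm (u y) * e" if "y \<in> {c..f}" for y
        proof -
          have "dist y x < d" "y \<in> {a..b}"
            using that cf in_ab by (auto simp: dist_real_def)
          then have "norm (k y - k x) \<le> e"
            using d(2)[of y] by (simp add: dist_norm)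
          then show ?thesis
            by (simp add: scaleC_diff_right[symmetric] norm_scaleC mult_left_mono)
        qed
        ultimately show "\<exists>g. g integrable_on {c..f} \<and>
            (\<forall>x\<in>{c..f}. norm (u x *\<^sub>C k x - g x) \<le> norm (u x) * e)" by (intro exI conjI ballI) auto
      qed
      then show ?case using d(1) by blast
    qed
    then show ?thesis using ab by (auto simp: P_def)
  qed
  then have "\<exists>g. g integrable_on {a..b} \<and>
      (\<forall>x\<in>{a..b}. norm (u x *\<^sub>C k x - g x) \<le> norm (u x) / (real n + 1))" for n
    by (auto simp: divide_inverse)
  then obtain g where "\<And>n. g n integrable_on {a..b}"
    "\<And>n x. x \<in> {a..b} \<Longrightarrow> norm (u x *\<^sub>C k x - g n x) \<le> norm (u x) / (real n + 1)"
    by metis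
  from integrable_weighted_limit[OF this(1) nu this(2)] show ?thesis .
qed (simp add: integrable_on_empty)

section \<open>Causal convolution of a scalar signal with a vector-valued kernel\<close>

definition loc_int :: "(real \<Rightarrow> complex) \<Rightarrow> bool"
  where "loc_int u \<longleftrightarrow> (\<forall>t. u absolutely_integrable_on {0..t})"

text \<open>A scalar signal against a vector-valued kernel keeps every integrand in the form covered
  by \<open>integrable_scaleC_continuous\<close>.\<close>

definition conv :: "(real \<Rightarrow> 'e::complex_banach) \<Rightarrow> (real \<Rightarrow> complex) \<Rightarrow> real \<Rightarrow> 'e"
  where "conv k u t = integral {0..t} (\<lambda>s. u s *\<^sub>C k (t - s))"

definition int0 :: "(real \<Rightarrow> 'e::banach) \<Rightarrow> real \<Rightarrow> 'e"
  where "int0 k t = integral {0..t} k"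

text \<open>The zero extension turns convolutions at different times into integrals over one common
  interval, at the price of a possible jump of the kernel at 0.\<close>

definition ext0 :: "(real \<Rightarrow> 'e::zero) \<Rightarrow> real \<Rightarrow> 'e"
  where "ext0 k t = (if 0 \<le> t then k t else 0)"

lemma loc_int_absD: "loc_int u \<Longrightarrow> 0 \<le> a \<Longrightarrow> u absolutely_integrable_on {a..b}"
  unfolding loc_int_def by (rule absolutely_integrable_on_subinterval[where S = "{0..b}"]) auto

lemma loc_int_normD: "loc_int u \<Longrightarrow> 0 \<le> a \<Longrightarrow> (\<lambda>s. norm (u s)) integrable_on {a..b}"
  using loc_int_absD absolutely_integrable_on_def by blast

lemma continuous_on_reflected:
  fixes k :: "real \<Rightarrow> 'e::topological_space"
  assumes "continuous_on {0..} k"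
  shows "continuous_on {a..t} (\<lambda>s. k (t - s))"
  by (rule continuous_on_compose2[OF assms]) (auto intro!: continuous_intros)

lemma conv_integrable:
  assumes "continuous_on {0..} k" "loc_int u"
  shows "(\<lambda>s. u s *\<^sub>C k (t - s)) integrable_on {0..t}"
  by (rule integrable_scaleC_continuous[OF loc_int_absD[OF assms(2)] continuous_on_reflected[OF assms(1)]])
    simp

lemma conv_ext:
  assumes "continuous_on {0..} k" "loc_int u" "t \<le> T"
  shows "((\<lambda>s. u s *\<^sub>C ext0 k (t - s)) has_integral conv k u t) {0..T}"
proof -
  have "((\<lambda>s. if s \<in> {0..t} then u s *\<^sub>C k (t - s) else 0) has_integral conv k u t) {0..T}"
    using conv_integrable[OF assms(1,2), of t] assms(3)
    by (subst has_integral_restrict) (auto simp: conv_def integrable_integral)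
  then show ?thesis
    by (rule has_integral_eq[rotated]) (auto simp: ext0_def)
qed

text \<open>\<open>\<eta>\<close> is a uniform error and \<open>\<theta>\<close> a coarse bound on
  the short window \<open>{a..b}\<close> between two times, where the jump of the extended kernel
  sits; there the mass of \<open>u\<close> is small instead.\<close>

lemma norm_integral_scaleC_le:
  assumes I: "((\<lambda>s. u s *\<^sub>C N s) has_integral I) {0..T}" and u: "loc_int u"
    and ab: "0 \<le> a" "b \<le> T"
    and N: "\<And>s. s \<in> {0..T} \<Longrightarrow> norm (N s) \<le> \<eta> + (if s \<in> {a..b} then \<theta> else 0)"
  shows "norm I \<le> \<eta> * integral {0..T} (\<lambda>s. norm (u s)) + \<theta> * integral {a..b} (\<lambda>s. norm (u s))"
proof -
  let ?g = "\<lambda>s. \<eta> * norm (u s) + (if s \<in> {a..b} then \<theta> * norm (u s) else 0)"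
  have "((\<lambda>s. if s \<in> {a..b} then \<theta> * norm (u s) else 0) has_integral
      \<theta> * integral {a..b} (\<lambda>s. norm (u s))) {0..T}"
    using ab loc_int_normD[OF u]
    by (subst has_integral_restrict) (auto intro!: has_integral_mult_right integrable_integral)
  then have g: "(?g has_integral
      (\<eta> * integral {0..T} (\<lambda>s. norm (u s)) + \<theta> * integral {a..b} (\<lambda>s. norm (u s)))) {0..T}"
    using loc_int_normD[OF u]
    by (intro has_integral_add has_integral_mult_right integrable_integral) auto
  have "norm (integral {0..T} (\<lambda>s. u s *\<^sub>C N s)) \<le> integral {0..T} ?g"
  proof (rule integral_norm_bound_integral)
    fix s assume s: "s \<in> {0..T}"
    have "norm (u s) * norm (N s) \<le> norm (u s) * (\<eta> + (if s \<in> {a..b} then \<theta> else 0))"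
      by (rule mult_left_mono[OF N[OF s]]) simp
    also have "\<dots> = ?g s" by (simp add: algebra_simps)
    finally show "norm (u s *\<^sub>C N s) \<le> ?g s"
      by (simp only: norm_scaleC)
  qed (use I g in auto)
  then show ?thesis
    using integral_unique[OF I] integral_unique[OF g] by simp
qed

lemma norm_conv_le:
  assumes k: "continuous_on {0..} k" and u: "loc_int u"
    and B: "\<And>s. s \<in> {0..t} \<Longrightarrow> norm (k s) \<le> B"
  shows "norm (conv k u t) \<le> B * integral {0..t} (\<lambda>s. norm (u s))"
proof -
  have "norm (conv k u t) \<le> B * integral {0..t} (\<lambda>s. norm (u s)) + 0 * integral {0..t} (\<lambda>s. norm (u s))"
    by (rule norm_integral_scaleC_le[OF conv_ext[OF k u order_refl] u])
      (auto simp: ext0_def intro: B)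
  then show ?thesis by simp
qed

lemma bounded_on_Icc:
  fixes k :: "real \<Rightarrow> 'e::real_normed_vector"
  assumes "continuous_on {0..} k"
  obtains B where "0 \<le> B" "\<And>s. s \<in> {0..T} \<Longrightarrow> norm (k s) \<le> B"
proof -
  have "bounded (k ` {0..T})"
    by (intro compact_imp_bounded compact_continuous_image continuous_on_subset[OF assms]) auto
  then show ?thesis
    using that unfolding bounded_pos by (metis imageI less_imp_le)
qed

lemma unif_cont_Icc:
  fixes k :: "real \<Rightarrow> 'e::real_normed_vector"
  assumes "continuous_on {a..b} k" "0 < e"
  obtains d where "0 < d" "\<And>x y. x \<in> {a..b} \<Longrightarrow> y \<in> {a..b} \<Longrightarrow> \<bar>x - y\<bar> < d \<Longrightarrow> norm (k x - k y) < e"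
proof -
  have "uniformly_continuous_on {a..b} k"
    by (intro compact_uniformly_continuous assms) auto
  then obtain d where "d > 0"
    "\<And>x x'. x \<in> {a..b} \<Longrightarrow> x' \<in> {a..b} \<Longrightarrow> dist x' x < d \<Longrightarrow> dist (k x') (k x) < e"
    using assms(2) unfolding uniformly_continuous_on_def by meson
  then show ?thesis
    using that[of d] by (auto simp: dist_norm abs_minus_commute)
qed

text \<open>Absolute continuity of the integral, read off from the continuity of the primitive of
  \<open>norm (u s)\<close>.\<close>

lemma small_mass:
  assumes u: "loc_int u" and t: "t \<in> {0..T}" and e: "0 < e"
  obtains d where "0 < d"
    "\<And>t'. t' \<in> {0..T} \<Longrightarrow> \<bar>t' - t\<bar> < d \<Longrightarrow> integral {min t t'..max t t'} (\<lambda>s. norm (u s)) < e"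
proof -
  let ?m = "\<lambda>t. integral {0..t} (\<lambda>s. norm (u s))"
  have "continuous_on {0..T} ?m"
    by (rule indefinite_integral_continuous_1[OF loc_int_normD[OF u]]) simp
  then obtain d where d: "0 < d" "\<And>t'. t' \<in> {0..T} \<Longrightarrow> dist t' t < d \<Longrightarrow> dist (?m t') (?m t) < e"
    using t e unfolding continuous_on_iff by meson
  have diff: "integral {x..y} (\<lambda>s. norm (u s)) = ?m y - ?m x" if "0 \<le> x" "x \<le> y" for x y
    using Henstock_Kurzweil_Integration.integral_combine[OF that loc_int_normD[OF u order_refl]]
    by (metis add_diff_cancel_left')
  have "integral {min t t'..max t t'} (\<lambda>s. norm (u s)) < e"
    if "t' \<in> {0..T}" "\<bar>t' - t\<bar> < d" for t'
    using d(2)[of t'] that t diff[of t t'] diff[of t' t]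
    by (cases "t \<le> t'") (simp_all add: dist_real_def min_def max_def)
  then show ?thesis using that d(1) by blast
qed

lemma conv_0 [simp]: "t \<le> 0 \<Longrightarrow> conv k u t = 0"
  by (cases "t = 0") (auto simp: conv_def)

lemma int0_0 [simp]: "t \<le> 0 \<Longrightarrow> int0 k t = 0"
  by (cases "t = 0") (auto simp: int0_def)

lemma continuous_on_Ici:
  fixes f :: "real \<Rightarrow> 'e::topological_space"
  assumes "\<And>T. continuous_on {0..T} f"
  shows "continuous_on {0..} f"
  unfolding continuous_on_eq_continuous_within
proof
  fix x :: real assume x: "x \<in> {0..}"
  have "continuous (at x within {0..x+1}) f"
    using assms[of "x + 1"] x by (auto simp: continuous_on_eq_continuous_within)
  moreover have "at x within {0..x+1} = at x within {0..}"
    by (rule at_within_nhd[where S = "{..<x+1}"]) auto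
  ultimately show "continuous (at x within {0..}) f" by simp
qed

text \<open>Three ranges of \<open>s\<close>: before both times uniform continuity of
  \<open>k\<close> applies, after both times the extended kernels vanish, and in between
  \<open>k\<close> is merely bounded but \<open>small_mass\<close> makes the contribution
  small.\<close>

lemma continuous_on_conv:
  fixes k :: "real \<Rightarrow> 'e::complex_banach"
  assumes k: "continuous_on {0..} k" and u: "loc_int u"
  shows "continuous_on {0..} (conv k u)"
proof (rule continuous_on_Ici)
  fix T
  obtain B where B: "0 \<le> B" "\<And>s. s \<in> {0..T} \<Longrightarrow> norm (k s) \<le> B"
    using bounded_on_Icc[OF k] by blast
  define U where "U = integral {0..T} (\<lambda>s. norm (u s))"
  have U0: "0 \<le> U"
    unfolding U_def by (rule integral_nonneg[OF loc_int_normD[OF u order_refl]]) simp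
  show "continuous_on {0..T} (conv k u)"
    unfolding continuous_on_iff
  proof (intro ballI allI impI)
    fix t e :: real assume t: "t \<in> {0..T}" and e: "0 < e"
    have "0 < e / (2 * (U + 1))" "0 < e / (2 * (2 * B + 1))"
      using e U0 B(1) by auto
    note pos = this
    have "continuous_on {0..T} k"
      by (rule continuous_on_subset[OF k]) auto
    from unif_cont_Icc[OF this pos(1)] obtain d1 where
      d1: "0 < d1" "\<And>x y. x \<in> {0..T} \<Longrightarrow> y \<in> {0..T} \<Longrightarrow> \<bar>x - y\<bar> < d1 \<Longrightarrow> norm (k x - k y) < e / (2 * (U + 1))"
      by blast
    from small_mass[OF u t pos(2)] obtain d2 where
      d2: "0 < d2" "\<And>t'. t' \<in> {0..T} \<Longrightarrow> \<bar>t' - t\<bar> < d2 \<Longrightarrow>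
        integral {min t t'..max t t'} (\<lambda>s. norm (u s)) < e / (2 * (2 * B + 1))"
      by blast
    have "dist (conv k u t') (conv k u t) < e"
      if t': "t' \<in> {0..T}" and tt: "dist t' t < min d1 d2" for t'
    proof -
      define a b where "a = min t t'" and "b = max t t'"
      have ab: "0 \<le> a" "b \<le> T" "a \<le> b" using t t' by (auto simp: a_def b_def)
      have "((\<lambda>s. u s *\<^sub>C (ext0 k (t' - s) - ext0 k (t - s))) has_integral
          (conv k u t' - conv k u t)) {0..T}"
        unfolding scaleC_diff_right using t t'
        by (intro has_integral_diff conv_ext[OF k u]) auto
      then have "norm (conv k u t' - conv k u t) \<le>
          e / (2 * (U + 1)) * U + 2 * B * integral {a..b} (\<lambda>s. norm (u s))"
        unfolding U_def
      proof (rule norm_integral_scaleC_le[OF _ u ab(1,2)], fold U_def)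
        fix s assume s: "s \<in> {0..T}"
        have ext: "norm (ext0 k r) \<le> B" if "r \<le> T" for r
          using B that by (auto simp: ext0_def)
        have 1: "norm (ext0 k (t' - s) - ext0 k (t - s)) \<le> 2 * B"
          using norm_triangle_le_diff[OF add_mono[OF ext[of "t' - s"] ext[of "t - s"]]] s t t' by auto
        have 2: "norm (ext0 k (t' - s) - ext0 k (t - s)) < e / (2 * (U + 1))" if "s < a"
          using that d1(2)[of "t' - s" "t - s"] s t t' tt by (auto simp: a_def ext0_def dist_real_def)
        have 3: "ext0 k (t' - s) - ext0 k (t - s) = 0" if "s > b"
          using that by (auto simp: b_def ext0_def)
        have 4: "0 \<le> e / (2 * (U + 1))" using e U0 by auto
        show "norm (ext0 k (t' - s) - ext0 k (t - s)) \<le>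
            e / (2 * (U + 1)) + (if s \<in> {a..b} then 2 * B else 0)"
          using 1 2 3 4 by (cases "s < a"; cases "s > b") fastforce+
      qed
      also have "\<dots> < e / 2 + e / 2"
      proof (rule add_le_less_mono)
        show "e / (2 * (U + 1)) * U \<le> e / 2"
          using e U0 by (simp add: field_simps)
        have "2 * B * integral {a..b} (\<lambda>s. norm (u s)) \<le> 2 * B * (e / (2 * (2 * B + 1)))"
          using d2(2)[OF t'] tt B(1) by (intro mult_left_mono) (auto simp: a_def b_def dist_real_def)
        also have "\<dots> < e / 2"
          using e B(1) by (simp add: field_simps)
        finally show "2 * B * integral {a..b} (\<lambda>s. norm (u s)) < e / 2" .
      qed
      finally show ?thesis by (simp add: dist_norm)
    qed
    then show "\<exists>d>0. \<forall>t'\<in>{0..T}. dist t' t < d \<longrightarrow> dist (conv k u t') (conv k u t) < e"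
      using d1(1) d2(1) by (intro exI[of _ "min d1 d2"]) auto
  qed
qed

text \<open>Mean value estimate for the primitive: with \<open>v = 0\<close> it is a Lipschitz
  bound, with \<open>v\<close> a value of \<open>k\<close> it bounds the error of
  linearisation.\<close>

lemma int0_increment:
  fixes k :: "real \<Rightarrow> 'e::banach"
  assumes k: "continuous_on {0..} k" and cd: "0 \<le> c" "c \<le> d"
    and e: "\<And>r. r \<in> {c..d} \<Longrightarrow> norm (k r - v) \<le> e"
  shows "norm (int0 k d - int0 k c - (d - c) *\<^sub>R v) \<le> e * (d - c)"
proof -
  have int: "k integrable_on {a..b}" if "0 \<le> a" for a b
    using that by (intro integrable_continuous_real continuous_on_subset[OF k]) auto
  have "norm (integral {c..d} (\<lambda>r. k r - v)) \<le> integral {c..d} (\<lambda>r. e)"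
    by (rule integral_norm_bound_integral) (use int[OF cd(1)] e in \<open>auto intro: integrable_diff\<close>)
  moreover have "integral {c..d} (\<lambda>r. k r - v) = int0 k d - int0 k c - (d - c) *\<^sub>R v"
  proof -
    have 1: "integral {c..d} (\<lambda>r. k r - v) = integral {c..d} k - integral {c..d} (\<lambda>r. v)"
      by (rule Henstock_Kurzweil_Integration.integral_diff[OF int[OF cd(1)]])
        (rule integrable_const_ivl)
    have "integral {0..c} k + integral {c..d} k = integral {0..d} k"
      by (rule Henstock_Kurzweil_Integration.integral_combine[OF cd int]) simp
    then have 2: "integral {c..d} k = integral {0..d} k - integral {0..c} k"
      by (metis add_diff_cancel_left')
    show ?thesis
      unfolding 1 2 int0_def using cd(2) by simp
  qed
  moreover have "integral {c..d} (\<lambda>r. e) = e * (d - c)"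
    by (simp only: integral_const_real measure_lborel_Icc[OF cd(2)] real_scaleR_def mult.commute)
  ultimately show ?thesis by metis
qed

lemma int0_has_vector_derivative:
  fixes k :: "real \<Rightarrow> 'e::banach"
  assumes k: "continuous_on {0..} k" and "0 \<le> t"
  shows "(int0 k has_vector_derivative k t) (at t within {0..})"
proof -
  have "((\<lambda>u. integral {0..u} k) has_vector_derivative k t) (at t within {0..t+1})"
    by (rule integral_has_vector_derivative[OF continuous_on_subset[OF k]]) (use assms in auto)
  moreover have "at t within {0..t+1} = at t within {0..}"
    by (rule at_within_nhd[where S = "{..<t+1}"]) auto
  ultimately show ?thesis by (simp add: int0_def[abs_def])
qed

lemma continuous_on_int0:
  fixes k :: "real \<Rightarrow> 'e::banach"
  assumes k: "continuous_on {0..} k"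
  shows "continuous_on {0..} (int0 k)"
  using has_vector_derivative_continuous[OF int0_has_vector_derivative[OF k]]
  by (auto simp: continuous_on_eq_continuous_within)

text \<open>The three ranges from the continuity proof, now for the linearisation error
  \<open>N s\<close>, which must be small relative to the increment of time.\<close>

lemma conv_int0_has_vector_derivative:
  fixes k :: "real \<Rightarrow> 'e::complex_banach"
  assumes k: "continuous_on {0..} k" and u: "loc_int u" and t: "t \<in> {0..T}"
  shows "(conv (int0 k) u has_vector_derivative conv k u t) (at t within {0..T})"
proof -
  let ?K = "int0 k"
  note K = continuous_on_int0[OF k]
  obtain B where B: "0 \<le> B" "\<And>s. s \<in> {0..T} \<Longrightarrow> norm (k s) \<le> B"
    using bounded_on_Icc[OF k] by blast
  define U where "U = integral {0..T} (\<lambda>s. norm (u s))"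
  have U0: "0 \<le> U"
    unfolding U_def by (rule integral_nonneg[OF loc_int_normD[OF u order_refl]]) simp
  \<comment> \<open>A primitive has no jump at 0, so its zero extension stays Lipschitz; on the
    window between the two times this bounds the error by a multiple of the increment.\<close>
  have lip0: "norm (ext0 ?K y - ext0 ?K x) \<le> B * (y - x)" if "x \<le> y" "y \<le> T" for x y
  proof -
    consider "0 \<le> x" | "x < 0" "0 \<le> y" | "y < 0" by linarith
    then show ?thesis
    proof cases
      case 1
      then show ?thesis
        using int0_increment[OF k, of x y 0 B] that B by (auto simp: ext0_def)
    next
      case 2
      then have "norm (?K y) \<le> B * y"
        using int0_increment[OF k, of 0 y 0 B] that B by auto
      also have "\<dots> \<le> B * (y - x)" using 2 B(1) by (intro mult_left_mono) auto
      finally show ?thesis using 2 by (simp add: ext0_def)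
    qed (use that B(1) in \<open>auto simp: ext0_def\<close>)
  qed
  have lip: "norm (ext0 ?K y - ext0 ?K x) \<le> B * \<bar>y - x\<bar>" if "x \<le> T" "y \<le> T" for x y
    using lip0[of x y] lip0[of y x] that by (cases "x \<le> y") (auto simp: norm_minus_commute)
  show ?thesis
    unfolding has_vector_derivative_def has_derivative_within_alt
  proof (intro conjI allI impI bounded_linear_scaleR_left)
    fix e :: real assume e: "0 < e"
    have "0 < e / (2 * (U + 1))" "0 < e / (2 * (2 * B + 1))"
      using e U0 B(1) by auto
    note pos = this
    have "continuous_on {0..T} k"
      by (rule continuous_on_subset[OF k]) auto
    from unif_cont_Icc[OF this pos(1)] obtain d1 where
      d1: "0 < d1" "\<And>x y. x \<in> {0..T} \<Longrightarrow> y \<in> {0..T} \<Longrightarrow> \<bar>x - y\<bar> < d1 \<Longrightarrow> norm (k x - k y) < e / (2 * (U + 1))"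
      by blast
    from small_mass[OF u t pos(2)] obtain d2 where
      d2: "0 < d2" "\<And>t'. t' \<in> {0..T} \<Longrightarrow> \<bar>t' - t\<bar> < d2 \<Longrightarrow>
        integral {min t t'..max t t'} (\<lambda>s. norm (u s)) < e / (2 * (2 * B + 1))"
      by blast
    have "norm (conv ?K u t' - conv ?K u t - (t' - t) *\<^sub>R conv k u t) \<le> e * norm (t' - t)"
      if t': "t' \<in> {0..T}" and tt: "norm (t' - t) < min d1 d2" for t'
    proof -
      define a b where "a = min t t'" and "b = max t t'"
      have ab: "0 \<le> a" "b \<le> T" "a \<le> b" using t t' by (auto simp: a_def b_def)
      define N where "N s = ext0 ?K (t' - s) - ext0 ?K (t - s) - (t' - t) *\<^sub>R ext0 k (t - s)" for s
      have "((\<lambda>s. u s *\<^sub>C N s) has_integral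
          (conv ?K u t' - conv ?K u t - (t' - t) *\<^sub>R conv k u t)) {0..T}"
        unfolding scaleC_diff_right scaleC_scaleR N_def using t t'
        by (intro has_integral_diff has_integral_cmul conv_ext[OF k u] conv_ext[OF K u]) auto
      then have "norm (conv ?K u t' - conv ?K u t - (t' - t) *\<^sub>R conv k u t) \<le>
          e / (2 * (U + 1)) * \<bar>t' - t\<bar> * U + 2 * B * \<bar>t' - t\<bar> * integral {a..b} (\<lambda>s. norm (u s))"
        unfolding U_def
      proof (rule norm_integral_scaleC_le[OF _ u ab(1,2)], fold U_def)
        fix s assume s: "s \<in> {0..T}"
        have "norm (ext0 k (t - s)) \<le> B"
          using B s t by (auto simp: ext0_def)
        then have "norm ((t' - t) *\<^sub>R ext0 k (t - s)) \<le> B * \<bar>t' - t\<bar>"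
          using mult_left_mono[of "norm (ext0 k (t - s))" B "\<bar>t' - t\<bar>"] by (simp add: mult.commute)
        moreover have "norm (ext0 ?K (t' - s) - ext0 ?K (t - s)) \<le> B * \<bar>t' - t\<bar>"
          using lip[of "t - s" "t' - s"] s t t' by simp
        ultimately have 1: "norm (N s) \<le> 2 * B * \<bar>t' - t\<bar>"
          unfolding N_def
          using norm_triangle_ineq4[of "ext0 ?K (t' - s) - ext0 ?K (t - s)" "(t' - t) *\<^sub>R ext0 k (t - s)"]
          by linarith
        have 2: "norm (N s) \<le> e / (2 * (U + 1)) * \<bar>t' - t\<bar>" if "s < a"
        proof (cases "t \<le> t'")
          case True
          have "norm (k r - k (t - s)) \<le> e / (2 * (U + 1))" if "r \<in> {t - s..t' - s}" for r
            using that \<open>s < a\<close> tt s t t' by (intro less_imp_le d1(2)) (auto simp: a_def)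
          then show ?thesis
            using int0_increment[OF k, of "t - s" "t' - s" "k (t - s)" "e / (2 * (U + 1))"] that True
            by (auto simp: N_def a_def ext0_def)
        next
          case False
          have "norm (k r - k (t - s)) \<le> e / (2 * (U + 1))" if "r \<in> {t' - s..t - s}" for r
            using that \<open>s < a\<close> tt s t t' by (intro less_imp_le d1(2)) (auto simp: a_def)
          then have "norm (?K (t - s) - ?K (t' - s) - ((t - s) - (t' - s)) *\<^sub>R k (t - s))
              \<le> e / (2 * (U + 1)) * ((t - s) - (t' - s))"
            using that False by (intro int0_increment[OF k]) (auto simp: a_def)
          moreover have "N s = - (?K (t - s) - ?K (t' - s) - ((t - s) - (t' - s)) *\<^sub>R k (t - s))"
            using that False by (auto simp: N_def a_def ext0_def algebra_simps)
          ultimately show ?thesis using False by (simp only: norm_minus_cancel) simp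
        qed
        have 3: "N s = 0" if "s > b"
          using that by (auto simp: b_def ext0_def N_def)
        have 4: "0 \<le> e / (2 * (U + 1)) * \<bar>t' - t\<bar>" using e U0 by auto
        show "norm (N s) \<le> e / (2 * (U + 1)) * \<bar>t' - t\<bar> + (if s \<in> {a..b} then 2 * B * \<bar>t' - t\<bar> else 0)"
          using 1 2 3 4 by (cases "s < a"; cases "s > b") fastforce+
      qed
      also have "\<dots> \<le> e / 2 * \<bar>t' - t\<bar> + e / 2 * \<bar>t' - t\<bar>"
      proof (rule add_mono)
        have "e / (2 * (U + 1)) * U \<le> e / 2"
          using e U0 by (simp add: field_simps)
        from mult_right_mono[OF this, of "\<bar>t' - t\<bar>"]
        show "e / (2 * (U + 1)) * \<bar>t' - t\<bar> * U \<le> e / 2 * \<bar>t' - t\<bar>"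
          by (simp add: mult_ac)
        have "2 * B * integral {a..b} (\<lambda>s. norm (u s)) \<le> 2 * B * (e / (2 * (2 * B + 1)))"
          using d2(2)[OF t'] tt B(1) by (intro mult_left_mono) (auto simp: a_def b_def)
        also have "\<dots> \<le> e / 2"
          using e B(1) by (simp add: field_simps)
        finally have "2 * B * integral {a..b} (\<lambda>s. norm (u s)) \<le> e / 2" .
        from mult_right_mono[OF this, of "\<bar>t' - t\<bar>"]
        show "2 * B * \<bar>t' - t\<bar> * integral {a..b} (\<lambda>s. norm (u s)) \<le> e / 2 * \<bar>t' - t\<bar>"
          by (simp add: mult_ac)
      qed
      finally show ?thesis by simp
    qed
    then show "\<exists>d>0. \<forall>t'\<in>{0..T}. norm (t' - t) < d \<longrightarrow>
        norm (conv ?K u t' - conv ?K u t - (t' - t) *\<^sub>R conv k u t) \<le> e * norm (t' - t)"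
      using d1(1) d2(1) by (intro exI[of _ "min d1 d2"]) auto
  qed
qed

text \<open>This instance of Fubini's theorem is obtained from the fundamental theorem of calculus, since
  the library has no Fubini theorem for functions with values in a nonseparable space.\<close>

lemma int0_conv:
  fixes k :: "real \<Rightarrow> 'e::complex_banach"
  assumes k: "continuous_on {0..} k" and u: "loc_int u"
  shows "int0 (conv k u) = conv (int0 k) u"
proof
  fix t
  show "int0 (conv k u) t = conv (int0 k) u t"
  proof (cases "0 \<le> t")
    case True
    have "(conv k u has_integral (conv (int0 k) u t - conv (int0 k) u 0)) {0..t}"
      by (rule fundamental_theorem_of_calculus[OF True conv_int0_has_vector_derivative[OF k u]])
    then show ?thesis by (simp add: int0_def integral_unique)
  qed simp
qed

section \<open>Causal functions and second differences\<close>

text \<open>Living on the whole line frees translates and second differences of boundary cases;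
  continuity there excludes a jump at 0.\<close>

definition caus :: "(real \<Rightarrow> 'e::real_normed_vector) \<Rightarrow> bool"
  where "caus p \<longleftrightarrow> continuous_on UNIV p \<and> (\<forall>t\<le>0. p t = 0)"

text \<open>Backward differences, so that a step \<open>h \<ge> 0\<close> preserves
  causality.\<close>

definition sd :: "real \<Rightarrow> (real \<Rightarrow> 'e::real_vector) \<Rightarrow> real \<Rightarrow> 'e"
  where "sd h p t = p t - 2 *\<^sub>R p (t - h) + p (t - 2 * h)"

lemma caus_cont: "caus p \<Longrightarrow> continuous_on S p"
  using continuous_on_subset by (auto simp: caus_def)

lemma caus_neg: "caus p \<Longrightarrow> t \<le> 0 \<Longrightarrow> p t = 0"
  by (simp add: caus_def)

lemma caus_loc_int: "caus p \<Longrightarrow> loc_int p"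
  by (auto simp: loc_int_def intro: absolutely_integrable_continuous_real caus_cont)

lemma caus_diff: "caus p \<Longrightarrow> caus q \<Longrightarrow> caus (\<lambda>t. p t - q t)"
  by (auto simp: caus_def intro: continuous_on_diff)

lemma caus_scaleR: "caus p \<Longrightarrow> caus (\<lambda>t. r *\<^sub>R p t)"
  by (auto simp: caus_def intro: continuous_on_scaleR continuous_on_const)

lemma caus_shift: "caus p \<Longrightarrow> 0 \<le> h \<Longrightarrow> caus (\<lambda>t. p (t - h))"
  unfolding caus_def by (auto intro!: continuous_on_compose2[of UNIV p] continuous_intros)

lemma caus_sd: "caus p \<Longrightarrow> 0 \<le> h \<Longrightarrow> caus (sd h p)"
  using caus_shift[of p h] caus_shift[of p "2 * h"]
  unfolding sd_def[abs_def] by (auto simp: caus_def intro!: continuous_intros)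

lemma integral_reverse:
  fixes f :: "real \<Rightarrow> 'e::banach"
  shows "integral {0..t} (\<lambda>s. f (t - s)) = integral {0..t} f"
proof -
  have "integral {0..t} (\<lambda>s. f (t - s)) = integral {0..t} ((\<lambda>x. f (- x)) \<circ> ((+) (- t)))"
    by (simp add: o_def)
  also have "\<dots> = integral {0 + - t..t + - t} (\<lambda>x. f (- x))"
    by (rule integral_shift_Icc_real)
  also have "\<dots> = integral {0..t} f"
    using Henstock_Kurzweil_Integration.integral_reflect_real[of t 0 f] by simp
  finally show ?thesis .
qed

lemma conv_commute: "conv a b t = conv b a t" for a b :: "real \<Rightarrow> complex"
  using integral_reverse[of t "\<lambda>s. b s * a (t - s)"]
  by (simp add: conv_def scaleC_complex_def mult.commute)

text \<open>By causality \<open>int0 p\<close> is also the integral from any point left of 0, which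
  gives a two-sided derivative at 0 as well.\<close>

lemma caus_int0:
  fixes p :: "real \<Rightarrow> 'e::banach"
  assumes "caus p"
  shows "(int0 p has_vector_derivative p t) (at t)" "caus (int0 p)"
proof -
  show der: "(int0 p has_vector_derivative p t) (at t)" for t
  proof -
    define M where "M = \<bar>t\<bar> + 1"
    have "((\<lambda>x. integral {-M..x} p) has_vector_derivative p t) (at t within {-M..M})"
      by (rule integral_has_vector_derivative[OF caus_cont[OF assms]]) (auto simp: M_def)
    then have "((\<lambda>x. integral {-M..x} p) has_vector_derivative p t) (at t)"
      by (subst (asm) at_within_interior) (auto simp: M_def)
    then show ?thesis
    proof (rule has_vector_derivative_transform_within_open[of _ _ _ "{-M<..}"])
      fix x assume x: "x \<in> {-M<..}"
      show "integral {-M..x} p = int0 p x"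
      proof (cases "0 \<le> x")
        case True
        have "integral {-M..0} p + integral {0..x} p = integral {-M..x} p"
          using True by (intro Henstock_Kurzweil_Integration.integral_combine
              integrable_continuous_real caus_cont[OF assms]) (auto simp: M_def)
        moreover have "integral {-M..0} p = integral {-M..0} (\<lambda>_. 0)"
          by (rule Henstock_Kurzweil_Integration.integral_cong) (simp add: caus_neg[OF assms])
        ultimately show ?thesis by (simp add: int0_def)
      next
        case False
        have "integral {-M..x} p = integral {-M..x} (\<lambda>_. 0)"
          by (rule Henstock_Kurzweil_Integration.integral_cong)
            (use False in \<open>simp add: caus_neg[OF assms]\<close>)
        then show ?thesis using False by simp
      qed
    qed (auto simp: M_def)
  qed
  show "caus (int0 p)"
    unfolding caus_def
    using has_vector_derivative_continuous[OF der]
    by (auto simp: continuous_on_eq_continuous_within)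
qed

lemma caus_conv:
  fixes k :: "real \<Rightarrow> 'e::complex_banach"
  assumes "continuous_on {0..} k" "loc_int u"
  shows "caus (conv k u)"
proof -
  have "continuous_on {..0} (conv k u)"
    by (rule continuous_on_eq[OF continuous_on_const[of _ 0]]) simp
  from continuous_on_closed_Un[OF closed_atMost closed_atLeast this continuous_on_conv[OF assms]]
  have "continuous_on ({..0} \<union> {0..}) (conv k u)" by simp
  moreover have "{..0} \<union> {0..} = (UNIV :: real set)" by auto
  ultimately show ?thesis by (simp add: caus_def)
qed

text \<open>The part of the delayed kernel that is 0 by causality fills up the integration range
  from \<open>t - h\<close> to \<open>t\<close>.\<close>

lemma conv_shift:
  assumes k: "caus k" and u: "loc_int u" and h: "0 \<le> h"
  shows "conv k u (t - h) = conv (\<lambda>s. k (s - h)) u t"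
proof -
  have "((\<lambda>s. u s *\<^sub>C ext0 k (t - h - s)) has_integral conv k u (t - h)) {0..t}"
    by (rule conv_ext[OF caus_cont[OF k] u]) (use h in simp)
  then have "((\<lambda>s. u s *\<^sub>C k (t - s - h)) has_integral conv k u (t - h)) {0..t}"
    by (rule has_integral_eq[rotated]) (auto simp: ext0_def caus_neg[OF k] algebra_simps)
  then show ?thesis by (simp add: conv_def integral_unique)
qed

lemma conv_diff_left:
  assumes "continuous_on {0..} k" "continuous_on {0..} l" "loc_int u"
  shows "conv (\<lambda>s. k s - l s) u t = conv k u t - conv l u t"
  unfolding conv_def scaleC_diff_right
  by (rule Henstock_Kurzweil_Integration.integral_diff) (intro conv_integrable assms)+

lemma conv_scaleR_left:
  "conv (\<lambda>s. r *\<^sub>R k s) u t = r *\<^sub>R conv k u t"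
  by (simp add: conv_def scaleC_scaleR)

lemma loc_int_diff: "loc_int u \<Longrightarrow> loc_int v \<Longrightarrow> loc_int (\<lambda>s. u s - v s)"
  unfolding loc_int_def by (auto intro: set_integral_diff)

lemma conv_diff_right:
  assumes "continuous_on {0..} k" "loc_int u" "loc_int v"
  shows "conv k (\<lambda>s. u s - v s) t = conv k u t - conv k v t"
  unfolding conv_def scaleC_diff_left
  by (rule Henstock_Kurzweil_Integration.integral_diff) (intro conv_integrable assms)+

lemma sd_conv:
  assumes k: "caus k" and u: "loc_int u" and h: "0 \<le> h"
  shows "sd h (conv k u) t = conv (sd h k) u t"
proof -
  note c = caus_cont[OF k] caus_cont[OF caus_shift[OF k]]
  let ?a = "\<lambda>s. k (s - h)" and ?b = "\<lambda>s. k (s - 2 * h)"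
  have a: "continuous_on {0..} ?a" and b: "continuous_on {0..} ?b"
    using caus_cont[OF caus_shift[OF k]] h by auto
  have "conv (sd h k) u t = conv (\<lambda>s. k s - (2 *\<^sub>R ?a s - ?b s)) u t"
    by (simp add: sd_def[abs_def] algebra_simps)
  also have "\<dots> = conv k u t - conv (\<lambda>s. 2 *\<^sub>R ?a s - ?b s) u t"
    by (rule conv_diff_left[OF caus_cont[OF k] _ u]) (intro continuous_intros a b)
  also have "\<dots> = conv k u t - (conv (\<lambda>s. 2 *\<^sub>R ?a s) u t - conv ?b u t)"
    by (subst conv_diff_left[OF _ b u]) (auto intro!: continuous_intros a)
  finally show ?thesis
    using conv_shift[OF k u h, of t] conv_shift[OF k u, of "2 * h" t] h
    by (simp add: sd_def conv_scaleR_left)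
qed

lemma int0_shift:
  fixes p :: "real \<Rightarrow> 'e::banach"
  assumes p: "caus p" and h: "0 \<le> h"
  shows "int0 p (t - h) = int0 (\<lambda>s. p (s - h)) t"
proof (cases "0 \<le> t")
  case True
  have "((\<lambda>s. int0 p (s - h)) has_vector_derivative p (x - h)) (at x within {0..t})" for x
  proof -
    have "((\<lambda>s. s - h) has_vector_derivative 1) (at x within {0..t})"
      by (auto intro!: derivative_eq_intros)
    from vector_diff_chain_within[OF this
        has_vector_derivative_at_within[OF caus_int0(1)[OF p, of "x - h"]]]
    show ?thesis by (simp add: o_def)
  qed
  then have "((\<lambda>s. p (s - h)) has_integral (int0 p (t - h) - int0 p (0 - h))) {0..t}"
    by (intro fundamental_theorem_of_calculus[OF True])
  then show ?thesis
    using h by (simp add: int0_def[of "\<lambda>s. p (s - h)"] integral_unique)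
qed (use h in simp)

lemma int0_diff:
  assumes "caus p" "caus q"
  shows "int0 (\<lambda>s. p s - q s) t = int0 p t - int0 q t"
  unfolding int0_def
  by (intro Henstock_Kurzweil_Integration.integral_diff integrable_continuous_real caus_cont assms)

lemma int0_scaleR: "int0 (\<lambda>s. r *\<^sub>R p s) t = r *\<^sub>R int0 p t"
  by (simp add: int0_def)

lemma int0_sd:
  fixes p :: "real \<Rightarrow> 'e::banach"
  assumes p: "caus p" and h: "0 \<le> h"
  shows "int0 (sd h p) t = sd h (int0 p) t"
proof -
  let ?a = "\<lambda>s. p (s - h)" and ?b = "\<lambda>s. p (s - 2 * h)"
  have ab: "caus ?a" "caus ?b"
    using caus_shift[OF p] h by auto
  have "int0 (sd h p) t = int0 (\<lambda>s. p s - (2 *\<^sub>R ?a s - ?b s)) t"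
    by (simp add: sd_def[abs_def] algebra_simps)
  also have "\<dots> = int0 p t - int0 (\<lambda>s. 2 *\<^sub>R ?a s - ?b s) t"
    by (intro int0_diff p caus_diff caus_scaleR ab)
  also have "\<dots> = int0 p t - (int0 (\<lambda>s. 2 *\<^sub>R ?a s) t - int0 ?b t)"
    by (subst int0_diff) (intro caus_scaleR ab refl)+
  finally show ?thesis
    using int0_shift[OF p h, of t] int0_shift[OF p, of "2 * h" t] h
    by (simp add: sd_def int0_scaleR)
qed

section \<open>Second differences of twice differentiable functions\<close>

text \<open>Mean value inequality for \<open>f s - s *\<^sub>R d\<close>; the closed segment leaves
  the order of \<open>a\<close> and \<open>b\<close> free.\<close>

lemma vector_derivative_bound:
  fixes f :: "real \<Rightarrow> 'e::real_normed_vector"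
  assumes "\<And>s. s \<in> closed_segment a b \<Longrightarrow> (f has_vector_derivative f' s) (at s)"
    and "\<And>s. s \<in> closed_segment a b \<Longrightarrow> norm (f' s - d) \<le> e"
  shows "norm (f b - f a - (b - a) *\<^sub>R d) \<le> e * \<bar>b - a\<bar>"
proof -
  have "norm ((f b - b *\<^sub>R d) - (f a - a *\<^sub>R d)) \<le> e * norm (b - a)"
  proof (rule differentiable_bound[of "closed_segment a b" _ "\<lambda>s h. h *\<^sub>R (f' s - d)"])
    fix s assume s: "s \<in> closed_segment a b"
    have "((\<lambda>s. f s - s *\<^sub>R d) has_vector_derivative (f' s - d)) (at s)"
      using assms(1)[OF s] by (auto intro!: derivative_eq_intros)
    then show "((\<lambda>s. f s - s *\<^sub>R d) has_derivative (\<lambda>h. h *\<^sub>R (f' s - d)))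
        (at s within closed_segment a b)"
      unfolding has_vector_derivative_def by (rule has_derivative_at_withinI)
    show "onorm (\<lambda>h. h *\<^sub>R (f' s - d)) \<le> e"
    proof (rule onorm_bound)
      show "0 \<le> e" using assms(2)[OF s] norm_ge_zero order_trans by blast
      show "norm (h *\<^sub>R (f' s - d)) \<le> e * norm h" for h
        using mult_left_mono[OF assms(2)[OF s], of "\<bar>h\<bar>"] by (simp add: mult.commute)
    qed
  qed auto
  then show ?thesis by (simp add: algebra_simps)
qed

text \<open>A second difference is a first difference of \<open>g s = p s - p (s - h)\<close>. The
  mean value inequality is applied to \<open>g\<close> and then to \<open>p1\<close>, with all
  points staying within \<open>2 * \<bar>h\<bar>\<close> of \<open>t\<close>.\<close>

lemma sd_bound:
  fixes p :: "real \<Rightarrow> 'e::real_normed_vector"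
  assumes p: "\<And>s. (p has_vector_derivative p1 s) (at s)"
    and p1: "\<And>s. (p1 has_vector_derivative p2 s) (at s)"
    and e: "\<And>s. \<bar>s - t\<bar> \<le> 2 * \<bar>h\<bar> \<Longrightarrow> norm (p2 s - p2 t) \<le> e"
  shows "norm (sd h p t - h\<^sup>2 *\<^sub>R p2 t) \<le> e * h\<^sup>2"
proof -
  define g where "g s = p s - p (s - h)" for s
  have shift: "((\<lambda>s. p (s - h)) has_vector_derivative p1 (s - h)) (at s)" for s
  proof -
    have "((\<lambda>s. s - h) has_vector_derivative 1) (at s)"
      by (auto intro!: derivative_eq_intros)
    from vector_diff_chain_at[OF this p[of "s - h"]]
    show ?thesis by (simp add: o_def)
  qed
  have seg: "\<bar>x - t\<bar> \<le> 2 * \<bar>h\<bar>"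
    if "s \<in> closed_segment (t - h) t" "x \<in> closed_segment (s - h) s" for s x
    using that by (auto simp: closed_segment_eq_real_ivl split: if_splits)
  have "norm (g t - g (t - h) - (t - (t - h)) *\<^sub>R (h *\<^sub>R p2 t)) \<le> (e * \<bar>h\<bar>) * \<bar>t - (t - h)\<bar>"
  proof (rule vector_derivative_bound)
    show "(g has_vector_derivative (p1 s - p1 (s - h))) (at s)" for s
      unfolding g_def using p[of s] shift by (auto intro!: derivative_eq_intros)
    fix s assume s: "s \<in> closed_segment (t - h) t"
    have "norm (p1 s - p1 (s - h) - (s - (s - h)) *\<^sub>R p2 t) \<le> e * \<bar>s - (s - h)\<bar>"
      by (rule vector_derivative_bound[OF p1]) (auto intro: e seg[OF s])
    then show "norm (p1 s - p1 (s - h) - h *\<^sub>R p2 t) \<le> e * \<bar>h\<bar>" by simp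
  qed
  moreover have "g t - g (t - h) = sd h p t"
    by (simp add: g_def sd_def algebra_simps scaleR_2)
  ultimately show ?thesis
    by (simp add: power2_eq_square mult.assoc)
qed

lemma sd_int0_int0:
  fixes a :: "real \<Rightarrow> 'e::banach"
  assumes a: "caus a" and e: "0 < e"
  obtains d where "0 < d"
    "\<And>h t. 0 < h \<Longrightarrow> h < d \<Longrightarrow> t \<in> {0..T} \<Longrightarrow> norm (sd h (int0 (int0 a)) t - h\<^sup>2 *\<^sub>R a t) \<le> e * h\<^sup>2"
proof -
  \<comment> \<open>The margin of 1 on the left makes room for the backward points down to
    \<open>t - 2 * h\<close>.\<close>
  obtain d where d: "0 < d"
    "\<And>x y. x \<in> {-1..T+1} \<Longrightarrow> y \<in> {-1..T+1} \<Longrightarrow> \<bar>x - y\<bar> < d \<Longrightarrow> norm (a x - a y) < e"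
    using unif_cont_Icc[OF caus_cont[OF a] e] by blast
  have "norm (sd h (int0 (int0 a)) t - h\<^sup>2 *\<^sub>R a t) \<le> e * h\<^sup>2"
    if "0 < h" "h < min (d / 2) (1 / 2)" "t \<in> {0..T}" for h t
  proof (rule sd_bound[where ?p1.0 = "int0 a"])
    fix s assume "\<bar>s - t\<bar> \<le> 2 * \<bar>h\<bar>"
    with that show "norm (a s - a t) \<le> e"
      by (intro less_imp_le d(2)) auto
  qed (rule caus_int0(1)[OF a] caus_int0(1)[OF caus_int0(2)[OF a]])+
  then show ?thesis
    using that[of "min (d / 2) (1 / 2)"] d(1) by auto
qed

lemma caus_norm: "caus p \<Longrightarrow> caus (\<lambda>t. complex_of_real (norm (p t)))"
  by (auto simp: caus_def intro!: continuous_intros)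

section \<open>Estimates for scalar convolutions in L1 and in L-infinity\<close>

text \<open>Young's inequality. The convolution of the norms dominates, and \<open>int0_conv\<close>
  turns its integral into a single convolution at time \<open>T\<close> whose kernel is bounded by
  the L1 norm of \<open>q\<close>.\<close>

lemma integral_norm_conv_le:
  fixes q u :: "real \<Rightarrow> complex"
  assumes q: "caus q" and u: "loc_int u"
  shows "integral {0..T} (\<lambda>t. norm (conv q u t))
    \<le> integral {0..T} (\<lambda>t. norm (q t)) * integral {0..T} (\<lambda>t. norm (u t))"
proof -
  \<comment> \<open>The norms are stored as complex numbers so that \<open>conv\<close> applies to
    them.\<close>
  define q' where "q' = (\<lambda>t. complex_of_real (norm (q t)))"
  define u' where "u' = (\<lambda>t. complex_of_real (norm (u t)))"
  have q': "caus q'" unfolding q'_def by (rule caus_norm[OF q])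
  have "(\<lambda>s. norm (u s)) absolutely_integrable_on {0..t}" for t
    using loc_int_normD[OF u order_refl] by (auto intro: nonnegative_absolutely_integrable_1)
  from absolutely_integrable_linear[OF this bounded_linear_of_real[where 'a=complex]]
  have u': "loc_int u'"
    by (simp add: loc_int_def u'_def o_def)
  have c': "continuous_on {0..T} (conv q' u')" and c: "continuous_on {0..T} (conv q u)"
    using caus_conv caus_cont q q' u u' by metis+
  have le: "norm (conv q u t) \<le> Re (conv q' u' t)" for t
  proof -
    have i: "(\<lambda>s. u' s *\<^sub>C q' (t - s)) integrable_on {0..t}"
      by (rule conv_integrable[OF caus_cont[OF q'] u'])
    have "norm (conv q u t) \<le> integral {0..t} (\<lambda>s. Re (u' s *\<^sub>C q' (t - s)))"
      unfolding conv_def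
    proof (rule integral_norm_bound_integral)
      show "(\<lambda>s. u s *\<^sub>C q (t - s)) integrable_on {0..t}"
        by (rule conv_integrable[OF caus_cont[OF q] u])
      show "(\<lambda>s. Re (u' s *\<^sub>C q' (t - s))) integrable_on {0..t}"
        using integrable_linear[OF i bounded_linear_Re] by (simp add: o_def)
    qed (simp add: u'_def q'_def scaleC_complex_def norm_mult)
    also have "\<dots> = Re (conv q' u' t)"
      using integral_linear[OF i bounded_linear_Re] by (simp add: o_def conv_def)
    finally show ?thesis .
  qed
  have "integral {0..T} (\<lambda>t. norm (conv q u t)) \<le> integral {0..T} (\<lambda>t. Re (conv q' u' t))"
    by (intro integral_le integrable_continuous_real continuous_intros c c' le)
  also have "\<dots> = Re (int0 (conv q' u') T)"
    unfolding int0_def using integral_linear[OF integrable_continuous_real[OF c'] bounded_linear_Re]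
    by (simp add: o_def)
  also have "\<dots> \<le> norm (conv (int0 q') u' T)"
    by (simp add: int0_conv[OF caus_cont[OF q'] u'] complex_Re_le_cmod)
  also have "\<dots> \<le> integral {0..T} (\<lambda>t. norm (q t)) * integral {0..T} (\<lambda>s. norm (u' s))"
  proof (rule norm_conv_le[OF caus_cont[OF caus_int0(2)[OF q']] u'])
    fix s assume s: "s \<in> {0..T}"
    have nq: "(\<lambda>t. norm (q t)) integrable_on {0..x}" for x
      by (intro integrable_continuous_real continuous_intros caus_cont[OF q])
    have "norm (int0 q' s) \<le> integral {0..s} (\<lambda>t. norm (q t))"
      unfolding int0_def
      by (intro integral_norm_bound_integral integrable_continuous_real caus_cont[OF q'] nq)
        (simp add: q'_def)
    also have "\<dots> \<le> integral {0..T} (\<lambda>t. norm (q t))"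
      by (rule integral_subset_le[OF _ nq nq]) (use s in auto)
    finally show "norm (int0 q' s) \<le> integral {0..T} (\<lambda>t. norm (q t))" .
  qed
  finally show ?thesis by (simp add: u'_def)
qed

lemma norm_conv_le_ess:
  fixes q u :: "real \<Rightarrow> complex"
  assumes q: "caus q" and u: "loc_int u" and N: "negligible N"
    and K: "\<And>s. s \<in> {0..t} - N \<Longrightarrow> norm (u s) \<le> K"
  shows "norm (conv q u t) \<le> K * integral {0..t} (\<lambda>s. norm (q s))"
proof -
  let ?f = "\<lambda>s. if s \<in> N then 0 else u s *\<^sub>C q (t - s)"
  have nq: "(\<lambda>s. norm (q (t - s))) integrable_on {0..t}"
    by (intro integrable_continuous_real continuous_intros
        continuous_on_reflected[OF caus_cont[OF q]])
  have "conv q u t = integral {0..t} ?f"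
    unfolding conv_def by (rule integral_spike[OF N]) auto
  also have "norm \<dots> \<le> integral {0..t} (\<lambda>s. \<bar>K\<bar> * norm (q (t - s)))"
  proof (rule integral_norm_bound_integral)
    show "?f integrable_on {0..t}"
      by (rule integrable_spike[OF conv_integrable[OF caus_cont[OF q] u] N]) auto
    show "norm (?f s) \<le> \<bar>K\<bar> * norm (q (t - s))" if "s \<in> {0..t}" for s
      using K[of s] that by (auto simp: norm_scaleC intro!: mult_right_mono)
  qed (intro integrable_on_mult_right nq)
  also have "\<dots> = \<bar>K\<bar> * integral {0..t} (\<lambda>s. norm (q (t - s)))"
    by simp
  finally have *: "norm (conv q u t) \<le> \<bar>K\<bar> * integral {0..t} (\<lambda>s. norm (q s))"
    by (simp only: integral_reverse[of t "\<lambda>s. norm (q s)"])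
  \<comment> \<open>So far the bound carries \<open>\<bar>K\<bar>\<close>. For \<open>0 < t\<close>
    some point outside \<open>N\<close> forces \<open>0 \<le> K\<close>; for
    \<open>t \<le> 0\<close> the integral of \<open>norm (q s)\<close> is 0.\<close>
  show ?thesis
  proof (cases "0 < t")
    case True
    have "\<not> {0..t} \<subseteq> N"
      using negligible_subset[OF N, of "{0..t}"] negligible_interval(1)[of 0 t] True by auto
    then obtain s where "s \<in> {0..t} - N" by blast
    then have "0 \<le> K" using K[of s] norm_ge_zero order_trans by blast
    with * show ?thesis by simp
  next
    case False
    then have "integral {0..t} (\<lambda>s. norm (q s)) = 0"
      by (cases "t = 0") auto
    then show ?thesis using False by simp
  qed
qed

section \<open>Approximation in the mean\<close>

lemma AE_Icc_iff:
  "(AE t in lebesgue_on {a..b::real}. P t) \<longleftrightarrow> (\<exists>N. negligible N \<and> (\<forall>t\<in>{a..b} - N. P t))"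
proof
  assume "AE t in lebesgue_on {a..b}. P t"
  then have "AE t in lebesgue. t \<in> {a..b} \<longrightarrow> P t"
    by (subst (asm) AE_restrict_space_iff) auto
  then obtain N where "N \<in> null_sets lebesgue" "{t \<in> space lebesgue. \<not> (t \<in> {a..b} \<longrightarrow> P t)} \<subseteq> N"
    by (auto simp: eventually_ae_filter)
  then show "\<exists>N. negligible N \<and> (\<forall>t\<in>{a..b} - N. P t)"
    by (intro exI[of _ N]) (auto simp: negligible_iff_null_sets)
next
  assume "\<exists>N. negligible N \<and> (\<forall>t\<in>{a..b} - N. P t)"
  then obtain N where N: "N \<in> null_sets lebesgue" "\<forall>t\<in>{a..b} - N. P t"
    by (auto simp: negligible_iff_null_sets)
  then have "AE t in lebesgue. t \<in> {a..b} \<longrightarrow> P t"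
    by (intro AE_I'[OF N(1)]) auto
  then show "AE t in lebesgue_on {a..b}. P t"
    by (subst AE_restrict_space_iff) auto
qed

lemma integral_norm_triangle:
  fixes f g h :: "real \<Rightarrow> complex"
  assumes "f absolutely_integrable_on S" "g absolutely_integrable_on S" "h absolutely_integrable_on S"
  shows "integral S (\<lambda>x. norm (f x - h x))
    \<le> integral S (\<lambda>x. norm (f x - g x)) + integral S (\<lambda>x. norm (g x - h x))"
proof -
  have i: "(\<lambda>x. norm (f x - h x)) integrable_on S" "(\<lambda>x. norm (f x - g x)) integrable_on S"
    "(\<lambda>x. norm (g x - h x)) integrable_on S"
    using set_integral_diff(1)[OF assms(1,3)] set_integral_diff(1)[OF assms(1,2)]
      set_integral_diff(1)[OF assms(2,3)] by (auto simp: absolutely_integrable_on_def)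
  have "integral S (\<lambda>x. norm (f x - h x)) \<le> integral S (\<lambda>x. norm (f x - g x) + norm (g x - h x))"
    by (intro integral_le i integrable_add norm_diff_triangle_ineq[of "_" "_" "_" "_", simplified])
      (metis diff_add_cancel add_diff_eq norm_triangle_ineq)
  also have "\<dots> = integral S (\<lambda>x. norm (f x - g x)) + integral S (\<lambda>x. norm (g x - h x))"
    by (rule Henstock_Kurzweil_Integration.integral_add[OF i(2,3)])
  finally show ?thesis .
qed

text \<open>Setting all functions to 0 on \<open>N\<close> turns the almost everywhere assumptions
  into pointwise ones.\<close>

lemma dominated_convergence_L1:
  fixes f :: "nat \<Rightarrow> real \<Rightarrow> complex"
  assumes f: "\<And>n. f n absolutely_integrable_on S" and h: "h integrable_on S" and N: "negligible N"
    and le: "\<And>n x. x \<in> S - N \<Longrightarrow> norm (f n x) \<le> h x"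
    and lim: "\<And>x. x \<in> S - N \<Longrightarrow> (\<lambda>n. f n x) \<longlonglongrightarrow> g x"
  shows "g absolutely_integrable_on S" "(\<lambda>n. integral S (\<lambda>x. norm (f n x - g x))) \<longlonglongrightarrow> 0"
proof -
  define F where "F n x = (if x \<in> N then 0 else f n x)" for n x
  define G where "G x = (if x \<in> N then 0 else g x)" for x
  define H where "H x = (if x \<in> N then 0 else h x)" for x
  have Fa: "F n absolutely_integrable_on S" for n
    by (rule absolutely_integrable_spike[OF f[of n] N]) (auto simp: F_def)
  have Hi: "H integrable_on S"
    by (rule integrable_spike[OF h N]) (auto simp: H_def)
  have le': "norm (F n x) \<le> H x" if "x \<in> S" for n x
    using le that by (auto simp: F_def H_def)
  have lim': "(\<lambda>n. F n x) \<longlonglongrightarrow> G x" if "x \<in> S" for x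
    using lim that by (auto simp: F_def G_def)
  have leG: "norm (G x) \<le> H x" if "x \<in> S" for x
    by (rule LIMSEQ_le_const2[OF tendsto_norm[OF lim'[OF that]]]) (use le'[OF that] in blast)
  have Ga: "G absolutely_integrable_on S"
    by (rule dominated_convergence_absolutely_integrable[OF Fa Hi leG lim'])
  show "g absolutely_integrable_on S"
    by (rule absolutely_integrable_spike[OF Ga N]) (auto simp: G_def)
  have "(\<lambda>n. integral S (\<lambda>x. norm (F n x - G x))) \<longlonglongrightarrow> integral S (\<lambda>x. 0)"
  proof (rule dominated_convergence(2)[where h = "\<lambda>x. 2 * H x"])
    show "(\<lambda>x. norm (F n x - G x)) integrable_on S" for n
      using set_integral_diff(1)[OF Fa Ga] by (auto simp: absolutely_integrable_on_def)
    show "(\<lambda>x. 2 * H x) integrable_on S"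
      using Hi by (rule integrable_on_mult_right)
    show "norm (norm (F n x - G x)) \<le> 2 * H x" if "x \<in> S" for n x
      using norm_triangle_ineq4[of "F n x" "G x"] le'[OF that, of n] leG[OF that] by simp
    show "(\<lambda>n. norm (F n x - G x)) \<longlonglongrightarrow> 0" if "x \<in> S" for x
      using tendsto_norm[OF tendsto_diff[OF lim'[OF that] tendsto_const[of "G x"]]] by simp
  qed
  moreover have "integral S (\<lambda>x. norm (F n x - G x)) = integral S (\<lambda>x. norm (f n x - g x))" for n
    by (rule integral_spike[OF N]) (auto simp: F_def G_def)
  ultimately show "(\<lambda>n. integral S (\<lambda>x. norm (f n x - g x))) \<longlonglongrightarrow> 0" by simp
qed

lemma absolutely_integrable_truncate:
  fixes u :: "real \<Rightarrow> complex"
  assumes "u absolutely_integrable_on S" "S \<in> sets lebesgue"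
  shows "(\<lambda>t. if norm (u t) \<le> M then u t else 0) absolutely_integrable_on S"
proof -
  have [measurable]: "u \<in> borel_measurable (lebesgue_on S)"
    using assms by (simp add: absolutely_integrable_measurable)
  have "(\<lambda>t. norm (u t)) integrable_on S"
    using assms(1) by (simp add: absolutely_integrable_on_def)
  then show ?thesis
    by (rule measurable_bounded_by_integrable_imp_absolutely_integrable[rotated 2])
      (auto simp: assms(2))
qed

text \<open>Truncation makes \<open>u\<close> bounded. The continuous functions that witness
  \<open>measurable_on\<close> are then reshaped: \<open>cl\<close> retracts them to a ball, which
  gives a dominating constant, and a steepening factor forces the value 0 up to time 0.\<close>

lemma L1_approx_caus:
  assumes u: "loc_int u" and e: "0 < e"
  shows "\<exists>v. caus v \<and> integral {0..T} (\<lambda>t. norm (u t - v t)) < e"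
proof -
  let ?S = "{0..T}"
  have ua: "u absolutely_integrable_on ?S" and un: "(\<lambda>t. norm (u t)) integrable_on ?S"
    using loc_int_absD[OF u order_refl] loc_int_normD[OF u order_refl] by auto
  define w where "w n t = (if norm (u t) \<le> real n then u t else 0)" for n t
  have wa: "w n absolutely_integrable_on ?S" for n
    unfolding w_def by (rule absolutely_integrable_truncate[OF ua]) simp
  have "(\<lambda>n. integral ?S (\<lambda>t. norm (w n t - u t))) \<longlonglongrightarrow> 0"
  proof (rule dominated_convergence_L1(2)[OF wa un negligible_empty])
    show "(\<lambda>n. w n t) \<longlonglongrightarrow> u t" for t
    proof (rule tendsto_eventually)
      show "\<forall>\<^sub>F n in sequentially. w n t = u t"
        using eventually_ge_at_top[of "nat \<lceil>norm (u t)\<rceil>"]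
        by eventually_elim (auto simp: w_def nat_le_iff ceiling_le_iff)
    qed
  qed (auto simp: w_def)
  then have "\<forall>\<^sub>F n in sequentially. integral ?S (\<lambda>t. norm (w n t - u t)) < e / 2"
    by (rule order_tendstoD(2)) (use e in simp)
  then obtain n where n: "integral ?S (\<lambda>t. norm (w n t - u t)) < e / 2"
    by (auto simp: eventually_sequentially)
  have "w n measurable_on ?S"
    using wa[of n] by (subst measurable_on_iff_borel_measurable)
      (auto simp: absolutely_integrable_measurable)
  then obtain N g where N: "negligible N" and g: "\<And>k. continuous_on UNIV (g k)"
    and gw: "\<And>t. t \<notin> N \<Longrightarrow> (\<lambda>k. g k t) \<longlonglongrightarrow> (if t \<in> ?S then w n t else 0)"
    unfolding measurable_on_def by blast
  \<comment> \<open>One more than the truncation level: positive even for \<open>n = 0\<close>,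
    while \<open>cl\<close> still fixes all values of \<open>w n\<close>.\<close>
  define M where "M = real n + 1"
  have M: "0 < M" by (simp add: M_def)
  define cl where "cl z = (M / max M (norm z)) *\<^sub>R z" for z :: complex
  define v where "v k t = min 1 (max 0 (real k * t)) *\<^sub>R cl (g k t)" for k t
  have cl_cont: "continuous_on UNIV cl"
    unfolding cl_def using M by (intro continuous_intros) auto
  have cl_le: "norm (cl z) \<le> M" for z
    using M by (auto simp: cl_def field_simps max_def)
  have cl_id: "cl z = z" if "norm z \<le> real n" for z
    using that by (simp add: cl_def M_def max_def)
  have v: "caus (v k)" for k
    unfolding caus_def
  proof (intro conjI allI impI)
    show "continuous_on UNIV (v k)"
      unfolding v_def
      by (intro continuous_intros g continuous_on_compose2[OF cl_cont]) auto
    show "v k t = 0" if "t \<le> 0" for t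
      using that by (simp add: v_def mult_nonneg_nonpos max_absorb1)
  qed
  \<comment> \<open>At time 0 the steepening factor is 0 for every \<open>k\<close>, so 0 joins the
    null set.\<close>
  have "(\<lambda>k. integral ?S (\<lambda>t. norm (v k t - w n t))) \<longlonglongrightarrow> 0"
  proof (rule dominated_convergence_L1(2)[where h = "\<lambda>_. M" and N = "insert 0 N"])
    show "v k absolutely_integrable_on ?S" for k
      by (rule loc_int_absD[OF caus_loc_int[OF v]]) simp
    show "negligible (insert 0 N)" using N by simp
    show "norm (v k t) \<le> M" for k t
    proof -
      have "norm (v k t) \<le> 1 * norm (cl (g k t))"
        unfolding v_def norm_scaleR by (intro mult_right_mono) auto
      then show ?thesis using cl_le[of "g k t"] by simp
    qed
    fix t assume t: "t \<in> ?S - insert 0 N"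
    have "(\<lambda>k. cl (g k t)) \<longlonglongrightarrow> cl (w n t)"
    proof (rule isCont_tendsto_compose[where g = cl and l = "w n t"])
      show "isCont cl (w n t)"
        using cl_cont by (simp add: continuous_on_eq_continuous_at)
      show "(\<lambda>k. g k t) \<longlonglongrightarrow> w n t" using gw[of t] t by simp
    qed
    moreover have "cl (w n t) = w n t"
      by (rule cl_id) (simp add: w_def)
    moreover have "(\<lambda>k. min 1 (max 0 (real k * t))) \<longlonglongrightarrow> 1"
    proof (rule tendsto_eventually)
      have "min 1 (max 0 (real k * t)) = 1" if "nat \<lceil>1 / t\<rceil> \<le> k" for k
      proof -
        have "1 / t \<le> real k" using that by (simp add: nat_le_iff ceiling_le_iff)
        then have "1 \<le> real k * t" using t by (simp add: field_simps)
        then show ?thesis by simp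
      qed
      then show "\<forall>\<^sub>F k in sequentially. min 1 (max 0 (real k * t)) = 1"
        by (rule eventually_sequentiallyI)
    qed
    ultimately show "(\<lambda>k. v k t) \<longlonglongrightarrow> w n t"
      unfolding v_def using tendsto_scaleR[of "\<lambda>k. min 1 (max 0 (real k * t))" 1] by fastforce
  qed (rule integrable_const_ivl)
  then have "\<forall>\<^sub>F k in sequentially. integral ?S (\<lambda>t. norm (v k t - w n t)) < e / 2"
    by (rule order_tendstoD(2)) (use e in simp)
  then obtain k where k: "integral ?S (\<lambda>t. norm (v k t - w n t)) < e / 2"
    by (auto simp: eventually_sequentially)
  have "integral ?S (\<lambda>t. norm (u t - v k t))
      \<le> integral ?S (\<lambda>t. norm (u t - w n t)) + integral ?S (\<lambda>t. norm (w n t - v k t))"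
    by (rule integral_norm_triangle[OF ua wa loc_int_absD[OF caus_loc_int[OF v]]]) simp
  with n k have "integral ?S (\<lambda>t. norm (u t - v k t)) < e"
    by (simp add: norm_minus_commute)
  with v show ?thesis by blast
qed

lemma integral_norm_le_const:
  fixes f :: "real \<Rightarrow> 'e::banach"
  assumes "\<And>t. t \<in> {0..T} \<Longrightarrow> norm (f t) \<le> e" "0 \<le> e" "(\<lambda>t. norm (f t)) integrable_on {0..T}"
  shows "integral {0..T} (\<lambda>t. norm (f t)) \<le> e * \<bar>T\<bar>"
proof (cases "0 \<le> T")
  case True
  have "integral {0..T} (\<lambda>t. norm (f t)) \<le> integral {0..T} (\<lambda>t. e)"
    by (rule integral_le) (use assms in auto)
  then show ?thesis using True by (simp add: mult.commute)
qed (use assms(2) in \<open>simp add: mult_nonneg_nonpos\<close>)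

text \<open>Take for \<open>g\<close> the second difference quotient of a continuous causal
  \<open>v\<close>. Differences commute with \<open>int0\<close>, so the double primitive of
  \<open>g\<close> is the difference quotient of the double primitive of \<open>v\<close>, which is
  uniformly close to \<open>v\<close>.\<close>

lemma L1_approx_int0_int0:
  assumes u: "loc_int u" and e: "0 < e"
  shows "\<exists>g. caus g \<and> integral {0..T} (\<lambda>t. norm (u t - int0 (int0 g) t)) < e"
proof -
  obtain v where v: "caus v" and uv: "integral {0..T} (\<lambda>t. norm (u t - v t)) < e / 2"
    using L1_approx_caus[OF u, of "e / 2"] e by auto
  define e' where "e' = e / (2 * (\<bar>T\<bar> + 1))"
  have e': "0 < e'" using e by (simp add: e'_def)
  obtain d where d: "0 < d"
    "\<And>h t. 0 < h \<Longrightarrow> h < d \<Longrightarrow> t \<in> {0..T} \<Longrightarrow> norm (sd h (int0 (int0 v)) t - h\<^sup>2 *\<^sub>R v t) \<le> e' * h\<^sup>2"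
    using sd_int0_int0[OF v e'] by blast
  define h where "h = d / 2"
  have h: "0 < h" "h < d" using d(1) by (auto simp: h_def)
  define g where "g t = inverse (h\<^sup>2) *\<^sub>R sd h v t" for t
  have g: "caus g" unfolding g_def[abs_def] using h by (intro caus_scaleR caus_sd v) simp
  have "int0 g = (\<lambda>t. inverse (h\<^sup>2) *\<^sub>R sd h (int0 v) t)"
    using h by (simp add: g_def[abs_def] int0_scaleR int0_sd[OF v] fun_eq_iff)
  then have gg: "int0 (int0 g) t = inverse (h\<^sup>2) *\<^sub>R sd h (int0 (int0 v)) t" for t
    using h by (simp add: int0_scaleR int0_sd[OF caus_int0(2)[OF v]])
  have G: "caus (int0 (int0 g))" by (intro caus_int0(2) g)
  have "norm (v t - int0 (int0 g) t) \<le> e'" if "t \<in> {0..T}" for t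
  proof -
    have "v t - int0 (int0 g) t = - (inverse (h\<^sup>2) *\<^sub>R (sd h (int0 (int0 v)) t - h\<^sup>2 *\<^sub>R v t))"
      using h by (simp add: gg scaleR_diff_right)
    then have "norm (v t - int0 (int0 g) t) = inverse (h\<^sup>2) * norm (sd h (int0 (int0 v)) t - h\<^sup>2 *\<^sub>R v t)"
      by (simp only: norm_minus_cancel norm_scaleR) simp
    also have "\<dots> \<le> inverse (h\<^sup>2) * (e' * h\<^sup>2)"
      by (rule mult_left_mono[OF d(2)[OF h that]]) simp
    also have "\<dots> = e'" using h by (simp add: field_simps)
    finally show ?thesis .
  qed
  then have "integral {0..T} (\<lambda>t. norm (v t - int0 (int0 g) t)) \<le> e' * \<bar>T\<bar>"
    using e' by (intro integral_norm_le_const integrable_continuous_real continuous_intros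
        caus_cont v G) auto
  also have "\<dots> < e / 2"
    using e by (simp add: e'_def field_simps)
  finally have "integral {0..T} (\<lambda>t. norm (v t - int0 (int0 g) t)) < e / 2" .
  moreover have "integral {0..T} (\<lambda>t. norm (u t - int0 (int0 g) t))
      \<le> integral {0..T} (\<lambda>t. norm (u t - v t)) + integral {0..T} (\<lambda>t. norm (v t - int0 (int0 g) t))"
    using loc_int_absD[OF u order_refl] loc_int_absD[OF caus_loc_int[OF v] order_refl]
      loc_int_absD[OF caus_loc_int[OF G] order_refl] by (rule integral_norm_triangle)
  ultimately show ?thesis using uv g by (intro exI[of _ g]) auto
qed

section \<open>Completeness of L1 on compact intervals\<close>

text \<open>Monotone convergence: the sum has a finite integral and is therefore finite almost
  everywhere.\<close>

lemma AE_summable_integrable: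
  fixes g :: "nat \<Rightarrow> 'a \<Rightarrow> real"
  assumes g: "\<And>n. integrable M (g n)" and nonneg: "\<And>n x. 0 \<le> g n x"
    and sum: "summable (\<lambda>n. integral\<^sup>L M (g n))"
  shows "AE x in M. summable (\<lambda>n. g n x)" "integrable M (\<lambda>x. \<Sum>n. g n x)"
proof -
  have [measurable]: "g n \<in> borel_measurable M" for n
    using g by auto
  have "(\<integral>\<^sup>+x. (\<Sum>n. ennreal (g n x)) \<partial>M) = (\<Sum>n. \<integral>\<^sup>+x. ennreal (g n x) \<partial>M)"
    by (rule nn_integral_suminf) simp
  also have "\<dots> = (\<Sum>n. ennreal (integral\<^sup>L M (g n)))"
    using nn_integral_eq_integral[OF g] nonneg by simp
  also have "\<dots> = ennreal (\<Sum>n. integral\<^sup>L M (g n))"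
    by (rule suminf_ennreal_eq[OF _ summable_sums[OF sum]]) (simp add: nonneg)
  finally have "(\<integral>\<^sup>+x. (\<Sum>n. ennreal (g n x)) \<partial>M) \<noteq> \<infinity>" by simp
  then have "AE x in M. (\<Sum>n. ennreal (g n x)) \<noteq> \<infinity>"
    by (intro nn_integral_PInf_AE) auto
  then show *: "AE x in M. summable (\<lambda>n. g n x)"
    by eventually_elim (rule summable_suminf_not_top, auto simp: nonneg)
  show "integrable M (\<lambda>x. \<Sum>n. g n x)"
    using g * sum nonneg by (intro integrable_suminf) auto
qed

text \<open>Riesz-Fischer with a window that grows with \<open>n\<close>, so that one limit
  function, defined pointwise by \<open>lim\<close>, serves every \<open>T\<close>.\<close>

lemma L1_complete:
  fixes Y :: "nat \<Rightarrow> real \<Rightarrow> complex"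
  assumes Y: "\<And>n. caus (Y n)"
    and diff: "\<And>n. integral {0..real n} (\<lambda>t. norm (Y (Suc n) t - Y n t)) \<le> (1 / 2) ^ n"
  obtains f where "loc_int f"
    "\<And>T. (\<lambda>n. integral {0..T} (\<lambda>t. norm (Y n t - f t))) \<longlonglongrightarrow> 0"
    "\<And>T. \<exists>N. negligible N \<and> (\<forall>t\<in>{0..T} - N. (\<lambda>n. Y n t) \<longlonglongrightarrow> f t)"
proof -
  define f where "f t = lim (\<lambda>n. Y n t)" for t
  define g where "g n t = norm (Y (Suc n) t - Y n t)" for n t
  have gc: "continuous_on S (g n)" for n S
    unfolding g_def by (intro continuous_intros caus_cont Y)
  have main: "f absolutely_integrable_on {0..T} \<and>
      (\<lambda>n. integral {0..T} (\<lambda>t. norm (Y n t - f t))) \<longlonglongrightarrow> 0 \<and>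
      (\<exists>N. negligible N \<and> (\<forall>t\<in>{0..T} - N. (\<lambda>n. Y n t) \<longlonglongrightarrow> f t))" for T
  proof -
    let ?M = "lebesgue_on {0..T}"
    have gi: "integrable ?M (g n)" for n
      by (rule continuous_imp_integrable_real[OF gc])
    have gI: "integral\<^sup>L ?M (g n) = integral {0..T} (g n)" for n
      by (rule lebesgue_integral_eq_integral[OF gi]) simp
    \<comment> \<open>Only from the index \<open>nat \<lceil>T\<rceil>\<close> on does the window
      \<open>{0..real n}\<close> contain \<open>{0..T}\<close>.\<close>
    have "norm (integral\<^sup>L ?M (g n)) \<le> (1 / 2) ^ n" if "n \<ge> nat \<lceil>T\<rceil>" for n
    proof -
      have "0 \<le> integral {0..T} (g n)"
        by (rule integral_nonneg[OF integrable_continuous_real[OF gc]]) (simp add: g_def)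
      moreover have "integral {0..T} (g n) \<le> integral {0..real n} (g n)"
        using that by (intro integral_subset_le integrable_continuous_real gc)
          (auto simp: g_def nat_le_iff ceiling_le_iff)
      moreover have "integral {0..real n} (g n) \<le> (1 / 2) ^ n"
        using diff[of n] unfolding g_def .
      ultimately show ?thesis unfolding gI by simp
    qed
    then have sum: "summable (\<lambda>n. integral\<^sup>L ?M (g n))"
      by (intro summable_comparison_test'[OF summable_geometric[of "1 / 2 :: real"], of "nat \<lceil>T\<rceil>"]) auto
    note AE = AE_summable_integrable[OF gi _ sum]
    have g0: "0 \<le> g n t" for n t by (simp add: g_def)
    have "\<exists>N. negligible N \<and> (\<forall>t\<in>{0..T} - N. summable (\<lambda>n. g n t))"
      using AE(1)[OF g0] by (simp only: AE_Icc_iff)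
    then obtain N where N': "negligible N \<and> (\<forall>t\<in>{0..T} - N. summable (\<lambda>n. g n t))" ..
    then have N: "negligible N" "\<And>t. t \<in> {0..T} - N \<Longrightarrow> summable (\<lambda>n. g n t)"
      by simp_all
    \<comment> \<open>\<open>Y n\<close> telescopes into its first term and increments, so
      \<open>D\<close> dominates all of them.\<close>
    define D where "D t = norm (Y 0 t) + (\<Sum>n. g n t)" for t
    have gsum: "(\<lambda>t. \<Sum>n. g n t) integrable_on {0..T}"
      using AE(2)[OF g0] by (rule integrable_on_lebesgue_on) simp
    have "continuous_on {0..T} (\<lambda>t. norm (Y 0 t))"
      by (intro continuous_intros caus_cont Y)
    from integrable_add[OF integrable_continuous_real[OF this] gsum]
    have D: "D integrable_on {0..T}"
      by (simp add: D_def[abs_def])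
    have lim: "(\<lambda>n. Y n t) \<longlonglongrightarrow> f t" and le: "norm (Y n t) \<le> D t" if t: "t \<in> {0..T} - N" for t n
    proof -
      have tele: "Y n t = Y 0 t + (\<Sum>k<n. Y (Suc k) t - Y k t)" for n
        by (induction n) simp_all
      have "summable (\<lambda>k. Y (Suc k) t - Y k t)"
        using N(2)[OF t] unfolding g_def by (rule summable_norm_cancel)
      then have "(\<lambda>n. Y 0 t + (\<Sum>k<n. Y (Suc k) t - Y k t)) \<longlonglongrightarrow> Y 0 t + (\<Sum>k. Y (Suc k) t - Y k t)"
        by (intro tendsto_add tendsto_const summable_LIMSEQ)
      then have "convergent (\<lambda>n. Y n t)"
        unfolding tele[symmetric] by (rule convergentI)
      then show "(\<lambda>n. Y n t) \<longlonglongrightarrow> f t"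
        by (simp add: f_def convergent_LIMSEQ_iff)
      have "norm (\<Sum>k<n. Y (Suc k) t - Y k t) \<le> (\<Sum>k<n. g k t)"
        unfolding g_def by (rule norm_sum)
      also have "\<dots> \<le> (\<Sum>k. g k t)"
        by (rule sum_le_suminf[OF N(2)[OF t]]) (auto simp: g0)
      finally have "norm (Y 0 t + (\<Sum>k<n. Y (Suc k) t - Y k t)) \<le> D t"
        unfolding D_def by (rule norm_triangle_mono[OF order_refl])
      then show "norm (Y n t) \<le> D t" by (simp only: tele[symmetric])
    qed
    have Ya: "Y n absolutely_integrable_on {0..T}" for n
      by (rule loc_int_absD[OF caus_loc_int[OF Y]]) simp
    from dominated_convergence_L1[OF Ya D N(1) le lim] N(1) lim show ?thesis by blast
  qed
  show ?thesis
    by (rule that[of f]) (use main in \<open>auto simp: loc_int_def\<close>)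
qed

section \<open>Kernels whose second derivative is a bounded measure\<close>

text \<open>The condition \<open>bv2 \<psi> c\<close> says that the distributional second derivative of \<open>\<psi>\<close> is a complex
  measure of total variation at most \<open>c\<close>.\<close>

definition bv2 :: "(real \<Rightarrow> complex) \<Rightarrow> real \<Rightarrow> bool"
  where "bv2 \<psi> c \<longleftrightarrow> (\<forall>h>0. \<forall>T. integral {0..T} (\<lambda>t. norm (sd h \<psi> t)) \<le> c * h\<^sup>2)"

lemma bv2_nonneg: "bv2 \<psi> c \<Longrightarrow> 0 \<le> c"
  unfolding bv2_def by (drule spec[of _ 1]) (auto dest!: spec[of _ 0])

text \<open>The second derivative of the output is obtained as the limit of these quotients as
  \<open>h\<close> tends to 0; \<open>bv2\<close> bounds them uniformly in \<open>h\<close>.\<close>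

definition dq :: "(real \<Rightarrow> complex) \<Rightarrow> (real \<Rightarrow> complex) \<Rightarrow> real \<Rightarrow> real \<Rightarrow> complex"
  where "dq \<psi> u h t = inverse (h\<^sup>2) *\<^sub>R sd h (conv \<psi> u) t"

lemma caus_dq: "caus \<psi> \<Longrightarrow> loc_int u \<Longrightarrow> 0 < h \<Longrightarrow> caus (dq \<psi> u h)"
  unfolding dq_def[abs_def] by (intro caus_scaleR caus_sd caus_conv caus_cont) auto

lemma dq_conv: "caus \<psi> \<Longrightarrow> loc_int u \<Longrightarrow> 0 < h \<Longrightarrow> dq \<psi> u h t = inverse (h\<^sup>2) *\<^sub>R conv (sd h \<psi>) u t"
  by (simp add: dq_def sd_conv)

text \<open>Young's inequality for the kernel \<open>sd h \<psi>\<close>; the factor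
  \<open>h\<^sup>2\<close> of \<open>bv2\<close> cancels the one in the quotient.\<close>

lemma dq_L1_bound:
  assumes \<psi>: "caus \<psi>" and bv: "bv2 \<psi> c" and u: "loc_int u" and h: "0 < h"
  shows "integral {0..T} (\<lambda>t. norm (dq \<psi> u h t)) \<le> c * integral {0..T} (\<lambda>t. norm (u t))"
proof -
  have U0: "0 \<le> integral {0..T} (\<lambda>t. norm (u t))"
    by (rule integral_nonneg[OF loc_int_normD[OF u order_refl]]) simp
  have "integral {0..T} (\<lambda>t. norm (dq \<psi> u h t))
      = inverse (h\<^sup>2) * integral {0..T} (\<lambda>t. norm (conv (sd h \<psi>) u t))"
    using h by (simp add: dq_conv[OF \<psi> u h])
  also have "\<dots> \<le> inverse (h\<^sup>2) * ((c * h\<^sup>2) * integral {0..T} (\<lambda>t. norm (u t)))"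
  proof (rule mult_left_mono)
    have "integral {0..T} (\<lambda>t. norm (conv (sd h \<psi>) u t))
        \<le> integral {0..T} (\<lambda>t. norm (sd h \<psi> t)) * integral {0..T} (\<lambda>t. norm (u t))"
      using h by (intro integral_norm_conv_le caus_sd \<psi> u) simp
    also have "\<dots> \<le> (c * h\<^sup>2) * integral {0..T} (\<lambda>t. norm (u t))"
      using bv h by (intro mult_right_mono U0) (auto simp: bv2_def)
    finally show "integral {0..T} (\<lambda>t. norm (conv (sd h \<psi>) u t))
        \<le> (c * h\<^sup>2) * integral {0..T} (\<lambda>t. norm (u t))" .
  qed simp
  also have "\<dots> = c * integral {0..T} (\<lambda>t. norm (u t))"
    using h by (simp add: field_simps)
  finally show ?thesis .
qed

lemma dq_diff:
  assumes "caus \<psi>" "loc_int u" "loc_int v" "0 < h"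
  shows "dq \<psi> u h t - dq \<psi> v h t = dq \<psi> (\<lambda>s. u s - v s) h t"
  using assms caus_cont[OF caus_sd[OF assms(1), of h]]
  by (simp add: dq_conv loc_int_diff conv_diff_right scaleR_diff_right)

lemma dq_ess_bound:
  assumes \<psi>: "caus \<psi>" and bv: "bv2 \<psi> c" and u: "loc_int u" and h: "0 < h"
    and N: "negligible N" and K: "\<And>s. s \<in> {0..T} - N \<Longrightarrow> norm (u s) \<le> K" and t: "t \<in> {0..T}"
    and K0: "0 \<le> K"
  shows "norm (dq \<psi> u h t) \<le> c * K"
proof -
  have "norm (conv (sd h \<psi>) u t) \<le> K * integral {0..t} (\<lambda>s. norm (sd h \<psi> s))"
    by (rule norm_conv_le_ess[OF caus_sd[OF \<psi>] u N K]) (use h t in auto)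
  also have "\<dots> \<le> K * (c * h\<^sup>2)"
    using bv h K0 by (intro mult_left_mono) (auto simp: bv2_def)
  finally have "inverse (h\<^sup>2) * norm (conv (sd h \<psi>) u t) \<le> inverse (h\<^sup>2) * (K * (c * h\<^sup>2))"
    by (rule mult_left_mono) simp
  also have "\<dots> = c * K" using h by (simp add: field_simps)
  finally show ?thesis using h by (simp add: dq_conv[OF \<psi> u h])
qed

text \<open>Commutativity lets \<open>\<psi>\<close> act as the signal, so that both integrations
  can be pulled out of the kernel by \<open>int0_conv\<close>.\<close>

lemma conv_int0_int0:
  assumes "caus \<psi>" "caus g"
  shows "conv \<psi> (int0 (int0 g)) = int0 (int0 (conv g \<psi>))"
proof -
  have "conv \<psi> (int0 (int0 g)) = conv (int0 (int0 g)) \<psi>"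
    by (rule ext) (rule conv_commute)
  also have "\<dots> = int0 (conv (int0 g) \<psi>)"
    by (rule int0_conv[symmetric, OF caus_cont[OF caus_int0(2)[OF assms(2)]] caus_loc_int[OF assms(1)]])
  also have "conv (int0 g) \<psi> = int0 (conv g \<psi>)"
    by (rule int0_conv[symmetric, OF caus_cont[OF assms(2)] caus_loc_int[OF assms(1)]])
  finally show ?thesis .
qed

text \<open>For a signal that is a double primitive, the convolution has the classical second
  derivative \<open>conv g \<psi>\<close>, and \<open>sd_int0_int0\<close> applies.\<close>

lemma dq_int0_int0:
  assumes \<psi>: "caus \<psi>" and g: "caus g" and e: "0 < e"
  obtains d where "0 < d"
    "\<And>h t. 0 < h \<Longrightarrow> h < d \<Longrightarrow> t \<in> {0..T} \<Longrightarrow> norm (dq \<psi> (int0 (int0 g)) h t - conv g \<psi> t) \<le> e"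
proof -
  have a: "caus (conv g \<psi>)" by (rule caus_conv[OF caus_cont[OF g] caus_loc_int[OF \<psi>]])
  obtain d where d: "0 < d" "\<And>h t. 0 < h \<Longrightarrow> h < d \<Longrightarrow> t \<in> {0..T} \<Longrightarrow>
      norm (sd h (int0 (int0 (conv g \<psi>))) t - h\<^sup>2 *\<^sub>R conv g \<psi> t) \<le> e * h\<^sup>2"
    using sd_int0_int0[OF a e] by blast
  have "norm (dq \<psi> (int0 (int0 g)) h t - conv g \<psi> t) \<le> e"
    if h: "0 < h" "h < d" and t: "t \<in> {0..T}" for h t
  proof -
    have "dq \<psi> (int0 (int0 g)) h t - conv g \<psi> t
        = inverse (h\<^sup>2) *\<^sub>R (sd h (int0 (int0 (conv g \<psi>))) t - h\<^sup>2 *\<^sub>R conv g \<psi> t)"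
      using h by (simp add: dq_def conv_int0_int0[OF \<psi> g] scaleR_diff_right)
    then have "norm (dq \<psi> (int0 (int0 g)) h t - conv g \<psi> t)
        = inverse (h\<^sup>2) * norm (sd h (int0 (int0 (conv g \<psi>))) t - h\<^sup>2 *\<^sub>R conv g \<psi> t)"
      by (simp only: norm_scaleR) simp
    also have "\<dots> \<le> inverse (h\<^sup>2) * (e * h\<^sup>2)"
      by (rule mult_left_mono[OF d(2)[OF h t]]) simp
    also have "\<dots> = e" using h by (simp add: field_simps)
    finally show ?thesis .
  qed
  with d(1) show ?thesis by (rule that)
qed

text \<open>Density argument: \<open>u\<close> is replaced by a double primitive \<open>v\<close>,
  for which the quotients converge uniformly, and \<open>dq_L1_bound\<close> controls the
  replacement uniformly in \<open>h\<close>.\<close>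

lemma dq_Cauchy:
  assumes \<psi>: "caus \<psi>" and bv: "bv2 \<psi> c" and u: "loc_int u" and e: "0 < e"
  obtains d where "0 < d"
    "\<And>h k. 0 < h \<Longrightarrow> h < d \<Longrightarrow> 0 < k \<Longrightarrow> k < d \<Longrightarrow>
      integral {0..T} (\<lambda>t. norm (dq \<psi> u h t - dq \<psi> u k t)) \<le> e"
proof -
  note c0 = bv2_nonneg[OF bv]
  \<comment> \<open>Each step size spends \<open>e / 4\<close> on the replacement and
    \<open>e / 4\<close> on the convergence for \<open>v\<close>, so that a pair spends
    \<open>e\<close>.\<close>
  have "0 < e / (4 * (c + 1))" using e c0 by simp
  then obtain g where g: "caus g"
    and ug: "integral {0..T} (\<lambda>t. norm (u t - int0 (int0 g) t)) < e / (4 * (c + 1))"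
    using L1_approx_int0_int0[OF u] by blast
  define v where "v = int0 (int0 g)"
  have v: "loc_int v" unfolding v_def by (intro caus_loc_int caus_int0(2) g)
  define a where "a = conv g \<psi>"
  have a: "caus a" unfolding a_def by (rule caus_conv[OF caus_cont[OF g] caus_loc_int[OF \<psi>]])
  have "0 < e / (4 * (\<bar>T\<bar> + 1))" using e by simp
  then obtain d where d: "0 < d" "\<And>h t. 0 < h \<Longrightarrow> h < d \<Longrightarrow> t \<in> {0..T} \<Longrightarrow>
      norm (dq \<psi> v h t - a t) \<le> e / (4 * (\<bar>T\<bar> + 1))"
    by (rule dq_int0_int0[OF \<psi> g, where T = T, folded v_def a_def]) (rule that)
  have ai: "f absolutely_integrable_on {0..T}" if "caus f" for f :: "real \<Rightarrow> complex"
    by (rule loc_int_absD[OF caus_loc_int[OF that] order_refl])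
  have one: "integral {0..T} (\<lambda>t. norm (dq \<psi> u h t - a t)) \<le> e / 2" if h: "0 < h" "h < d" for h
  proof -
    note y = caus_dq[OF \<psi> u h(1)] caus_dq[OF \<psi> v h(1)]
    have "integral {0..T} (\<lambda>t. norm (dq \<psi> u h t - dq \<psi> v h t))
        \<le> c * integral {0..T} (\<lambda>t. norm (u t - v t))"
      unfolding dq_diff[OF \<psi> u v h(1)] by (rule dq_L1_bound[OF \<psi> bv loc_int_diff[OF u v] h(1)])
    also have "\<dots> \<le> c * (e / (4 * (c + 1)))"
      using ug c0 by (intro mult_left_mono) (auto simp: v_def)
    also have "\<dots> \<le> e / 4" using e c0 by (simp add: field_simps)
    finally have 1: "integral {0..T} (\<lambda>t. norm (dq \<psi> u h t - dq \<psi> v h t)) \<le> e / 4" .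
    have "integral {0..T} (\<lambda>t. norm (dq \<psi> v h t - a t)) \<le> e / (4 * (\<bar>T\<bar> + 1)) * \<bar>T\<bar>"
      using d(2)[OF h] e
      by (intro integral_norm_le_const integrable_continuous_real continuous_intros caus_cont y a) auto
    also have "\<dots> \<le> e / 4" using e by (simp add: field_simps)
    finally have 2: "integral {0..T} (\<lambda>t. norm (dq \<psi> v h t - a t)) \<le> e / 4" .
    from 1 2 integral_norm_triangle[OF ai[OF y(1)] ai[OF y(2)] ai[OF a]] show ?thesis by linarith
  qed
  have "integral {0..T} (\<lambda>t. norm (dq \<psi> u h t - dq \<psi> u k t)) \<le> e"
    if "0 < h" "h < d" "0 < k" "k < d" for h k
    using one[OF that(1,2)] one[OF that(3,4)]
      integral_norm_triangle[OF ai[OF caus_dq[OF \<psi> u that(1)]] ai[OF a] ai[OF caus_dq[OF \<psi> u that(3)]]]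
    by (simp add: norm_minus_commute)
  with d(1) show ?thesis by (rule that)
qed

text \<open>\<open>f\<close> is a limit of difference quotients along a sequence. The L1 bound
  survives because they converge in the mean, the essential bound because they converge almost
  everywhere. The last conclusion says weakly that \<open>f\<close> is the second derivative of
  \<open>conv \<psi> u\<close>, both derivatives having been moved onto
  \<open>int0 (int0 \<rho>)\<close>.\<close>

lemma bv2_second_derivative:
  assumes \<psi>: "caus \<psi>" and bv: "bv2 \<psi> c" and u: "loc_int u"
  obtains f where "loc_int f"
    "\<And>T. integral {0..T} (\<lambda>t. norm (f t)) \<le> c * integral {0..T} (\<lambda>t. norm (u t))"
    "\<And>T K N. negligible N \<Longrightarrow> (\<And>s. s \<in> {0..T} - N \<Longrightarrow> norm (u s) \<le> K) \<Longrightarrow> 0 \<le> K \<Longrightarrow>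
      \<exists>N. negligible N \<and> (\<forall>s\<in>{0..T} - N. norm (f s) \<le> c * K)"
    "\<And>(\<rho>::real \<Rightarrow> complex) R. caus \<rho> \<Longrightarrow> conv (int0 (int0 \<rho>)) f R = conv \<rho> (conv \<psi> u) R"
proof -
  define P where "P n d \<longleftrightarrow> 0 < d \<and> (\<forall>h k. 0 < h \<longrightarrow> h < d \<longrightarrow> 0 < k \<longrightarrow> k < d \<longrightarrow>
      integral {0..real n} (\<lambda>t. norm (dq \<psi> u h t - dq \<psi> u k t)) \<le> (1 / 2) ^ n)" for n d
  have "\<exists>d. P n d" for n
  proof (rule dq_Cauchy[OF \<psi> bv u, of "(1 / 2) ^ n" "real n"])
    fix d :: real
    assume "0 < d" "\<And>h k. 0 < h \<Longrightarrow> h < d \<Longrightarrow> 0 < k \<Longrightarrow> k < d \<Longrightarrow>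
      integral {0..real n} (\<lambda>t. norm (dq \<psi> u h t - dq \<psi> u k t)) \<le> (1 / 2) ^ n"
    then show ?thesis unfolding P_def by (intro exI[of _ d]) simp
  qed simp
  then obtain d where "\<And>n. P n (d n)" by metis
  then have d: "\<And>n. 0 < d n" "\<And>n h k. 0 < h \<Longrightarrow> h < d n \<Longrightarrow> 0 < k \<Longrightarrow> k < d n \<Longrightarrow>
      integral {0..real n} (\<lambda>t. norm (dq \<psi> u h t - dq \<psi> u k t)) \<le> (1 / 2) ^ n"
    by (simp_all add: P_def)
  \<comment> \<open>Below all of \<open>d 0\<close>, ..., \<open>d n\<close>, so that both
    \<open>h n\<close> and \<open>h (Suc n)\<close> are admissible at stage \<open>n\<close>;
    halving makes the inequality strict.\<close>
  define h where "h n = min (Min (d ` {..n})) (1 / (real n + 1)) / 2" for n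
  have Min0: "0 < Min (d ` {..n})" for n
    using d(1) by (subst Min_gr_iff) auto
  have h0: "0 < h n" for n
    using Min0[of n] by (simp add: h_def)
  have hd: "h m < d n" if "n \<le> m" for n m
  proof -
    have "h m < Min (d ` {..m})"
    proof -
      have "h m \<le> Min (d ` {..m}) / 2" by (simp add: h_def)
      then show ?thesis using Min0[of m] by linarith
    qed
    also have "\<dots> \<le> d n" using that by (intro Min_le) auto
    finally show ?thesis .
  qed
  have h_lim: "h \<longlonglongrightarrow> 0"
  proof (rule tendsto_sandwich[of "\<lambda>_. 0" _ _ "\<lambda>n. 1 / (real n + 1)"])
    show "\<forall>\<^sub>F n in sequentially. h n \<le> 1 / (real n + 1)"
      by (rule always_eventually) (auto simp: h_def min_def field_simps)
    show "(\<lambda>n. 1 / (real n + 1)) \<longlonglongrightarrow> 0"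
      using LIMSEQ_inverse_real_of_nat by (simp add: inverse_eq_divide add.commute)
  qed (use h0 in \<open>auto intro: always_eventually less_imp_le\<close>)
  define Y where "Y n = dq \<psi> u (h n)" for n
  have Y: "caus (Y n)" for n
    unfolding Y_def by (rule caus_dq[OF \<psi> u h0])
  have diff: "integral {0..real n} (\<lambda>t. norm (Y (Suc n) t - Y n t)) \<le> (1 / 2) ^ n" for n
    unfolding Y_def by (intro d(2) h0 hd) auto
  obtain f where f: "loc_int f"
    and lim1: "\<And>T. (\<lambda>n. integral {0..T} (\<lambda>t. norm (Y n t - f t))) \<longlonglongrightarrow> 0"
    and lim: "\<And>T. \<exists>N. negligible N \<and> (\<forall>t\<in>{0..T} - N. (\<lambda>n. Y n t) \<longlonglongrightarrow> f t)"
    by (rule L1_complete[of Y, OF Y diff]) (rule that)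
  show ?thesis
  proof (rule that[OF f])
    fix T
    let ?U = "integral {0..T} (\<lambda>t. norm (u t))"
    have "integral {0..T} (\<lambda>t. norm (f t)) \<le> c * ?U + integral {0..T} (\<lambda>t. norm (Y n t - f t))" for n
    proof -
      have "integral {0..T} (\<lambda>t. norm (f t - 0))
          \<le> integral {0..T} (\<lambda>t. norm (f t - Y n t)) + integral {0..T} (\<lambda>t. norm (Y n t - 0))"
        using loc_int_absD[OF f order_refl] loc_int_absD[OF caus_loc_int[OF Y] order_refl]
        by (rule integral_norm_triangle) (simp add: absolutely_integrable_on_def)
      moreover have "integral {0..T} (\<lambda>t. norm (Y n t)) \<le> c * ?U"
        unfolding Y_def by (rule dq_L1_bound[OF \<psi> bv u h0])
      ultimately show ?thesis by (simp add: norm_minus_commute)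
    qed
    moreover have "(\<lambda>n. c * ?U + integral {0..T} (\<lambda>t. norm (Y n t - f t))) \<longlonglongrightarrow> c * ?U + 0"
      by (intro tendsto_add tendsto_const lim1)
    ultimately show "integral {0..T} (\<lambda>t. norm (f t)) \<le> c * ?U"
      using LIMSEQ_le_const[of _ "c * ?U + 0"] by auto
  next
    fix T K N
    assume N: "negligible N" and K: "\<And>s. s \<in> {0..T} - N \<Longrightarrow> norm (u s) \<le> K" and K0: "(0::real) \<le> K"
    obtain N' where N': "negligible N' \<and> (\<forall>t\<in>{0..T} - N'. (\<lambda>n. Y n t) \<longlonglongrightarrow> f t)"
      using lim[of T] ..
    have "norm (f t) \<le> c * K" if "t \<in> {0..T} - N'" for t
    proof (rule LIMSEQ_le_const2)
      show "(\<lambda>n. norm (Y n t)) \<longlonglongrightarrow> norm (f t)"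
        using N' that by (intro tendsto_norm) blast
      have "norm (Y n t) \<le> c * K" for n
        unfolding Y_def by (rule dq_ess_bound[OF \<psi> bv u h0 N K _ K0]) (use that in auto)
      then show "\<exists>N. \<forall>n\<ge>N. norm (Y n t) \<le> c * K" by blast
    qed
    then show "\<exists>N. negligible N \<and> (\<forall>s\<in>{0..T} - N. norm (f s) \<le> c * K)"
      using N' by (intro exI[of _ N']) auto
  next
    fix \<rho> :: "real \<Rightarrow> complex" and R
    assume \<rho>: "caus \<rho>"
    define w where "w = conv \<psi> u"
    have w: "caus w" unfolding w_def by (rule caus_conv[OF caus_cont[OF \<psi>] u])
    define p where "p = int0 (int0 \<rho>)"
    have p: "caus p" unfolding p_def by (intro caus_int0(2) \<rho>)
    have a: "caus (conv \<rho> w)" by (rule caus_conv[OF caus_cont[OF \<rho>] caus_loc_int[OF w]])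
    \<comment> \<open>\<open>conv p (Y n) R\<close> has two limits: as a difference quotient of a
      double primitive it tends to \<open>conv \<rho> w R\<close>, and by convergence of
      \<open>Y n\<close> in the mean it tends to \<open>conv p f R\<close>.\<close>
    have "conv p w = int0 (int0 (conv \<rho> w))"
      using conv_int0_int0[OF w \<rho>] conv_commute[of p w] by (simp add: p_def fun_eq_iff)
    moreover have "conv p (Y n) R = inverse ((h n)\<^sup>2) *\<^sub>R sd (h n) (conv p w) R" for n
    proof -
      have "conv p (Y n) R = conv (Y n) p R" by (rule conv_commute)
      also have "\<dots> = inverse ((h n)\<^sup>2) *\<^sub>R conv (sd (h n) w) p R"
        by (simp add: Y_def dq_def[abs_def] conv_scaleR_left w_def)
      also have "conv (sd (h n) w) p R = sd (h n) (conv w p) R"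
        using h0[of n] by (intro sd_conv[symmetric] w caus_loc_int p) simp
      also have "conv w p = conv p w" by (rule ext) (rule conv_commute)
      finally show ?thesis .
    qed
    ultimately have Yp: "conv p (Y n) R = inverse ((h n)\<^sup>2) *\<^sub>R sd (h n) (int0 (int0 (conv \<rho> w))) R" for n
      by simp
    have "(\<lambda>n. conv p (Y n) R) \<longlonglongrightarrow> conv \<rho> w R"
    proof (cases "0 \<le> R")
      case True
      show ?thesis
      proof (rule LIMSEQ_I)
        fix e :: real assume e: "0 < e"
        then have "0 < e / 2" by simp
        then obtain b where b: "0 < b" "\<And>h t. 0 < h \<Longrightarrow> h < b \<Longrightarrow> t \<in> {0..R} \<Longrightarrow>
            norm (sd h (int0 (int0 (conv \<rho> w))) t - h\<^sup>2 *\<^sub>R conv \<rho> w t) \<le> (e / 2) * h\<^sup>2"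
          using sd_int0_int0[OF a] by blast
        have "\<forall>\<^sub>F n in sequentially. h n < b"
          using h_lim b(1) by (rule order_tendstoD(2))
        then obtain n0 where n0: "\<And>n. n \<ge> n0 \<Longrightarrow> h n < b"
          by (auto simp: eventually_sequentially)
        have "norm (conv p (Y n) R - conv \<rho> w R) < e" if "n \<ge> n0" for n
        proof -
          have "conv p (Y n) R - conv \<rho> w R
              = inverse ((h n)\<^sup>2) *\<^sub>R (sd (h n) (int0 (int0 (conv \<rho> w))) R - (h n)\<^sup>2 *\<^sub>R conv \<rho> w R)"
            using h0[of n] by (simp add: Yp scaleR_diff_right)
          then have "norm (conv p (Y n) R - conv \<rho> w R)
              = inverse ((h n)\<^sup>2) * norm (sd (h n) (int0 (int0 (conv \<rho> w))) R - (h n)\<^sup>2 *\<^sub>R conv \<rho> w R)"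
            by (simp only: norm_scaleR) simp
          also have "\<dots> \<le> inverse ((h n)\<^sup>2) * ((e / 2) * (h n)\<^sup>2)"
            by (rule mult_left_mono[OF b(2)[OF h0 n0[OF that]]]) (use True in auto)
          also have "\<dots> = e / 2" using h0[of n] by (simp add: field_simps)
          finally show ?thesis using e by linarith
        qed
        then show "\<exists>no. \<forall>n\<ge>no. norm (conv p (Y n) R - conv \<rho> w R) < e" by blast
      qed
    qed simp
    moreover have "(\<lambda>n. conv p (Y n) R) \<longlonglongrightarrow> conv p f R"
    proof -
      obtain B where B: "0 \<le> B" "\<And>s. s \<in> {0..R} \<Longrightarrow> norm (p s) \<le> B"
        using bounded_on_Icc[OF caus_cont[OF p]] by blast
      have "norm (conv p (Y n) R - conv p f R) \<le> B * integral {0..R} (\<lambda>t. norm (Y n t - f t))" for n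
        unfolding conv_diff_right[OF caus_cont[OF p] caus_loc_int[OF Y] f, symmetric]
        by (rule norm_conv_le[OF caus_cont[OF p] loc_int_diff[OF caus_loc_int[OF Y] f] B(2)])
      then have "(\<lambda>n. conv p (Y n) R - conv p f R) \<longlonglongrightarrow> 0"
        by (intro tendsto_0_le[OF tendsto_mult_right_zero[OF lim1[of R], of B], of _ 1] always_eventually)
          (auto intro: order_trans[OF _ abs_ge_self])
      then show ?thesis by (simp add: LIM_zero_iff)
    qed
    ultimately have "conv p f R = conv \<rho> w R" by (rule LIMSEQ_unique[rotated])
    then show "conv (int0 (int0 \<rho>)) f R = conv \<rho> (conv \<psi> u) R"
      by (simp only: p_def w_def)
  qed
qed

section \<open>Test functions\<close>

text \<open>All derivatives as one sequence of data, so that smoothness can be built up by rules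
  instead of iterating \<open>vector_derivative\<close>.\<close>

definition derivs :: "(real \<Rightarrow> 'e::real_normed_vector) \<Rightarrow> (nat \<Rightarrow> real \<Rightarrow> 'e) \<Rightarrow> bool"
  where "derivs f d \<longleftrightarrow> d 0 = f \<and> (\<forall>n t. (d n has_vector_derivative d (Suc n) t) (at t))"

abbreviation iter_deriv :: "nat \<Rightarrow> (real \<Rightarrow> complex) \<Rightarrow> real \<Rightarrow> complex"
  where "iter_deriv n \<equiv> (\<lambda>f t. vector_derivative f (at t)) ^^ n"

lemma derivs_iter:
  assumes "derivs f d"
  shows "iter_deriv n f = d n"
proof (induction n)
  case (Suc n)
  have "(\<lambda>t. vector_derivative (d n) (at t)) = d (Suc n)"
    using assms by (auto simp: derivs_def intro!: ext vector_derivative_at)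
  with Suc show ?case by simp
qed (use assms in \<open>simp add: derivs_def\<close>)

lemma test_functionI:
  assumes "derivs f d" "bounded {t. f t \<noteq> 0}"
  shows "test_function f"
  unfolding test_function_def derivs_iter[OF assms(1)]
  using assms by (auto simp: derivs_def differentiable_on_def
      intro: differentiable_at_withinI differentiableI_vector)

lemma test_function_derivs:
  assumes "test_function f"
  shows "derivs f (\<lambda>n. iter_deriv n f)"
proof -
  have "(iter_deriv n f has_vector_derivative vector_derivative (iter_deriv n f) (at t)) (at t)" for n t
    using assms by (simp add: test_function_def differentiable_on_def vector_derivative_works)
  then show ?thesis by (simp add: derivs_def)
qed

text \<open>Choose a derivative inside the family and iterate the choice.\<close>

lemma derivs_of_closed_family:
  assumes "f \<in> S" and step: "\<And>f. f \<in> S \<Longrightarrow> \<exists>f'\<in>S. \<forall>t. (f has_vector_derivative f' t) (at t)"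
  shows "\<exists>d. derivs f d"
proof -
  obtain F where F: "\<And>f. f \<in> S \<Longrightarrow> F f \<in> S \<and> (\<forall>t. (f has_vector_derivative F f t) (at t))"
    using step by metis
  have "(F ^^ n) f \<in> S" for n
    by (induction n) (use F assms(1) in auto)
  then show ?thesis
    using F by (intro exI[of _ "\<lambda>n. (F ^^ n) f"]) (auto simp: derivs_def)
qed

lemma derivs_mult:
  fixes f g :: "real \<Rightarrow> real"
  assumes "derivs f d" "derivs g e"
  shows "\<exists>d. derivs (\<lambda>t. f t * g t) d"
proof (rule derivs_of_closed_family)
  \<comment> \<open>Sums of products of derivatives, indexed by lists of pairs of orders; the
    product rule replaces each pair by two.\<close>
  define P where "P xs t = (\<Sum>(i,j)\<leftarrow>xs. d i t * e j t)" for xs :: "(nat \<times> nat) list" and t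
  show "(\<lambda>t. f t * g t) \<in> range P"
    using assms by (intro image_eqI[of _ _ "[(0, 0)]"]) (auto simp: P_def derivs_def)
  fix p assume "p \<in> range P"
  then obtain xs where p: "p = P xs" by blast
  define ys where "ys = concat (map (\<lambda>(i,j). [(Suc i, j), (i, Suc j)]) xs)"
  have "(P xs has_vector_derivative P ys t) (at t)" for t
    unfolding ys_def
  proof (induction xs)
    case (Cons x xs)
    obtain i j where x: "x = (i, j)" by (cases x)
    have "(d i has_vector_derivative d (Suc i) t) (at t)" "(e j has_vector_derivative e (Suc j) t) (at t)"
      using assms by (simp_all add: derivs_def)
    from has_vector_derivative_add[OF has_vector_derivative_mult[OF this] Cons.IH]
    show ?case by (simp add: P_def[abs_def] x algebra_simps)
  qed (simp add: P_def[abs_def])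
  then show "\<exists>f'\<in>range P. \<forall>t. (p has_vector_derivative f' t) (at t)"
    unfolding p by blast
qed

lemma derivs_affine:
  fixes f :: "real \<Rightarrow> real"
  assumes "derivs f d"
  shows "derivs (\<lambda>t. f (a * t + b)) (\<lambda>n t. a ^ n * d n (a * t + b))"
proof -
  have "((\<lambda>t. a ^ n * d n (a * t + b)) has_vector_derivative a ^ Suc n * d (Suc n) (a * t + b)) (at t)"
    for n t
  proof -
    have "((\<lambda>t. a * t + b) has_vector_derivative a) (at t)"
      by (auto intro!: derivative_eq_intros)
    moreover have "(d n has_vector_derivative d (Suc n) (a * t + b)) (at (a * t + b))"
      using assms by (simp add: derivs_def)
    ultimately have "(d n \<circ> (\<lambda>t. a * t + b) has_vector_derivative a *\<^sub>R d (Suc n) (a * t + b)) (at t)"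
      by (rule vector_diff_chain_at)
    from has_vector_derivative_mult_right[OF this, of "a ^ n"]
    show ?thesis by (simp add: o_def mult_ac)
  qed
  then show ?thesis using assms by (simp add: derivs_def)
qed

lemma derivs_cmult:
  fixes f :: "real \<Rightarrow> real"
  assumes "derivs f d"
  shows "derivs (\<lambda>t. c * f t) (\<lambda>n t. c * d n t)"
  using assms by (auto simp: derivs_def intro: has_vector_derivative_mult_right)

lemma derivs_add:
  "derivs f d \<Longrightarrow> derivs g e \<Longrightarrow> derivs (\<lambda>t. f t + g t) (\<lambda>n t. d n t + e n t)"
  by (auto simp: derivs_def intro: has_vector_derivative_add)

lemma derivs_antiderivative:
  assumes "derivs f d" "\<And>t. (F has_vector_derivative f t) (at t)"
  shows "derivs F (case_nat F d)"
  using assms by (auto simp: derivs_def split: nat.splits)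

section \<open>Smooth bumps and the test functions made from them\<close>

lemma poly_exp_tendsto_0: "((\<lambda>x::real. x ^ n * poly p x * exp (- x)) \<longlongrightarrow> 0) at_top"
proof (induction p arbitrary: n)
  case (pCons a p)
  have "((\<lambda>x::real. a * (x ^ n / exp x) + x ^ Suc n * poly p x * exp (- x)) \<longlongrightarrow> a * 0 + 0) at_top"
    by (intro tendsto_add tendsto_mult tendsto_const tendsto_power_div_exp_0 pCons.IH)
  then show ?case by (simp add: algebra_simps exp_minus field_simps)
qed simp

text \<open>The classical flat function exp(-1/t), with a polynomial factor in 1/t that makes the
  family closed under differentiation.\<close>

definition flat :: "real poly \<Rightarrow> real \<Rightarrow> real"
  where "flat p t = (if 0 < t then poly p (1 / t) * exp (- (1 / t)) else 0)"

text \<open>Away from 0 the chain rule produces 1/t^2, encoded by \<open>[:0, 0, 1:]\<close>, and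
  the difference \<open>p - pderiv p\<close>; at 0 the exponential beats every polynomial in
  1/t.\<close>

lemma flat_has_vector_derivative:
  "(flat p has_vector_derivative flat ([:0, 0, 1:] * (p - pderiv p)) t) (at t)"
proof -
  consider "t < 0" | "0 < t" | "t = 0" by linarith
  then show ?thesis
  proof cases
    case 1
    have "((\<lambda>_. 0) has_vector_derivative flat ([:0, 0, 1:] * (p - pderiv p)) t) (at t)"
      using 1 by (simp add: flat_def)
    then show ?thesis
      by (rule has_vector_derivative_transform_within_open[of _ _ _ "{..<0}"])
        (use 1 in \<open>auto simp: flat_def\<close>)
  next
    case 2
    have "((\<lambda>t. poly p (1 / t) * exp (- (1 / t))) has_real_derivative
        flat ([:0, 0, 1:] * (p - pderiv p)) t) (at t)"
      using 2 by (auto intro!: derivative_eq_intros simp: flat_def field_simps power2_eq_square)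
    then have "((\<lambda>t. poly p (1 / t) * exp (- (1 / t))) has_vector_derivative
        flat ([:0, 0, 1:] * (p - pderiv p)) t) (at t)"
      by (simp add: has_real_derivative_iff_has_vector_derivative)
    then show ?thesis
      by (rule has_vector_derivative_transform_within_open[of _ _ _ "{0<..}"])
        (use 2 in \<open>auto simp: flat_def\<close>)
  next
    case 3
    have "((\<lambda>h. flat p h / h) \<longlongrightarrow> 0) (at 0)"
    proof (rule filterlim_split_at)
      show "((\<lambda>h. flat p h / h) \<longlongrightarrow> 0) (at_left 0)"
        by (rule tendsto_eventually) (auto simp: flat_def eventually_at_left[of "-1"] intro!: exI[of _ "-1"])
      have "((\<lambda>h. (inverse h) ^ 1 * poly p (inverse h) * exp (- (inverse h))) \<longlongrightarrow> 0) (at_right (0::real))"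
        by (rule filterlim_compose[OF poly_exp_tendsto_0 filterlim_inverse_at_top_right])
      then show "((\<lambda>h. flat p h / h) \<longlongrightarrow> 0) (at_right 0)"
      proof (rule Lim_transform_eventually)
        show "\<forall>\<^sub>F h in at_right 0. inverse h ^ 1 * poly p (inverse h) * exp (- inverse h) = flat p h / h"
          using eventually_at_right_less by eventually_elim (auto simp: flat_def field_simps)
      qed
    qed
    then have "(flat p has_real_derivative 0) (at 0)"
      by (simp add: has_field_derivative_iff flat_def[of p 0])
    then show ?thesis
      using 3 by (simp add: has_real_derivative_iff_has_vector_derivative flat_def[of _ 0])
  qed
qed

lemma derivs_flat: "\<exists>d. derivs (flat p) d"
  by (rule derivs_of_closed_family[of _ "range flat"]) (use flat_has_vector_derivative in auto)

text \<open>Product of two flat functions facing each other from 0 and \<open>\<delta>\<close>,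
  normalised to unit mass.\<close>

lemma bump_exists:
  assumes "0 < \<delta>"
  obtains r :: "real \<Rightarrow> real" and d where "derivs r d" "\<And>s. 0 \<le> r s" "\<And>s. s \<le> 0 \<Longrightarrow> r s = 0"
    "\<And>s. \<delta> \<le> s \<Longrightarrow> r s = 0" "integral {0..\<delta>} r = 1" "continuous_on UNIV r"
proof -
  define g where "g s = flat 1 (1 * s + 0) * flat 1 ((-1) * s + \<delta>)" for s
  obtain d0 where d0: "derivs (flat 1) d0" using derivs_flat by blast
  obtain d where d: "derivs g d"
    using derivs_mult[OF derivs_affine[OF d0] derivs_affine[OF d0]] unfolding g_def by blast
  have gc: "continuous_on S g" for S
    using d unfolding derivs_def continuous_on_eq_continuous_within
    by (metis continuous_at_imp_continuous_at_within has_vector_derivative_continuous)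
  have g0: "0 \<le> g s" for s by (simp add: g_def flat_def)
  define J where "J = integral {0..\<delta>} g"
  have "J \<noteq> 0"
  proof
    assume "J = 0"
    then have "g (\<delta> / 2) = 0"
      unfolding J_def using assms by (subst (asm) integral_eq_0_iff[OF gc _ g0]) auto
    then show False using assms by (simp add: g_def flat_def)
  qed
  moreover have "0 \<le> J"
    unfolding J_def by (intro integral_nonneg integrable_continuous_real gc g0)
  ultimately have J: "0 < J" by simp
  show ?thesis
  proof (rule that[OF derivs_cmult[OF d, of "1 / J"]])
    show "integral {0..\<delta>} (\<lambda>s. 1 / J * g s) = 1"
      using J by (simp add: J_def)
    show "continuous_on UNIV (\<lambda>s. 1 / J * g s)"
      by (intro continuous_intros gc)
  qed (use g0 J assms in \<open>auto simp: g_def flat_def\<close>)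
qed

lemma integral_support:
  fixes f :: "real \<Rightarrow> 'e::banach"
  assumes "S \<subseteq> T" "\<And>x. x \<in> T - S \<Longrightarrow> f x = 0"
  shows "integral T f = integral S f"
proof -
  have "integral T f = integral T (\<lambda>x. if x \<in> S then f x else 0)"
    by (rule Henstock_Kurzweil_Integration.integral_cong) (use assms(2) in auto)
  also have "\<dots> = integral (S \<inter> T) f" by (rule integral_restrict_Int)
  finally show ?thesis using assms(1) by (simp add: Int_absorb2)
qed

text \<open>\<open>max 0 (t0 - s)\<close> has a point mass at \<open>t0\<close> as second
  derivative. It is smoothed near \<open>t0\<close> and continued to the left of 0 so that its
  support becomes compact.\<close>

lemma test_function_exists:
  assumes t0: "0 \<le> t0" and \<delta>: "0 < \<delta>"
  obtains \<phi> \<rho> where "test_function \<phi>" "\<And>s. 0 \<le> s \<Longrightarrow> iter_deriv 2 \<phi> s = complex_of_real (\<rho> s)"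
    "\<And>s. 0 \<le> \<rho> s" "continuous_on UNIV \<rho>" "\<And>s. s \<notin> {t0..t0+\<delta>} \<Longrightarrow> \<rho> s = 0"
    "integral {t0..t0+\<delta>} \<rho> = 1" "\<And>s. t0 + \<delta> \<le> s \<Longrightarrow> \<phi> s = 0"
    "\<And>s. 0 \<le> s \<Longrightarrow> norm (\<phi> s - complex_of_real (max 0 (t0 - s))) \<le> \<delta>"
proof -
  obtain r :: "real \<Rightarrow> real" and d where r: "derivs r d" "\<And>s. 0 \<le> r s" "\<And>s. s \<le> 0 \<Longrightarrow> r s = 0"
    "\<And>s. \<delta> \<le> s \<Longrightarrow> r s = 0" "integral {0..\<delta>} r = 1" "continuous_on UNIV r"
    using bump_exists[OF \<delta>] by blast
  have rc: "caus r" using r by (simp add: caus_def)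
  define P1 where "P1 = int0 r"
  define P2 where "P2 = int0 P1"
  have P1c: "caus P1" and P1': "(P1 has_vector_derivative r t) (at t)" for t
    unfolding P1_def using caus_int0[OF rc] by auto
  have P2c: "caus P2" and P2': "(P2 has_vector_derivative P1 t) (at t)" for t
    unfolding P2_def using caus_int0[OF P1c] by auto
  have ri: "r integrable_on {a..b}" for a b
    by (intro integrable_continuous_real caus_cont rc)
  have P1i: "P1 integrable_on {a..b}" for a b
    by (intro integrable_continuous_real caus_cont P1c)
  have P1_1: "P1 x = 1" if "\<delta> \<le> x" for x
  proof -
    have "integral {0..x} r = integral {0..\<delta>} r"
      by (rule integral_support) (use that \<delta> r(4) in auto)
    then show ?thesis using r(5) by (simp add: P1_def int0_def)
  qed
  have P1_ge: "0 \<le> P1 x" for x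
    unfolding P1_def int0_def by (rule integral_nonneg[OF ri r(2)])
  have P1_le: "P1 x \<le> 1" for x
  proof (cases "x \<le> \<delta>")
    case True
    then have "P1 x \<le> P1 \<delta>"
      unfolding P1_def int0_def by (intro integral_subset_le ri) (use r(2) in auto)
    then show ?thesis using P1_1[of \<delta>] by simp
  qed (use P1_1 in simp)
  have P2_0: "P2 x = 0" if "x \<le> 0" for x
    using caus_neg[OF P2c that] .
  have P2_ge: "0 \<le> P2 x" for x
    unfolding P2_def int0_def by (rule integral_nonneg[OF P1i P1_ge])
  have P2_le: "P2 x \<le> x" if "0 \<le> x" for x
  proof -
    have "P2 x \<le> integral {0..x} (\<lambda>_. 1)"
      unfolding P2_def int0_def by (rule integral_le[OF P1i]) (use P1_le in auto)
    then show ?thesis using that by simp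
  qed
  \<comment> \<open>\<open>P2\<close> is a smoothed ramp: the bump lies to the right of 0, so from
    \<open>\<delta>\<close> on \<open>P2\<close> is the ramp delayed by \<open>m\<close>.\<close>
  define m where "m = \<delta> - P2 \<delta>"
  have m: "0 \<le> m" "m \<le> \<delta>"
    using P2_le[of \<delta>] P2_ge[of \<delta>] \<delta> by (auto simp: m_def)
  have P2_lin: "P2 x = x - m" if "\<delta> \<le> x" for x
  proof -
    have "integral {0..\<delta>} P1 + integral {\<delta>..x} P1 = integral {0..x} P1"
      by (rule Henstock_Kurzweil_Integration.integral_combine[OF _ that P1i]) (use \<delta> in simp)
    moreover have "integral {\<delta>..x} P1 = integral {\<delta>..x} (\<lambda>_. 1)"
      by (rule Henstock_Kurzweil_Integration.integral_cong) (simp add: P1_1)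
    ultimately show ?thesis using that by (simp add: P2_def int0_def m_def)
  qed
  obtain dP where dP: "derivs P2 dP" "dP 2 = r"
    using derivs_antiderivative[OF derivs_antiderivative[OF r(1) P1'] P2']
    by (metis One_nat_def Suc_1 derivs_def nat.case(2) r(1))
  \<comment> \<open>\<open>q\<close> is a forward second difference of \<open>P2\<close>: the affine
    growth cancels, which gives compact support. With step \<open>t0 + \<delta>\<close> the bumps in
    the second derivative that come from the shifted copies lie at or left of 0, so that only the
    one at \<open>t0\<close> is seen on \<open>{0..}\<close>.\<close>
  define h where "h = t0 + \<delta>"
  have h: "0 < h" using t0 \<delta> by (simp add: h_def)
  define q where "q s = P2 (1 * s + - t0) + ((-2) * P2 (1 * s + (h - t0)) + P2 (1 * s + (2 * h - t0)))" for s
  define dq' where "dq' n s = 1 ^ n * dP n (1 * s + - t0) +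
      ((-2) * (1 ^ n * dP n (1 * s + (h - t0))) + 1 ^ n * dP n (1 * s + (2 * h - t0)))" for n s
  have dq': "derivs q dq'"
    unfolding q_def[abs_def] dq'_def[abs_def]
    by (intro derivs_add derivs_cmult derivs_affine dP(1))
  define \<phi> where "\<phi> s = complex_of_real (q s)" for s
  have d\<phi>: "derivs \<phi> (\<lambda>n s. complex_of_real (dq' n s))"
    using dq' unfolding derivs_def \<phi>_def[abs_def]
    by (auto intro: bounded_linear.has_vector_derivative[OF bounded_linear_of_real])
  have q_pos: "q s = P2 (s - t0) - (s - t0) + m" if "0 \<le> s" for s
    using that h by (simp add: q_def P2_lin h_def)
  show ?thesis
  proof (rule that[of \<phi> "\<lambda>s. r (s - t0)"])
    have "{t. \<phi> t \<noteq> 0} \<subseteq> {t0 - 2 * h..h}"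
    proof
      fix t assume "t \<in> {t. \<phi> t \<noteq> 0}"
      then have t: "q t \<noteq> 0" by (simp add: \<phi>_def)
      have "t0 - 2 * h \<le> t"
      proof (rule ccontr)
        assume "\<not> t0 - 2 * h \<le> t"
        then have "q t = 0" using h by (simp add: q_def P2_0)
        with t show False ..
      qed
      moreover have "t \<le> h"
      proof (rule ccontr)
        assume "\<not> t \<le> h"
        then have "q t = 0" using q_pos[of t] h t0 by (simp add: P2_lin h_def)
        with t show False ..
      qed
      ultimately show "t \<in> {t0 - 2 * h..h}" by simp
    qed
    then have "bounded {t. \<phi> t \<noteq> 0}"
      using bounded_subset bounded_closed_interval by blast
    with d\<phi> show "test_function \<phi>" by (rule test_functionI)
    show "iter_deriv 2 \<phi> s = complex_of_real (r (s - t0))" if "0 \<le> s" for s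
      unfolding derivs_iter[OF d\<phi>] using that h r(4) by (simp add: dq'_def dP(2) h_def)
    show "\<phi> s = 0" if "t0 + \<delta> \<le> s" for s
      using q_pos[of s] that t0 \<delta> by (simp add: \<phi>_def P2_lin)
    show "continuous_on UNIV (\<lambda>s. r (s - t0))"
      by (intro continuous_on_compose2[OF r(6)] continuous_intros) auto
    show "integral {t0..t0 + \<delta>} (\<lambda>s. r (s - t0)) = 1"
      using integral_shift_Icc_real[of t0 "t0 + \<delta>" r "- t0"] r(5) by (simp add: o_def)
    show "norm (\<phi> s - complex_of_real (max 0 (t0 - s))) \<le> \<delta>" if "0 \<le> s" for s
    proof -
      have "\<bar>q s - max 0 (t0 - s)\<bar> \<le> \<delta>"
      proof (cases "s \<le> t0")
        case True
        then show ?thesis using q_pos[OF that] m by (simp add: P2_0)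
      next
        case False
        show ?thesis
        proof (cases "s - t0 \<le> \<delta>")
          case True
          then show ?thesis
            using False q_pos[OF that] m P2_le[of "s - t0"] P2_ge[of "s - t0"] by simp
        next
          case F: False
          then show ?thesis using False q_pos[OF that] \<delta> by (simp add: P2_lin)
        qed
      qed
      then show ?thesis unfolding \<phi>_def by (simp only: of_real_diff[symmetric] norm_of_real)
    qed
  qed (use r in auto)
qed

section \<open>Distributional second derivatives\<close>

definition second_deriv :: "(real \<Rightarrow> complex) \<Rightarrow> (real \<Rightarrow> complex) \<Rightarrow> bool"
  where "second_deriv w f \<longleftrightarrow> (\<forall>\<phi>. test_function \<phi> \<longrightarrow>
    integral {0..} (\<lambda>t. iter_deriv 2 \<phi> t * w t) = integral {0..} (\<lambda>t. \<phi> t * f t))"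

text \<open>Fundamental solution of the second derivative: convolving with it integrates
  twice.\<close>

definition ramp :: "real \<Rightarrow> complex"
  where "ramp s = complex_of_real (max 0 s)"

lemma caus_ramp: "caus ramp"
  unfolding caus_def ramp_def by (auto intro!: continuous_intros)

text \<open>Test with the smoothed \<open>max 0 (t0 - s)\<close>: the second derivatives concentrate
  at \<open>t0\<close> and give \<open>w t0\<close>, the functions themselves give
  \<open>conv ramp f t0\<close>. Such test functions are nonzero at 0, so no affine function is left
  undetermined.\<close>

lemma second_deriv_unique:
  assumes w: "caus w" and f: "loc_int f" and wf: "second_deriv w f"
  shows "w = conv ramp f"
proof
  fix t0 :: real
  show "w t0 = conv ramp f t0"
  proof (cases "0 < t0")
    case t0: True
    define C where "C = integral {0..t0+1} (\<lambda>s. norm (f s))"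
    have C0: "0 \<le> C"
      unfolding C_def by (rule integral_nonneg[OF loc_int_normD[OF f order_refl]]) simp
    have "norm (w t0 - conv ramp f t0) \<le> e" if e: "0 < e" for e
    proof -
      define e' where "e' = e / (C + 1)"
      have e': "0 < e'" using e C0 by (simp add: e'_def)
      obtain b where b: "0 < b" "\<And>x y. x \<in> {0..t0+1} \<Longrightarrow> y \<in> {0..t0+1} \<Longrightarrow> \<bar>x - y\<bar> < b \<Longrightarrow> norm (w x - w y) < e'"
        using unif_cont_Icc[OF caus_cont[OF w] e'] by blast
      \<comment> \<open>Small against the continuity of \<open>w\<close> and against the tolerance
        for the smoothing error, and at most 1 so that all integrals stay inside
        \<open>{0..t0+1}\<close>.\<close>
      define \<delta> where "\<delta> = min (b / 2) (min e' 1)"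
      have \<delta>: "0 < \<delta>" "\<delta> < b" "\<delta> \<le> e'" "\<delta> \<le> 1" using b e' by (auto simp: \<delta>_def)
      obtain \<phi> \<rho> where \<phi>: "test_function \<phi>" "\<And>s. 0 \<le> s \<Longrightarrow> iter_deriv 2 \<phi> s = complex_of_real (\<rho> s)"
        "\<And>s. 0 \<le> \<rho> s" "continuous_on UNIV \<rho>" "\<And>s. s \<notin> {t0..t0+\<delta>} \<Longrightarrow> \<rho> s = 0"
        "integral {t0..t0+\<delta>} \<rho> = 1" "\<And>s. t0 + \<delta> \<le> s \<Longrightarrow> \<phi> s = 0"
        "\<And>s. 0 \<le> s \<Longrightarrow> norm (\<phi> s - complex_of_real (max 0 (t0 - s))) \<le> \<delta>"
        by (rule test_function_exists[OF less_imp_le[OF t0] \<delta>(1)]) (rule that)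
      have \<rho>c: "continuous_on S \<rho>" for S using \<phi>(4) continuous_on_subset by blast
      have \<phi>c: "continuous_on S \<phi>" for S
        using test_function_derivs[OF \<phi>(1)] unfolding derivs_def continuous_on_eq_continuous_within
        by (metis (no_types, lifting) continuous_at_imp_continuous_at_within has_vector_derivative_continuous)
      let ?I = "{t0..t0+\<delta>}" and ?J = "{0..t0+\<delta>}"
      have "integral {0..} (\<lambda>t. iter_deriv 2 \<phi> t * w t) = integral {0..} (\<lambda>t. complex_of_real (\<rho> t) * w t)"
        by (rule Henstock_Kurzweil_Integration.integral_cong) (simp add: \<phi>(2))
      also have "\<dots> = integral ?I (\<lambda>t. complex_of_real (\<rho> t) * w t)"
        by (rule integral_support) (use t0 \<phi>(5) in auto)
      finally have L: "integral {0..} (\<lambda>t. iter_deriv 2 \<phi> t * w t) = integral ?I (\<lambda>t. complex_of_real (\<rho> t) * w t)" .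
      have "integral ?I (\<lambda>t. complex_of_real (\<rho> t) * (w t - w t0))
          = integral ?I (\<lambda>t. complex_of_real (\<rho> t) * w t) - integral ?I (\<lambda>t. complex_of_real (\<rho> t) * w t0)"
        unfolding right_diff_distrib
        by (intro Henstock_Kurzweil_Integration.integral_diff integrable_continuous_real continuous_intros
            \<rho>c caus_cont w)
      moreover have "integral ?I (\<lambda>t. complex_of_real (\<rho> t) * w t0) = w t0"
        using \<phi>(6) integral_linear[OF integrable_continuous_real[OF \<rho>c] bounded_linear_of_real[where 'a=complex], of t0 "t0+\<delta>"]
        by (simp add: o_def del: mult_cancel_right1)
      moreover have "norm (integral ?I (\<lambda>t. complex_of_real (\<rho> t) * (w t - w t0))) \<le> integral ?I (\<lambda>t. e' * \<rho> t)"
      proof (rule integral_norm_bound_integral)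
        fix t assume t: "t \<in> ?I"
        have "norm (w t - w t0) \<le> e'"
          by (intro less_imp_le b(2)) (use t t0 \<delta> in auto)
        then show "norm (complex_of_real (\<rho> t) * (w t - w t0)) \<le> e' * \<rho> t"
          using mult_right_mono[OF _ \<phi>(3)[of t], of "norm (w t - w t0)" e'] \<phi>(3)[of t]
          by (simp add: norm_mult mult.commute)
      qed (intro integrable_continuous_real continuous_intros \<rho>c caus_cont w)+
      ultimately have 1: "norm (integral {0..} (\<lambda>t. iter_deriv 2 \<phi> t * w t) - w t0) \<le> e'"
        by (simp only: L Henstock_Kurzweil_Integration.integral_mult_right \<phi>(6) mult_1_right)
      have fi: "(\<lambda>s. f s *\<^sub>C p s) integrable_on ?J" if "continuous_on ?J p" for p :: "real \<Rightarrow> complex"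
        by (rule integrable_scaleC_continuous[OF loc_int_absD[OF f order_refl] that])
      have "integral {0..} (\<lambda>t. \<phi> t * f t) = integral ?J (\<lambda>t. \<phi> t * f t)"
        by (rule integral_support) (use \<phi>(7) in auto)
      also have "\<dots> = integral ?J (\<lambda>t. f t *\<^sub>C \<phi> t)"
        by (simp add: scaleC_complex_def mult.commute)
      finally have A: "integral {0..} (\<lambda>t. \<phi> t * f t) = integral ?J (\<lambda>t. f t *\<^sub>C \<phi> t)" .
      have "((\<lambda>s. f s *\<^sub>C ext0 ramp (t0 - s)) has_integral conv ramp f t0) ?J"
        by (rule conv_ext[OF caus_cont[OF caus_ramp] f]) (use \<delta> in simp)
      moreover have "ext0 ramp x = ramp x" for x
        by (simp add: ext0_def ramp_def)
      ultimately have B: "conv ramp f t0 = integral ?J (\<lambda>s. f s *\<^sub>C ramp (t0 - s))"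
        by (simp add: integral_unique)
      have rampc: "continuous_on ?J (\<lambda>s. ramp (t0 - s))"
        unfolding ramp_def by (intro continuous_intros)
      have "integral {0..} (\<lambda>t. \<phi> t * f t) - conv ramp f t0
          = integral ?J (\<lambda>s. f s *\<^sub>C (\<phi> s - ramp (t0 - s)))"
        unfolding A B scaleC_diff_right
        by (intro Henstock_Kurzweil_Integration.integral_diff[symmetric] fi \<phi>c rampc)
      also have "norm \<dots> \<le> integral ?J (\<lambda>s. \<delta> * norm (f s))"
      proof (rule integral_norm_bound_integral[OF fi])
        show "continuous_on ?J (\<lambda>s. \<phi> s - ramp (t0 - s))" by (intro continuous_intros \<phi>c rampc)
        show "(\<lambda>s. \<delta> * norm (f s)) integrable_on ?J"
          by (intro integrable_on_mult_right loc_int_normD[OF f]) simp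
        show "norm (f s *\<^sub>C (\<phi> s - ramp (t0 - s))) \<le> \<delta> * norm (f s)" if "s \<in> ?J" for s
          using mult_left_mono[OF \<phi>(8)[of s], of "norm (f s)"] that
          by (simp add: norm_scaleC ramp_def mult.commute)
      qed
      also have "\<dots> = \<delta> * integral ?J (\<lambda>s. norm (f s))" by simp
      also have "\<dots> \<le> e' * C"
        unfolding C_def using \<delta> e'
        by (intro mult_mono integral_subset_le loc_int_normD[OF f] integral_nonneg) auto
      finally have 2: "norm (integral {0..} (\<lambda>t. \<phi> t * f t) - conv ramp f t0) \<le> e' * C" .
      have "integral {0..} (\<lambda>t. iter_deriv 2 \<phi> t * w t) = integral {0..} (\<lambda>t. \<phi> t * f t)"
        using wf \<phi>(1) by (simp add: second_deriv_def)
      with 1 2 have "norm (w t0 - conv ramp f t0) \<le> e' + e' * C"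
        by (metis norm_minus_commute norm_diff_triangle_le)
      also have "\<dots> = e' * (C + 1)" by (simp add: algebra_simps)
      also have "\<dots> = e" using C0 by (simp add: e'_def)
      finally show ?thesis .
    qed
    then have "norm (w t0 - conv ramp f t0) \<le> 0"
      by (rule field_le_epsilon) simp
    then show ?thesis by simp
  qed (use caus_neg[OF w] in simp)
qed

lemma int0_eqI:
  fixes p :: "real \<Rightarrow> 'e::banach"
  assumes "caus p" "\<And>s. (F has_vector_derivative p s) (at s)" "\<And>s. s \<le> 0 \<Longrightarrow> F s = 0"
  shows "int0 p = F"
proof
  fix s
  show "int0 p s = F s"
  proof (cases "0 \<le> s")
    case True
    have "(p has_integral (F s - F 0)) {0..s}"
      by (rule fundamental_theorem_of_calculus[OF True has_vector_derivative_at_within[OF assms(2)]])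
    from integral_unique[OF this] show ?thesis
      unfolding int0_def by (simp add: assms(3)[of 0])
  next
    case False
    then show ?thesis using assms(3)[of s] by simp
  qed
qed

text \<open>A function that vanishes on an open half-line has derivatives that vanish there, so one
  bound serves all orders.\<close>

lemma test_function_support:
  assumes \<phi>: "test_function \<phi>"
  obtains B where "\<And>n t. B < t \<Longrightarrow> iter_deriv n \<phi> t = 0"
proof -
  define d where "d n = iter_deriv n \<phi>" for n
  have d: "d 0 = \<phi>" "(d n has_vector_derivative d (Suc n) t) (at t)" for n t
    using test_function_derivs[OF \<phi>] by (auto simp: derivs_def d_def)
  obtain B where B: "\<And>t. \<phi> t \<noteq> 0 \<Longrightarrow> \<bar>t\<bar> \<le> B"
    using \<phi> unfolding test_function_def bounded_iff by auto
  have zero: "d n t = 0" if "B < t" for n t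
    using that
  proof (induction n arbitrary: t)
    case 0
    then have "\<not> \<bar>t\<bar> \<le> B" by linarith
    then show ?case using B[of t] d(1) by auto
  next
    case (Suc n)
    have "((\<lambda>_. 0) has_vector_derivative d (Suc n) t) (at t)"
      by (rule has_vector_derivative_transform_within_open[OF d(2)[of n t], of "{B<..}"])
        (use Suc in auto)
    then show ?case
      using vector_derivative_unique_at has_vector_derivative_const by blast
  qed
  show ?thesis
    by (rule that) (use zero in \<open>simp add: d_def\<close>)
qed

lemma continuous_on_iter_deriv: "test_function \<phi> \<Longrightarrow> continuous_on S (iter_deriv n \<phi>)"
  using test_function_derivs[of \<phi>] unfolding derivs_def continuous_on_eq_continuous_within
  by (metis (no_types, lifting) continuous_at_imp_continuous_at_within has_vector_derivative_continuous)

text \<open>A pairing over \<open>{0..R}\<close> is a convolution at time \<open>R\<close> with the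
  reflected function. For \<open>R\<close> beyond the support, the reflected second derivative of
  the test function is causal, and its double primitive is the reflected test function.\<close>

lemma second_derivI:
  assumes w: "caus w" and f: "loc_int f"
    and eq: "\<And>(\<rho>::real \<Rightarrow> complex) R. caus \<rho> \<Longrightarrow> conv (int0 (int0 \<rho>)) f R = conv \<rho> w R"
  shows "second_deriv w f"
  unfolding second_deriv_def
proof (intro allI impI)
  fix \<phi> assume \<phi>: "test_function \<phi>"
  define d where "d n = iter_deriv n \<phi>" for n
  have d: "d 0 = \<phi>" "(d n has_vector_derivative d (Suc n) t) (at t)" for n t
    using test_function_derivs[OF \<phi>] by (auto simp: derivs_def d_def)
  obtain B where zero: "\<And>n t. B < t \<Longrightarrow> d n t = 0"
    unfolding d_def using test_function_support[OF \<phi>] by blast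
  define R where "R = \<bar>B\<bar> + 1"
  have R: "0 < R" "B < R" by (auto simp: R_def)
  have dR: "((\<lambda>s. d n (R - s)) has_vector_derivative - d (Suc n) (R - s)) (at s)" for n s
  proof -
    have "((\<lambda>s. R - s) has_vector_derivative -1) (at s)"
      by (auto intro!: derivative_eq_intros)
    from vector_diff_chain_at[OF this d(2)[of n "R - s"]] show ?thesis by (simp add: o_def)
  qed
  have dRc: "caus (\<lambda>s. d n (R - s))" for n
    unfolding caus_def using has_vector_derivative_continuous[OF dR] zero R(2)
    by (auto simp: continuous_on_eq_continuous_within)
  define \<rho> where "\<rho> s = d (Suc (Suc 0)) (R - s)" for s
  have \<rho>: "caus \<rho>" unfolding \<rho>_def by (rule dRc)
  have 1: "int0 \<rho> = (\<lambda>s. - d (Suc 0) (R - s))"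
  proof (rule int0_eqI[OF \<rho>])
    show "((\<lambda>s. - d (Suc 0) (R - s)) has_vector_derivative \<rho> s) (at s)" for s
      using has_vector_derivative_minus[OF dR[of "Suc 0" s]] by (simp add: \<rho>_def)
  qed (use zero R in auto)
  have 2: "int0 (int0 \<rho>) = (\<lambda>s. d 0 (R - s))"
    unfolding 1
  proof (rule int0_eqI)
    show "caus (\<lambda>s. - d (Suc 0) (R - s))"
      using caus_scaleR[OF dRc, of "-1"] by simp
  qed (use dR zero R in auto)
  have "integral {0..} (\<lambda>t. iter_deriv 2 \<phi> t * w t) = integral {0..R} (\<lambda>t. iter_deriv 2 \<phi> t * w t)"
    by (rule integral_support) (use zero[of _ 2] R(2) in \<open>auto simp: d_def\<close>)
  also have "\<dots> = conv \<rho> w R"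
    by (simp add: conv_def \<rho>_def scaleC_complex_def d_def mult.commute eval_nat_numeral)
  also have "\<dots> = conv (int0 (int0 \<rho>)) f R"
    by (rule eq[OF \<rho>, symmetric])
  also have "\<dots> = integral {0..R} (\<lambda>t. \<phi> t * f t)"
    unfolding 2 by (simp add: conv_def scaleC_complex_def d(1) mult.commute)
  also have "\<dots> = integral {0..} (\<lambda>t. \<phi> t * f t)"
    by (rule integral_support[symmetric]) (use zero[of _ 0] R(2) d(1) in auto)
  finally show "integral {0..} (\<lambda>t. iter_deriv 2 \<phi> t * w t) = integral {0..} (\<lambda>t. \<phi> t * f t)" .
qed

lemma int0_ramp: "int0 ramp t = complex_of_real ((max 0 t)\<^sup>2 / 2)"
proof (cases "0 \<le> t")
  case True
  have "(ramp has_integral (complex_of_real (t\<^sup>2 / 2) - complex_of_real (0\<^sup>2 / 2))) {0..t}"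
  proof (rule fundamental_theorem_of_calculus[OF True])
    fix x assume x: "x \<in> {0..t}"
    have "((\<lambda>x. x\<^sup>2 / 2) has_real_derivative x) (at x within {0..t})"
      by (auto intro!: derivative_eq_intros)
    then have "((\<lambda>x. x\<^sup>2 / 2) has_vector_derivative x) (at x within {0..t})"
      by (simp add: has_real_derivative_iff_has_vector_derivative)
    from bounded_linear.has_vector_derivative[OF bounded_linear_of_real[where 'a=complex] this]
    have "((\<lambda>x. complex_of_real (x\<^sup>2 / 2)) has_vector_derivative complex_of_real x) (at x within {0..t})" .
    moreover have "ramp x = complex_of_real x" using x by (simp add: ramp_def)
    ultimately show "((\<lambda>x. complex_of_real (x\<^sup>2 / 2)) has_vector_derivative ramp x) (at x within {0..t})"
      by (simp only:)
  qed
  then show ?thesis using True by (simp add: int0_def integral_unique)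
qed simp

text \<open>\<open>sd h ramp\<close> is the hat on \<open>{0..2 * h}\<close> of height
  \<open>h\<close>. As it is nonnegative, its integral is the second difference of
  \<open>int0 ramp\<close>.\<close>

lemma integral_norm_sd_ramp:
  assumes h: "0 < h"
  shows "integral {0..T} (\<lambda>t. norm (sd h ramp t)) \<le> h\<^sup>2"
proof -
  have k: "caus (sd h ramp)" using h by (intro caus_sd caus_ramp) simp
  have nn: "0 \<le> max 0 t - 2 * max 0 (t - h) + max 0 (t - 2 * h)" for t :: real
    using h by (auto simp: max_def)
  have re: "sd h ramp t = complex_of_real (max 0 t - 2 * max 0 (t - h) + max 0 (t - 2 * h))" for t
    by (simp add: sd_def ramp_def scaleR_conv_of_real)
  have "norm (sd h ramp t) = Re (sd h ramp t)" for t
    using nn[of t] unfolding re by (simp only: norm_of_real Re_complex_of_real abs_of_nonneg)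
  then have "integral {0..T} (\<lambda>t. norm (sd h ramp t)) = integral {0..T} (Re \<circ> sd h ramp)"
    by (simp add: o_def)
  also have "\<dots> = Re (int0 (sd h ramp) T)"
    unfolding int0_def by (rule integral_linear[OF integrable_continuous_real[OF caus_cont[OF k]] bounded_linear_Re])
  also have "\<dots> = Re (sd h (int0 ramp) T)"
    using h by (simp add: int0_sd[OF caus_ramp])
  also have "\<dots> = (max 0 T)\<^sup>2 / 2 - 2 * ((max 0 (T - h))\<^sup>2 / 2) + (max 0 (T - 2 * h))\<^sup>2 / 2"
    by (simp add: sd_def int0_ramp)
  also have "\<dots> \<le> h\<^sup>2"
  proof -
    consider "T \<le> 0" | "0 \<le> T" "T \<le> h" | "h \<le> T" "T \<le> 2 * h" | "2 * h \<le> T" by linarith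
    then show ?thesis
    proof cases
      case 2
      then have "T\<^sup>2 \<le> h\<^sup>2" by (intro power_mono) auto
      moreover have "0 \<le> h\<^sup>2" by simp
      ultimately have "T\<^sup>2 / 2 \<le> h\<^sup>2" by linarith
      then show ?thesis using 2 h by (simp add: max_absorb1 max_absorb2)
    next
      case 3
      have "0 \<le> (T - 2 * h)\<^sup>2" by simp
      moreover have "T\<^sup>2 / 2 - (T - h)\<^sup>2 = h\<^sup>2 - (T - 2 * h)\<^sup>2 / 2"
        by (simp add: power2_eq_square field_simps)
      ultimately show ?thesis using 3 h by (simp add: max_absorb1 max_absorb2)
    next
      case 4
      have "T\<^sup>2 / 2 - (T - h)\<^sup>2 + (T - 2 * h)\<^sup>2 / 2 = h\<^sup>2"
        by (simp add: power2_eq_square field_simps)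
      then show ?thesis using 4 h by (simp add: max_absorb2)
    qed (use h in auto)
  qed
  finally show ?thesis .
qed

text \<open>Both sides are the second difference of one function, because
  \<open>conv \<psi> u\<close> is \<open>conv ramp f\<close>. An estimate of \<open>f\<close> thus
  becomes an estimate for the kernel \<open>sd h \<psi>\<close>.\<close>

lemma sd_conv_second_deriv:
  assumes \<psi>: "caus \<psi>" and u: "loc_int u" and f: "loc_int f"
    and wf: "second_deriv (conv \<psi> u) f" and h: "0 < h"
  shows "conv (sd h \<psi>) u t = conv (sd h ramp) f t"
proof -
  have "conv \<psi> u = conv ramp f"
    by (rule second_deriv_unique[OF caus_conv[OF caus_cont[OF \<psi>] u] f wf])
  then show ?thesis
    using sd_conv[OF \<psi> u, of h t] sd_conv[OF caus_ramp f, of h t] h by simp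
qed

section \<open>Stability forces the bound on second differences\<close>

lemma le_of_approx:
  fixes a b c :: real
  assumes "\<And>e. 0 < e \<Longrightarrow> a \<le> b + e * c" "0 \<le> c"
  shows "a \<le> b"
proof (rule field_le_epsilon)
  fix e :: real assume "0 < e"
  then have "0 < e / (c + 1)" using assms(2) by simp
  then have "a \<le> b + e / (c + 1) * c" by (rule assms(1))
  also have "e / (c + 1) * c \<le> e" using \<open>0 < e\<close> assms(2) by (simp add: divide_le_eq algebra_simps)
  finally show "a \<le> b + e" by simp
qed

text \<open>Duality of L1 and L-infinity at the single time \<open>T\<close>: for the reflected sign
  of \<open>q\<close> as input, the convolution at \<open>T\<close> is the L1 norm of
  \<open>q\<close> on \<open>{0..T}\<close>, up to regularisation.\<close>

lemma bv2_of_Linf: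
  assumes \<psi>: "caus \<psi>"
    and ex: "\<And>u. continuous_on UNIV u \<Longrightarrow> (\<And>s. norm (u s) \<le> 1) \<Longrightarrow> \<exists>f. loc_int f \<and>
      (\<forall>T. \<exists>N. negligible N \<and> (\<forall>s\<in>{0..T} - N. norm (f s) \<le> c)) \<and> second_deriv (conv \<psi> u) f"
    and c: "0 \<le> c"
  shows "bv2 \<psi> c"
  unfolding bv2_def
proof (intro allI impI)
  fix h T :: real assume h: "0 < h"
  define q where "q = sd h \<psi>"
  have q: "caus q" unfolding q_def using h by (intro caus_sd \<psi>) simp
  show "integral {0..T} (\<lambda>t. norm (sd h \<psi> t)) \<le> c * h\<^sup>2"
  proof (rule le_of_approx)
    fix e :: real assume e: "0 < e"
    \<comment> \<open>A continuous substitute for the sign: \<open>e\<close> keeps the denominator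
      away from 0, and the loss in the integral is at most \<open>e\<close> per unit of
      time.\<close>
    define u where "u s = cnj (q (T - s)) / complex_of_real (norm (q (T - s)) + e)" for s
    have ne: "norm z + e \<noteq> 0" "complex_of_real (norm z) + complex_of_real e \<noteq> 0" for z :: complex
    proof -
      show "norm z + e \<noteq> 0" using e norm_ge_zero[of z] by linarith
      then show "complex_of_real (norm z) + complex_of_real e \<noteq> 0"
        by (metis of_real_add of_real_eq_0_iff)
    qed
    have qr: "continuous_on S (\<lambda>s. q (T - s))" for S
      by (rule continuous_on_compose2[OF caus_cont[OF q, of UNIV]]) (auto intro!: continuous_intros)
    have uc: "continuous_on S u" for S
      unfolding u_def using ne by (intro continuous_intros qr) auto
    have "norm (u s) \<le> 1" for s
    proof -
      have "0 < norm (q (T - s)) + e" using e norm_ge_zero[of "q (T - s)"] by linarith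
      then have "norm (q (T - s)) / \<bar>norm (q (T - s)) + e\<bar> \<le> 1" using e by simp
      then show ?thesis unfolding u_def norm_divide norm_of_real complex_mod_cnj .
    qed
    then obtain f where f: "loc_int f" "\<And>T. \<exists>N. negligible N \<and> (\<forall>s\<in>{0..T} - N. norm (f s) \<le> c)"
      "second_deriv (conv \<psi> u) f"
      using ex[OF uc] by blast
    have u: "loc_int u" unfolding loc_int_def by (intro allI absolutely_integrable_continuous_real uc)
    obtain N where N: "negligible N" "\<And>s. s \<in> {0..T} - N \<Longrightarrow> norm (f s) \<le> c"
      using f(2)[of T] by blast
    define g where "g x = (norm (q x))\<^sup>2 / (norm (q x) + e)" for x
    have gc: "continuous_on S g" for S
      unfolding g_def using ne by (intro continuous_intros caus_cont q) auto
    have "integral {0..T} (\<lambda>t. norm (q t)) \<le> integral {0..T} (\<lambda>t. g t + e)"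
    proof (intro integral_le integrable_continuous_real continuous_intros caus_cont[OF q] gc)
      fix x
      have pos: "0 < norm (q x) + e" using e norm_ge_zero[of "q x"] by linarith
      have "norm (q x) * (norm (q x) + e) \<le> (norm (q x))\<^sup>2 + e * (norm (q x) + e)"
        using e by (simp add: power2_eq_square algebra_simps)
      then have "norm (q x) \<le> ((norm (q x))\<^sup>2 + e * (norm (q x) + e)) / (norm (q x) + e)"
        using pos by (simp only: pos_le_divide_eq)
      also have "\<dots> = g x + e"
        using pos by (simp add: g_def add_divide_distrib)
      finally show "norm (q x) \<le> g x + e" .
    qed
    also have "\<dots> = integral {0..T} g + e * max 0 T"
      by (subst Henstock_Kurzweil_Integration.integral_add)
        (auto intro: integrable_continuous_real gc simp: max_def)
    also have "integral {0..T} g \<le> c * h\<^sup>2"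
    proof -
      have "cnj z * z = complex_of_real ((norm z)\<^sup>2)" for z
        by (metis complex_norm_square mult.commute)
      then have "u s * q (T - s) = complex_of_real (g (T - s))" for s
        unfolding u_def g_def by (simp only: times_divide_eq_left of_real_divide)
      then have "conv q u T = integral {0..T} (\<lambda>s. complex_of_real (g (T - s)))"
        by (simp add: conv_def scaleC_complex_def)
      also have "\<dots> = integral {0..T} (\<lambda>s. complex_of_real (g s))"
        by (rule integral_reverse[of T "\<lambda>s. complex_of_real (g s)"])
      also have "\<dots> = complex_of_real (integral {0..T} g)"
        using integral_linear[OF integrable_continuous_real[OF gc] bounded_linear_of_real] by (simp add: o_def)
      finally have "integral {0..T} g \<le> norm (conv q u T)" by simp
      also have "\<dots> = norm (conv (sd h ramp) f T)"
        unfolding q_def by (simp only: sd_conv_second_deriv[OF \<psi> u f(1,3) h])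
      also have "\<dots> \<le> c * integral {0..T} (\<lambda>s. norm (sd h ramp s))"
        using h by (intro norm_conv_le_ess[OF caus_sd[OF caus_ramp] f(1) N]) auto
      also have "\<dots> \<le> c * h\<^sup>2"
        by (intro mult_left_mono integral_norm_sd_ramp h c)
      finally show ?thesis .
    qed
    finally show "integral {0..T} (\<lambda>t. norm (sd h \<psi> t)) \<le> c * h\<^sup>2 + e * max 0 T"
      by (simp add: q_def)
  qed simp
qed

text \<open>Convolution with a short bump of unit mass moves \<open>q\<close> uniformly little on
  \<open>{0..T}\<close>, and \<open>sd_conv_second_deriv\<close> with Young's inequality bounds the
  L1 norm of the convolution by \<open>c * h\<^sup>2\<close>.\<close>

lemma bv2_of_L1:
  assumes \<psi>: "caus \<psi>"
    and ex: "\<And>u. caus u \<Longrightarrow> (\<And>T. integral {0..T} (\<lambda>s. norm (u s)) \<le> 1) \<Longrightarrow> \<exists>f. loc_int f \<and>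
      (\<forall>T. integral {0..T} (\<lambda>s. norm (f s)) \<le> c) \<and> second_deriv (conv \<psi> u) f"
  shows "bv2 \<psi> c"
  unfolding bv2_def
proof (intro allI impI)
  fix h T :: real assume h: "0 < h"
  define q where "q = sd h \<psi>"
  have q: "caus q" unfolding q_def using h by (intro caus_sd \<psi>) simp
  show "integral {0..T} (\<lambda>t. norm (sd h \<psi> t)) \<le> c * h\<^sup>2"
  proof (rule le_of_approx)
    fix e :: real assume e: "0 < e"
    obtain b where b: "0 < b" "\<And>x y. x \<in> {-1..T} \<Longrightarrow> y \<in> {-1..T} \<Longrightarrow> \<bar>x - y\<bar> < b \<Longrightarrow> norm (q x - q y) < e"
      using unif_cont_Icc[OF caus_cont[OF q] e] by blast
    define \<delta> where "\<delta> = min (b / 2) 1"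
    have \<delta>: "0 < \<delta>" "\<delta> < b" "\<delta> \<le> 1" using b(1) by (auto simp: \<delta>_def)
    obtain r :: "real \<Rightarrow> real" and d where r: "derivs r d" "\<And>s. 0 \<le> r s" "\<And>s. s \<le> 0 \<Longrightarrow> r s = 0"
      "\<And>s. \<delta> \<le> s \<Longrightarrow> r s = 0" "integral {0..\<delta>} r = 1" "continuous_on UNIV r"
      by (rule bump_exists[OF \<delta>(1)]) (rule that)
    have rc: "continuous_on S r" for S using r(6) continuous_on_subset by blast
    have ri: "r integrable_on {a..b}" for a b by (intro integrable_continuous_real rc)
    define u where "u s = complex_of_real (r s)" for s
    have u: "caus u" unfolding caus_def u_def using r by (auto intro!: continuous_intros)
    have nu: "norm (u s) = r s" for s by (simp add: u_def r(2))
    have r1: "integral {0..t} r = 1" if "\<delta> \<le> t" for t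
    proof -
      have "integral {0..t} r = integral {0..\<delta>} r"
        by (rule integral_support) (use that r(4) in auto)
      then show ?thesis using r(5) by simp
    qed
    have "integral {0..t} (\<lambda>s. norm (u s)) \<le> 1" for t
    proof -
      have "integral {0..t} r \<le> integral {0..max t \<delta>} r"
        by (rule integral_subset_le[OF _ ri ri]) (use r(2) in auto)
      then show ?thesis using r1[of "max t \<delta>"] by (simp add: nu)
    qed
    from ex[OF u this] obtain f where f: "loc_int f" "\<And>T. integral {0..T} (\<lambda>s. norm (f s)) \<le> c"
      "second_deriv (conv \<psi> u) f" by blast
    have c: "0 \<le> c" using f(2)[of 0] by simp
    note ul = caus_loc_int[OF u]
    have qu: "caus (conv q u)" by (rule caus_conv[OF caus_cont[OF q] ul])
    have close: "norm (q t - conv q u t) \<le> e" if t: "t \<in> {0..T}" for t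
    proof -
      \<comment> \<open>Integrating up to \<open>t + \<delta>\<close> captures the whole mass of the
        bump even when \<open>t < \<delta>\<close>; causality of \<open>q\<close> leaves the
        convolution unchanged.\<close>
      let ?J = "{0..t+\<delta>}"
      have "((\<lambda>s. u s *\<^sub>C ext0 q (t - s)) has_integral conv q u t) ?J"
        by (rule conv_ext[OF caus_cont[OF q] ul]) (use \<delta> in simp)
      moreover have "ext0 q x = q x" for x
        using caus_neg[OF q, of x] by (simp add: ext0_def)
      ultimately have 1: "((\<lambda>s. u s * q (t - s)) has_integral conv q u t) ?J"
        by (simp add: scaleC_complex_def)
      have "(r has_integral 1) ?J"
        using r1[of "t + \<delta>"] t integrable_integral[OF ri[of 0 "t + \<delta>"]] by simp
      from has_integral_linear[OF this bounded_linear_of_real]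
      have "(u has_integral 1) ?J" by (simp add: o_def u_def[abs_def])
      from has_integral_mult_left[OF this, of "q t"]
      have 2: "((\<lambda>s. u s * q t) has_integral q t) ?J" by simp
      from has_integral_diff[OF 2 1]
      have 3: "((\<lambda>s. u s * (q t - q (t - s))) has_integral (q t - conv q u t)) ?J"
        by (simp add: algebra_simps)
      have "norm (integral ?J (\<lambda>s. u s * (q t - q (t - s)))) \<le> integral ?J (\<lambda>s. e * r s)"
      proof (rule integral_norm_bound_integral)
        show "(\<lambda>s. u s * (q t - q (t - s))) integrable_on ?J" using 3 by blast
        show "(\<lambda>s. e * r s) integrable_on ?J" by (intro integrable_on_mult_right ri)
        fix s assume s: "s \<in> ?J"
        show "norm (u s * (q t - q (t - s))) \<le> e * r s"
        proof (cases "s \<le> \<delta>")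
          case True
          have "norm (q t - q (t - s)) \<le> e"
            by (intro less_imp_le b(2)) (use True s t \<delta> in auto)
          then show ?thesis
            using mult_left_mono[OF _ r(2)[of s], of "norm (q t - q (t - s))" e]
            by (simp add: norm_mult nu mult.commute)
        qed (simp add: u_def r(4))
      qed
      then show ?thesis
        using r1[of "t + \<delta>"] t by (simp add: integral_unique[OF 3])
    qed
    have ai: "p absolutely_integrable_on {0..T}" if "caus p" for p :: "real \<Rightarrow> complex"
      by (rule loc_int_absD[OF caus_loc_int[OF that] order_refl])
    have "integral {0..T} (\<lambda>t. norm (q t - 0))
        \<le> integral {0..T} (\<lambda>t. norm (q t - conv q u t)) + integral {0..T} (\<lambda>t. norm (conv q u t - 0))"
      by (rule integral_norm_triangle[OF ai[OF q] ai[OF qu]]) (simp add: absolutely_integrable_on_def)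
    moreover have "integral {0..T} (\<lambda>t. norm (q t - conv q u t)) \<le> e * \<bar>T\<bar>"
      by (rule integral_norm_le_const[OF close])
        (use e in \<open>auto intro!: integrable_continuous_real continuous_intros caus_cont[OF q] caus_cont[OF qu]\<close>)
    moreover have "integral {0..T} (\<lambda>t. norm (conv q u t)) \<le> c * h\<^sup>2"
    proof -
      have "integral {0..T} (\<lambda>t. norm (conv q u t)) = integral {0..T} (\<lambda>t. norm (conv (sd h ramp) f t))"
        unfolding q_def by (simp only: sd_conv_second_deriv[OF \<psi> ul f(1,3) h])
      also have "\<dots> \<le> integral {0..T} (\<lambda>t. norm (sd h ramp t)) * integral {0..T} (\<lambda>t. norm (f t))"
        using h by (intro integral_norm_conv_le caus_sd caus_ramp f(1)) simp
      also have "\<dots> \<le> h\<^sup>2 * c"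
        by (intro mult_mono integral_norm_sd_ramp h f(2) integral_nonneg loc_int_normD[OF f(1)]) auto
      finally show ?thesis by (simp add: mult.commute)
    qed
    ultimately show "integral {0..T} (\<lambda>t. norm (sd h \<psi> t)) \<le> c * h\<^sup>2 + e * \<bar>T\<bar>"
      by (simp add: q_def)
  qed simp
qed

section \<open>Coordinates in finite-dimensional spaces\<close>

text \<open>A predicate on plain functions, because kernels arise from integrals and case
  distinctions rather than as elements of the operator type.\<close>

definition clin :: "('a::complex_banach \<Rightarrow> 'b::complex_banach) \<Rightarrow> bool"
  where "clin f \<longleftrightarrow> bounded_linear f \<and> (\<forall>c x. f (c *\<^sub>C x) = c *\<^sub>C f x)"

lemma Abs_cblinfun_apply: "clin f \<Longrightarrow> cblinfun_apply (Abs_cblinfun f) = f"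
  by (rule Abs_cblinfun_inverse) (simp add: clin_def)

lemma clin_cblinfun: "clin (cblinfun_apply F)"
  by (simp add: clin_def bounded_linear_cblinfun_apply cblinfun_scaleC)

lemma clin_bl: "clin f \<Longrightarrow> bounded_linear f"
  by (simp add: clin_def)

lemma clin_scaleC: "clin f \<Longrightarrow> f (c *\<^sub>C x) = c *\<^sub>C f x"
  by (simp add: clin_def)

lemma clin_compose: "clin f \<Longrightarrow> clin g \<Longrightarrow> clin (\<lambda>x. f (g x))"
  by (auto simp: clin_def intro: bounded_linear_compose)

interpretation cvec: vector_space "scaleC :: complex \<Rightarrow> 'a::complex_banach \<Rightarrow> 'a"
  by (rule vector_space_scaleC)

text \<open>An expansion with bounded coordinates is the form of finite-dimensionality that passes
  directly to the dual space.\<close>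

definition frame :: "'i set \<Rightarrow> ('i \<Rightarrow> 'a::complex_banach) \<Rightarrow> ('i \<Rightarrow> 'a \<Rightarrow> complex) \<Rightarrow> bool"
  where "frame I e \<xi> \<longleftrightarrow> finite I \<and> (\<forall>i\<in>I. clin (\<xi> i)) \<and> (\<forall>x. x = (\<Sum>i\<in>I. \<xi> i x *\<^sub>C e i))"

text \<open>Inductive step for the equivalence of norms. The bound on \<open>B\<close> makes its
  span closed, so \<open>e\<close> has a positive distance \<open>d\<close> from it;
  \<open>d\<close> controls the coefficient of \<open>e\<close>, and the triangle inequality leaves
  the rest to the old bound.\<close>

lemma coordinate_bound_insert:
  fixes B :: "'a::complex_banach set"
  assumes B: "finite B" and M: "\<And>a. (\<Sum>v\<in>B. cmod (a v)) \<le> M * norm (\<Sum>v\<in>B. a v *\<^sub>C v)"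
    and e: "e \<notin> cvec.span B"
  shows "\<exists>M. \<forall>a. (\<Sum>v\<in>insert e B. cmod (a v)) \<le> M * norm (\<Sum>v\<in>insert e B. a v *\<^sub>C v)"
proof -
  have span: "cvec.span B = range (\<lambda>a. \<Sum>v\<in>B. a v *\<^sub>C v)"
    by (rule cvec.span_finite[OF B])
  have eB: "e \<notin> B" using e cvec.span_base by blast
  define M' where "M' = \<bar>M\<bar>"
  have M': "0 \<le> M'" "(\<Sum>v\<in>B. cmod (a v)) \<le> M' * norm (\<Sum>v\<in>B. a v *\<^sub>C v)" for a
  proof -
    show "0 \<le> M'" by (simp add: M'_def)
    have "M * norm (\<Sum>v\<in>B. a v *\<^sub>C v) \<le> M' * norm (\<Sum>v\<in>B. a v *\<^sub>C v)"
      by (intro mult_right_mono) (simp_all add: M'_def)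
    with M[of a] show "(\<Sum>v\<in>B. cmod (a v)) \<le> M' * norm (\<Sum>v\<in>B. a v *\<^sub>C v)"
      by (rule order_trans)
  qed
  have "closed (cvec.span B)"
    unfolding closed_sequential_limits
  proof (intro allI impI, elim conjE)
    fix x l assume x: "\<forall>n. x n \<in> cvec.span B" and l: "x \<longlonglongrightarrow> l"
    then have "\<forall>n. \<exists>a. x n = (\<Sum>v\<in>B. a v *\<^sub>C v)"
      unfolding span by (simp add: image_iff)
    from choice[OF this] obtain a where "\<forall>n. x n = (\<Sum>v\<in>B. a n v *\<^sub>C v)" ..
    then have a: "x n = (\<Sum>v\<in>B. a n v *\<^sub>C v)" for n ..
    have "convergent (\<lambda>n. a n v)" if v: "v \<in> B" for v
    proof -
      have "Cauchy (\<lambda>n. a n v)"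
      proof (rule metric_CauchyI)
        fix r :: real assume r: "0 < r"
        then have "0 < r / (M' + 1)" using M'(1) by simp
        then obtain N where N: "\<And>m n. m \<ge> N \<Longrightarrow> n \<ge> N \<Longrightarrow> dist (x m) (x n) < r / (M' + 1)"
          using metric_CauchyD[OF LIMSEQ_imp_Cauchy[OF l]] by blast
        have "dist (a m v) (a n v) < r" if mn: "m \<ge> N" "n \<ge> N" for m n
        proof -
          have "cmod (a m v - a n v) \<le> (\<Sum>v\<in>B. cmod (a m v - a n v))"
            by (rule member_le_sum[OF v _ B]) simp
          also have "\<dots> \<le> M' * norm (\<Sum>v\<in>B. (a m v - a n v) *\<^sub>C v)" by (rule M'(2))
          also have "(\<Sum>v\<in>B. (a m v - a n v) *\<^sub>C v) = x m - x n"
            by (simp add: a scaleC_diff_left sum_subtractf)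
          also have "M' * norm (x m - x n) \<le> M' * (r / (M' + 1))"
            using N[OF mn] M'(1) by (intro mult_left_mono) (auto simp: dist_norm)
          also have "\<dots> < r" using r M'(1) by (simp add: field_simps)
          finally show ?thesis by (simp add: dist_norm)
        qed
        then show "\<exists>M. \<forall>m\<ge>M. \<forall>n\<ge>M. dist (a m v) (a n v) < r" by blast
      qed
      then show ?thesis by (simp add: Cauchy_convergent_iff)
    qed
    then have b: "(\<lambda>n. a n v) \<longlonglongrightarrow> lim (\<lambda>n. a n v)" if "v \<in> B" for v
      using that by (simp add: convergent_LIMSEQ_iff)
    have "(\<lambda>n. \<Sum>v\<in>B. a n v *\<^sub>C v) \<longlonglongrightarrow> (\<Sum>v\<in>B. lim (\<lambda>n. a n v) *\<^sub>C v)"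
      by (intro tendsto_sum tendsto_scaleC b tendsto_const)
    with l have "l = (\<Sum>v\<in>B. lim (\<lambda>n. a n v) *\<^sub>C v)"
      unfolding a[abs_def, symmetric] by (rule LIMSEQ_unique)
    then show "l \<in> cvec.span B" unfolding span by (intro image_eqI[of _ _ "\<lambda>v. lim (\<lambda>n. a n v)"]) auto
  qed
  then have "open (- cvec.span B)" by (rule open_Compl)
  then obtain d where d0: "0 < d" "ball e d \<subseteq> - cvec.span B"
    using e by (meson ComplI open_contains_ball)
  then have d: "0 < d" "\<And>y. y \<in> cvec.span B \<Longrightarrow> d \<le> dist e y"
    by (auto simp: subset_iff not_less[symmetric])
  have sc: "cmod z * d \<le> norm (z *\<^sub>C e + y)" if "y \<in> cvec.span B" for z y
  proof (cases "z = 0")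
    case False
    have "d \<le> dist e ((- inverse z) *\<^sub>C y)"
      by (rule d(2)) (rule cvec.span_scale[OF that])
    then have "cmod z * d \<le> cmod z * norm (e + inverse z *\<^sub>C y)"
      by (intro mult_left_mono) (simp_all add: dist_norm)
    also have "\<dots> = norm (z *\<^sub>C (e + inverse z *\<^sub>C y))" by (simp only: norm_scaleC)
    also have "z *\<^sub>C (e + inverse z *\<^sub>C y) = z *\<^sub>C e + y"
      using False by (simp add: scaleC_add_right scaleC_scaleC)
    finally show ?thesis .
  qed simp
  \<comment> \<open>\<open>1 / d\<close> bounds the coefficient of \<open>e\<close>; the remaining
    vector is then bounded by the factor \<open>1 + norm e / d\<close>, and \<open>M'\<close> turns
    this into a bound on its coefficients.\<close>
  define L where "L = 1 / d + M' * (1 + norm e / d)"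
  have "(\<Sum>v\<in>insert e B. cmod (a v)) \<le> L * norm (\<Sum>v\<in>insert e B. a v *\<^sub>C v)" for a
  proof -
    let ?y = "\<Sum>v\<in>B. a v *\<^sub>C v" and ?n = "norm (\<Sum>v\<in>insert e B. a v *\<^sub>C v)"
    have y: "?y \<in> cvec.span B" unfolding span by (rule rangeI)
    have s: "(\<Sum>v\<in>insert e B. a v *\<^sub>C v) = a e *\<^sub>C e + ?y" using B eB by simp
    have ae: "cmod (a e) \<le> ?n / d" using sc[OF y, of "a e"] d(1) by (simp add: s field_simps)
    have "norm ?y = norm ((a e *\<^sub>C e + ?y) - a e *\<^sub>C e)" by simp
    also have "\<dots> \<le> ?n + cmod (a e) * norm e"
      unfolding s by (rule order_trans[OF norm_triangle_ineq4]) (simp add: norm_scaleC)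
    also have "\<dots> \<le> ?n + ?n / d * norm e" using ae by (intro add_left_mono mult_right_mono) auto
    finally have "norm ?y \<le> ?n * (1 + norm e / d)" by (simp add: algebra_simps)
    then have "M' * norm ?y \<le> M' * (?n * (1 + norm e / d))" using M'(1) by (rule mult_left_mono)
    with M'(2)[of a] ae have "cmod (a e) + (\<Sum>v\<in>B. cmod (a v)) \<le> ?n / d + M' * (?n * (1 + norm e / d))"
      by linarith
    also have "\<dots> = L * ?n" by (simp add: L_def algebra_simps)
    finally show ?thesis using B eB by simp
  qed
  then show ?thesis by blast
qed

text \<open>Vectors already in the span of the earlier ones are skipped, so that every vector kept
  falls under \<open>coordinate_bound_insert\<close>.\<close>

lemma coordinate_bound:
  fixes b :: "'a::complex_banach set"
  assumes "finite b"
  shows "\<exists>B\<subseteq>b. cvec.span B = cvec.span b \<and>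
    (\<exists>M. \<forall>a. (\<Sum>v\<in>B. cmod (a v)) \<le> M * norm (\<Sum>v\<in>B. a v *\<^sub>C v))"
  using assms
proof (induction b rule: finite_induct)
  case empty
  then show ?case by (intro exI[of _ "{}"]) auto
next
  case (insert e b)
  then obtain B M where B: "B \<subseteq> b" "cvec.span B = cvec.span b"
    and M: "\<And>a. (\<Sum>v\<in>B. cmod (a v)) \<le> M * norm (\<Sum>v\<in>B. a v *\<^sub>C v)"
    by blast
  have fB: "finite B" using B(1) insert.hyps(1) finite_subset by blast
  show ?case
  proof (cases "e \<in> cvec.span b")
    case True
    then have "cvec.span (insert e b) = cvec.span b" by (rule cvec.span_redundant)
    then show ?thesis using B M by (intro exI[of _ B]) auto
  next
    case False
    then have "e \<notin> cvec.span B" using B(2) by simp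
    from coordinate_bound_insert[OF fB M this]
    have "\<exists>M. \<forall>a. (\<Sum>v\<in>insert e B. cmod (a v)) \<le> M * norm (\<Sum>v\<in>insert e B. a v *\<^sub>C v)" .
    moreover have "cvec.span (insert e B) = cvec.span (insert e b)"
      by (simp add: cvec.span_insert B(2))
    ultimately show ?thesis using B(1) by (intro exI[of _ "insert e B"]) auto
  qed
qed

lemma finite_dimensional_frame:
  assumes "finite_dimensional TYPE('a::complex_banach)"
  obtains I :: "'a::complex_banach set" and e :: "'a \<Rightarrow> 'a" and \<xi> where "frame I e \<xi>"
proof -
  obtain b :: "'a set" where b: "finite b" "cvec.span b = UNIV"
    using assms by (auto simp: finite_dimensional_def)
  obtain B M where B: "B \<subseteq> b" "cvec.span B = UNIV"
    and M: "\<And>a. (\<Sum>v\<in>B. cmod (a v)) \<le> M * norm (\<Sum>v\<in>B. a v *\<^sub>C v)"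
    using coordinate_bound[OF b(1)] b(2) by auto
  have fB: "finite B" using B(1) b(1) finite_subset by blast
  have "\<forall>x. \<exists>a. x = (\<Sum>v\<in>B. a v *\<^sub>C v)"
  proof
    fix x :: 'a
    have "x \<in> range (\<lambda>a. \<Sum>v\<in>B. a v *\<^sub>C v)"
      using B(2) cvec.span_finite[OF fB] by auto
    then show "\<exists>a. x = (\<Sum>v\<in>B. a v *\<^sub>C v)" by (simp add: image_iff)
  qed
  from choice[OF this] obtain A where "\<forall>x. x = (\<Sum>v\<in>B. A x v *\<^sub>C v)" ..
  then have A: "x = (\<Sum>v\<in>B. A x v *\<^sub>C v)" for x ..
  \<comment> \<open>The bound makes coefficients unique; this is why the coordinates, obtained by
    mere choice, are linear.\<close>
  have uniq: "A x v = a v" if "x = (\<Sum>v\<in>B. a v *\<^sub>C v)" "v \<in> B" for x a v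
  proof -
    have "(\<Sum>v\<in>B. (A x v - a v) *\<^sub>C v) = 0"
      using A[of x] that(1) by (simp add: scaleC_diff_left sum_subtractf)
    with M[of "\<lambda>v. A x v - a v"] have "(\<Sum>v\<in>B. cmod (A x v - a v)) \<le> 0" by simp
    moreover have "cmod (A x v - a v) \<le> (\<Sum>v\<in>B. cmod (A x v - a v))"
      by (rule member_le_sum[OF that(2) _ fB]) simp
    ultimately show ?thesis by (metis eq_iff_diff_eq_0 norm_le_zero_iff order_trans)
  qed
  have "clin (\<lambda>x. A x v)" if v: "v \<in> B" for v
    unfolding clin_def
  proof (intro conjI allI)
    have add: "A (x + y) v = A x v + A y v" for x y
      by (rule uniq[OF _ v, of _ "\<lambda>v. A x v + A y v"])
        (simp add: scaleC_add_left sum.distrib A[symmetric])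
    have scC: "A (c *\<^sub>C x) v = c * A x v" for c x
    proof (rule uniq[OF _ v])
      have "(\<Sum>v\<in>B. (c * A x v) *\<^sub>C v) = c *\<^sub>C (\<Sum>v\<in>B. A x v *\<^sub>C v)"
        by (simp add: cvec.scale_sum_right scaleC_scaleC)
      then show "c *\<^sub>C x = (\<Sum>v\<in>B. (c * A x v) *\<^sub>C v)"
        by (simp only: A[of x, symmetric])
    qed
    show "A (c *\<^sub>C x) v = c *\<^sub>C A x v" for c x
      by (simp add: scC scaleC_complex_def)
    show "bounded_linear (\<lambda>x. A x v)"
    proof (rule bounded_linear_intro[of _ M])
      show "A (r *\<^sub>R x) v = r *\<^sub>R A x v" for r x
        using scC[of "of_real r" x] by (simp add: scaleC_of_real scaleR_conv_of_real)
      have "cmod (A x v) \<le> (\<Sum>v\<in>B. cmod (A x v))" for x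
        by (rule member_le_sum[OF v _ fB]) simp
      also have "\<dots> x \<le> norm x * M" for x
        using M[of "A x"] by (simp add: A[symmetric] mult.commute)
      finally show "cmod (A x v) \<le> norm x * M" for x .
    qed (rule add)
  qed
  then have "frame B (\<lambda>v. v) (\<lambda>v x. A x v)"
    using fB A by (auto simp: frame_def)
  then show ?thesis by (rule that)
qed

text \<open>Conjugation turns a linear coordinate into a conjugate-linear functional; the zero
  function is a default that makes the lift total.\<close>

lift_definition conj_functional :: "('a::complex_banach \<Rightarrow> complex) \<Rightarrow> 'a antidual"
  is "\<lambda>\<xi>. if clin \<xi> then (\<lambda>x. cnj (\<xi> x)) else (\<lambda>_. 0)"
  by (auto simp: clin_def scaleC_complex_def intro: bounded_linear_compose[OF bounded_linear_cnj])

lemma conj_functional_apply: "clin \<xi> \<Longrightarrow> antidual_apply (conj_functional \<xi>) x = cnj (\<xi> x)"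
  by (simp add: conj_functional.rep_eq)

lemma norm_antidual_apply_le: "norm (antidual_apply f x) \<le> norm f * norm x"
  by (simp add: norm_antidual.rep_eq onorm bounded_linear_antidual_apply)

lemma clin_evaluation: "clin (\<lambda>f. antidual_apply f x)"
  unfolding clin_def
proof (intro conjI allI)
  show "bounded_linear (\<lambda>f. antidual_apply f x)"
    by (rule bounded_linear_intro[of _ "norm x"])
      (simp_all add: plus_antidual.rep_eq scaleR_antidual.rep_eq norm_antidual_apply_le)
  show "antidual_apply (c *\<^sub>C f) x = c *\<^sub>C antidual_apply f x" for c f
    by (simp add: scaleC_antidual.rep_eq scaleC_complex_def)
qed

lemma antidual_apply_sum: "antidual_apply (\<Sum>i\<in>I. f i) x = (\<Sum>i\<in>I. antidual_apply (f i) x)"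
  using linear_sum[OF bounded_linear.linear[OF clin_bl[OF clin_evaluation[of x]]], of f I] .

lemma antidual_sum: "antidual_apply f (\<Sum>i\<in>I. x i) = (\<Sum>i\<in>I. antidual_apply f (x i))"
  using linear_sum[OF bounded_linear.linear[OF bounded_linear_antidual_apply[of f]], of x I] .

text \<open>Vectors and coordinates exchange roles: expanding \<open>x\<close> inside
  \<open>f x\<close> exhibits the values at \<open>e i\<close> as the new coordinates.\<close>

lemma frame_antidual:
  fixes e :: "'i \<Rightarrow> 'a::complex_banach"
  assumes "frame I e \<xi>"
  shows "frame I (\<lambda>i. conj_functional (\<xi> i)) (\<lambda>i f. antidual_apply f (e i))"
  unfolding frame_def
proof (intro conjI ballI allI)
  fix f :: "'a antidual"
  show "f = (\<Sum>i\<in>I. antidual_apply f (e i) *\<^sub>C conj_functional (\<xi> i))"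
  proof (rule antidual_eqI)
    fix x
    have "antidual_apply f x = antidual_apply f (\<Sum>i\<in>I. \<xi> i x *\<^sub>C e i)"
      using assms by (simp add: frame_def)
    also have "\<dots> = (\<Sum>i\<in>I. cnj (\<xi> i x) * antidual_apply f (e i))"
      by (simp add: antidual_sum antidual_scaleC)
    also have "\<dots> = (\<Sum>i\<in>I. antidual_apply (antidual_apply f (e i) *\<^sub>C conj_functional (\<xi> i)) x)"
      using assms by (intro sum.cong) (auto simp: scaleC_antidual.rep_eq conj_functional_apply frame_def)
    finally show "antidual_apply f x
        = antidual_apply (\<Sum>i\<in>I. antidual_apply f (e i) *\<^sub>C conj_functional (\<xi> i)) x"
      by (simp add: antidual_apply_sum)
  qed
qed (use assms in \<open>auto simp: frame_def clin_evaluation\<close>)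

section \<open>Stability of convolution operators\<close>

lemma restrict_measurable_Icc:
  fixes f :: "real \<Rightarrow> 'a::euclidean_space"
  assumes "f measurable_on {0..}"
  shows "f \<in> borel_measurable (lebesgue_on {0..t})"
proof -
  have "f \<in> borel_measurable (lebesgue_on {0..})"
    using assms by (subst (asm) measurable_on_iff_borel_measurable) auto
  then show ?thesis by (rule measurable_restrict_mono) auto
qed

lemma loc_int_measurable:
  assumes "loc_int f"
  shows "f measurable_on {0..}"
proof -
  define g where "g n t = (if t \<in> {0..real n} then f t else 0)" for n t
  have gm: "g n \<in> borel_measurable lebesgue" for n
  proof -
    have "f \<in> borel_measurable (lebesgue_on {0..real n})"
      using loc_int_absD[OF assms order_refl] by (simp add: absolutely_integrable_measurable)
    then show ?thesis unfolding g_def by (intro borel_measurable_if_I) auto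
  qed
  have lim: "(\<lambda>n. g n t) \<longlonglongrightarrow> (if t \<in> {0..} then f t else 0)" for t
  proof (rule tendsto_eventually)
    show "\<forall>\<^sub>F n in sequentially. g n t = (if t \<in> {0..} then f t else 0)"
      using eventually_ge_at_top[of "nat \<lceil>t\<rceil>"]
      by eventually_elim (auto simp: g_def nat_le_iff ceiling_le_iff)
  qed
  have "(\<lambda>t. if t \<in> {0..} then f t else 0) \<in> borel_measurable lebesgue"
    by (rule borel_measurable_LIMSEQ_metric[OF gm lim])
  then have "(\<lambda>t. if t \<in> {0..} then f t else 0) measurable_on UNIV"
    by (intro lebesgue_measurable_imp_measurable_on) auto
  then show ?thesis by (simp only: measurable_on_UNIV)
qed

lemma clin_bound: "clin \<xi> \<Longrightarrow> norm (\<xi> x) \<le> onorm \<xi> * norm x"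
  by (rule onorm[OF clin_bl])

lemma clin_0: "clin \<xi> \<Longrightarrow> \<xi> 0 = 0"
  using linear_0[OF bounded_linear.linear[OF clin_bl]] .

lemma clin_onorm_pos: "clin \<xi> \<Longrightarrow> 0 \<le> onorm \<xi>"
  by (rule onorm_pos_le[OF clin_bl])

lemma clin_continuous: "clin \<xi> \<Longrightarrow> continuous_on S \<xi>"
  using linear_continuous_on[OF clin_bl] by blast

lemma L1_loc_norm_integrable: "L1_loc u \<Longrightarrow> (\<lambda>s. norm (u s)) integrable_on {0..t}"
proof (cases "0 < t")
  case False
  then have "measure lborel (cbox 0 t) = 0" by simp
  from integrable_on_null[OF this] show ?thesis by simp
qed (simp add: L1_loc_def)

lemma L1_loc_coord:
  fixes \<xi> :: "'a::complex_banach \<Rightarrow> complex"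
  assumes \<xi>: "clin \<xi>" and u: "L1_loc u"
  shows "loc_int (\<lambda>s. \<xi> (u s))"
    "integral {0..t} (\<lambda>s. norm (\<xi> (u s))) \<le> onorm \<xi> * L1_norm t u"
proof -
  have m: "(\<lambda>s. \<xi> (u s)) measurable_on {0..}"
    using measurable_on_compose_continuous_0[of u "{0..}" \<xi>] u clin_continuous[OF \<xi>] clin_0[OF \<xi>]
    by (simp add: L1_loc_def o_def)
  have i: "(\<lambda>s. onorm \<xi> * norm (u s)) integrable_on {0..t}" for t
    by (intro integrable_on_mult_right L1_loc_norm_integrable u)
  have "(\<lambda>s. \<xi> (u s)) absolutely_integrable_on {0..t}" for t
    by (rule measurable_bounded_by_integrable_imp_absolutely_integrable[OF restrict_measurable_Icc[OF m] _ i])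
      (auto intro: clin_bound \<xi>)
  then show l: "loc_int (\<lambda>s. \<xi> (u s))" by (simp add: loc_int_def)
  have "integral {0..t} (\<lambda>s. norm (\<xi> (u s))) \<le> integral {0..t} (\<lambda>s. onorm \<xi> * norm (u s))"
    by (intro integral_le i loc_int_normD[OF l]) (auto intro: clin_bound \<xi>)
  then show "integral {0..t} (\<lambda>s. norm (\<xi> (u s))) \<le> onorm \<xi> * L1_norm t u"
    by (simp add: L1_norm_def)
qed

lemma measurable_on_combination:
  assumes "finite P" "\<And>p. p \<in> P \<Longrightarrow> loc_int (f p)"
  shows "(\<lambda>t. \<Sum>p\<in>P. f p t *\<^sub>C v p) measurable_on {0..}"
proof (rule measurable_on_sum[OF assms(1)])
  fix p assume "p \<in> P"
  have "((\<lambda>z. z *\<^sub>C v p) \<circ> f p) measurable_on {0..}"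
    by (rule measurable_on_compose_continuous_0[OF loc_int_measurable[OF assms(2)[OF \<open>p \<in> P\<close>]]])
      (auto intro: continuous_intros)
  then show "(\<lambda>t. f p t *\<^sub>C v p) measurable_on {0..}" by (simp add: o_def)
qed

lemma norm_combination_le: "norm (\<Sum>p\<in>P. a p *\<^sub>C v p) \<le> (\<Sum>p\<in>P. norm (a p) * norm (v p))"
  using norm_sum[of "\<lambda>p. a p *\<^sub>C v p" P] by (simp add: norm_scaleC)

lemma L1_loc_combination:
  assumes P: "finite P" and f: "\<And>p. p \<in> P \<Longrightarrow> loc_int (f p)"
  shows "L1_loc (\<lambda>t. \<Sum>p\<in>P. f p t *\<^sub>C v p)"
    "L1_norm t (\<lambda>t. \<Sum>p\<in>P. f p t *\<^sub>C v p)
      \<le> (\<Sum>p\<in>P. integral {0..t} (\<lambda>s. norm (f p s)) * norm (v p))"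
proof -
  let ?F = "\<lambda>t. \<Sum>p\<in>P. f p t *\<^sub>C v p"
  have m: "?F measurable_on {0..}" by (rule measurable_on_combination[OF P f])
  have "(norm \<circ> ?F) measurable_on {0..}"
    by (rule measurable_on_compose_continuous_0[OF m]) (auto intro: continuous_intros)
  then have nm: "(\<lambda>t. norm (?F t)) measurable_on {0..}" by (simp add: o_def)
  have i: "(\<lambda>s. \<Sum>p\<in>P. norm (f p s) * norm (v p)) integrable_on {0..t}" for t
    by (intro integrable_sum P integrable_on_mult_left loc_int_normD f) auto
  have ni: "(\<lambda>s. norm (?F s)) integrable_on {0..t}" for t
    by (rule measurable_bounded_by_integrable_imp_integrable[OF restrict_measurable_Icc[OF nm] i])
      (auto intro: norm_combination_le)
  show "L1_loc ?F" using m ni by (simp add: L1_loc_def)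
  have "L1_norm t ?F \<le> integral {0..t} (\<lambda>s. \<Sum>p\<in>P. norm (f p s) * norm (v p))"
    unfolding L1_norm_def by (intro integral_le ni i norm_combination_le)
  also have "\<dots> = (\<Sum>p\<in>P. integral {0..t} (\<lambda>s. norm (f p s) * norm (v p)))"
    by (rule integral_sum[OF P]) (intro integrable_on_mult_left loc_int_normD f order_refl)
  finally show "L1_norm t ?F \<le> (\<Sum>p\<in>P. integral {0..t} (\<lambda>s. norm (f p s)) * norm (v p))"
    by simp
qed

text \<open>\<open>{0..t}\<close> is not a null set, so the essential supremum dominates the norm of
  some value and cannot be negative.\<close>

lemma Linf_normD:
  assumes t: "0 < t" and fin: "Linf_norm t f < \<infinity>"
  obtains K N where "0 \<le> K" "Linf_norm t f = ereal K" "negligible N"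
    "\<And>s. s \<in> {0..t} - N \<Longrightarrow> norm (f s) \<le> K"
proof -
  have "AE s in lebesgue_on {0..t}. ereal (norm (f s)) \<le> Linf_norm t f"
    unfolding Linf_norm_def by (rule esssup_AE)
  then obtain N where N: "negligible N \<and> (\<forall>s\<in>{0..t} - N. ereal (norm (f s)) \<le> Linf_norm t f)"
    unfolding AE_Icc_iff ..
  have "\<not> {0..t} \<subseteq> N"
    using N negligible_subset[of N "{0..t}"] negligible_interval(1)[of 0 t] t by auto
  then obtain s where "s \<in> {0..t} - N" by blast
  then have "ereal (norm (f s)) \<le> Linf_norm t f" using N by blast
  moreover have "0 \<le> ereal (norm (f s))" by simp
  ultimately have "0 \<le> Linf_norm t f" by (rule order_trans[rotated])
  with fin obtain K where K: "Linf_norm t f = ereal K" "0 \<le> K"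
    by (cases "Linf_norm t f") auto
  show ?thesis
    by (rule that[OF K(2,1), of N]) (use N K in auto)
qed

lemma Linf_normI:
  assumes m: "f measurable_on {0..}" and N: "negligible N"
    and K: "\<And>s. s \<in> {0..t} - N \<Longrightarrow> norm (f s) \<le> K"
  shows "Linf_norm t f \<le> ereal K"
proof -
  have "(norm \<circ> f) measurable_on {0..}"
    by (rule measurable_on_compose_continuous_0[OF m]) (auto intro: continuous_intros)
  then have [measurable]: "(\<lambda>s. norm (f s)) \<in> borel_measurable (lebesgue_on {0..t})"
    using restrict_measurable_Icc[of "\<lambda>s. norm (f s)"] by (simp add: o_def)
  have "AE s in lebesgue_on {0..t}. ereal (norm (f s)) \<le> ereal K"
    unfolding AE_Icc_iff using N K by (intro exI[of _ N]) auto
  then show ?thesis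
    unfolding Linf_norm_def by (intro esssup_I) auto
qed

text \<open>Off a null set the norm agrees with its truncation at \<open>K\<close>, which is
  measurable and bounded.\<close>

lemma Linf_loc_imp_L1_loc:
  assumes "Linf_loc f"
  shows "L1_loc f"
  unfolding L1_loc_def
proof (intro conjI allI impI)
  show m: "f measurable_on {0..}" using assms by (simp add: Linf_loc_def)
  fix t :: real assume t: "0 < t"
  then have "Linf_norm t f < \<infinity>" using assms by (simp add: Linf_loc_def)
  from Linf_normD[OF t this] obtain K N where K: "0 \<le> K" "negligible N"
    "\<And>s. s \<in> {0..t} - N \<Longrightarrow> norm (f s) \<le> K" by metis
  have "((\<lambda>x. min (norm x) K) \<circ> f) measurable_on {0..}"
    by (rule measurable_on_compose_continuous_0[OF m]) (use K(1) in \<open>auto intro!: continuous_intros\<close>)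
  then have "(\<lambda>s. min (norm (f s)) K) measurable_on {0..}" by (simp add: o_def)
  from restrict_measurable_Icc[OF this]
  have "(\<lambda>s. min (norm (f s)) K) integrable_on {0..t}"
    by (rule measurable_bounded_by_integrable_imp_integrable[where g = "\<lambda>_. K"])
      (use K(1) in \<open>auto simp: min_def\<close>)
  then show "(\<lambda>s. norm (f s)) integrable_on {0..t}"
    by (rule integrable_spike[OF _ K(2)]) (use K(3) in \<open>auto simp: min_absorb1\<close>)
qed

text \<open>Vector-valued counterpart of \<open>second_deriv\<close>; by
  \<open>regular_iff_vsd\<close> it says that the output distribution is the function
  \<open>f\<close>.\<close>

definition vsd :: "(real \<Rightarrow> 'y::complex_banach) \<Rightarrow> (real \<Rightarrow> 'y) \<Rightarrow> bool"
  where "vsd w f \<longleftrightarrow> (\<forall>\<phi>. test_function \<phi> \<longrightarrow>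
    integral {0..} (\<lambda>t. iter_deriv 2 \<phi> t *\<^sub>C w t) = integral {0..} (\<lambda>t. \<phi> t *\<^sub>C f t))"

lemma integrable_test_combination:
  assumes "continuous_on {0..R} \<phi>" "loc_int f"
  shows "(\<lambda>t. \<phi> t *\<^sub>C (f t *\<^sub>C v)) integrable_on {0..R}"
proof -
  have "(\<lambda>t. f t *\<^sub>C (\<phi> t *\<^sub>C v)) integrable_on {0..R}"
    by (rule integrable_scaleC_continuous[OF loc_int_absD[OF assms(2) order_refl]])
      (intro continuous_intros assms(1))
  then show ?thesis by (simp add: scaleC_scaleC mult.commute)
qed

lemma integral_scaleC_vector:
  assumes "f integrable_on S"
  shows "integral S (\<lambda>t. f t *\<^sub>C v) = integral S f *\<^sub>C v"
  using integral_linear[OF assms bounded_linear_scaleC_left[of v]] by (simp add: o_def)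

lemma vsd_combination:
  assumes P: "finite P" and w: "\<And>p. p \<in> P \<Longrightarrow> loc_int (w p)" and f: "\<And>p. p \<in> P \<Longrightarrow> loc_int (f p)"
    and sd: "\<And>p. p \<in> P \<Longrightarrow> second_deriv (w p) (f p)"
  shows "vsd (\<lambda>t. \<Sum>p\<in>P. w p t *\<^sub>C v p) (\<lambda>t. \<Sum>p\<in>P. f p t *\<^sub>C v p)"
  unfolding vsd_def
proof (intro allI impI)
  fix \<phi> assume \<phi>: "test_function \<phi>"
  obtain B where B: "\<And>n t. B < t \<Longrightarrow> iter_deriv n \<phi> t = 0"
    by (rule test_function_support[OF \<phi>]) (rule that)
  have gen: "integral {0..} (\<lambda>t. iter_deriv n \<phi> t *\<^sub>C (\<Sum>p\<in>P. g p t *\<^sub>C v p))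
      = (\<Sum>p\<in>P. integral {0..} (\<lambda>t. iter_deriv n \<phi> t * g p t) *\<^sub>C v p)"
    if g: "\<And>p. p \<in> P \<Longrightarrow> loc_int (g p)" for g n
  proof -
    have "integral {0..} (\<lambda>t. iter_deriv n \<phi> t *\<^sub>C (\<Sum>p\<in>P. g p t *\<^sub>C v p))
        = integral {0..B} (\<lambda>t. iter_deriv n \<phi> t *\<^sub>C (\<Sum>p\<in>P. g p t *\<^sub>C v p))"
      by (rule integral_support) (use B in auto)
    also have "\<dots> = integral {0..B} (\<lambda>t. \<Sum>p\<in>P. iter_deriv n \<phi> t *\<^sub>C (g p t *\<^sub>C v p))"
      by (simp only: cvec.scale_sum_right)
    also have "\<dots> = (\<Sum>p\<in>P. integral {0..B} (\<lambda>t. iter_deriv n \<phi> t *\<^sub>C (g p t *\<^sub>C v p)))"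
      by (rule integral_sum[OF P]) (intro integrable_test_combination continuous_on_iter_deriv \<phi> g)
    also have "\<dots> = (\<Sum>p\<in>P. integral {0..} (\<lambda>t. iter_deriv n \<phi> t * g p t) *\<^sub>C v p)"
    proof (rule sum.cong[OF refl])
      fix p assume p: "p \<in> P"
      have "(\<lambda>t. g p t *\<^sub>C iter_deriv n \<phi> t) integrable_on {0..B}"
        by (rule integrable_scaleC_continuous[OF loc_int_absD[OF g[OF p] order_refl]
              continuous_on_iter_deriv[OF \<phi>]])
      then have "(\<lambda>t. iter_deriv n \<phi> t * g p t) integrable_on {0..B}"
        by (simp add: scaleC_complex_def mult.commute)
      from integral_scaleC_vector[OF this, of "v p"]
      have "integral {0..B} (\<lambda>t. iter_deriv n \<phi> t *\<^sub>C (g p t *\<^sub>C v p))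
          = integral {0..B} (\<lambda>t. iter_deriv n \<phi> t * g p t) *\<^sub>C v p"
        by (simp only: scaleC_scaleC)
      also have "integral {0..B} (\<lambda>t. iter_deriv n \<phi> t * g p t) = integral {0..} (\<lambda>t. iter_deriv n \<phi> t * g p t)"
        by (rule integral_support[symmetric]) (use B in auto)
      finally show "integral {0..B} (\<lambda>t. iter_deriv n \<phi> t *\<^sub>C (g p t *\<^sub>C v p))
          = integral {0..} (\<lambda>t. iter_deriv n \<phi> t * g p t) *\<^sub>C v p" .
    qed
    finally show ?thesis .
  qed
  have "integral {0..} (\<lambda>t. iter_deriv 2 \<phi> t *\<^sub>C (\<Sum>p\<in>P. w p t *\<^sub>C v p))
      = (\<Sum>p\<in>P. integral {0..} (\<lambda>t. iter_deriv 2 \<phi> t * w p t) *\<^sub>C v p)"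
    by (rule gen[OF w])
  also have "\<dots> = (\<Sum>p\<in>P. integral {0..} (\<lambda>t. iter_deriv 0 \<phi> t * f p t) *\<^sub>C v p)"
    using sd \<phi> by (intro sum.cong refl) (simp add: second_deriv_def)
  also have "\<dots> = integral {0..} (\<lambda>t. iter_deriv 0 \<phi> t *\<^sub>C (\<Sum>p\<in>P. f p t *\<^sub>C v p))"
    by (rule gen[OF f, symmetric])
  finally show "integral {0..} (\<lambda>t. iter_deriv 2 \<phi> t *\<^sub>C (\<Sum>p\<in>P. w p t *\<^sub>C v p))
      = integral {0..} (\<lambda>t. \<phi> t *\<^sub>C (\<Sum>p\<in>P. f p t *\<^sub>C v p))" by simp
qed

text \<open>\<open>\<eta>\<close> may be pulled out of the integral once the integrand is
  integrable, and the frame expansion reduces integrability to scalar signals.\<close>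

lemma vsd_coord:
  fixes \<eta> :: "'y::complex_banach \<Rightarrow> complex" and e :: "'i \<Rightarrow> 'y"
  assumes fr: "frame J e \<xi>" and w: "L1_loc w" and f: "L1_loc f" and vs: "vsd w f" and \<eta>: "clin \<eta>"
  shows "second_deriv (\<lambda>t. \<eta> (w t)) (\<lambda>t. \<eta> (f t))"
  unfolding second_deriv_def
proof (intro allI impI)
  fix \<phi> assume \<phi>: "test_function \<phi>"
  obtain B where B: "\<And>n t. B < t \<Longrightarrow> iter_deriv n \<phi> t = 0"
    by (rule test_function_support[OF \<phi>]) (rule that)
  have gen: "integral {0..} (\<lambda>t. iter_deriv n \<phi> t * \<eta> (g t)) = \<eta> (integral {0..} (\<lambda>t. iter_deriv n \<phi> t *\<^sub>C g t))"
    if g: "L1_loc g" for g n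
  proof -
    have "(\<lambda>t. \<Sum>j\<in>J. iter_deriv n \<phi> t *\<^sub>C (\<xi> j (g t) *\<^sub>C e j)) integrable_on {0..B}"
      using fr by (intro integrable_sum integrable_test_combination continuous_on_iter_deriv \<phi> L1_loc_coord(1) g)
        (auto simp: frame_def)
    then have "(\<lambda>t. iter_deriv n \<phi> t *\<^sub>C (\<Sum>j\<in>J. \<xi> j (g t) *\<^sub>C e j)) integrable_on {0..B}"
      by (simp only: cvec.scale_sum_right)
    moreover have "(\<Sum>j\<in>J. \<xi> j (g t) *\<^sub>C e j) = g t" for t
      using fr by (simp add: frame_def)
    ultimately have i: "(\<lambda>t. iter_deriv n \<phi> t *\<^sub>C g t) integrable_on {0..B}" by simp
    have "integral {0..} (\<lambda>t. iter_deriv n \<phi> t * \<eta> (g t)) = integral {0..B} (\<lambda>t. iter_deriv n \<phi> t * \<eta> (g t))"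
      by (rule integral_support) (use B in auto)
    also have "\<dots> = integral {0..B} (\<eta> \<circ> (\<lambda>t. iter_deriv n \<phi> t *\<^sub>C g t))"
      by (simp add: o_def clin_scaleC[OF \<eta>] scaleC_complex_def)
    also have "\<dots> = \<eta> (integral {0..B} (\<lambda>t. iter_deriv n \<phi> t *\<^sub>C g t))"
      by (rule integral_linear[OF i clin_bl[OF \<eta>]])
    also have "integral {0..B} (\<lambda>t. iter_deriv n \<phi> t *\<^sub>C g t) = integral {0..} (\<lambda>t. iter_deriv n \<phi> t *\<^sub>C g t)"
      by (rule integral_support[symmetric]) (use B in auto)
    finally show ?thesis .
  qed
  have "integral {0..} (\<lambda>t. iter_deriv 2 \<phi> t *\<^sub>C w t) = integral {0..} (\<lambda>t. iter_deriv 0 \<phi> t *\<^sub>C f t)"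
    using vs \<phi> by (simp add: vsd_def)
  then have "integral {0..} (\<lambda>t. iter_deriv 2 \<phi> t * \<eta> (w t)) = integral {0..} (\<lambda>t. iter_deriv 0 \<phi> t * \<eta> (f t))"
    by (simp only: gen[OF w] gen[OF f])
  then show "integral {0..} (\<lambda>t. iter_deriv 2 \<phi> t * \<eta> (w t)) = integral {0..} (\<lambda>t. \<phi> t * \<eta> (f t))"
    by simp
qed

section \<open>Operator-valued kernels and their entries\<close>

definition kernel :: "(real \<Rightarrow> 'u::complex_banach \<Rightarrow> 'y::complex_banach) \<Rightarrow> bool"
  where "kernel K \<longleftrightarrow> (\<forall>t. clin (K t)) \<and> (\<forall>x. caus (\<lambda>t. K t x))"

definition opconv :: "(real \<Rightarrow> 'u::complex_banach \<Rightarrow> 'y::complex_banach) \<Rightarrow> (real \<Rightarrow> 'u) \<Rightarrow> real \<Rightarrow> 'y"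
  where "opconv K u t = integral {0..t} (\<lambda>s. K (t - s) (u s))"

text \<open>Stability with node, state and distribution eliminated; \<open>stable_iff\<close>
  translates back.\<close>

definition stab_inf :: "(real \<Rightarrow> 'u::complex_banach \<Rightarrow> 'y::complex_banach) \<Rightarrow> bool"
  where "stab_inf K \<longleftrightarrow> (\<exists>c>0. \<forall>u. L1_loc u \<and> Linf_loc u \<longrightarrow>
    (\<exists>f. vsd (opconv K u) f \<and> Linf_loc f \<and> (\<forall>t>0. Linf_norm t f \<le> ereal c * Linf_norm t u)))"

definition stab_one :: "(real \<Rightarrow> 'u::complex_banach \<Rightarrow> 'y::complex_banach) \<Rightarrow> bool"
  where "stab_one K \<longleftrightarrow> (\<exists>c>0. \<forall>u. L1_loc u \<longrightarrow>
    (\<exists>f. vsd (opconv K u) f \<and> L1_loc f \<and> (\<forall>t>0. L1_norm t f \<le> c * L1_norm t u)))"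

definition entry :: "(real \<Rightarrow> 'u \<Rightarrow> 'y) \<Rightarrow> 'u \<Rightarrow> ('y \<Rightarrow> complex) \<Rightarrow> real \<Rightarrow> complex"
  where "entry K e \<eta> t = \<eta> (K t e)"

lemma clin_sum: "clin F \<Longrightarrow> F (\<Sum>i\<in>I. f i) = (\<Sum>i\<in>I. F (f i))"
  by (rule linear_sum[OF bounded_linear.linear[OF clin_bl]])

lemma caus_clin: "clin \<eta> \<Longrightarrow> caus p \<Longrightarrow> caus (\<lambda>t. \<eta> (p t))"
  unfolding caus_def using clin_0 continuous_on_compose2[OF clin_continuous[of \<eta> UNIV]] by fastforce

lemma caus_entry: "kernel K \<Longrightarrow> clin \<eta> \<Longrightarrow> caus (entry K e \<eta>)"
  unfolding entry_def[abs_def] kernel_def by (rule caus_clin) auto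

lemma clin_conv:
  assumes "clin \<eta>" "caus k" "loc_int u"
  shows "\<eta> (conv k u t) = conv (\<lambda>s. \<eta> (k s)) u t"
  using integral_linear[OF conv_integrable[OF caus_cont[OF assms(2)] assms(3)] clin_bl[OF assms(1)], of t]
  by (simp add: conv_def o_def clin_scaleC[OF assms(1)])

lemma opconv_frame:
  fixes K :: "real \<Rightarrow> 'u::complex_banach \<Rightarrow> 'y::complex_banach" and e :: "'i \<Rightarrow> 'u"
  assumes K: "kernel K" and fr: "frame I e \<xi>" and u: "L1_loc u"
  shows "opconv K u t = (\<Sum>i\<in>I. conv (\<lambda>t. K t (e i)) (\<lambda>s. \<xi> i (u s)) t)"
proof -
  have "K r (u s) = (\<Sum>i\<in>I. \<xi> i (u s) *\<^sub>C K r (e i))" for r s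
  proof -
    have "K r (u s) = K r (\<Sum>i\<in>I. \<xi> i (u s) *\<^sub>C e i)" using fr by (simp add: frame_def)
    then show ?thesis using K by (simp add: kernel_def clin_sum clin_scaleC)
  qed
  then have "opconv K u t = integral {0..t} (\<lambda>s. \<Sum>i\<in>I. \<xi> i (u s) *\<^sub>C K (t - s) (e i))"
    by (simp add: opconv_def)
  also have "\<dots> = (\<Sum>i\<in>I. integral {0..t} (\<lambda>s. \<xi> i (u s) *\<^sub>C K (t - s) (e i)))"
  proof (rule integral_sum)
    show "finite I" using fr by (simp add: frame_def)
    fix i assume "i \<in> I"
    then have "loc_int (\<lambda>s. \<xi> i (u s))" using fr u by (intro L1_loc_coord(1)) (auto simp: frame_def)
    from conv_integrable[OF _ this, of "\<lambda>t. K t (e i)"]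
    show "(\<lambda>s. \<xi> i (u s) *\<^sub>C K (t - s) (e i)) integrable_on {0..t}"
      using K by (simp add: kernel_def caus_cont)
  qed
  finally show ?thesis by (simp add: conv_def)
qed

lemma opconv_frames:
  fixes K :: "real \<Rightarrow> 'u::complex_banach \<Rightarrow> 'y::complex_banach"
    and e :: "'i \<Rightarrow> 'u" and e' :: "'j \<Rightarrow> 'y"
  assumes K: "kernel K" and fr: "frame I e \<xi>" and fr': "frame J e' \<eta>" and u: "L1_loc u"
  shows "opconv K u t = (\<Sum>p\<in>I \<times> J.
    conv (entry K (e (fst p)) (\<eta> (snd p))) (\<lambda>s. \<xi> (fst p) (u s)) t *\<^sub>C e' (snd p))"
proof -
  have "conv (\<lambda>t. K t (e i)) (\<lambda>s. \<xi> i (u s)) t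
      = (\<Sum>j\<in>J. conv (entry K (e i) (\<eta> j)) (\<lambda>s. \<xi> i (u s)) t *\<^sub>C e' j)" if i: "i \<in> I" for i
  proof -
    let ?c = "conv (\<lambda>t. K t (e i)) (\<lambda>s. \<xi> i (u s)) t"
    have l: "loc_int (\<lambda>s. \<xi> i (u s))" using fr u i by (intro L1_loc_coord(1)) (auto simp: frame_def)
    have "\<eta> j ?c = conv (entry K (e i) (\<eta> j)) (\<lambda>s. \<xi> i (u s)) t" if "j \<in> J" for j
      unfolding entry_def[abs_def] using fr' K l that
      by (intro clin_conv) (auto simp: frame_def kernel_def)
    moreover have "?c = (\<Sum>j\<in>J. \<eta> j ?c *\<^sub>C e' j)" using fr' by (simp add: frame_def)
    ultimately show ?thesis by simp
  qed
  then show ?thesis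
    unfolding opconv_frame[OF K fr u] by (simp add: sum.cartesian_product split_def)
qed

lemma L1_loc_single:
  assumes "loc_int v"
  shows "L1_loc (\<lambda>s. v s *\<^sub>C x)" "L1_norm t (\<lambda>s. v s *\<^sub>C x) = integral {0..t} (\<lambda>s. norm (v s)) * norm x"
  using L1_loc_combination(1)[of "{()}" "\<lambda>_. v" "\<lambda>_. x"] assms by (simp_all add: L1_norm_def norm_scaleC)

lemma opconv_single:
  assumes "kernel K"
  shows "opconv K (\<lambda>s. v s *\<^sub>C x) t = conv (\<lambda>t. K t x) v t"
  using assms by (simp add: opconv_def conv_def kernel_def clin_scaleC)

lemma L1_loc_opconv:
  fixes K :: "real \<Rightarrow> 'u::complex_banach \<Rightarrow> 'y::complex_banach"
    and e :: "'i \<Rightarrow> 'u" and e' :: "'j \<Rightarrow> 'y"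
  assumes K: "kernel K" and fr: "frame I e \<xi>" and fr': "frame J e' \<eta>" and u: "L1_loc u"
  shows "L1_loc (opconv K u)"
proof -
  have "L1_loc (\<lambda>t. \<Sum>p\<in>I \<times> J.
      conv (entry K (e (fst p)) (\<eta> (snd p))) (\<lambda>s. \<xi> (fst p) (u s)) t *\<^sub>C e' (snd p))"
    using fr fr' K u
    by (intro L1_loc_combination(1) caus_loc_int caus_conv caus_cont caus_entry L1_loc_coord(1))
      (auto simp: frame_def)
  then show ?thesis unfolding opconv_frames[OF K fr fr' u, abs_def] .
qed

text \<open>A scalar signal in the fixed direction \<open>x\<close>, observed through one output
  coordinate, sees exactly the scalar convolution with the entry.\<close>

lemma stab_inf_imp_bv2:
  fixes K :: "real \<Rightarrow> 'u::complex_banach \<Rightarrow> 'y::complex_banach"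
    and e :: "'i \<Rightarrow> 'u" and e' :: "'j \<Rightarrow> 'y"
  assumes K: "kernel K" and fr: "frame I e \<xi>" and fr': "frame J e' \<eta>" and st: "stab_inf K" and j: "j \<in> J"
  shows "\<exists>c. bv2 (entry K x (\<eta> j)) c"
proof -
  have \<eta>: "clin (\<eta> j)" using fr' j by (simp add: frame_def)
  obtain c where c: "0 < c" and "\<forall>u. L1_loc u \<and> Linf_loc u \<longrightarrow>
      (\<exists>f. vsd (opconv K u) f \<and> Linf_loc f \<and> (\<forall>t>0. Linf_norm t f \<le> ereal c * Linf_norm t u))"
    using st unfolding stab_inf_def by (elim exE conjE) (rule that)
  note st = mp[OF spec[OF this(2)]]
  define c' where "c' = onorm (\<eta> j) * (c * norm x)"
  have "bv2 (entry K x (\<eta> j)) c'"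
  proof (rule bv2_of_Linf[OF caus_entry[OF K \<eta>]])
    show "0 \<le> c'" using c clin_onorm_pos[OF \<eta>] by (simp add: c'_def)
    fix v :: "real \<Rightarrow> complex"
    assume vc: "continuous_on UNIV v" and v1: "\<And>s. norm (v s) \<le> 1"
    have v: "loc_int v" unfolding loc_int_def
      by (intro allI absolutely_integrable_continuous_real continuous_on_subset[OF vc]) auto
    define u where "u s = v s *\<^sub>C x" for s
    have u: "L1_loc u" unfolding u_def by (rule L1_loc_single[OF v])
    have un: "Linf_norm t u \<le> ereal (norm x)" for t
    proof (rule Linf_normI[OF _ negligible_empty])
      show "u measurable_on {0..}" using u by (simp add: L1_loc_def)
      show "norm (u s) \<le> norm x" for s
        using mult_right_mono[OF v1[of s], of "norm x"] by (simp add: u_def norm_scaleC)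
    qed
    have "Linf_norm t u < \<infinity>" for t
      using un[of t] by (rule le_less_trans) simp
    then have "Linf_loc u"
      using u by (simp add: Linf_loc_def L1_loc_def)
    with u have "L1_loc u \<and> Linf_loc u" by simp
    from st[OF this] obtain f where "vsd (opconv K u) f \<and> Linf_loc f \<and>
      (\<forall>t>0. Linf_norm t f \<le> ereal c * Linf_norm t u)" ..
    then have f: "vsd (opconv K u) f" "Linf_loc f"
      "\<And>t. 0 < t \<Longrightarrow> Linf_norm t f \<le> ereal c * Linf_norm t u" by simp_all
    have fl: "L1_loc f" by (rule Linf_loc_imp_L1_loc[OF f(2)])
    have "\<exists>N. negligible N \<and> (\<forall>s\<in>{0..T} - N. norm (\<eta> j (f s)) \<le> c')" for T
    proof -
      \<comment> \<open>\<open>T\<close> is arbitrary, whereas the stability estimate speaks of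
        positive times.\<close>
      define t where "t = max T 1"
      have t: "0 < t" by (simp add: t_def)
      have le: "Linf_norm t f \<le> ereal (c * norm x)"
        using order_trans[OF f(3)[OF t] ereal_mult_left_mono[OF un[of t], of "ereal c"]] c by simp
      then have "Linf_norm t f < \<infinity>" by (auto intro: le_less_trans)
      from Linf_normD[OF t this] obtain k N where kN: "Linf_norm t f = ereal k" "negligible N"
        "\<And>s. s \<in> {0..t} - N \<Longrightarrow> norm (f s) \<le> k" by metis
      have "norm (\<eta> j (f s)) \<le> c'" if "s \<in> {0..T} - N" for s
      proof -
        have "s \<in> {0..t} - N" using that by (auto simp: t_def)
        moreover have "k \<le> c * norm x" using le kN(1) by simp
        ultimately have "norm (f s) \<le> c * norm x" using kN(3) order_trans by blast
        then have "onorm (\<eta> j) * norm (f s) \<le> c'"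
          unfolding c'_def by (intro mult_left_mono clin_onorm_pos[OF \<eta>])
        with clin_bound[OF \<eta>, of "f s"] show ?thesis by (rule order_trans)
      qed
      then show ?thesis using kN(2) by (intro exI[of _ N]) auto
    qed
    moreover have "second_deriv (conv (entry K x (\<eta> j)) v) (\<lambda>t. \<eta> j (f t))"
    proof -
      have "second_deriv (\<lambda>t. \<eta> j (opconv K u t)) (\<lambda>t. \<eta> j (f t))"
        by (rule vsd_coord[OF fr' L1_loc_opconv[OF K fr fr' u] fl f(1) \<eta>])
      moreover have "\<eta> j (opconv K u t) = conv (entry K x (\<eta> j)) v t" for t
        unfolding u_def opconv_single[OF K] entry_def[abs_def]
        using K by (intro clin_conv \<eta> v) (simp add: kernel_def)
      ultimately show ?thesis by simp
    qed
    ultimately show "\<exists>g. loc_int g \<and> (\<forall>T. \<exists>N. negligible N \<and> (\<forall>s\<in>{0..T} - N. norm (g s) \<le> c')) \<and>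
        second_deriv (conv (entry K x (\<eta> j)) v) g"
      using L1_loc_coord(1)[OF \<eta> fl] by (intro exI[of _ "\<lambda>t. \<eta> j (f t)"]) simp
  qed
  then show ?thesis ..
qed

lemma stab_one_imp_bv2:
  fixes K :: "real \<Rightarrow> 'u::complex_banach \<Rightarrow> 'y::complex_banach"
    and e :: "'i \<Rightarrow> 'u" and e' :: "'j \<Rightarrow> 'y"
  assumes K: "kernel K" and fr: "frame I e \<xi>" and fr': "frame J e' \<eta>" and st: "stab_one K" and j: "j \<in> J"
  shows "\<exists>c. bv2 (entry K x (\<eta> j)) c"
proof -
  have \<eta>: "clin (\<eta> j)" using fr' j by (simp add: frame_def)
  obtain c where c: "0 < c" and "\<forall>u. L1_loc u \<longrightarrow>
      (\<exists>f. vsd (opconv K u) f \<and> L1_loc f \<and> (\<forall>t>0. L1_norm t f \<le> c * L1_norm t u))"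
    using st unfolding stab_one_def by (elim exE conjE) (rule that)
  note st = mp[OF spec[OF this(2)]]
  define c' where "c' = onorm (\<eta> j) * (c * norm x)"
  have "bv2 (entry K x (\<eta> j)) c'"
  proof (rule bv2_of_L1[OF caus_entry[OF K \<eta>]])
    fix v :: "real \<Rightarrow> complex"
    assume vc: "caus v" and v1: "\<And>T. integral {0..T} (\<lambda>s. norm (v s)) \<le> 1"
    note v = caus_loc_int[OF vc]
    define u where "u s = v s *\<^sub>C x" for s
    have u: "L1_loc u" unfolding u_def by (rule L1_loc_single[OF v])
    from st[OF u] obtain f where "vsd (opconv K u) f \<and> L1_loc f \<and>
      (\<forall>t>0. L1_norm t f \<le> c * L1_norm t u)" ..
    then have f: "vsd (opconv K u) f" "L1_loc f"
      "\<And>t. 0 < t \<Longrightarrow> L1_norm t f \<le> c * L1_norm t u" by simp_all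
    note l = L1_loc_coord(1)[OF \<eta> f(2)]
    have "integral {0..T} (\<lambda>s. norm (\<eta> j (f s))) \<le> c'" for T
    proof -
      define t where "t = max T 1"
      have t: "0 < t" by (simp add: t_def)
      have "integral {0..T} (\<lambda>s. norm (\<eta> j (f s))) \<le> integral {0..t} (\<lambda>s. norm (\<eta> j (f s)))"
        by (rule integral_subset_le[OF _ loc_int_normD[OF l order_refl] loc_int_normD[OF l order_refl]])
          (auto simp: t_def)
      also have "\<dots> \<le> onorm (\<eta> j) * L1_norm t f" by (rule L1_loc_coord(2)[OF \<eta> f(2)])
      also have "\<dots> \<le> c'"
      proof -
        have "L1_norm t u \<le> norm x"
          unfolding u_def L1_loc_single(2)[OF v] using mult_right_mono[OF v1[of t], of "norm x"] by simp
        then have "L1_norm t f \<le> c * norm x"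
          using order_trans[OF f(3)[OF t] mult_left_mono[of "L1_norm t u" "norm x" c]] c by simp
        then show ?thesis unfolding c'_def by (intro mult_left_mono clin_onorm_pos[OF \<eta>])
      qed
      finally show ?thesis .
    qed
    moreover have "second_deriv (conv (entry K x (\<eta> j)) v) (\<lambda>t. \<eta> j (f t))"
    proof -
      have "second_deriv (\<lambda>t. \<eta> j (opconv K u t)) (\<lambda>t. \<eta> j (f t))"
        by (rule vsd_coord[OF fr' L1_loc_opconv[OF K fr fr' u] f(2,1) \<eta>])
      moreover have "\<eta> j (opconv K u t) = conv (entry K x (\<eta> j)) v t" for t
        unfolding u_def opconv_single[OF K] entry_def[abs_def]
        using K by (intro clin_conv \<eta> v) (simp add: kernel_def)
      ultimately show ?thesis by simp
    qed
    ultimately show "\<exists>g. loc_int g \<and> (\<forall>T. integral {0..T} (\<lambda>s. norm (g s)) \<le> c') \<and>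
        second_deriv (conv (entry K x (\<eta> j)) v) g"
      using l by (intro exI[of _ "\<lambda>t. \<eta> j (f t)"]) simp
  qed
  then show ?thesis ..
qed

text \<open>Assembles the output from scalar second derivatives of the entries. One \<open>f\<close>
  carries both estimates, hence the joint statement.\<close>

lemma bv2_imp_second_derivative:
  fixes K :: "real \<Rightarrow> 'u::complex_banach \<Rightarrow> 'y::complex_banach"
    and e :: "'i \<Rightarrow> 'u" and e' :: "'j \<Rightarrow> 'y"
  assumes K: "kernel K" and fr: "frame I e \<xi>" and fr': "frame J e' \<eta>"
    and bv: "\<And>i j. i \<in> I \<Longrightarrow> j \<in> J \<Longrightarrow> \<exists>c. bv2 (entry K (e i) (\<eta> j)) c"
  obtains c where "0 < c" "\<And>u. L1_loc u \<Longrightarrow> \<exists>f. vsd (opconv K u) f \<and> L1_loc f \<and>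
    (\<forall>t. L1_norm t f \<le> c * L1_norm t u) \<and>
    (\<forall>t k N. 0 \<le> k \<longrightarrow> negligible N \<longrightarrow> (\<forall>s\<in>{0..t} - N. norm (u s) \<le> k) \<longrightarrow>
      (\<exists>N. negligible N \<and> (\<forall>s\<in>{0..t} - N. norm (f s) \<le> c * k)))"
proof -
  let ?P = "I \<times> J"
  have P: "finite ?P" using fr fr' by (simp add: frame_def)
  define \<psi> where "\<psi> p = entry K (e (fst p)) (\<eta> (snd p))" for p
  have \<psi>: "caus (\<psi> p)" if "p \<in> ?P" for p
    unfolding \<psi>_def using that fr' K by (intro caus_entry) (auto simp: frame_def)
  have "\<forall>p. \<exists>c. p \<in> ?P \<longrightarrow> bv2 (\<psi> p) c"
    unfolding \<psi>_def using bv by auto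
  from choice[OF this] obtain C where "\<forall>p. p \<in> ?P \<longrightarrow> bv2 (\<psi> p) (C p)" ..
  then have C: "bv2 (\<psi> p) (C p)" if "p \<in> ?P" for p using that by blast
  have C0: "0 \<le> C p" if "p \<in> ?P" for p by (rule bv2_nonneg[OF C[OF that]])
  have \<xi>: "clin (\<xi> (fst p))" if "p \<in> ?P" for p using that fr by (auto simp: frame_def)
  define c0 where "c0 = (\<Sum>p\<in>?P. C p * onorm (\<xi> (fst p)) * norm (e' (snd p)))"
  have c0: "0 \<le> c0"
    unfolding c0_def by (intro sum_nonneg mult_nonneg_nonneg C0 clin_onorm_pos \<xi>) auto
  \<comment> \<open>Adding 1 keeps the constant positive when \<open>c0\<close> is 0.\<close>
  define c where "c = c0 + 1"
  have "\<exists>f. vsd (opconv K u) f \<and> L1_loc f \<and> (\<forall>t. L1_norm t f \<le> c * L1_norm t u) \<and>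
      (\<forall>t k N. 0 \<le> k \<longrightarrow> negligible N \<longrightarrow> (\<forall>s\<in>{0..t} - N. norm (u s) \<le> k) \<longrightarrow>
        (\<exists>N. negligible N \<and> (\<forall>s\<in>{0..t} - N. norm (f s) \<le> c * k)))"
    if u: "L1_loc u" for u
  proof -
    define v where "v p s = \<xi> (fst p) (u s)" for p :: "'i \<times> 'j" and s
    have v: "loc_int (v p)" "integral {0..t} (\<lambda>s. norm (v p s)) \<le> onorm (\<xi> (fst p)) * L1_norm t u"
      if "p \<in> ?P" for p t
      unfolding v_def using L1_loc_coord[OF \<xi>[OF that] u] by auto
    \<comment> \<open>Bundles what is known about a scalar second derivative, so that one can be
      chosen for each entry.\<close>
    define good where "good p g \<longleftrightarrow> loc_int g \<and> second_deriv (conv (\<psi> p) (v p)) g \<and>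
      (\<forall>T. integral {0..T} (\<lambda>t. norm (g t)) \<le> C p * integral {0..T} (\<lambda>t. norm (v p t))) \<and>
      (\<forall>T k N. 0 \<le> k \<longrightarrow> negligible N \<longrightarrow> (\<forall>s\<in>{0..T} - N. norm (v p s) \<le> k) \<longrightarrow>
        (\<exists>N. negligible N \<and> (\<forall>s\<in>{0..T} - N. norm (g s) \<le> C p * k)))" for p g
    have "\<exists>g. good p g" if p: "p \<in> ?P" for p
    proof (rule bv2_second_derivative[OF \<psi>[OF p] C[OF p] v(1)[OF p]])
      fix g assume g: "loc_int g"
        "\<And>T. integral {0..T} (\<lambda>t. norm (g t)) \<le> C p * integral {0..T} (\<lambda>t. norm (v p t))"
        "\<And>T K N. negligible N \<Longrightarrow> (\<And>s. s \<in> {0..T} - N \<Longrightarrow> norm (v p s) \<le> K) \<Longrightarrow> 0 \<le> K \<Longrightarrow>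
          \<exists>N. negligible N \<and> (\<forall>s\<in>{0..T} - N. norm (g s) \<le> C p * K)"
        "\<And>(\<rho>::real \<Rightarrow> complex) R. caus \<rho> \<Longrightarrow> conv (int0 (int0 \<rho>)) g R = conv \<rho> (conv (\<psi> p) (v p)) R"
      have "second_deriv (conv (\<psi> p) (v p)) g"
        by (rule second_derivI[OF caus_conv[OF caus_cont[OF \<psi>[OF p]] v(1)[OF p]] g(1) g(4)])
      then show ?thesis
        unfolding good_def using g(1-3) by (intro exI[of _ g] conjI allI impI) simp_all
    qed
    then have "\<forall>p. \<exists>g. p \<in> ?P \<longrightarrow> good p g" by blast
    from choice[OF this] obtain G where "\<forall>p. p \<in> ?P \<longrightarrow> good p (G p)" ..
    then have good: "good p (G p)" if "p \<in> ?P" for p using that by blast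
    then have G: "loc_int (G p)" if "p \<in> ?P" for p using that by (simp add: good_def)
    define f where "f t = (\<Sum>p\<in>?P. G p t *\<^sub>C e' (snd p))" for t
    have "vsd (\<lambda>t. \<Sum>p\<in>?P. conv (\<psi> p) (v p) t *\<^sub>C e' (snd p)) f"
      unfolding f_def
    proof (rule vsd_combination[OF P])
      show "loc_int (conv (\<psi> p) (v p))" if "p \<in> ?P" for p
        by (intro caus_loc_int caus_conv caus_cont \<psi> v(1) that)
      show "second_deriv (conv (\<psi> p) (v p)) (G p)" if "p \<in> ?P" for p
        using good[OF that] by (simp add: good_def)
    qed (rule G)
    then have 1: "vsd (opconv K u) f"
      unfolding opconv_frames[OF K fr fr' u, abs_def] \<psi>_def v_def .
    have 2: "L1_loc f" unfolding f_def by (rule L1_loc_combination(1)[OF P G])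
    have 3: "L1_norm t f \<le> c * L1_norm t u" for t
    proof -
      have U0: "0 \<le> L1_norm t u"
        unfolding L1_norm_def by (rule integral_nonneg[OF L1_loc_norm_integrable[OF u]]) simp
      have "L1_norm t f \<le> (\<Sum>p\<in>?P. integral {0..t} (\<lambda>s. norm (G p s)) * norm (e' (snd p)))"
        unfolding f_def by (rule L1_loc_combination(2)[OF P G])
      also have "\<dots> \<le> (\<Sum>p\<in>?P. C p * onorm (\<xi> (fst p)) * norm (e' (snd p)) * L1_norm t u)"
      proof (rule sum_mono)
        fix p assume p: "p \<in> ?P"
        have "integral {0..t} (\<lambda>s. norm (G p s)) \<le> C p * integral {0..t} (\<lambda>s. norm (v p s))"
          using good[OF p] by (simp add: good_def)
        also have "\<dots> \<le> C p * (onorm (\<xi> (fst p)) * L1_norm t u)"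
          by (intro mult_left_mono v(2) p C0)
        finally have "integral {0..t} (\<lambda>s. norm (G p s)) * norm (e' (snd p))
            \<le> C p * (onorm (\<xi> (fst p)) * L1_norm t u) * norm (e' (snd p))"
          by (rule mult_right_mono) simp
        then show "integral {0..t} (\<lambda>s. norm (G p s)) * norm (e' (snd p))
            \<le> C p * onorm (\<xi> (fst p)) * norm (e' (snd p)) * L1_norm t u"
          by (simp only: mult_ac)
      qed
      also have "\<dots> = c0 * L1_norm t u" by (simp add: c0_def sum_distrib_right)
      also have "\<dots> \<le> c * L1_norm t u" by (intro mult_right_mono U0) (simp add: c_def)
      finally show ?thesis .
    qed
    have 4: "\<exists>N. negligible N \<and> (\<forall>s\<in>{0..t} - N. norm (f s) \<le> c * k)"
      if k: "0 \<le> k" and N: "negligible N" and uk: "\<forall>s\<in>{0..t} - N. norm (u s) \<le> k" for t k N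
    proof -
      have "\<forall>p. \<exists>M. p \<in> ?P \<longrightarrow> negligible M \<and> (\<forall>s\<in>{0..t} - M. norm (G p s) \<le> C p * (onorm (\<xi> (fst p)) * k))"
      proof (intro allI)
        fix p
        show "\<exists>M. p \<in> ?P \<longrightarrow> negligible M \<and> (\<forall>s\<in>{0..t} - M. norm (G p s) \<le> C p * (onorm (\<xi> (fst p)) * k))"
        proof (cases "p \<in> ?P")
          case True
          have o: "0 \<le> onorm (\<xi> (fst p))" by (rule clin_onorm_pos[OF \<xi>[OF True]])
          have "norm (v p s) \<le> onorm (\<xi> (fst p)) * k" if "s \<in> {0..t} - N" for s
          proof -
            have "norm (v p s) \<le> onorm (\<xi> (fst p)) * norm (u s)"
              unfolding v_def by (rule clin_bound[OF \<xi>[OF True]])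
            also have "\<dots> \<le> onorm (\<xi> (fst p)) * k" using uk that o by (intro mult_left_mono) auto
            finally show ?thesis .
          qed
          then have "\<exists>M. negligible M \<and> (\<forall>s\<in>{0..t} - M. norm (G p s) \<le> C p * (onorm (\<xi> (fst p)) * k))"
            using good[OF True] N mult_nonneg_nonneg[OF o k] unfolding good_def by simp
          then show ?thesis by blast
        qed simp
      qed
      from choice[OF this] obtain M where M: "\<forall>p. p \<in> ?P \<longrightarrow> negligible (M p) \<and>
        (\<forall>s\<in>{0..t} - M p. norm (G p s) \<le> C p * (onorm (\<xi> (fst p)) * k))" ..
      have "norm (f s) \<le> c * k" if s: "s \<in> {0..t} - (\<Union>p\<in>?P. M p)" for s
      proof -
        have "norm (f s) \<le> (\<Sum>p\<in>?P. norm (G p s) * norm (e' (snd p)))"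
          unfolding f_def by (rule norm_combination_le)
        also have "\<dots> \<le> (\<Sum>p\<in>?P. C p * (onorm (\<xi> (fst p)) * k) * norm (e' (snd p)))"
          using M s by (intro sum_mono mult_right_mono) auto
        also have "\<dots> = c0 * k"
          unfolding c0_def sum_distrib_right by (intro sum.cong refl) (simp add: mult_ac)
        also have "\<dots> \<le> c * k" by (intro mult_right_mono k) (simp add: c_def)
        finally show ?thesis .
      qed
      moreover have "negligible (\<Union>p\<in>?P. M p)"
        using M by (intro negligible_Union finite_imageI P) auto
      ultimately show ?thesis by (intro exI[of _ "\<Union>p\<in>?P. M p"]) auto
    qed
    from 1 2 3 4 show ?thesis by (intro exI[of _ f] conjI allI impI)
  qed
  then show ?thesis using c0 by (intro that[of c]) (auto simp: c_def)
qed

lemma bv2_imp_stab: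
  fixes K :: "real \<Rightarrow> 'u::complex_banach \<Rightarrow> 'y::complex_banach"
    and e :: "'i \<Rightarrow> 'u" and e' :: "'j \<Rightarrow> 'y"
  assumes K: "kernel K" and fr: "frame I e \<xi>" and fr': "frame J e' \<eta>"
    and bv: "\<And>i j. i \<in> I \<Longrightarrow> j \<in> J \<Longrightarrow> \<exists>c. bv2 (entry K (e i) (\<eta> j)) c"
  shows "stab_inf K" "stab_one K"
proof -
  obtain c where c: "0 < c" and ex: "\<And>u. L1_loc u \<Longrightarrow> \<exists>f. vsd (opconv K u) f \<and> L1_loc f \<and>
    (\<forall>t. L1_norm t f \<le> c * L1_norm t u) \<and>
    (\<forall>t k N. 0 \<le> k \<longrightarrow> negligible N \<longrightarrow> (\<forall>s\<in>{0..t} - N. norm (u s) \<le> k) \<longrightarrow>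
      (\<exists>N. negligible N \<and> (\<forall>s\<in>{0..t} - N. norm (f s) \<le> c * k)))"
    by (rule bv2_imp_second_derivative[OF K fr fr']) (rule bv, assumption+, rule that)
  show "stab_one K"
    unfolding stab_one_def
  proof (intro exI[of _ c] conjI c allI impI)
    fix u :: "real \<Rightarrow> 'u" assume "L1_loc u"
    from ex[OF this] show "\<exists>f. vsd (opconv K u) f \<and> L1_loc f \<and> (\<forall>t>0. L1_norm t f \<le> c * L1_norm t u)"
      by (elim exE conjE) (intro exI conjI allI impI, assumption+, simp)
  qed
  show "stab_inf K"
    unfolding stab_inf_def
  proof (intro exI[of _ c] conjI c allI impI)
    fix u :: "real \<Rightarrow> 'u" assume u: "L1_loc u \<and> Linf_loc u"
    from ex[OF conjunct1[OF u]] obtain f where f: "vsd (opconv K u) f \<and> L1_loc f \<and>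
      (\<forall>t. L1_norm t f \<le> c * L1_norm t u) \<and>
      (\<forall>t k N. 0 \<le> k \<longrightarrow> negligible N \<longrightarrow> (\<forall>s\<in>{0..t} - N. norm (u s) \<le> k) \<longrightarrow>
        (\<exists>N. negligible N \<and> (\<forall>s\<in>{0..t} - N. norm (f s) \<le> c * k)))" ..
    have m: "f measurable_on {0..}" using f by (simp add: L1_loc_def)
    have le: "Linf_norm t f \<le> ereal c * Linf_norm t u" "Linf_norm t f < \<infinity>" if t: "0 < t" for t
    proof -
      have "Linf_norm t u < \<infinity>" using u t by (simp add: Linf_loc_def)
      from Linf_normD[OF t this] obtain k N where k: "0 \<le> k" "Linf_norm t u = ereal k" "negligible N"
        "\<And>s. s \<in> {0..t} - N \<Longrightarrow> norm (u s) \<le> k" by metis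
      then have "\<exists>N. negligible N \<and> (\<forall>s\<in>{0..t} - N. norm (f s) \<le> c * k)"
        using f by simp
      then obtain N' where "negligible N' \<and> (\<forall>s\<in>{0..t} - N'. norm (f s) \<le> c * k)" ..
      then have "Linf_norm t f \<le> ereal (c * k)"
        by (intro Linf_normI[OF m, of N']) auto
      then show "Linf_norm t f \<le> ereal c * Linf_norm t u" "Linf_norm t f < \<infinity>"
        by (auto simp: k(2) intro: le_less_trans)
    qed
    then show "\<exists>f. vsd (opconv K u) f \<and> Linf_loc f \<and> (\<forall>t>0. Linf_norm t f \<le> ereal c * Linf_norm t u)"
      using f m by (intro exI[of _ f]) (simp add: Linf_loc_def)
  qed
qed

lemma stab_iff_bv2:
  fixes K :: "real \<Rightarrow> 'u::complex_banach \<Rightarrow> 'y::complex_banach"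
    and e :: "'i \<Rightarrow> 'u" and e' :: "'j \<Rightarrow> 'y"
  assumes "kernel K" "frame I e \<xi>" "frame J e' \<eta>"
  shows "stab_inf K \<longleftrightarrow> (\<forall>i\<in>I. \<forall>j\<in>J. \<exists>c. bv2 (entry K (e i) (\<eta> j)) c)"
    "stab_one K \<longleftrightarrow> (\<forall>i\<in>I. \<forall>j\<in>J. \<exists>c. bv2 (entry K (e i) (\<eta> j)) c)"
proof -
  show "stab_inf K \<longleftrightarrow> (\<forall>i\<in>I. \<forall>j\<in>J. \<exists>c. bv2 (entry K (e i) (\<eta> j)) c)"
    using stab_inf_imp_bv2[OF assms] bv2_imp_stab(1)[OF assms] by (intro iffI ballI) simp_all
  show "stab_one K \<longleftrightarrow> (\<forall>i\<in>I. \<forall>j\<in>J. \<exists>c. bv2 (entry K (e i) (\<eta> j)) c)"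
    using stab_one_imp_bv2[OF assms] bv2_imp_stab(2)[OF assms] by (intro iffI ballI) simp_all
qed

lemma bv2_cnj: "bv2 (\<lambda>t. cnj (\<psi> t)) = bv2 \<psi>"
proof -
  have "sd h (\<lambda>t. cnj (\<psi> t)) t = cnj (sd h \<psi> t)" for h t
    by (simp add: sd_def complex_cnj_scaleR)
  then show ?thesis by (simp add: bv2_def fun_eq_iff)
qed

lemma stab_inf_iff_stab_one:
  fixes K :: "real \<Rightarrow> 'u::complex_banach \<Rightarrow> 'y::complex_banach"
  assumes K: "kernel K" and U: "finite_dimensional TYPE('u)" and Y: "finite_dimensional TYPE('y)"
  shows "stab_inf K \<longleftrightarrow> stab_one K"
proof -
  obtain I :: "'u set" and e :: "'u \<Rightarrow> 'u" and \<xi> where fr: "frame I e \<xi>"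
    by (rule finite_dimensional_frame[OF U]) (rule that)
  obtain J :: "'y set" and e' :: "'y \<Rightarrow> 'y" and \<eta> where fr': "frame J e' \<eta>"
    by (rule finite_dimensional_frame[OF Y]) (rule that)
  show ?thesis unfolding stab_iff_bv2[OF K fr fr'] ..
qed

text \<open>In the dual frames the entries of \<open>K'\<close> are the conjugates of the transposed
  entries of \<open>K\<close>, and \<open>bv2\<close> does not distinguish a kernel from its
  conjugate.\<close>

lemma stab_adjoint_kernel:
  fixes K :: "real \<Rightarrow> 'u::complex_banach \<Rightarrow> 'y::complex_banach"
  assumes K: "kernel K" and K': "kernel K'" and U: "finite_dimensional TYPE('u)" and Y: "finite_dimensional TYPE('y)"
    and dual: "\<And>t f x. antidual_apply (K' t f) x = antidual_apply f (K t x)"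
  shows "stab_inf K \<longleftrightarrow> stab_inf K'" "stab_inf K \<longleftrightarrow> stab_one K'"
proof -
  obtain I :: "'u set" and e :: "'u \<Rightarrow> 'u" and \<xi> where fr: "frame I e \<xi>"
    by (rule finite_dimensional_frame[OF U]) (rule that)
  obtain J :: "'y set" and e' :: "'y \<Rightarrow> 'y" and \<eta> where fr': "frame J e' \<eta>"
    by (rule finite_dimensional_frame[OF Y]) (rule that)
  have "entry K' (conj_functional (\<eta> j)) (\<lambda>f. antidual_apply f (e i)) = (\<lambda>t. cnj (entry K (e i) (\<eta> j) t))"
    if "j \<in> J" for i j
    using fr' that by (simp add: entry_def[abs_def] dual conj_functional_apply frame_def)
  then have "stab_inf K' \<longleftrightarrow> (\<forall>j\<in>J. \<forall>i\<in>I. \<exists>c. bv2 (entry K (e i) (\<eta> j)) c)"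
    "stab_one K' \<longleftrightarrow> (\<forall>j\<in>J. \<forall>i\<in>I. \<exists>c. bv2 (entry K (e i) (\<eta> j)) c)"
    unfolding stab_iff_bv2[OF K' frame_antidual[OF fr'] frame_antidual[OF fr]]
    by (simp_all add: bv2_cnj)
  then show "stab_inf K \<longleftrightarrow> stab_inf K'" "stab_inf K \<longleftrightarrow> stab_one K'"
    unfolding stab_iff_bv2[OF K fr fr'] by blast+
qed

section \<open>The Hahn-Banach theorem and the uniform boundedness principle\<close>

text \<open>Homogeneity as an inequality passes to infima; equality is recovered in
  \<open>sublinear_scale\<close>.\<close>

definition sublinear :: "('a::real_vector \<Rightarrow> real) \<Rightarrow> bool"
  where "sublinear p \<longleftrightarrow> (\<forall>x y. p (x + y) \<le> p x + p y) \<and> (\<forall>t x. 0 < t \<longrightarrow> p (t *\<^sub>R x) \<le> t * p x)"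

lemma sublinear_add: "sublinear p \<Longrightarrow> p (x + y) \<le> p x + p y"
  by (simp add: sublinear_def)

lemma sublinear_scale: "sublinear p \<Longrightarrow> 0 \<le> t \<Longrightarrow> p (t *\<^sub>R x) = t * p x"
proof -
  assume p: "sublinear p" and t: "0 \<le> t"
  have le: "p (t *\<^sub>R x) \<le> t * p x" if "0 < t" for t x using p that by (simp add: sublinear_def)
  show ?thesis
  proof (cases "t = 0")
    case True
    have "p 0 \<le> 2 * p 0" "p 0 \<le> (1 / 2) * p 0" using le[of 2 0] le[of "1 / 2" 0] by simp_all
    then show ?thesis using True by simp
  next
    case False
    then have t: "0 < t" using t by simp
    have "p x = p (inverse t *\<^sub>R (t *\<^sub>R x))" using t by simp
    also have "\<dots> \<le> inverse t * p (t *\<^sub>R x)" using t by (intro le) simp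
    finally have "t * p x \<le> p (t *\<^sub>R x)" using t by (simp add: field_simps)
    with le[OF t, of x] show ?thesis by (rule antisym)
  qed
qed

lemma sublinear_minus: "sublinear p \<Longrightarrow> - p (- x) \<le> p x"
  using sublinear_add[of p x "- x"] sublinear_scale[of p 0 0] by simp

text \<open>The largest sublinear function below \<open>p\<close> that is additive in the direction \<open>y\<close>.\<close>

definition flatten :: "('a::real_vector \<Rightarrow> real) \<Rightarrow> 'a \<Rightarrow> 'a \<Rightarrow> real"
  where "flatten p y x = (INF t\<in>{0..}. p (x + t *\<^sub>R y) - t * p y)"

lemma flatten_le: "sublinear p \<Longrightarrow> 0 \<le> t \<Longrightarrow> flatten p y x \<le> p (x + t *\<^sub>R y) - t * p y"
  unfolding flatten_def
proof (rule cINF_lower)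
  assume p: "sublinear p"
  have "- p (- x) \<le> p (x + t *\<^sub>R y) - t * p y" if "0 \<le> t" for t
    using sublinear_add[OF p, of "x + t *\<^sub>R y" "- x"] sublinear_scale[OF p that, of y] by simp
  then show "bdd_below ((\<lambda>t. p (x + t *\<^sub>R y) - t * p y) ` {0..})"
    by (intro bdd_belowI2[of _ "- p (- x)"]) auto
qed simp

lemma flatten_greatest: "(\<And>t. 0 \<le> t \<Longrightarrow> c \<le> p (x + t *\<^sub>R y) - t * p y) \<Longrightarrow> c \<le> flatten p y x"
  unfolding flatten_def by (rule cINF_greatest) auto

lemma sublinear_flatten:
  assumes p: "sublinear p"
  shows "sublinear (flatten p y)"
  unfolding sublinear_def
proof (intro conjI allI impI)
  fix x1 x2
  have "flatten p y (x1 + x2) - (p (x1 + t1 *\<^sub>R y) - t1 * p y) \<le> p (x2 + t2 *\<^sub>R y) - t2 * p y"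
    if "0 \<le> t1" "0 \<le> t2" for t1 t2
  proof -
    have "flatten p y (x1 + x2) \<le> p ((x1 + x2) + (t1 + t2) *\<^sub>R y) - (t1 + t2) * p y"
      using that by (intro flatten_le p) simp
    also have "(x1 + x2) + (t1 + t2) *\<^sub>R y = (x1 + t1 *\<^sub>R y) + (x2 + t2 *\<^sub>R y)"
      by (simp add: algebra_simps)
    also have "p \<dots> \<le> p (x1 + t1 *\<^sub>R y) + p (x2 + t2 *\<^sub>R y)" by (rule sublinear_add[OF p])
    finally show ?thesis by (simp add: algebra_simps)
  qed
  then have "flatten p y (x1 + x2) - (p (x1 + t1 *\<^sub>R y) - t1 * p y) \<le> flatten p y x2" if "0 \<le> t1" for t1
    using that by (intro flatten_greatest) auto
  then have "flatten p y (x1 + x2) - flatten p y x2 \<le> p (x1 + t1 *\<^sub>R y) - t1 * p y" if "0 \<le> t1" for t1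
    using that by (smt (verit))
  then have "flatten p y (x1 + x2) - flatten p y x2 \<le> flatten p y x1"
    by (rule flatten_greatest)
  then show "flatten p y (x1 + x2) \<le> flatten p y x1 + flatten p y x2" by simp
next
  fix s :: real and x assume s: "0 < s"
  have "flatten p y (s *\<^sub>R x) / s \<le> p (x + t *\<^sub>R y) - t * p y" if t: "0 \<le> t" for t
  proof -
    have "flatten p y (s *\<^sub>R x) \<le> p (s *\<^sub>R x + (s * t) *\<^sub>R y) - (s * t) * p y"
      using s t by (intro flatten_le p) simp
    also have "s *\<^sub>R x + (s * t) *\<^sub>R y = s *\<^sub>R (x + t *\<^sub>R y)" by (simp add: scaleR_add_right)
    also have "p \<dots> = s * p (x + t *\<^sub>R y)" using s by (simp add: sublinear_scale[OF p])
    finally show ?thesis using s by (simp add: field_simps)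
  qed
  then have "flatten p y (s *\<^sub>R x) / s \<le> flatten p y x" by (rule flatten_greatest)
  then show "flatten p y (s *\<^sub>R x) \<le> s * flatten p y x" using s by (simp add: field_simps)
qed

text \<open>Zorn's lemma with the reversed order: the pointwise infimum along a chain is again
  sublinear, and \<open>- p0 (- x)\<close> bounds it from below.\<close>

lemma minimal_sublinear_exists:
  fixes p0 :: "'a::real_vector \<Rightarrow> real"
  assumes p0: "sublinear p0"
  obtains m where "sublinear m" "m \<le> p0" "\<And>q. sublinear q \<Longrightarrow> q \<le> m \<Longrightarrow> q = m"
proof -
  define S where "S = {p. sublinear p \<and> p \<le> p0}"
  define P where "P p q \<longleftrightarrow> q \<le> p" for p q :: "'a \<Rightarrow> real"
  have "\<exists>m\<in>S. \<forall>q\<in>S. P m q \<longrightarrow> q = m"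
  proof (rule predicate_Zorn)
    show "partial_order_on S (relation_of P S)"
      by (rule partial_order_on_relation_ofI) (auto simp: P_def)
    fix C assume "C \<in> Chains (relation_of P S)"
    then have C: "\<And>p. p \<in> C \<Longrightarrow> sublinear p \<and> p \<le> p0"
      and chain: "\<And>p q. p \<in> C \<Longrightarrow> q \<in> C \<Longrightarrow> p \<le> q \<or> q \<le> p"
      unfolding Chains_def relation_of_def S_def P_def by auto
    show "\<exists>u\<in>S. \<forall>p\<in>C. P p u"
    proof (cases "C = {}")
      case True
      then show ?thesis using p0 by (intro bexI[of _ p0]) (auto simp: S_def)
    next
      case ne: False
      define u where "u x = (INF p\<in>C. p x)" for x
      have bdd: "bdd_below ((\<lambda>p. p x) ` C)" for x
      proof (rule bdd_belowI2[of _ "- p0 (- x)"])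
        fix p assume "p \<in> C"
        then have "sublinear p" "p (- x) \<le> p0 (- x)" using C by (auto simp: le_fun_def)
        then show "- p0 (- x) \<le> p x" using sublinear_minus[of p x] by simp
      qed
      have lower: "u x \<le> p x" if "p \<in> C" for p x
        unfolding u_def by (rule cINF_lower[OF bdd that])
      have greatest: "c \<le> u x" if "\<And>p. p \<in> C \<Longrightarrow> c \<le> p x" for c x
        unfolding u_def by (rule cINF_greatest[OF ne that])
      have "sublinear u"
        unfolding sublinear_def
      proof (intro conjI allI impI)
        fix x y
        have "u (x + y) - p x \<le> q y" if pq: "p \<in> C" "q \<in> C" for p q
        proof -
          obtain r where r: "r \<in> C" "r \<le> p" "r \<le> q"
            using chain[OF pq] pq by auto
          have "u (x + y) \<le> r (x + y)" by (rule lower[OF r(1)])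
          also have "\<dots> \<le> r x + r y" using C[OF r(1)] by (simp add: sublinear_add)
          also have "\<dots> \<le> p x + q y" using r(2,3) by (intro add_mono) (auto simp: le_fun_def)
          finally show ?thesis by simp
        qed
        then have "u (x + y) - p x \<le> u y" if "p \<in> C" for p using that by (intro greatest) auto
        then have "u (x + y) - u y \<le> u x" by (intro greatest) (simp add: algebra_simps)
        then show "u (x + y) \<le> u x + u y" by simp
      next
        fix t :: real and x assume t: "0 < t"
        have "u (t *\<^sub>R x) / t \<le> p x" if p: "p \<in> C" for p
          using lower[OF p, of "t *\<^sub>R x"] C[OF p] t by (simp add: sublinear_scale field_simps)
        then have "u (t *\<^sub>R x) / t \<le> u x" by (rule greatest)
        then show "u (t *\<^sub>R x) \<le> t * u x" using t by (simp add: field_simps)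
      qed
      moreover have "u \<le> p0"
      proof -
        obtain p where p: "p \<in> C" using ne by blast
        show ?thesis
        proof (rule le_funI)
          fix x
          show "u x \<le> p0 x" using lower[OF p, of x] C[OF p] by (auto simp: le_fun_def intro: order_trans)
        qed
      qed
      ultimately show ?thesis using lower by (intro bexI[of _ u]) (auto simp: S_def P_def le_fun_def)
    qed
  qed
  then obtain m where m: "m \<in> S" "\<And>q. q \<in> S \<Longrightarrow> P m q \<Longrightarrow> q = m" by blast
  show ?thesis
  proof (rule that[of m])
    show "q = m" if "sublinear q" "q \<le> m" for q
      using m that by (intro m(2)) (auto simp: S_def P_def)
  qed (use m(1) in \<open>auto simp: S_def\<close>)
qed

text \<open>A minimal sublinear function equals all its flattenings and is therefore additive. The
  search starts below \<open>flatten norm x0\<close>, whose value at \<open>- x0\<close> is at most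
  \<open>- norm x0\<close>; this forces the norm to be attained at \<open>x0\<close>.\<close>

lemma linear_norming_functional:
  fixes x0 :: "'a::real_normed_vector"
  obtains f :: "'a \<Rightarrow> real" where "linear f" "\<And>x. f x \<le> norm x" "norm x0 \<le> f x0"
proof -
  have n: "sublinear (norm :: 'a \<Rightarrow> real)" by (auto simp: sublinear_def norm_triangle_ineq)
  obtain m where m: "sublinear m" "m \<le> flatten norm x0" "\<And>q. sublinear q \<Longrightarrow> q \<le> m \<Longrightarrow> q = m"
    by (rule minimal_sublinear_exists[OF sublinear_flatten[OF n, of x0]]) (rule that)
  have "flatten m y = m" for y
    by (rule m(3)[OF sublinear_flatten[OF m(1)]]) (use flatten_le[OF m(1), of 0] in \<open>auto simp: le_fun_def\<close>)
  then have "m x \<le> m (x + y) - m y" for x y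
    using flatten_le[OF m(1), of 1 y x] by simp
  then have add: "m (x + y) = m x + m y" for x y
    using sublinear_add[OF m(1), of x y] by (smt (verit))
  have neg: "m (- x) = - m x" for x
    using add[of x "- x"] sublinear_scale[OF m(1), of 0 0] by simp
  have scale: "m (r *\<^sub>R x) = r * m x" for r x
  proof (cases "0 \<le> r")
    case False
    then have "m ((- r) *\<^sub>R x) = (- r) * m x" by (intro sublinear_scale m(1)) simp
    then show ?thesis using neg[of "r *\<^sub>R x"] by simp
  qed (rule sublinear_scale[OF m(1)])
  have fl: "flatten norm x0 x \<le> norm (x + t *\<^sub>R x0) - t * norm x0" if "0 \<le> t" for x t
    by (rule flatten_le[OF n that])
  show ?thesis
  proof (rule that[of m])
    show "linear m" by (rule linearI) (simp_all add: add scale)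
    show "m x \<le> norm x" for x
      using m(2) fl[of 0 x] by (auto simp: le_fun_def intro: order_trans)
    have "m (- x0) \<le> - norm x0"
      using m(2) fl[of 1 "- x0"] by (auto simp: le_fun_def intro: order_trans)
    then show "norm x0 \<le> m x0" using neg[of x0] by simp
  qed
qed

lemma complex_decomp: "c *\<^sub>C x = Re c *\<^sub>R x + Im c *\<^sub>R (\<i> *\<^sub>C x)" for x :: "'a::complex_banach"
proof -
  have "c *\<^sub>C x = (complex_of_real (Re c) + complex_of_real (Im c) * \<i>) *\<^sub>C x"
    by (subst complex_eq[of c]) (simp add: mult.commute)
  then show ?thesis by (simp only: scaleC_add_left scaleC_scaleC[symmetric] scaleC_of_real)
qed

text \<open>The imaginary part \<open>f (\<i> *\<^sub>C x)\<close> carries a plus sign, which makes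
  the complexification conjugate-linear. Multiplying \<open>x\<close> by a unimodular factor that
  makes the value real transfers the bound from \<open>f\<close>.\<close>

lemma norming_antidual:
  fixes x0 :: "'a::complex_banach"
  obtains F :: "'a antidual" where "norm F \<le> 1" "norm x0 \<le> norm (antidual_apply F x0)"
proof -
  obtain f :: "'a \<Rightarrow> real" where f: "linear f" "\<And>x. f x \<le> norm x" "norm x0 \<le> f x0"
    by (rule linear_norming_functional[of x0]) (rule that)
  note fa = linear_add[OF f(1)] and fs = linear_scale[OF f(1)] and fn = linear_neg[OF f(1)]
  define G where "G x = Complex (f x) (f (\<i> *\<^sub>C x))" for x
  have ii: "\<i> *\<^sub>C (\<i> *\<^sub>C x) = - x" for x :: 'a
    by (simp add: scaleC_scaleC)
  have Ga: "G (x + y) = G x + G y" for x y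
    by (simp add: G_def fa scaleC_add_right complex_eq_iff)
  have Gs: "G (r *\<^sub>R x) = r *\<^sub>R G x" for r x
    by (simp add: G_def fs scaleC_scaleR complex_eq_iff)
  have Gi: "G (\<i> *\<^sub>C x) = - \<i> * G x" for x
    by (simp add: G_def ii fn complex_eq_iff)
  have GC: "G (c *\<^sub>C x) = cnj c * G x" for c x
    unfolding complex_decomp[of c x] Ga Gs Gi by (simp add: complex_eq_iff algebra_simps)
  have Gn: "norm (G x) \<le> norm x" for x
  proof (cases "G x = 0")
    case False
    define c where "c = G x / complex_of_real (norm (G x))"
    have "norm c = 1" using False by (simp add: c_def norm_divide)
    have "cnj (G x) * G x = complex_of_real ((norm (G x))\<^sup>2)"
      by (metis complex_norm_square mult.commute)
    then have "G (c *\<^sub>C x) = complex_of_real (norm (G x))"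
      using False by (simp add: GC c_def power2_eq_square)
    then have "norm (G x) = f (c *\<^sub>C x)" by (simp add: G_def complex_eq_iff)
    also have "\<dots> \<le> norm (c *\<^sub>C x)" by (rule f(2))
    finally show ?thesis by (simp add: norm_scaleC \<open>norm c = 1\<close>)
  qed simp
  have bl: "bounded_linear G" by (rule bounded_linear_intro[of _ 1]) (simp_all add: Ga Gs Gn)
  define F where "F = Abs_antidual G"
  have F: "antidual_apply F = G"
    unfolding F_def by (rule Abs_antidual_inverse) (simp add: bl GC)
  show ?thesis
  proof (rule that[of F])
    show "norm F \<le> 1"
      unfolding norm_antidual.rep_eq F by (rule onorm_bound) (simp_all add: Gn)
    have "\<bar>f x0\<bar> \<le> norm (G x0)" using abs_Re_le_cmod[of "G x0"] by (simp add: G_def)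
    then show "norm x0 \<le> norm (antidual_apply F x0)" using f(3) by (simp add: F)
  qed
qed

section \<open>Operator norms, adjoints and uniform boundedness\<close>

lemma norm_cblinfun_apply_le: "norm (cblinfun_apply F x) \<le> norm F * norm x"
  by (simp add: norm_cblinfun.rep_eq onorm bounded_linear_cblinfun_apply)

lemma norm_cblinfun_bound: "0 \<le> b \<Longrightarrow> (\<And>x. norm (cblinfun_apply F x) \<le> b * norm x) \<Longrightarrow> norm F \<le> b"
  unfolding norm_cblinfun.rep_eq by (rule onorm_bound)

text \<open>Testing \<open>F x\<close> with a norming functional; this is the use of Hahn-Banach,
  and it compares the growth bounds in \<open>half_plane_dual_semigroup\<close>.\<close>

lemma norm_le_norm_adjoint: "norm F \<le> norm (adjoint F)"
proof (rule norm_cblinfun_bound)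
  fix x
  obtain f where f: "norm f \<le> 1" "norm (cblinfun_apply F x) \<le> norm (antidual_apply f (cblinfun_apply F x))"
    by (rule norming_antidual[of "cblinfun_apply F x"]) (rule that)
  have "norm (cblinfun_apply F x) \<le> norm (antidual_apply (cblinfun_apply (adjoint F) f) x)"
    using f(2) by (simp add: adjoint_apply)
  also have "\<dots> \<le> norm (cblinfun_apply (adjoint F) f) * norm x" by (rule norm_antidual_apply_le)
  also have "\<dots> \<le> (norm (adjoint F) * 1) * norm x"
    by (intro mult_right_mono order_trans[OF norm_cblinfun_apply_le] mult_left_mono f(1)) auto
  finally show "norm (cblinfun_apply F x) \<le> norm (adjoint F) * norm x" by simp
qed simp

text \<open>If \<open>z\<close> nearly attains the norm, then \<open>x + z\<close> or
  \<open>x - z\<close> has an image at least as large, because these images differ by twice that of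
  \<open>z\<close>. The factor 2/3 must be below 1 and above the 1/2 lost in
  \<open>uniform_boundedness\<close>.\<close>

lemma norm_attained_near:
  fixes F :: "'a::complex_banach \<Rightarrow>\<^sub>C\<^sub>L 'b::complex_banach"
  assumes r: "0 < r"
  shows "\<exists>y. norm (y - x) \<le> r \<and> 2 / 3 * r * norm F \<le> norm (cblinfun_apply F y)"
proof -
  note lin = bounded_linear.linear[OF bounded_linear_cblinfun_apply[of F]]
  have "\<exists>z. norm z \<le> r \<and> 2 / 3 * r * norm F \<le> norm (cblinfun_apply F z)"
  proof (cases "norm F = 0")
    case True
    then show ?thesis using r by (intro exI[of _ 0]) simp
  next
    case False
    then have F0: "0 < norm F" by simp
    have "\<not> (\<forall>z. norm (cblinfun_apply F z) \<le> 2 / 3 * norm F * norm z)"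
      using norm_cblinfun_bound[of "2 / 3 * norm F" F] F0 by auto
    then obtain z where z: "2 / 3 * norm F * norm z < norm (cblinfun_apply F z)" by (auto simp: not_le)
    then have z0: "0 < norm z" using linear_0[OF lin] by (cases "z = 0") auto
    have "2 / 3 * r * norm F = (r / norm z) * (2 / 3 * norm F * norm z)" using z0 by simp
    also have "\<dots> \<le> (r / norm z) * norm (cblinfun_apply F z)"
      using z r z0 by (intro mult_left_mono) auto
    also have "\<dots> = norm (cblinfun_apply F ((r / norm z) *\<^sub>R z))"
      using r by (simp add: linear_scale[OF lin])
    finally show ?thesis using r z0 by (intro exI[of _ "(r / norm z) *\<^sub>R z"]) simp
  qed
  then obtain z where z: "norm z \<le> r" "2 / 3 * r * norm F \<le> norm (cblinfun_apply F z)" by blast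
  have "2 * norm (cblinfun_apply F z) = norm (cblinfun_apply F (x + z) - cblinfun_apply F (x - z))"
    by (simp add: linear_diff[OF lin, symmetric] scaleR_2[symmetric] linear_scale[OF lin])
  also have "\<dots> \<le> norm (cblinfun_apply F (x + z)) + norm (cblinfun_apply F (x - z))"
    by (rule norm_triangle_ineq4)
  finally have "norm (cblinfun_apply F z) \<le> norm (cblinfun_apply F (x + z))
      \<or> norm (cblinfun_apply F z) \<le> norm (cblinfun_apply F (x - z))" by linarith
  then show ?thesis
  proof
    assume "norm (cblinfun_apply F z) \<le> norm (cblinfun_apply F (x + z))"
    then show ?thesis using z by (intro exI[of _ "x + z"]) simp
  next
    assume "norm (cblinfun_apply F z) \<le> norm (cblinfun_apply F (x - z))"
    then show ?thesis using z by (intro exI[of _ "x - z"]) simp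
  qed
qed

text \<open>Gliding hump: steps of size at most 3^-n, each making the n-th selected operator large.
  The steps after the n-th add up to at most half of 3^-n, so of the factor 2/3 at least 2/3 - 1/2 =
  1/6 survives at the limit point \<open>l\<close>.\<close>

lemma uniform_boundedness:
  fixes F :: "nat \<Rightarrow> 'a::complex_banach \<Rightarrow>\<^sub>C\<^sub>L 'b::complex_banach"
  assumes "\<And>x. \<exists>K. \<forall>n. norm (cblinfun_apply (F n) x) \<le> K"
  shows "\<exists>M. \<forall>n. norm (F n) \<le> M"
proof (rule ccontr)
  assume "\<not> ?thesis"
  \<comment> \<open>\<open>3 ^ n\<close> compensates for the shrinking steps, and the factor
    \<open>real n\<close> leaves values of size n/6 at \<open>l\<close>.\<close>
  then have "\<forall>n. \<exists>k. real n * 3 ^ n \<le> norm (F k)" by (meson le_cases)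
  from choice[OF this] obtain k where k: "\<And>n. real n * 3 ^ n \<le> norm (F (k n))" by blast
  define S where "S n = F (k n)" for n
  have "\<exists>x. \<forall>n. True \<and> (norm (x (Suc n) - x n) \<le> (1 / 3) ^ n \<and>
      2 / 3 * (1 / 3) ^ n * norm (S n) \<le> norm (cblinfun_apply (S n) (x (Suc n))))"
    by (rule dependent_nat_choice) (use norm_attained_near[of "(1 / 3) ^ n" for n] in auto)
  then obtain x where x: "\<And>n. norm (x (Suc n) - x n) \<le> (1 / 3) ^ n"
    "\<And>n. 2 / 3 * (1 / 3) ^ n * norm (S n) \<le> norm (cblinfun_apply (S n) (x (Suc n)))" by blast
  have tail: "norm (x (Suc n + j) - x (Suc n)) \<le> 1 / 2 * (1 / 3) ^ n * (1 - (1 / 3) ^ j)" for n j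
  proof (induction j)
    case (Suc j)
    have "norm (x (Suc n + Suc j) - x (Suc n))
        \<le> norm (x (Suc (Suc n + j)) - x (Suc n + j)) + norm (x (Suc n + j) - x (Suc n))"
      using norm_triangle_ineq[of "x (Suc (Suc n + j)) - x (Suc n + j)" "x (Suc n + j) - x (Suc n)"] by simp
    also have "\<dots> \<le> (1 / 3) ^ (Suc n + j) + 1 / 2 * (1 / 3) ^ n * (1 - (1 / 3) ^ j)"
      by (intro add_mono x(1) Suc.IH)
    also have "\<dots> = 1 / 2 * (1 / 3) ^ n * (1 - (1 / 3) ^ Suc j)"
      by (simp add: power_add field_simps)
    finally show ?case .
  qed simp
  have "Cauchy x"
  proof (rule metric_CauchyI)
    fix e :: real assume "0 < e"
    then obtain n where n: "(1 / 3 :: real) ^ n < e" using real_arch_pow_inv[of e "1 / 3"] by auto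
    have d: "norm (x m - x (Suc n)) < e / 2" if "m \<ge> Suc n" for m
    proof -
      have "norm (x m - x (Suc n)) \<le> 1 / 2 * (1 / 3) ^ n * (1 - (1 / 3) ^ (m - Suc n))"
        using tail[of n "m - Suc n"] that by simp
      also have "\<dots> \<le> 1 / 2 * (1 / 3) ^ n * 1" by (intro mult_left_mono) auto
      finally show ?thesis using n by simp
    qed
    have "dist (x m) (x m') < e" if "m \<ge> Suc n" "m' \<ge> Suc n" for m m'
      using norm_triangle_ineq4[of "x m - x (Suc n)" "x m' - x (Suc n)"] d[OF that(1)] d[OF that(2)]
      by (simp add: dist_norm)
    then show "\<exists>M. \<forall>m\<ge>M. \<forall>n\<ge>M. dist (x m) (x n) < e" by blast
  qed
  then obtain l where l: "x \<longlonglongrightarrow> l" using Cauchy_convergent convergent_def by blast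
  have close: "norm (l - x (Suc n)) \<le> 1 / 2 * (1 / 3) ^ n" for n
  proof (rule LIMSEQ_le_const2)
    show "(\<lambda>j. norm (x (j + Suc n) - x (Suc n))) \<longlonglongrightarrow> norm (l - x (Suc n))"
      by (intro tendsto_norm tendsto_diff tendsto_const LIMSEQ_ignore_initial_segment l)
    have "norm (x (j + Suc n) - x (Suc n)) \<le> 1 / 2 * (1 / 3) ^ n" for j
    proof -
      have "1 / 2 * (1 / 3) ^ n * (1 - (1 / 3) ^ j) \<le> 1 / 2 * (1 / 3 :: real) ^ n * 1"
        by (intro mult_left_mono) auto
      from order_trans[OF tail[of n j] this] show ?thesis by (simp add: add.commute)
    qed
    then show "\<exists>N. \<forall>j\<ge>N. norm (x (j + Suc n) - x (Suc n)) \<le> 1 / 2 * (1 / 3) ^ n" by blast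
  qed
  obtain K where K: "\<And>n. norm (cblinfun_apply (F n) l) \<le> K" using assms by blast
  have "real n / 6 \<le> K" for n
  proof -
    note lin = bounded_linear.linear[OF bounded_linear_cblinfun_apply[of "S n"]]
    have "norm (cblinfun_apply (S n) (l - x (Suc n))) \<le> norm (S n) * (1 / 2 * (1 / 3) ^ n)"
      by (rule order_trans[OF norm_cblinfun_apply_le mult_left_mono[OF close]]) simp
    moreover have "norm (cblinfun_apply (S n) (x (Suc n)))
        \<le> norm (cblinfun_apply (S n) l) + norm (cblinfun_apply (S n) (l - x (Suc n)))"
      using norm_triangle_ineq4[of "cblinfun_apply (S n) l" "cblinfun_apply (S n) (l - x (Suc n))"]
      by (simp add: linear_diff[OF lin])
    moreover have "norm (cblinfun_apply (S n) l) \<le> K" using K by (simp add: S_def)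
    ultimately have "2 / 3 * (1 / 3) ^ n * norm (S n) - norm (S n) * (1 / 2 * (1 / 3) ^ n) \<le> K"
      using x(2)[of n] by linarith
    then have "(1 / 3) ^ n * norm (S n) / 6 \<le> K" by (simp add: mult.commute)
    moreover have "(1 / 3) ^ n * (real n * 3 ^ n) \<le> (1 / 3) ^ n * norm (S n)"
      using k[of n] by (intro mult_left_mono) (auto simp: S_def)
    then have "real n \<le> (1 / 3) ^ n * norm (S n)" by (simp add: power_divide)
    ultimately show ?thesis by linarith
  qed
  moreover obtain n where "6 * K < real n" using reals_Archimedean2 by blast
  ultimately show False by (metis divide_le_eq mult.commute not_le zero_less_numeral)
qed

section \<open>Strongly continuous semigroups\<close>

lemma cbl_add: "cblinfun_apply F (x + y) = cblinfun_apply F x + cblinfun_apply F y"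
  by (rule linear_add[OF bounded_linear.linear[OF bounded_linear_cblinfun_apply]])

lemma cbl_diff: "cblinfun_apply F (x - y) = cblinfun_apply F x - cblinfun_apply F y"
  by (rule linear_diff[OF bounded_linear.linear[OF bounded_linear_cblinfun_apply]])

lemma cbl_minus: "cblinfun_apply F (- x) = - cblinfun_apply F x"
  by (rule linear_neg[OF bounded_linear.linear[OF bounded_linear_cblinfun_apply]])

lemma cbl_scaleR: "cblinfun_apply F (r *\<^sub>R x) = r *\<^sub>R cblinfun_apply F x"
  by (rule linear_scale[OF bounded_linear.linear[OF bounded_linear_cblinfun_apply]])

lemma cbl_0: "cblinfun_apply F 0 = 0"
  by (rule linear_0[OF bounded_linear.linear[OF bounded_linear_cblinfun_apply]])

lemmas cbl_simps = cbl_add cbl_diff cbl_minus cbl_scaleR cbl_0 cblinfun_scaleC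

lemma cbl_tendsto: "(f \<longlongrightarrow> l) F \<Longrightarrow> ((\<lambda>x. cblinfun_apply G (f x)) \<longlongrightarrow> cblinfun_apply G l) F"
  by (rule bounded_linear.tendsto[OF bounded_linear_cblinfun_apply])

lemma cbl_continuous: "continuous_on S f \<Longrightarrow> continuous_on S (\<lambda>x. cblinfun_apply G (f x))"
  by (rule bounded_linear.continuous_on[OF bounded_linear_cblinfun_apply])

lemma at_within_Ici_0: "at 0 within {0..} = at_right (0::real)"
  by (rule at_within_nhd[of _ UNIV]) auto

lemma int0_continuous_diff:
  fixes f g :: "real \<Rightarrow> 'e::banach"
  assumes "continuous_on {0..} f" "continuous_on {0..} g"
  shows "int0 (\<lambda>s. f s - g s) t = int0 f t - int0 g t"
  unfolding int0_def
  by (intro Henstock_Kurzweil_Integration.integral_diff integrable_continuous_real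
      continuous_on_subset[OF assms(1)] continuous_on_subset[OF assms(2)]) auto

lemma int0_continuous_add:
  fixes f g :: "real \<Rightarrow> 'e::banach"
  assumes "continuous_on {0..} f" "continuous_on {0..} g"
  shows "int0 (\<lambda>s. f s + g s) t = int0 f t + int0 g t"
  unfolding int0_def
  by (intro Henstock_Kurzweil_Integration.integral_add integrable_continuous_real
      continuous_on_subset[OF assms(1)] continuous_on_subset[OF assms(2)]) auto

lemma int0_bounded_linear:
  fixes f :: "real \<Rightarrow> 'e::banach"
  assumes "bounded_linear L" "continuous_on {0..} f"
  shows "int0 (\<lambda>s. L (f s)) t = L (int0 f t)"
proof -
  have "f integrable_on {0..t}"
    by (intro integrable_continuous_real continuous_on_subset[OF assms(2)]) auto
  from integral_linear[OF this assms(1)] show ?thesis by (simp add: int0_def o_def)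
qed

lemma norm_int0_le:
  fixes f :: "real \<Rightarrow> 'e::banach"
  assumes "continuous_on {0..} f" "\<And>s. s \<in> {0..t} \<Longrightarrow> norm (f s) \<le> B" "0 \<le> t"
  shows "norm (int0 f t) \<le> B * t"
  using int0_increment[OF assms(1) order_refl assms(3), of 0 B] assms(2) by simp

lemma int0_difference_quotient:
  fixes f :: "real \<Rightarrow> 'e::banach"
  assumes f: "continuous_on {0..} f" and t: "0 \<le> t"
  shows "((\<lambda>h. (int0 f (t + h) - int0 f t) /\<^sub>R h) \<longlongrightarrow> f t) (at_right 0)"
proof -
  have D: "\<And>e. 0 < e \<Longrightarrow> \<exists>d>0. \<forall>y\<in>{0..}. norm (y - t) < d \<longrightarrow>
      norm (int0 f y - int0 f t - (y - t) *\<^sub>R f t) \<le> e * norm (y - t)"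
    using int0_has_vector_derivative[OF f t]
    unfolding has_vector_derivative_def has_derivative_within_alt by blast
  show ?thesis
    unfolding tendsto_iff
  proof (intro allI impI)
    fix e :: real assume e: "0 < e"
    then have "0 < e / 2" by simp
    from D[OF this] obtain d where d: "0 < d" "\<forall>y\<in>{0..}. norm (y - t) < d \<longrightarrow>
      norm (int0 f y - int0 f t - (y - t) *\<^sub>R f t) \<le> e / 2 * norm (y - t)" by blast
    have "dist ((int0 f (t + h) - int0 f t) /\<^sub>R h) (f t) < e" if h: "0 < h" "h < d" for h
    proof -
      have "norm (int0 f (t + h) - int0 f t - h *\<^sub>R f t) \<le> e / 2 * h"
        using d(2)[rule_format, of "t + h"] h t by simp
      then have "inverse h * norm (int0 f (t + h) - int0 f t - h *\<^sub>R f t) \<le> inverse h * (e / 2 * h)"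
        using h by (intro mult_left_mono) auto
      moreover have "(int0 f (t + h) - int0 f t) /\<^sub>R h - f t = (int0 f (t + h) - int0 f t - h *\<^sub>R f t) /\<^sub>R h"
        using h by (simp add: scaleR_diff_right)
      moreover have "inverse h * (e / 2 * h) = e / 2" using h by simp
      ultimately have "norm ((int0 f (t + h) - int0 f t) /\<^sub>R h - f t) \<le> e / 2"
        using h by (simp only: norm_scaleR abs_of_pos positive_imp_inverse_positive)
      then show ?thesis using e by (simp add: dist_norm)
    qed
    then show "\<forall>\<^sub>F h in at_right 0. dist ((int0 f (t + h) - int0 f t) /\<^sub>R h) (f t) < e"
      unfolding eventually_at_right_field using d(1) by (intro exI[of _ d]) auto
  qed
qed

section \<open>Bounds, orbits and the generator of a semigroup\<close>

locale c0 =
  fixes T :: "real \<Rightarrow> 'x::complex_banach \<Rightarrow>\<^sub>C\<^sub>L 'x"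
  assumes C0: "C0_semigroup T"
begin

lemma T_0 [simp]: "cblinfun_apply (T 0) x = x"
  using C0 by (simp add: C0_semigroup_def)

lemma T_add: "0 \<le> s \<Longrightarrow> 0 \<le> t \<Longrightarrow> cblinfun_apply (T (s + t)) x = cblinfun_apply (T s) (cblinfun_apply (T t) x)"
  using C0 by (simp add: C0_semigroup_def)

lemma T_lim: "((\<lambda>t. cblinfun_apply (T t) x) \<longlongrightarrow> x) (at_right 0)"
  using C0 by (simp add: C0_semigroup_def)

text \<open>Otherwise operators of unbounded norm occur at times tending to 0, although every orbit
  converges along these times; uniform boundedness excludes this.\<close>

lemma locally_bounded: "\<exists>d>0. \<exists>M\<ge>1. \<forall>t\<in>{0..d}. norm (T t) \<le> M"
proof (rule ccontr)
  assume neg: "\<not> ?thesis"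
  have "\<exists>t. t \<in> {0..1 / (real n + 1)} \<and> real n < norm (T t)" for n
  proof (rule ccontr)
    assume "\<not> ?thesis"
    then have "\<forall>t\<in>{0..1 / (real n + 1)}. norm (T t) \<le> max 1 (real n)" by (auto simp: not_less)
    then show False using neg by (metis max.cobounded1 zero_less_divide_1_iff of_nat_0_le_iff add_nonneg_pos zero_less_one)
  qed
  then obtain \<tau> where \<tau>: "\<And>n. \<tau> n \<in> {0..1 / (real n + 1)}" "\<And>n. real n < norm (T (\<tau> n))" by metis
  have "\<tau> \<longlonglongrightarrow> 0"
  proof (rule tendsto_sandwich[of "\<lambda>_. 0" _ _ "\<lambda>n. 1 / (real n + 1)"])
    show "(\<lambda>n. 1 / (real n + 1)) \<longlonglongrightarrow> 0"
      using LIMSEQ_inverse_real_of_nat by (simp add: inverse_eq_divide add.commute)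
  qed (use \<tau>(1) in \<open>auto intro: always_eventually\<close>)
  have "\<exists>K. \<forall>n. norm (cblinfun_apply (T (\<tau> n)) x) \<le> K" for x
  proof -
    have "continuous (at 0 within {0..}) (\<lambda>t. cblinfun_apply (T t) x)"
      using T_lim[of x] by (simp add: continuous_within at_within_Ici_0)
    then have "(\<lambda>n. cblinfun_apply (T (\<tau> n)) x) \<longlonglongrightarrow> cblinfun_apply (T 0) x"
      by (rule continuous_within_tendsto_compose'[OF _ _ \<open>\<tau> \<longlonglongrightarrow> 0\<close>]) (use \<tau>(1) in auto)
    then have "Bseq (\<lambda>n. cblinfun_apply (T (\<tau> n)) x)"
      by (intro convergent_imp_Bseq convergentI)
    then show ?thesis by (auto simp: Bseq_def)
  qed
  from uniform_boundedness[OF this] obtain M where M: "\<And>n. norm (T (\<tau> n)) \<le> M" by blast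
  obtain n where "M < real n" using reals_Archimedean2 by blast
  with M[of n] \<tau>(2)[of n] show False by simp
qed

lemma norm_T_add_le:
  assumes "0 \<le> s" "0 \<le> t"
  shows "norm (T (s + t)) \<le> norm (T s) * norm (T t)"
proof (rule norm_cblinfun_bound)
  fix x
  have "norm (cblinfun_apply (T (s + t)) x) \<le> norm (T s) * norm (cblinfun_apply (T t) x)"
    by (simp add: T_add[OF assms] norm_cblinfun_apply_le)
  also have "\<dots> \<le> norm (T s) * (norm (T t) * norm x)"
    by (intro mult_left_mono norm_cblinfun_apply_le) simp
  finally show "norm (cblinfun_apply (T (s + t)) x) \<le> norm (T s) * norm (T t) * norm x" by simp
qed simp

text \<open>Write \<open>t\<close> as \<open>n\<close> steps of length \<open>d\<close> and a
  remainder; each step costs a factor \<open>M\<close>, so the rate is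
  \<open>ln M / d\<close>.\<close>

lemma exponential_bound: "\<exists>M w. \<forall>t\<ge>0. norm (T t) \<le> M * exp (w * t)"
proof -
  obtain d M where d: "0 < d" and M: "1 \<le> M" "\<And>t. t \<in> {0..d} \<Longrightarrow> norm (T t) \<le> M"
    using locally_bounded by blast
  have step: "norm (T (real n * d + r)) \<le> M * M ^ n" if r: "r \<in> {0..d}" for n r
  proof (induction n)
    case (Suc n)
    have "norm (T (d + (real n * d + r))) \<le> norm (T d) * norm (T (real n * d + r))"
      using d r by (intro norm_T_add_le) auto
    also have "\<dots> \<le> M * (M * M ^ n)"
      using d M by (intro mult_mono M(2) Suc.IH) auto
    finally show ?case by (simp add: algebra_simps)
  qed (use M(2)[OF r] in simp)
  have "norm (T t) \<le> M * exp (ln M / d * t)" if t: "0 \<le> t" for t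
  proof -
    define n where "n = nat \<lfloor>t / d\<rfloor>"
    have n: "real n \<le> t / d" "t / d < real n + 1"
      using t d by (auto simp: n_def)
    define r where "r = t - real n * d"
    have r: "r \<in> {0..d}" using n d by (auto simp: r_def field_simps)
    have "norm (T t) \<le> M * M ^ n" using step[OF r, of n] by (simp add: r_def)
    also have "M ^ n = exp (ln M * real n)" using M(1) by (simp add: exp_of_nat2_mult)
    also have "\<dots> \<le> exp (ln M / d * t)"
      using mult_left_mono[OF n(1), of "ln M"] M(1) by simp
    finally show ?thesis using M(1) by simp
  qed
  then show ?thesis by blast
qed

lemma norm_T_bounded_on_Icc: "\<exists>M\<ge>0. \<forall>t\<in>{0..b}. norm (T t) \<le> M"
proof -
  obtain M w where M: "\<And>t. 0 \<le> t \<Longrightarrow> norm (T t) \<le> M * exp (w * t)"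
    using exponential_bound by blast
  have "norm (T t) \<le> \<bar>M\<bar> * exp (\<bar>w\<bar> * \<bar>b\<bar>)" if t: "t \<in> {0..b}" for t
  proof -
    have "w * t \<le> \<bar>w\<bar> * t" using t by (intro mult_right_mono) auto
    also have "\<dots> \<le> \<bar>w\<bar> * \<bar>b\<bar>" using t by (intro mult_left_mono) auto
    finally have wt: "w * t \<le> \<bar>w\<bar> * \<bar>b\<bar>" .
    have "norm (T t) \<le> M * exp (w * t)" using M t by simp
    also have "\<dots> \<le> \<bar>M\<bar> * exp (\<bar>w\<bar> * \<bar>b\<bar>)"
      using wt by (intro mult_mono) auto
    finally show ?thesis .
  qed
  then show ?thesis by (intro exI[of _ "\<bar>M\<bar> * exp (\<bar>w\<bar> * \<bar>b\<bar>)"]) auto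
qed

text \<open>The earlier operator is factored out of the difference, leaving the continuity at 0; its
  local bound makes this work from the left as well.\<close>

lemma T_continuous: "continuous_on {0..} (\<lambda>t. cblinfun_apply (T t) x)"
proof (rule continuous_on_Ici)
  fix b
  obtain M where M: "0 \<le> M" "\<And>t. t \<in> {0..b} \<Longrightarrow> norm (T t) \<le> M"
    using norm_T_bounded_on_Icc[of b] by blast
  have le: "norm (cblinfun_apply (T t) x - cblinfun_apply (T s) x)
      \<le> M * norm (cblinfun_apply (T (t - s)) x - x)" if "s \<in> {0..b}" "s \<le> t" for s t
  proof -
    have "cblinfun_apply (T t) x - cblinfun_apply (T s) x
        = cblinfun_apply (T s) (cblinfun_apply (T (t - s)) x - x)"
      using T_add[of s "t - s" x] that by (simp add: cbl_diff)
    also have "norm \<dots> \<le> norm (T s) * norm (cblinfun_apply (T (t - s)) x - x)"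
      by (rule norm_cblinfun_apply_le)
    also have "\<dots> \<le> M * norm (cblinfun_apply (T (t - s)) x - x)"
      by (intro mult_right_mono M(2) that) simp
    finally show ?thesis .
  qed
  show "continuous_on {0..b} (\<lambda>t. cblinfun_apply (T t) x)"
    unfolding continuous_on_iff
  proof (intro ballI allI impI)
    fix t e :: real assume t: "t \<in> {0..b}" and e: "0 < e"
    have "0 < e / (M + 1)" using e M(1) by simp
    then have "\<forall>\<^sub>F h in at_right 0. dist (cblinfun_apply (T h) x) x < e / (M + 1)"
      using T_lim[of x] by (simp add: tendsto_iff)
    then obtain d where d: "0 < d" "\<And>h. 0 < h \<Longrightarrow> h < d \<Longrightarrow> dist (cblinfun_apply (T h) x) x < e / (M + 1)"
      by (auto simp: eventually_at_right_field)
    have h: "M * norm (cblinfun_apply (T h) x - x) < e" if "0 \<le> h" "h < d" for h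
    proof -
      have "norm (cblinfun_apply (T h) x - x) \<le> e / (M + 1)"
        using d(2)[of h] that e M(1) by (cases "h = 0") (auto simp: dist_norm)
      then have "M * norm (cblinfun_apply (T h) x - x) \<le> M * (e / (M + 1))"
        using M(1) by (intro mult_left_mono)
      also have "\<dots> < e" using e M(1) by (simp add: field_simps)
      finally show ?thesis .
    qed
    have "dist (cblinfun_apply (T t') x) (cblinfun_apply (T t) x) < e"
      if t': "t' \<in> {0..b}" and "dist t' t < d" for t'
    proof (cases "t \<le> t'")
      case True
      then show ?thesis
        using le[OF t True] h[of "t' - t"] that by (simp add: dist_norm)
    next
      case False
      then show ?thesis
        using le[OF t', of t] h[of "t - t'"] that by (simp add: dist_norm norm_minus_commute)
    qed
    then show "\<exists>d>0. \<forall>t'\<in>{0..b}. dist t' t < d \<longrightarrow>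
        dist (cblinfun_apply (T t') x) (cblinfun_apply (T t) x) < e"
      using d(1) by blast
  qed
qed

lemma T_int0: "cblinfun_apply (T h) (int0 (\<lambda>s. cblinfun_apply (T s) x) t) = int0 (\<lambda>s. cblinfun_apply (T h) (cblinfun_apply (T s) x)) t"
  by (rule int0_bounded_linear[OF bounded_linear_cblinfun_apply T_continuous, symmetric])

lemma T_commute: "0 \<le> s \<Longrightarrow> 0 \<le> t \<Longrightarrow>
    cblinfun_apply (T s) (cblinfun_apply (T t) x) = cblinfun_apply (T t) (cblinfun_apply (T s) x)"
  using T_add[of s t x] T_add[of t s x] by (simp add: add.commute)

text \<open>\<open>T h\<close> shifts the integration interval by \<open>h\<close>, so the
  difference consists of the two end pieces.\<close>

lemma T_h_int0:
  assumes h: "0 \<le> h" and t: "0 \<le> t"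
  shows "cblinfun_apply (T h) (int0 (\<lambda>s. cblinfun_apply (T s) x) t) - int0 (\<lambda>s. cblinfun_apply (T s) x) t
    = (int0 (\<lambda>s. cblinfun_apply (T s) x) (t + h) - int0 (\<lambda>s. cblinfun_apply (T s) x) t)
      - int0 (\<lambda>s. cblinfun_apply (T s) x) h"
proof -
  let ?f = "\<lambda>s. cblinfun_apply (T s) x"
  have i: "?f integrable_on {a..b}" if "0 \<le> a" for a b
    using that by (intro integrable_continuous_real continuous_on_subset[OF T_continuous]) auto
  have "cblinfun_apply (T h) (int0 ?f t) = integral {0..t} (\<lambda>s. ?f (h + s))"
    unfolding T_int0 unfolding int0_def
    by (rule Henstock_Kurzweil_Integration.integral_cong) (use h in \<open>simp add: T_add\<close>)
  also have "\<dots> = integral {0 + h..t + h} ?f"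
    using integral_shift_Icc_real[of 0 t ?f h] by (simp add: o_def)
  finally have 1: "cblinfun_apply (T h) (int0 ?f t) = integral {h..t + h} ?f" by simp
  have "integral {0..h} ?f + integral {h..t + h} ?f = integral {0..t + h} ?f"
    using h t by (intro Henstock_Kurzweil_Integration.integral_combine i) auto
  then have "integral {h..t + h} ?f = int0 ?f (t + h) - int0 ?f h"
    unfolding int0_def by (metis add_diff_cancel_left')
  then show ?thesis unfolding 1 by simp
qed

lemma generator_int0:
  assumes t: "0 \<le> t"
  shows "(int0 (\<lambda>s. cblinfun_apply (T s) x) t, cblinfun_apply (T t) x - x) \<in> generator T"
proof -
  let ?f = "\<lambda>s. cblinfun_apply (T s) x"
  have "((\<lambda>h. (int0 ?f (t + h) - int0 ?f t) /\<^sub>R h - (int0 ?f (0 + h) - int0 ?f 0) /\<^sub>R h) \<longlongrightarrow> ?f t - ?f 0) (at_right 0)"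
    by (intro tendsto_diff int0_difference_quotient[OF T_continuous] t order_refl)
  then have "((\<lambda>h. (cblinfun_apply (T h) (int0 ?f t) - int0 ?f t) /\<^sub>R h) \<longlongrightarrow> ?f t - x) (at_right 0)"
    unfolding T_0
  proof (rule Lim_transform_eventually)
    show "\<forall>\<^sub>F h in at_right 0. (int0 ?f (t + h) - int0 ?f t) /\<^sub>R h - (int0 ?f (0 + h) - int0 ?f 0) /\<^sub>R h
        = (cblinfun_apply (T h) (int0 ?f t) - int0 ?f t) /\<^sub>R h"
      using eventually_at_right_less[of 0]
    proof eventually_elim
      case (elim h)
      show ?case using T_h_int0[of h t x] elim t by (simp add: scaleR_diff_right)
    qed
  qed
  then show ?thesis by (simp add: generator_def)
qed

lemma generator_unique: "(x, y) \<in> generator T \<Longrightarrow> (x, y') \<in> generator T \<Longrightarrow> y = y'"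
  unfolding generator_def by (auto intro: tendsto_unique[OF trivial_limit_at_right_real])

lemma generator_scaleC:
  assumes "(x, y) \<in> generator T"
  shows "(c *\<^sub>C x, c *\<^sub>C y) \<in> generator T"
proof -
  have "((\<lambda>h. c *\<^sub>C ((cblinfun_apply (T h) x - x) /\<^sub>R h)) \<longlongrightarrow> c *\<^sub>C y) (at_right 0)"
    using assms by (intro bounded_linear.tendsto[OF bounded_linear_scaleC]) (simp add: generator_def)
  then show ?thesis
    by (simp add: generator_def cblinfun_scaleC scaleC_diff_right scaleC_scaleR)
qed

lemma generator_T:
  assumes "(x, y) \<in> generator T" "0 \<le> t"
  shows "(cblinfun_apply (T t) x, cblinfun_apply (T t) y) \<in> generator T"
proof -
  have "((\<lambda>h. cblinfun_apply (T t) ((cblinfun_apply (T h) x - x) /\<^sub>R h)) \<longlongrightarrow> cblinfun_apply (T t) y) (at_right 0)"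
    using assms(1) by (intro cbl_tendsto) (simp add: generator_def)
  moreover have "\<forall>\<^sub>F h in at_right 0. cblinfun_apply (T t) ((cblinfun_apply (T h) x - x) /\<^sub>R h)
      = (cblinfun_apply (T h) (cblinfun_apply (T t) x) - cblinfun_apply (T t) x) /\<^sub>R h"
    using eventually_at_right_less[of 0]
    by eventually_elim (simp add: cbl_scaleR cbl_diff T_commute[OF assms(2)])
  ultimately show ?thesis
    unfolding generator_def mem_Collect_eq case_prod_conv by (rule Lim_transform_eventually)
qed

lemma clin_int0_T:
  assumes t: "0 \<le> t"
  shows "clin (\<lambda>x. int0 (\<lambda>s. cblinfun_apply (T s) x) t)" (is "clin ?I")
  unfolding clin_def
proof (intro conjI allI)
  obtain M where M: "0 \<le> M" "\<And>s. s \<in> {0..t} \<Longrightarrow> norm (T s) \<le> M"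
    using norm_T_bounded_on_Icc[of t] by blast
  show "bounded_linear ?I"
  proof (rule bounded_linear_intro[of _ "M * t"])
    show "?I (a + b) = ?I a + ?I b" for a b
      unfolding cbl_add by (rule int0_continuous_add) (rule T_continuous)+
    show "?I (r *\<^sub>R a) = r *\<^sub>R ?I a" for r a
      by (simp add: cbl_scaleR int0_scaleR)
    show "norm (?I a) \<le> norm a * (M * t)" for a
    proof -
      have "norm (?I a) \<le> (M * norm a) * t"
        by (rule norm_int0_le[OF T_continuous _ t])
          (use M in \<open>auto intro!: order_trans[OF norm_cblinfun_apply_le] mult_right_mono\<close>)
      then show ?thesis by (simp add: mult_ac)
    qed
  qed
  show "?I (c *\<^sub>C x) = c *\<^sub>C ?I x" for c x
    unfolding cblinfun_scaleC by (rule int0_bounded_linear[OF bounded_linear_scaleC T_continuous])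
qed

text \<open>The difference quotient of the semigroup at the integrated orbit is evaluated twice: by
  \<open>generator_int0\<close>, and by moving the quotient inside the bounded operator
  \<open>?I\<close>, which commutes with \<open>T h\<close>.\<close>

lemma T_minus_id:
  assumes xy: "(x, y) \<in> generator T" and t: "0 \<le> t"
  shows "cblinfun_apply (T t) x - x = int0 (\<lambda>s. cblinfun_apply (T s) y) t"
proof -
  let ?I = "\<lambda>x. int0 (\<lambda>s. cblinfun_apply (T s) x) t"
  have bl: "bounded_linear ?I" by (rule clin_bl[OF clin_int0_T[OF t]])
  have "((\<lambda>h. ?I ((cblinfun_apply (T h) x - x) /\<^sub>R h)) \<longlongrightarrow> ?I y) (at_right 0)"
    using xy by (intro bounded_linear.tendsto[OF bl]) (simp add: generator_def)
  moreover have "\<forall>\<^sub>F h in at_right 0. ?I ((cblinfun_apply (T h) x - x) /\<^sub>R h)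
      = (cblinfun_apply (T h) (?I x) - ?I x) /\<^sub>R h"
    using eventually_at_right_less[of 0]
  proof eventually_elim
    case (elim h)
    have "?I (cblinfun_apply (T h) x) = cblinfun_apply (T h) (?I x)"
      unfolding T_int0 unfolding int0_def
      by (rule Henstock_Kurzweil_Integration.integral_cong) (use elim in \<open>simp add: T_commute\<close>)
    then show ?case
      by (simp only: linear_scale[OF bounded_linear.linear[OF bl]] linear_diff[OF bounded_linear.linear[OF bl]])
  qed
  ultimately have "((\<lambda>h. (cblinfun_apply (T h) (?I x) - ?I x) /\<^sub>R h) \<longlongrightarrow> ?I y) (at_right 0)"
    by (rule Lim_transform_eventually)
  moreover have "((\<lambda>h. (cblinfun_apply (T h) (?I x) - ?I x) /\<^sub>R h) \<longlongrightarrow> cblinfun_apply (T t) x - x) (at_right 0)"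
    using generator_int0[OF t, of x] by (simp add: generator_def)
  ultimately show ?thesis
    by (rule tendsto_unique[OF trivial_limit_at_right_real, symmetric])
qed

lemma T_has_vector_derivative:
  assumes xy: "(x, y) \<in> generator T" and t: "0 \<le> t"
  shows "((\<lambda>s. cblinfun_apply (T s) x) has_vector_derivative cblinfun_apply (T t) y) (at t within {0..})"
proof -
  have "((\<lambda>s. x + int0 (\<lambda>s. cblinfun_apply (T s) y) s) has_vector_derivative 0 + cblinfun_apply (T t) y) (at t within {0..})"
    by (intro has_vector_derivative_add has_vector_derivative_const int0_has_vector_derivative[OF T_continuous t])
  moreover have "x + int0 (\<lambda>s. cblinfun_apply (T s) y) s = cblinfun_apply (T s) x" if "s \<in> {0..}" for s
    using T_minus_id[OF xy, of s] that by (simp add: algebra_simps)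
  ultimately show ?thesis
    using t has_vector_derivative_transform[of t "{0..}" "\<lambda>s. cblinfun_apply (T s) x" "\<lambda>s. x + int0 (\<lambda>s. cblinfun_apply (T s) y) s" "cblinfun_apply (T t) y"]
    by simp
qed

text \<open>Averages of the orbit over short intervals lie in the domain and tend to
  \<open>x\<close>.\<close>

lemma domain_dense: "closure (Domain (generator T)) = UNIV"
proof (intro equalityI subset_UNIV subsetI)
  fix x
  let ?f = "\<lambda>s. cblinfun_apply (T s) x"
  have lim: "((\<lambda>h. (int0 ?f (0 + h) - int0 ?f 0) /\<^sub>R h) \<longlongrightarrow> ?f 0) (at_right 0)"
    by (rule int0_difference_quotient[OF T_continuous order_refl])
  have ev: "\<forall>\<^sub>F h in at_right 0. (int0 ?f (0 + h) - int0 ?f 0) /\<^sub>R h \<in> closure (Domain (generator T))"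
    using eventually_at_right_less[of 0]
  proof eventually_elim
    case (elim h)
    have "(complex_of_real (inverse h) *\<^sub>C int0 ?f h, complex_of_real (inverse h) *\<^sub>C (?f h - x)) \<in> generator T"
      using elim by (intro generator_scaleC generator_int0) simp
    then have "int0 ?f h /\<^sub>R h \<in> Domain (generator T)" by (auto simp only: scaleC_of_real)
    then have "int0 ?f h /\<^sub>R h \<in> closure (Domain (generator T))" by (rule subsetD[OF closure_subset])
    then show ?case by (simp only: add_0_left int0_0 diff_zero)
  qed
  have "?f 0 \<in> closure (Domain (generator T))"
    by (rule Lim_in_closed_set[OF closed_closure ev _ lim]) simp
  then show "x \<in> closure (Domain (generator T))" by simp
qed

end

lemma antidual_add: "antidual_apply f (x + y) = antidual_apply f x + antidual_apply f y"
  by (rule linear_add[OF bounded_linear.linear[OF bounded_linear_antidual_apply]])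

lemma antidual_diff: "antidual_apply f (x - y) = antidual_apply f x - antidual_apply f y"
  by (rule linear_diff[OF bounded_linear.linear[OF bounded_linear_antidual_apply]])

lemma bounded_bilinear_antidual_apply: "bounded_bilinear antidual_apply"
proof
  show "\<exists>K. \<forall>f x. norm (antidual_apply f x) \<le> norm f * norm x * K"
    by (rule exI[of _ 1]) (simp add: norm_antidual_apply_le)
qed (simp_all add: plus_antidual.rep_eq scaleR_antidual.rep_eq antidual_add
    linear_scale[OF bounded_linear.linear[OF bounded_linear_antidual_apply]])

lemma dense_eqI:
  fixes f g :: "'p::topological_space \<Rightarrow> 'q::t2_space"
  assumes "closure D = UNIV" "continuous_on UNIV f" "continuous_on UNIV g" "\<And>x. x \<in> D \<Longrightarrow> f x = g x"
  shows "f x = g x"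
proof -
  have "closure D \<subseteq> {x. f x = g x}"
    by (intro closure_minimal closed_Collect_eq assms(2,3)) (use assms(4) in auto)
  then show ?thesis using assms(1) by auto
qed

lemma cblinfun_dense_eqI:
  assumes "closure D = UNIV" "\<And>x. x \<in> D \<Longrightarrow> cblinfun_apply F x = cblinfun_apply G x"
  shows "F = G"
  by (rule cblinfun_eqI, rule dense_eqI[OF assms(1) _ _ assms(2)])
    (auto intro: linear_continuous_on bounded_linear_cblinfun_apply)

subsection \<open>Resolvents\<close>

lemma resolvent_eq: "is_resolvent A l R \<Longrightarrow> resolvent A l = R"
  unfolding resolvent_def
  by (rule the_equality) (auto simp: is_resolvent_def intro!: cblinfun_eqI)

text \<open>The points \<open>x = R z\<close> run through the whole domain, so the defining relation
  of \<open>adjoint_op\<close> becomes an identity in \<open>z\<close>. Conjugate-linearity turns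
  \<open>a\<close> into \<open>cnj a\<close>.\<close>

lemma is_resolvent_adjoint:
  assumes "is_resolvent A a R"
  shows "is_resolvent (adjoint_op A) (cnj a) (adjoint R)"
  unfolding is_resolvent_def
proof (intro allI iffI)
  fix f g assume "cblinfun_apply (adjoint R) g = f"
  then have f: "antidual_apply f z = antidual_apply g (cblinfun_apply R z)" for z
    by (auto simp: adjoint_apply)
  have "antidual_apply f y = antidual_apply (cnj a *\<^sub>C f - g) x" if "(x, y) \<in> A" for x y
  proof -
    have "cblinfun_apply R (a *\<^sub>C x - y) = x"
      using assms that by (simp add: is_resolvent_def)
    then have "antidual_apply f (a *\<^sub>C x - y) = antidual_apply g x" by (simp add: f)
    then show ?thesis
      by (simp add: antidual_diff antidual_scaleC minus_antidual.rep_eq scaleC_antidual.rep_eq algebra_simps)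
  qed
  then show "(f, cnj a *\<^sub>C f - g) \<in> adjoint_op A" by (auto simp: adjoint_op_def)
next
  fix f g assume fg: "(f, cnj a *\<^sub>C f - g) \<in> adjoint_op A"
  show "cblinfun_apply (adjoint R) g = f"
  proof (rule antidual_eqI)
    fix z
    define x where "x = cblinfun_apply R z"
    have "(x, a *\<^sub>C x - z) \<in> A" using assms x_def by (auto simp: is_resolvent_def)
    then have "antidual_apply f (a *\<^sub>C x - z) = antidual_apply (cnj a *\<^sub>C f - g) x"
      using fg by (auto simp: adjoint_op_def)
    then show "antidual_apply (cblinfun_apply (adjoint R) g) z = antidual_apply f z"
      by (simp add: adjoint_apply antidual_diff antidual_scaleC minus_antidual.rep_eq scaleC_antidual.rep_eq
          flip: x_def)
  qed
qed

lemma exp_difference_quotient: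
  "((\<lambda>h. (exp (- a * of_real h) - 1) / of_real h) \<longlongrightarrow> - a) (at_right (0::real))" for a :: complex
proof -
  have "((\<lambda>z. exp (- a * z)) has_field_derivative exp (- a * 0) * (- a)) (at 0)"
    by (auto intro!: derivative_eq_intros)
  then have "((\<lambda>z. (exp (- a * z) - 1) / z) \<longlongrightarrow> - a) (at 0)"
    by (simp add: has_field_derivative_iff)
  moreover have "filterlim (\<lambda>h. complex_of_real h) (at 0) (at_right 0)"
  proof (rule filterlim_atI)
    show "((\<lambda>h. complex_of_real h) \<longlongrightarrow> 0) (at_right 0)"
      using tendsto_of_real[OF tendsto_ident_at, of 0 "{0<..}"] by simp
    show "\<forall>\<^sub>F h in at_right 0. complex_of_real h \<noteq> 0"
      using eventually_at_right_less[of "0::real"] by eventually_elim simp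
  qed
  ultimately show ?thesis by (rule filterlim_compose)
qed

text \<open>Its generator is that of \<open>T\<close> minus \<open>a\<close>, which reduces the
  resolvent at \<open>a\<close> to inverting a generator.\<close>

definition rescaled :: "complex \<Rightarrow> (real \<Rightarrow> 'x::complex_banach \<Rightarrow>\<^sub>C\<^sub>L 'x) \<Rightarrow> real \<Rightarrow> 'x \<Rightarrow>\<^sub>C\<^sub>L 'x"
  where "rescaled a T t = exp (- a * of_real t) *\<^sub>C T t"

lemma rescaled_apply: "cblinfun_apply (rescaled a T t) x = exp (- a * of_real t) *\<^sub>C cblinfun_apply (T t) x"
  by (simp add: rescaled_def scaleC_cblinfun.rep_eq)

lemma rescaled_rescaled: "rescaled (- a) (rescaled a T) = T"
  by (rule ext) (simp add: rescaled_def scaleC_scaleC flip: exp_add)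

context c0
begin

lemma C0_rescaled: "C0_semigroup (rescaled a T)"
  unfolding C0_semigroup_def
proof (intro conjI allI impI)
  show "cblinfun_apply (rescaled a T 0) x = x" for x
    by (simp add: rescaled_apply )
  show "cblinfun_apply (rescaled a T (s + t)) x = cblinfun_apply (rescaled a T s) (cblinfun_apply (rescaled a T t) x)"
    if "0 \<le> s" "0 \<le> t" for s t x
    using that by (simp add: rescaled_apply T_add cblinfun_scaleC scaleC_scaleC algebra_simps flip: exp_add)
  fix x
  have "((\<lambda>t. exp (- a * of_real t)) \<longlongrightarrow> exp (- a * of_real 0)) (at_right (0::real))"
    by (intro tendsto_intros)
  from tendsto_scaleC[OF this T_lim[of x]]
  show "((\<lambda>t. cblinfun_apply (rescaled a T t) x) \<longlongrightarrow> x) (at_right 0)"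
    by (simp add: rescaled_apply )
qed

lemma generator_rescaled:
  assumes xy: "(x, y) \<in> generator T"
  shows "(x, y - a *\<^sub>C x) \<in> generator (rescaled a T)"
proof -
  have 1: "((\<lambda>t. exp (- a * of_real t)) \<longlongrightarrow> exp (- a * of_real 0)) (at_right (0::real))"
    by (intro tendsto_intros)
  have 2: "((\<lambda>h. (cblinfun_apply (T h) x - x) /\<^sub>R h) \<longlongrightarrow> y) (at_right 0)"
    using xy by (simp add: generator_def)
  have "((\<lambda>h. exp (- a * of_real h) *\<^sub>C ((cblinfun_apply (T h) x - x) /\<^sub>R h)
      + ((exp (- a * of_real h) - 1) / of_real h) *\<^sub>C x) \<longlongrightarrow> exp (- a * of_real 0) *\<^sub>C y + (- a) *\<^sub>C x) (at_right 0)"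
    by (intro tendsto_add tendsto_scaleC[OF 1 2] tendsto_scaleC[OF exp_difference_quotient tendsto_const])
  moreover have "exp (- a * of_real h) *\<^sub>C ((cblinfun_apply (T h) x - x) /\<^sub>R h)
      + ((exp (- a * of_real h) - 1) / of_real h) *\<^sub>C x = (cblinfun_apply (rescaled a T h) x - x) /\<^sub>R h" for h
  proof -
    have "((exp (- a * of_real h) - 1) / of_real h) *\<^sub>C x = (exp (- a * of_real h) *\<^sub>C x - x) /\<^sub>R h"
      by (simp add: divide_inverse mult.commute scaleC_diff_left  scaleC_of_real
          flip: scaleC_scaleC of_real_inverse)
    then show ?thesis
      by (simp add: rescaled_apply scaleC_scaleR scaleC_diff_right flip: scaleR_add_right)
  qed
  ultimately show ?thesis
    by (simp add: generator_def )
qed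

lemma rescaled_generator_iff:
  "(x, y) \<in> generator (rescaled a T) \<longleftrightarrow> (x, y + a *\<^sub>C x) \<in> generator T"
proof
  interpret r: c0 "rescaled a T" by unfold_locales (rule C0_rescaled)
  show "(x, y + a *\<^sub>C x) \<in> generator T" if "(x, y) \<in> generator (rescaled a T)"
    using r.generator_rescaled[OF that, of "- a"] by (simp add: rescaled_rescaled )
qed (use generator_rescaled[of x "y + a *\<^sub>C x" a] in simp)

text \<open>If the semigroup is a strict contraction at some \<open>t\<close>, then \<open>1 - T t\<close> is invertible, and
  \<open>T t - 1\<close> is the generator composed with \<open>\<integral>\<^sub>0\<^sup>t T s ds\<close>.\<close>

lemma generator_invertible:
  assumes t: "0 \<le> t" and contr: "norm (T t) \<le> 1 / 2"
  shows "\<exists>R. is_resolvent (generator T) 0 R"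
proof -
  let ?V = "cblinfun_apply (T t)"
  define P where "P x = int0 (\<lambda>s. cblinfun_apply (T s) x) t" for x
  have P: "clin P" unfolding P_def by (rule clin_int0_T[OF t])
  have V: "norm (?V x) \<le> 1 / 2 * norm x" for x
    using order_trans[OF norm_cblinfun_apply_le mult_right_mono[OF contr norm_ge_zero]] .
  \<comment> \<open>The inverse of \<open>1 - T t\<close> is obtained by solving
    \<open>x = T t x + z\<close> with Banach's fixed point theorem.\<close>
  have ex1: "\<exists>!x. ?V x + z = x" for z
  proof (rule banach_fix_type[of "1/2"])
    show "\<forall>x y. dist (?V x + z) (?V y + z) \<le> 1 / 2 * dist x y"
      using V by (simp add: dist_norm flip: cbl_diff)
  qed auto
  define N where "N z = (THE x. ?V x + z = x)" for z
  have N: "?V (N z) + z = N z" for z unfolding N_def by (rule theI'[OF ex1])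
  have N_eq: "x = N z" if "?V x + z = x" for x z using ex1 N that by blast
  have clN: "clin N"
    unfolding clin_def
  proof (intro conjI allI)
    have N_scaleC: "c *\<^sub>C N z = N (c *\<^sub>C z)" for c z
    proof (rule N_eq)
      show "?V (c *\<^sub>C N z) + c *\<^sub>C z = c *\<^sub>C N z"
        using N[of z] by (metis cblinfun_scaleC scaleC_add_right)
    qed
    then show "N (c *\<^sub>C z) = c *\<^sub>C N z" for c z by simp
    show "bounded_linear N"
    proof (rule bounded_linear_intro[of _ 2])
      fix y z
      have "?V (N y + N z) + (y + z) = (?V (N y) + y) + (?V (N z) + z)" by (simp add: cbl_add)
      then have "?V (N y + N z) + (y + z) = N y + N z" unfolding N .
      then show "N (y + z) = N y + N z" by (rule N_eq[symmetric])
      show "N (r *\<^sub>R z) = r *\<^sub>R N z" for r using N_scaleC[of "of_real r" z] by (simp add: scaleC_of_real)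
      have "norm (N z) \<le> norm (?V (N z)) + norm z"
        by (subst N[symmetric]) (rule norm_triangle_ineq)
      then show "norm (N z) \<le> norm z * 2" using V[of "N z"] by simp
    qed
  qed
  have R: "cblinfun_apply (Abs_cblinfun (\<lambda>z. P (N z))) z = P (N z)" for z
    using Abs_cblinfun_apply[OF clin_compose[OF P clN]] by simp
  have lin: "P (x + y) = P x + P y" "P (- x) = - P x" for x y
    using P by (auto simp: clin_def bounded_linear.linear linear_add linear_neg)
  have PV: "P (?V x) = ?V (P x)" for x
    unfolding P_def T_int0 unfolding int0_def
    by (rule Henstock_Kurzweil_Integration.integral_cong) (use t in \<open>simp add: T_commute\<close>)
  have "is_resolvent (generator T) 0 (Abs_cblinfun (\<lambda>z. P (N z)))"
    unfolding is_resolvent_def R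
  proof (intro allI iffI)
    fix x z assume x: "P (N z) = x"
    have "(P (N z), ?V (N z) - N z) \<in> generator T"
      unfolding P_def by (rule generator_int0[OF t])
    moreover have "?V (N z) - N z = - z" using N[of z] by (simp add: algebra_simps eq_neg_iff_add_eq_0)
    ultimately show "(x, 0 *\<^sub>C x - z) \<in> generator T" using x by simp
  next
    fix x z assume "(x, 0 *\<^sub>C x - z) \<in> generator T"
    then have "(x, - z) \<in> generator T" by simp
    from T_minus_id[OF this t] have "?V x - x = P (- z)" by (simp add: P_def)
    then have "?V x + P z = x" by (simp add: lin algebra_simps)
    then have "x = N (P z)" by (rule N_eq)
    moreover have "?V (P (N z)) + P z = P (N z)"
      by (metis N PV lin(1))
    then have "P (N z) = N (P z)" by (rule N_eq)
    ultimately show "P (N z) = x" by simp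
  qed
  then show ?thesis by blast
qed

text \<open>Beyond the growth bound the rescaled semigroup decays, so it is a strict contraction at
  one large time and \<open>generator_invertible\<close> applies.\<close>

lemma resolvent_exists:
  assumes a: "a \<in> half_plane (growth_bound T)"
  shows "\<exists>R. is_resolvent (generator T) a R"
proof -
  from a have "growth_bound T < ereal (Re a)" by (simp add: half_plane_def)
  then obtain w M where w: "w < Re a" and M: "\<And>t. 0 \<le> t \<Longrightarrow> norm (T t) \<le> M * exp (w * t)"
    unfolding growth_bound_def Inf_less_iff by (auto intro: that)
  define d where "d = Re a - w"
  have d: "0 < d" using w by (simp add: d_def)
  \<comment> \<open>Chosen so that
    \<open>exp (d * t) \<ge> d * t + 1 \<ge> 2 * \<bar>M\<bar>\<close>.\<close>
  define t where "t = (2 * \<bar>M\<bar> + 1) / d"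
  have t: "0 \<le> t" using d by (simp add: t_def)
  have "2 * \<bar>M\<bar> \<le> exp (d * t)"
    using exp_ge_add_one_self[of "2 * \<bar>M\<bar> + 1"] d by (simp add: t_def)
  then have "\<bar>M\<bar> * exp (- (d * t)) \<le> 1 / 2"
    by (simp add: exp_minus field_simps)
  moreover have "norm (rescaled a T t) \<le> \<bar>M\<bar> * exp (- (d * t))"
  proof -
    have "norm (rescaled a T t) = exp (- (Re a * t)) * norm (T t)"
      by (simp add: rescaled_def norm_scaleC)
    also have "\<dots> \<le> exp (- (Re a * t)) * (\<bar>M\<bar> * exp (w * t))"
      using M[OF t] by (intro mult_left_mono) (auto intro: order_trans mult_right_mono)
    also have "\<dots> = \<bar>M\<bar> * exp (- (d * t))"
      by (simp add: d_def algebra_simps flip: exp_add)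
    finally show ?thesis .
  qed
  ultimately have contr: "norm (rescaled a T t) \<le> 1 / 2" by simp
  interpret r: c0 "rescaled a T" by unfold_locales (rule C0_rescaled)
  from r.generator_invertible[OF t contr] obtain R where R: "is_resolvent (generator (rescaled a T)) 0 R" ..
  have "is_resolvent (generator T) a R"
    using R unfolding is_resolvent_def rescaled_generator_iff by (simp add: algebra_simps)
  then show ?thesis by blast
qed

lemma is_resolvent_resolvent:
  "a \<in> half_plane (growth_bound T) \<Longrightarrow> is_resolvent (generator T) a (resolvent (generator T) a)"
  using resolvent_exists resolvent_eq by metis

lemma half_plane_nonempty: "\<exists>a. a \<in> half_plane (growth_bound T)"
proof -
  obtain M w where M: "\<forall>t\<ge>0. norm (T t) \<le> M * exp (w * t)" using exponential_bound by blast
  then have "growth_bound T \<le> ereal w" unfolding growth_bound_def by (intro Inf_lower) auto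
  also have "\<dots> < ereal (w + 1)" by simp
  finally show ?thesis by (intro exI[of _ "of_real (w + 1)"]) (simp add: half_plane_def)
qed

end

subsection \<open>The adjoint semigroup\<close>

text \<open>For \<open>f\<close> and \<open>x\<close> in the domains, the pairing of
  \<open>T' s f\<close> with \<open>T (t - s) x\<close> has derivative 0 in \<open>s\<close>; its
  values at the two ends give the claim. Both domains are dense, that of \<open>generator T'\<close>
  because \<open>T'\<close> is itself strongly continuous.\<close>

lemma dual_semigroup:
  assumes T: "C0_semigroup T" and T': "C0_semigroup T'"
    and gen: "generator T' = adjoint_op (generator T)" and t: "0 \<le> t"
  shows "T' t = adjoint (T t)"
proof -
  interpret T: c0 T by unfold_locales (rule T)
  interpret T': c0 T' by unfold_locales (rule T')
  have core: "antidual_apply (cblinfun_apply (T' t) f) x = antidual_apply f (cblinfun_apply (T t) x)"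
    if f: "(f, g) \<in> generator T'" and x: "(x, y) \<in> generator T" for f g x y
  proof -
    have "((\<lambda>s. antidual_apply (cblinfun_apply (T' s) f) (cblinfun_apply (T (t - s)) x)) has_vector_derivative 0)
        (at s within {0..t})" if s: "s \<in> {0..t}" for s
    proof -
      have "((\<lambda>s. cblinfun_apply (T' s) f) has_vector_derivative cblinfun_apply (T' s) g) (at s within {0..t})"
        by (rule has_vector_derivative_within_subset[OF T'.T_has_vector_derivative[OF f]]) (use s in auto)
      moreover have "((\<lambda>s. cblinfun_apply (T (t - s)) x) has_vector_derivative (- 1) *\<^sub>R cblinfun_apply (T (t - s)) y) (at s within {0..t})"
      proof -
        have "((\<lambda>s. t - s) has_vector_derivative - 1) (at s within {0..t})"
          by (auto intro!: derivative_eq_intros)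
        moreover have "((\<lambda>s. cblinfun_apply (T s) x) has_vector_derivative cblinfun_apply (T (t - s)) y)
            (at (t - s) within (\<lambda>s. t - s) ` {0..t})"
          by (rule has_vector_derivative_within_subset[OF T.T_has_vector_derivative[OF x]]) (use s in auto)
        ultimately show ?thesis
          using vector_diff_chain_within[of "\<lambda>s. t - s" "- 1" s "{0..t}" "\<lambda>s. cblinfun_apply (T s) x"]
          by (simp add: o_def)
      qed
      ultimately have "((\<lambda>s. antidual_apply (cblinfun_apply (T' s) f) (cblinfun_apply (T (t - s)) x)) has_vector_derivative
          antidual_apply (cblinfun_apply (T' s) f) ((- 1) *\<^sub>R cblinfun_apply (T (t - s)) y)
          + antidual_apply (cblinfun_apply (T' s) g) (cblinfun_apply (T (t - s)) x)) (at s within {0..t})"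
        by (rule bounded_bilinear.has_vector_derivative[OF bounded_bilinear_antidual_apply])
      moreover have "antidual_apply (cblinfun_apply (T' s) f) (cblinfun_apply (T (t - s)) y)
          = antidual_apply (cblinfun_apply (T' s) g) (cblinfun_apply (T (t - s)) x)"
      proof -
        have "(cblinfun_apply (T' s) f, cblinfun_apply (T' s) g) \<in> adjoint_op (generator T)"
          using T'.generator_T[OF f, of s] s gen by simp
        moreover have "(cblinfun_apply (T (t - s)) x, cblinfun_apply (T (t - s)) y) \<in> generator T"
          using T.generator_T[OF x, of "t - s"] s by simp
        ultimately show ?thesis by (auto simp: adjoint_op_def)
      qed
      ultimately show ?thesis
        by (simp add: bounded_bilinear.minus_right[OF bounded_bilinear_antidual_apply])
    qed
    then obtain c where "\<And>s. s \<in> {0..t} \<Longrightarrow>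
        antidual_apply (cblinfun_apply (T' s) f) (cblinfun_apply (T (t - s)) x) = c"
      using has_vector_derivative_zero_constant[of "{0..t}"] by blast
    from this[of 0] this[of t] show ?thesis using t by simp
  qed
  have "antidual_apply (cblinfun_apply (T' t) f) x = antidual_apply f (cblinfun_apply (T t) x)"
    if f: "f \<in> Domain (generator T')" for f x
  proof (rule dense_eqI[where f = "antidual_apply (cblinfun_apply (T' t) f)" and x = x, OF T.domain_dense])
    show "continuous_on UNIV (\<lambda>x. antidual_apply f (cblinfun_apply (T t) x))"
      by (intro linear_continuous_on bounded_linear_compose[OF bounded_linear_antidual_apply]
          bounded_linear_cblinfun_apply)
  qed (use core f in \<open>auto intro: linear_continuous_on bounded_linear_antidual_apply\<close>)
  then show ?thesis
    by (intro cblinfun_dense_eqI[OF T'.domain_dense] antidual_eqI) (simp add: adjoint_apply)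
qed

lemma half_plane_dual_semigroup:
  assumes T: "C0_semigroup T" and T': "C0_semigroup T'"
    and gen: "generator T' = adjoint_op (generator T)" and a: "a \<in> half_plane (growth_bound T')"
  shows "cnj a \<in> half_plane (growth_bound T)"
proof -
  have "growth_bound T \<le> growth_bound T'"
    unfolding growth_bound_def
  proof (rule Inf_superset_mono, safe)
    fix w M assume M: "\<forall>t\<ge>0. norm (T' t) \<le> M * exp (w * t)"
    have "norm (T t) \<le> M * exp (w * t)" if "0 \<le> t" for t
      using norm_le_norm_adjoint[of "T t"] M that dual_semigroup[OF T T' gen that] by (metis order_trans)
    then show "\<exists>w'. ereal w = ereal w' \<and> (\<exists>M. \<forall>t\<ge>0. norm (T t) \<le> M * exp (w' * t))" by blast
  qed
  then show ?thesis using a by (auto simp: half_plane_def)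
qed

section \<open>Operator-valued convolutions\<close>

text \<open>Unlike \<open>kernel\<close>, this constrains nonnegative times only, since a semigroup
  has no meaningful values at negative ones.\<close>

definition strong_kernel :: "(real \<Rightarrow> 'u::complex_banach \<Rightarrow> 'e::complex_banach) \<Rightarrow> bool"
  where "strong_kernel K \<longleftrightarrow> (\<forall>t\<ge>0. clin (K t)) \<and> (\<forall>x. continuous_on {0..} (\<lambda>t. K t x))"

lemma strong_kernelI:
  "(\<And>t. 0 \<le> t \<Longrightarrow> clin (K t)) \<Longrightarrow> (\<And>x. continuous_on {0..} (\<lambda>t. K t x)) \<Longrightarrow> strong_kernel K"
  by (simp add: strong_kernel_def)

lemma strong_kernelD:
  "strong_kernel K \<Longrightarrow> 0 \<le> t \<Longrightarrow> clin (K t)"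
  "strong_kernel K \<Longrightarrow> continuous_on {0..} (\<lambda>t. K t x)"
  by (simp_all add: strong_kernel_def)

lemma clin_add: "clin f \<Longrightarrow> clin g \<Longrightarrow> clin (\<lambda>x. f x + g x)"
  by (simp add: clin_def bounded_linear_add scaleC_add_right)

lemma clin_diff: "clin f \<Longrightarrow> clin g \<Longrightarrow> clin (\<lambda>x. f x - g x)"
  by (simp add: clin_def bounded_linear_sub scaleC_diff_right)

lemma clin_times_scaleC: "clin f \<Longrightarrow> clin (\<lambda>x. c *\<^sub>C f x)"
  by (simp add: clin_def bounded_linear_compose[OF bounded_linear_scaleC] scaleC_scaleC mult.commute)

lemma clin_times_scaleR: "clin f \<Longrightarrow> clin (\<lambda>x. r *\<^sub>R f x)"
  using clin_times_scaleC[of f "of_real r"] by (simp add: scaleC_of_real)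

lemma clin_ident: "clin (\<lambda>x. x)"
  by (simp add: clin_def)

lemma strong_kernel_clin: "clin \<eta> \<Longrightarrow> strong_kernel K \<Longrightarrow> strong_kernel (\<lambda>t x. \<eta> (K t x))"
  by (auto simp: strong_kernel_def intro: clin_compose bounded_linear.continuous_on[OF clin_bl])

lemma strong_kernel_compose: "clin b \<Longrightarrow> strong_kernel K \<Longrightarrow> strong_kernel (\<lambda>t x. K t (b x))"
  by (auto simp: strong_kernel_def intro: clin_compose)

lemma strong_kernel_add: "strong_kernel K \<Longrightarrow> strong_kernel K' \<Longrightarrow> strong_kernel (\<lambda>t x. K t x + K' t x)"
  by (auto simp: strong_kernel_def intro: clin_add continuous_on_add)

lemma strong_kernel_diff: "strong_kernel K \<Longrightarrow> strong_kernel K' \<Longrightarrow> strong_kernel (\<lambda>t x. K t x - K' t x)"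
  by (auto simp: strong_kernel_def intro: clin_diff continuous_on_diff)

lemma strong_kernel_times: "clin b \<Longrightarrow> strong_kernel (\<lambda>t x. t *\<^sub>R b x)"
  by (auto simp: strong_kernel_def intro!: clin_times_scaleR continuous_intros)

lemma strong_kernel_const: "clin b \<Longrightarrow> strong_kernel (\<lambda>t x. b x)"
  by (auto simp: strong_kernel_def)

text \<open>Integration by parts; the boundary terms vanish because \<open>t - s\<close> is 0 at
  \<open>t\<close> and \<open>int0 w\<close> is 0 at 0.\<close>

lemma integral_weighted_int0:
  fixes w :: "real \<Rightarrow> 'e::banach"
  assumes w: "continuous_on {0..} w" and t: "0 \<le> t"
  shows "integral {0..t} (\<lambda>s. (t - s) *\<^sub>R w s) = int0 (int0 w) t"
proof -
  have w': "continuous_on {0..t} w" "continuous_on {0..t} (int0 w)"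
    by (auto intro: continuous_on_subset[OF w] continuous_on_subset[OF continuous_on_int0[OF w]])
  have "((\<lambda>s. (t - s) *\<^sub>R w s + (- 1) *\<^sub>R int0 w s) has_integral (t - t) *\<^sub>R int0 w t - (t - 0) *\<^sub>R int0 w 0) {0..t}"
  proof (rule fundamental_theorem_of_calculus[OF t])
    fix s assume s: "s \<in> {0..t}"
    have "((\<lambda>s. t - s) has_vector_derivative - 1) (at s within {0..t})"
      by (auto intro!: derivative_eq_intros)
    then have "((\<lambda>s. t - s) has_field_derivative - 1) (at s within {0..t})"
      by (simp add: has_real_derivative_iff_has_vector_derivative)
    moreover have "(int0 w has_vector_derivative w s) (at s within {0..t})"
      by (rule has_vector_derivative_within_subset[OF int0_has_vector_derivative[OF w]]) (use s in auto)
    ultimately show "((\<lambda>s. (t - s) *\<^sub>R int0 w s) has_vector_derivative (t - s) *\<^sub>R w s + (- 1) *\<^sub>R int0 w s) (at s within {0..t})"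
      by (rule has_vector_derivative_scaleR)
  qed
  then have "integral {0..t} (\<lambda>s. (t - s) *\<^sub>R w s + (- 1) *\<^sub>R int0 w s) = 0"
    by (simp add: integral_unique)
  moreover have "integral {0..t} (\<lambda>s. (t - s) *\<^sub>R w s + (- 1) *\<^sub>R int0 w s)
      = integral {0..t} (\<lambda>s. (t - s) *\<^sub>R w s) + integral {0..t} (\<lambda>s. (- 1) *\<^sub>R int0 w s)"
    by (intro Henstock_Kurzweil_Integration.integral_add integrable_continuous_real continuous_intros w')
  ultimately show ?thesis by (simp add: int0_def[of "int0 w"])
qed

lemma clin_int0:
  assumes K: "strong_kernel K" and t: "0 \<le> t" and M: "\<And>s x. s \<in> {0..t} \<Longrightarrow> norm (K s x) \<le> M * norm x"
  shows "clin (\<lambda>x. int0 (\<lambda>s. K s x) t)" "norm (int0 (\<lambda>s. K s x) t) \<le> M * t * norm x"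
proof -
  have le: "norm (int0 (\<lambda>s. K s x) t) \<le> M * t * norm x" for x
    using norm_int0_le[OF strong_kernelD(2)[OF K] _ t, of x "M * norm x"] M by (simp add: mult_ac)
  have add: "int0 (\<lambda>s. K s (x + y)) t = int0 (\<lambda>s. K s x) t + int0 (\<lambda>s. K s y) t" for x y
  proof -
    have "int0 (\<lambda>s. K s (x + y)) t = int0 (\<lambda>s. K s x + K s y) t"
      unfolding int0_def by (intro Henstock_Kurzweil_Integration.integral_cong linear_add bounded_linear.linear clin_bl strong_kernelD(1)[OF K]) auto
    then show ?thesis by (simp add: int0_continuous_add strong_kernelD(2)[OF K])
  qed
  have sC: "int0 (\<lambda>s. K s (c *\<^sub>C x)) t = c *\<^sub>C int0 (\<lambda>s. K s x) t" for c x
  proof -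
    have "int0 (\<lambda>s. K s (c *\<^sub>C x)) t = int0 (\<lambda>s. c *\<^sub>C K s x) t"
      unfolding int0_def by (intro Henstock_Kurzweil_Integration.integral_cong clin_scaleC strong_kernelD(1)[OF K]) auto
    then show ?thesis by (simp add: int0_bounded_linear[OF bounded_linear_scaleC strong_kernelD(2)[OF K]])
  qed
  have "bounded_linear (\<lambda>x. int0 (\<lambda>s. K s x) t)"
  proof (rule bounded_linear_intro[of _ "M * t"])
    show "int0 (\<lambda>s. K s (r *\<^sub>R x)) t = r *\<^sub>R int0 (\<lambda>s. K s x) t" for r x
      using sC[of "of_real r" x] by (simp add: scaleC_of_real)
  qed (use le add in \<open>auto simp: mult.commute\<close>)
  then show "clin (\<lambda>x. int0 (\<lambda>s. K s x) t)" using sC by (simp add: clin_def)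
  show "norm (int0 (\<lambda>s. K s x) t) \<le> M * t * norm x" by (rule le)
qed

text \<open>An input with coordinates of its space: operator-valued convolutions become finite sums
  of scalar signals convolved with the continuous functions \<open>K t (e i)\<close>.\<close>

locale signal =
  fixes I :: "'i set" and e :: "'i \<Rightarrow> 'u::complex_banach" and \<xi> :: "'i \<Rightarrow> 'u \<Rightarrow> complex" and u :: "real \<Rightarrow> 'u"
  assumes frame: "frame I e \<xi>" and u: "L1_loc u"
begin

lemma loc_int_coord: "i \<in> I \<Longrightarrow> loc_int (\<lambda>s. \<xi> i (u s))"
  using frame u by (intro L1_loc_coord(1)) (auto simp: frame_def)

lemma expansion:
  assumes "clin F"
  shows "F (u s) = (\<Sum>i\<in>I. \<xi> i (u s) *\<^sub>C F (e i))"
proof -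
  have "F (u s) = F (\<Sum>i\<in>I. \<xi> i (u s) *\<^sub>C e i)" using frame by (simp add: frame_def)
  then show ?thesis using assms by (simp add: clin_sum clin_scaleC)
qed

lemma opconv_has_integral:
  assumes K: "strong_kernel K"
  shows "((\<lambda>s. K (t - s) (u s)) has_integral (\<Sum>i\<in>I. conv (\<lambda>t. K t (e i)) (\<lambda>s. \<xi> i (u s)) t)) {0..t}"
proof -
  have "((\<lambda>s. \<Sum>i\<in>I. \<xi> i (u s) *\<^sub>C K (t - s) (e i)) has_integral
      (\<Sum>i\<in>I. conv (\<lambda>t. K t (e i)) (\<lambda>s. \<xi> i (u s)) t)) {0..t}"
    unfolding conv_def
    by (intro has_integral_sum integrable_integral conv_integrable loc_int_coord strong_kernelD(2)[OF K])
      (use frame in \<open>auto simp: frame_def\<close>)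
  moreover have "K (t - s) (u s) = (\<Sum>i\<in>I. \<xi> i (u s) *\<^sub>C K (t - s) (e i))" if "s \<in> {0..t}" for s
    using that by (intro expansion strong_kernelD(1)[OF K]) auto
  ultimately show ?thesis by (subst has_integral_cong) auto
qed

lemma opconv_eq: "strong_kernel K \<Longrightarrow> opconv K u t = (\<Sum>i\<in>I. conv (\<lambda>t. K t (e i)) (\<lambda>s. \<xi> i (u s)) t)"
  unfolding opconv_def by (rule integral_unique[OF opconv_has_integral])

lemma opconv_integrable: "strong_kernel K \<Longrightarrow> (\<lambda>s. K (t - s) (u s)) integrable_on {0..t}"
  using opconv_has_integral by blast

lemma opconv_cong: "(\<And>s x. 0 \<le> s \<Longrightarrow> K s x = K' s x) \<Longrightarrow> opconv K u t = opconv K' u t"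
  unfolding opconv_def by (intro Henstock_Kurzweil_Integration.integral_cong) auto

lemma opconv_clin:
  assumes "clin \<eta>" "strong_kernel K"
  shows "opconv (\<lambda>t x. \<eta> (K t x)) u t = \<eta> (opconv K u t)"
  using integral_linear[OF opconv_integrable[OF assms(2)] clin_bl[OF assms(1)], of t]
  by (simp add: opconv_def o_def)

lemma opconv_add:
  assumes "strong_kernel K" "strong_kernel K'"
  shows "opconv (\<lambda>t x. K t x + K' t x) u t = opconv K u t + opconv K' u t"
  unfolding opconv_def
  by (rule Henstock_Kurzweil_Integration.integral_add[OF opconv_integrable[OF assms(1)] opconv_integrable[OF assms(2)]])

lemma opconv_diff:
  assumes "strong_kernel K" "strong_kernel K'"
  shows "opconv (\<lambda>t x. K t x - K' t x) u t = opconv K u t - opconv K' u t"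
  unfolding opconv_def
  by (rule Henstock_Kurzweil_Integration.integral_diff[OF opconv_integrable[OF assms(1)] opconv_integrable[OF assms(2)]])

lemma continuous_on_opconv:
  assumes K: "strong_kernel K"
  shows "continuous_on {0..} (opconv K u)"
proof -
  have "continuous_on {0..} (\<lambda>t. \<Sum>i\<in>I. conv (\<lambda>t. K t (e i)) (\<lambda>s. \<xi> i (u s)) t)"
    by (intro continuous_on_sum continuous_on_conv loc_int_coord strong_kernelD(2)[OF K])
  then show ?thesis by (simp add: opconv_eq[OF K, abs_def])
qed

lemma int0_opconv:
  assumes K: "strong_kernel K" and K': "strong_kernel (\<lambda>t x. int0 (\<lambda>s. K s x) t)" and t: "0 \<le> t"
  shows "int0 (opconv K u) t = opconv (\<lambda>t x. int0 (\<lambda>s. K s x) t) u t"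
proof -
  have "int0 (opconv K u) t = int0 (\<lambda>t. \<Sum>i\<in>I. conv (\<lambda>t. K t (e i)) (\<lambda>s. \<xi> i (u s)) t) t"
    by (simp add: opconv_eq[OF K, abs_def])
  also have "\<dots> = (\<Sum>i\<in>I. int0 (conv (\<lambda>t. K t (e i)) (\<lambda>s. \<xi> i (u s))) t)"
    unfolding int0_def
  proof (rule integral_sum)
    fix i assume "i \<in> I"
    then have "continuous_on {0..} (conv (\<lambda>t. K t (e i)) (\<lambda>s. \<xi> i (u s)))"
      by (intro continuous_on_conv loc_int_coord strong_kernelD(2)[OF K])
    then show "conv (\<lambda>t. K t (e i)) (\<lambda>s. \<xi> i (u s)) integrable_on {0..t}"
      by (intro integrable_continuous_real) (rule continuous_on_subset, auto)
  qed (use frame in \<open>auto simp: frame_def\<close>)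
  also have "\<dots> = (\<Sum>i\<in>I. conv (int0 (\<lambda>t. K t (e i))) (\<lambda>s. \<xi> i (u s)) t)"
    by (intro sum.cong refl fun_cong[OF int0_conv] loc_int_coord strong_kernelD(2)[OF K])
  finally show ?thesis by (simp add: opconv_eq[OF K'])
qed

end

subsection \<open>Extension of isometries\<close>

text \<open>Equal norms make \<open>r x\<close> a well-defined isometric function of
  \<open>j x\<close>. It extends by uniform continuity, and density preserves additivity, one
  argument at a time.\<close>

lemma extend_isometry:
  fixes j :: "'a::complex_banach \<Rightarrow>\<^sub>C\<^sub>L 'b::complex_banach" and r :: "'a \<Rightarrow>\<^sub>C\<^sub>L 'd::complex_banach"
  assumes dense: "closure (range (cblinfun_apply j)) = UNIV"
    and iso: "\<And>x. norm (cblinfun_apply r x) = norm (cblinfun_apply j x)"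
  shows "\<exists>J. \<forall>x. cblinfun_apply J (cblinfun_apply j x) = cblinfun_apply r x"
proof -
  define f where "f v = cblinfun_apply r (SOME x. cblinfun_apply j x = v)" for v
  have f: "f (cblinfun_apply j x) = cblinfun_apply r x" for x
  proof -
    have "cblinfun_apply j (SOME x'. cblinfun_apply j x' = cblinfun_apply j x) = cblinfun_apply j x"
      by (rule someI) (rule refl)
    then show ?thesis using iso[of "(SOME x'. cblinfun_apply j x' = cblinfun_apply j x) - x"]
      by (simp add: f_def cbl_diff)
  qed
  have "uniformly_continuous_on (range (cblinfun_apply j)) f"
    unfolding uniformly_continuous_on_def
  proof (intro allI impI)
    fix \<epsilon> :: real assume "0 < \<epsilon>"
    moreover have "dist (f (cblinfun_apply j y)) (f (cblinfun_apply j x))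
        = dist (cblinfun_apply j y) (cblinfun_apply j x)" for x y
      using iso[of "y - x"] by (simp add: f dist_norm cbl_diff)
    ultimately show "\<exists>d>0. \<forall>x\<in>range (cblinfun_apply j). \<forall>x'\<in>range (cblinfun_apply j). dist x' x < d \<longrightarrow> dist (f x') (f x) < \<epsilon>"
      by (intro exI[of _ \<epsilon>]) auto
  qed
  from uniformly_continuous_on_extension_on_closure[OF this]
  obtain g where g: "uniformly_continuous_on (closure (range (cblinfun_apply j))) g"
    "\<And>x. x \<in> range (cblinfun_apply j) \<Longrightarrow> f x = g x" by metis
  have cg: "continuous_on UNIV g" using uniformly_continuous_imp_continuous[OF g(1)] dense by simp
  have gj: "g (cblinfun_apply j x) = cblinfun_apply r x" for x using g(2) f by simp
  have "clin g"
    unfolding clin_def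
  proof (intro conjI allI)
    have cont: "continuous_on UNIV (\<lambda>v. g (h v))" if "continuous_on UNIV h" for h :: "'b \<Rightarrow> 'b"
      by (rule continuous_on_compose2[OF cg that]) auto
    have sC: "g (c *\<^sub>C v) = c *\<^sub>C g v" for c v
    proof (rule dense_eqI[where f = "\<lambda>v. g (c *\<^sub>C v)" and x = v, OF dense])
      show "g (c *\<^sub>C v) = c *\<^sub>C g v" if "v \<in> range (cblinfun_apply j)" for v
        using that by (auto simp: gj simp flip: cblinfun_scaleC)
    qed (intro cont continuous_on_scaleC continuous_intros cg)+
    then show "g (c *\<^sub>C v) = c *\<^sub>C g v" for c v .
    show "bounded_linear g"
    proof (rule bounded_linear_intro[of _ 1])
      show "g (r *\<^sub>R v) = r *\<^sub>R g v" for r v using sC[of "of_real r" v] by (simp add: scaleC_of_real)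
      have 1: "g (cblinfun_apply j x + w) = g (cblinfun_apply j x) + g w" for x w
      proof (rule dense_eqI[where f = "\<lambda>w. g (cblinfun_apply j x + w)" and x = w, OF dense])
        show "g (cblinfun_apply j x + w) = g (cblinfun_apply j x) + g w" if "w \<in> range (cblinfun_apply j)" for w
          using that by (auto simp: gj simp flip: cbl_add)
      qed (intro cont continuous_intros cg)+
      show "g (v + w) = g v + g w" for v w
      proof (rule dense_eqI[where f = "\<lambda>v. g (v + w)" and x = v, OF dense])
        show "g (v + w) = g v + g w" if "v \<in> range (cblinfun_apply j)" for v
          using that by (auto simp: 1)
      qed (intro cont continuous_intros cg)+
      have "norm (g v) = norm v" for v
      proof (rule dense_eqI[where f = "\<lambda>v. norm (g v)" and x = v, OF dense])
        show "norm (g v) = norm v" if "v \<in> range (cblinfun_apply j)" for v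
          using that by (auto simp: gj iso)
      qed (intro continuous_intros cg)+
      then show "norm (g v) \<le> norm v * 1" for v by simp
    qed
  qed
  then show ?thesis by (intro exI[of _ "Abs_cblinfun g"]) (simp add: Abs_cblinfun_apply gj)
qed

text \<open>Injectivity makes the preimage under \<open>F\<close> a linear function of
  \<open>z\<close>, and the equality of norms makes it bounded.\<close>

lemma factor_through_injective:
  fixes F :: "'w::complex_banach \<Rightarrow>\<^sub>C\<^sub>L 'd::complex_banach" and G :: "'z::complex_banach \<Rightarrow>\<^sub>C\<^sub>L 'd"
  assumes inj: "inj (cblinfun_apply F)" and ran: "range (cblinfun_apply G) \<subseteq> range (cblinfun_apply F)"
    and bd: "\<And>w z. cblinfun_apply F w = cblinfun_apply G z \<Longrightarrow> norm w = norm z"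
  shows "\<exists>H. \<forall>z. cblinfun_apply F (cblinfun_apply H z) = cblinfun_apply G z"
proof -
  have "\<exists>w. cblinfun_apply F w = cblinfun_apply G z" for z using ran by (metis rangeE rangeI subsetD)
  then obtain h where h: "\<And>z. cblinfun_apply F (h z) = cblinfun_apply G z" by metis
  have h_eq: "h z = w" if "cblinfun_apply F w = cblinfun_apply G z" for z w
    using injD[OF inj, of "h z" w] h[of z] that by simp
  have "clin h"
    unfolding clin_def
  proof (intro conjI allI)
    show "h (c *\<^sub>C z) = c *\<^sub>C h z" for c z
      by (rule h_eq) (simp add: cbl_simps h)
    show "bounded_linear h"
    proof (rule bounded_linear_intro[of _ 1])
      show "h (y + z) = h y + h z" "h (r *\<^sub>R z) = r *\<^sub>R h z" for y z r
        by (rule h_eq, simp add: cbl_simps h)+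
      show "norm (h z) \<le> norm z * 1" for z using bd[OF h] by simp
    qed
  qed
  then show ?thesis by (intro exI[of _ "Abs_cblinfun h"]) (simp add: Abs_cblinfun_apply h)
qed

section \<open>System nodes in terms of bounded operators on the state space\<close>

text \<open>With \<open>R = (\<beta> - A)\<^sup>-\<^sup>1\<close>, the kernel \<open>qker T \<beta>\<close> is \<open>(\<beta> - A)\<^sup>2\<close> applied to
  \<open>\<integral>\<^sub>0\<^sup>t (t - s) T s ds - t R\<close>, with all occurrences of \<open>A\<close> removed by integration.\<close>

definition qker :: "(real \<Rightarrow> 'x::complex_banach \<Rightarrow>\<^sub>C\<^sub>L 'x) \<Rightarrow> complex \<Rightarrow> real \<Rightarrow> 'x \<Rightarrow> 'x"
  where "qker T \<beta> t v = cblinfun_apply (T t) v - v + t *\<^sub>R (\<beta> *\<^sub>C v)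
    - (2 * \<beta>) *\<^sub>C int0 (\<lambda>s. cblinfun_apply (T s) v) t
    + \<beta>\<^sup>2 *\<^sub>C int0 (int0 (\<lambda>s. cblinfun_apply (T s) v)) t"

text \<open>\<open>g\<close> stands in for the transfer function at \<open>\<beta>\<close>, which
  may lie outside the half-plane of \<open>tfG\<close>. The default 0 up to time 0 makes the kernel
  causal, and \<open>qker_0\<close> makes it continuous there.\<close>

definition output_kernel :: "('u::complex_banach, 'x1::complex_banach, 'x::complex_banach,
    'xm::complex_banach, 'y::complex_banach) node \<Rightarrow> complex \<Rightarrow> ('x \<Rightarrow>\<^sub>C\<^sub>L 'x1) \<Rightarrow> ('xm \<Rightarrow>\<^sub>C\<^sub>L 'x)
    \<Rightarrow> ('u \<Rightarrow>\<^sub>C\<^sub>L 'y) \<Rightarrow> real \<Rightarrow> 'u \<Rightarrow> 'y"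
  where "output_kernel S \<beta> L J g t u = (if t \<le> 0 then 0 else
    cblinfun_apply (opC S) (cblinfun_apply L (qker (semigroup_of (opA S)) \<beta> t (cblinfun_apply J (cblinfun_apply (opB S) u))))
    + t *\<^sub>R cblinfun_apply g u)"

lemma semigroup_of:
  assumes "generates_semigroup A"
  shows "C0_semigroup (semigroup_of A)" "generator (semigroup_of A) = A"
  using someI_ex[OF assms[unfolded generates_semigroup_def]] by (auto simp: semigroup_of_def)

context c0
begin

lemma strong_kernel_T: "strong_kernel (\<lambda>t. cblinfun_apply (T t))"
  by (intro strong_kernelI clin_cblinfun T_continuous)

lemma strong_kernel_int0_T: "strong_kernel (\<lambda>t x. int0 (\<lambda>s. cblinfun_apply (T s) x) t)"
  by (intro strong_kernelI clin_int0_T continuous_on_int0 T_continuous)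

lemma strong_kernel_int0_int0_T: "strong_kernel (\<lambda>t x. int0 (int0 (\<lambda>s. cblinfun_apply (T s) x)) t)"
proof (rule strong_kernelI)
  fix t :: real assume t: "0 \<le> t"
  obtain M where M: "0 \<le> M" "\<And>s. s \<in> {0..t} \<Longrightarrow> norm (T s) \<le> M"
    using norm_T_bounded_on_Icc[of t] by blast
  have T_le: "norm (cblinfun_apply (T s) x) \<le> M * norm x" if "s \<in> {0..t}" for s x
    by (rule order_trans[OF norm_cblinfun_apply_le mult_right_mono[OF M(2)[OF that] norm_ge_zero]])
  have "norm (int0 (\<lambda>s. cblinfun_apply (T s) x) s) \<le> (M * t) * norm x" if s: "s \<in> {0..t}" for s x
  proof -
    have "norm (int0 (\<lambda>s. cblinfun_apply (T s) x) s) \<le> M * s * norm x"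
      by (rule clin_int0(2)[OF strong_kernel_T]) (use s T_le in auto)
    also have "\<dots> \<le> M * t * norm x"
      using s M(1) by (intro mult_right_mono mult_left_mono) auto
    finally show ?thesis .
  qed
  from clin_int0(1)[OF strong_kernel_int0_T t this]
  show "clin (\<lambda>x. int0 (int0 (\<lambda>s. cblinfun_apply (T s) x)) t)" .
qed (intro continuous_on_int0 T_continuous)

lemma strong_kernel_qker: "strong_kernel (qker T \<beta>)"
proof -
  have "strong_kernel (\<lambda>t v. cblinfun_apply (T t) v - v + t *\<^sub>R (\<beta> *\<^sub>C v)
    - (2 * \<beta>) *\<^sub>C int0 (\<lambda>s. cblinfun_apply (T s) v) t
    + \<beta>\<^sup>2 *\<^sub>C int0 (int0 (\<lambda>s. cblinfun_apply (T s) v)) t)"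
    by (intro strong_kernel_add strong_kernel_diff strong_kernel_T strong_kernel_const strong_kernel_times
        clin_ident clin_times_scaleC strong_kernel_clin[of "\<lambda>v. c *\<^sub>C v" for c]
        strong_kernel_int0_T strong_kernel_int0_int0_T)
  then show ?thesis by (simp add: qker_def[abs_def])
qed

lemma qker_0: "qker T \<beta> 0 v = 0"
  by (simp add: qker_def)

text \<open>By \<open>generator_int0\<close>, \<open>R\<close> undoes \<open>\<beta> - A\<close> on
  integrated orbits. The first \<open>R\<close> leaves
  \<open>\<beta> *\<^sub>C ?I2 t - ?I1 t\<close>; the second leaves the double primitive and the
  term linear in \<open>t\<close>.\<close>

lemma resolvent_qker:
  assumes R: "is_resolvent (generator T) \<beta> R" and t: "0 \<le> t"
  shows "cblinfun_apply R (cblinfun_apply R (qker T \<beta> t v))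
    = int0 (int0 (\<lambda>s. cblinfun_apply (T s) v)) t - t *\<^sub>R cblinfun_apply R v"
proof -
  let ?I1 = "int0 (\<lambda>s. cblinfun_apply (T s) v)"
  let ?I2 = "int0 ?I1"
  have 1: "cblinfun_apply R (\<beta> *\<^sub>C ?I1 s - (cblinfun_apply (T s) v - v)) = ?I1 s" if "0 \<le> s" for s
    using R generator_int0[OF that, of v] by (simp add: is_resolvent_def)
  have c: "continuous_on {0..} (\<lambda>s. \<beta> *\<^sub>C ?I1 s - (cblinfun_apply (T s) v - v))"
    by (intro continuous_intros continuous_on_scaleC continuous_on_int0 T_continuous)
  have "cblinfun_apply R (int0 (\<lambda>s. \<beta> *\<^sub>C ?I1 s - (cblinfun_apply (T s) v - v)) t)
      = int0 (\<lambda>s. cblinfun_apply R (\<beta> *\<^sub>C ?I1 s - (cblinfun_apply (T s) v - v))) t"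
    by (rule int0_bounded_linear[OF bounded_linear_cblinfun_apply c, symmetric])
  also have "\<dots> = ?I2 t"
    unfolding int0_def[of _ t] by (rule Henstock_Kurzweil_Integration.integral_cong) (simp add: 1)
  also have "int0 (\<lambda>s. \<beta> *\<^sub>C ?I1 s - (cblinfun_apply (T s) v - v)) t = \<beta> *\<^sub>C ?I2 t - (?I1 t - t *\<^sub>R v)"
  proof -
    have "int0 (\<lambda>s. v) t = t *\<^sub>R v" using t by (simp add: int0_def)
    moreover have "int0 (\<lambda>s. \<beta> *\<^sub>C ?I1 s) t = \<beta> *\<^sub>C ?I2 t"
      by (intro int0_bounded_linear bounded_linear_scaleC continuous_on_int0 T_continuous)
    ultimately show ?thesis
      by (simp add: int0_continuous_diff continuous_on_diff continuous_on_scaleC continuous_on_int0 T_continuous)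
  qed
  finally have 2: "cblinfun_apply R (\<beta> *\<^sub>C ?I2 t - (?I1 t - t *\<^sub>R v)) = ?I2 t" .
  have "qker T \<beta> t v = \<beta> *\<^sub>C (\<beta> *\<^sub>C ?I2 t - (?I1 t - t *\<^sub>R v)) - (\<beta> *\<^sub>C ?I1 t - (cblinfun_apply (T t) v - v))"
  proof -
    have "(2 * \<beta>) *\<^sub>C w = \<beta> *\<^sub>C w + \<beta> *\<^sub>C w" for w :: 'x
      by (simp only: mult_2 scaleC_add_left)
    then show ?thesis
      by (simp add: qker_def scaleC_diff_right scaleC_add_right scaleC_scaleC power2_eq_square scaleC_scaleR)
  qed
  then have "cblinfun_apply R (qker T \<beta> t v)
      = cblinfun_apply R (\<beta> *\<^sub>C (\<beta> *\<^sub>C ?I2 t - (?I1 t - t *\<^sub>R v)) - (\<beta> *\<^sub>C ?I1 t - (cblinfun_apply (T t) v - v)))"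
    by (rule arg_cong)
  also have "\<dots> = \<beta> *\<^sub>C ?I2 t - ?I1 t"
    unfolding cbl_diff[of R "\<beta> *\<^sub>C (\<beta> *\<^sub>C ?I2 t - (?I1 t - t *\<^sub>R v))"] cblinfun_scaleC[of R \<beta> "\<beta> *\<^sub>C ?I2 t - (?I1 t - t *\<^sub>R v)"] 2 1[OF t] ..
  also have "\<dots> = (\<beta> *\<^sub>C ?I2 t - (?I1 t - t *\<^sub>R v)) - t *\<^sub>R v" by simp
  also have "cblinfun_apply R \<dots> = ?I2 t - t *\<^sub>R cblinfun_apply R v"
    by (simp only: cbl_diff[of R _ "t *\<^sub>R v"] 2 cbl_scaleR)
  finally show ?thesis .
qed

lemma resolvent_inj:
  assumes "is_resolvent (generator T) \<beta> R"
  shows "inj (cblinfun_apply R)"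
proof (rule injI)
  fix z z' assume "cblinfun_apply R z = cblinfun_apply R z'"
  then have "(cblinfun_apply R z, \<beta> *\<^sub>C cblinfun_apply R z - z) \<in> generator T"
      "(cblinfun_apply R z, \<beta> *\<^sub>C cblinfun_apply R z - z') \<in> generator T"
    using assms unfolding is_resolvent_def by metis+
  then have "\<beta> *\<^sub>C cblinfun_apply R z - z = \<beta> *\<^sub>C cblinfun_apply R z - z'" by (rule generator_unique)
  then show "z = z'" by simp
qed

end

lemma range_resolvent:
  assumes "is_resolvent A \<beta> R"
  shows "range (cblinfun_apply R) = Domain A"
proof (intro equalityI subsetI)
  fix x assume "x \<in> Domain A"
  then obtain y where "(x, y) \<in> A" by blast
  then have "cblinfun_apply R (\<beta> *\<^sub>C x - y) = x" using assms by (simp add: is_resolvent_def)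
  then show "x \<in> range (cblinfun_apply R)" by (metis rangeI)
next
  fix x assume "x \<in> range (cblinfun_apply R)"
  then obtain z where "cblinfun_apply R z = x" by auto
  then have "(x, \<beta> *\<^sub>C x - z) \<in> A" using assms by (simp add: is_resolvent_def)
  then show "x \<in> Domain A" by blast
qed

text \<open>\<open>J\<close> is the extension of \<open>R\<close> to an isomorphism \<open>X\<^sub>-\<^sub>1 \<rightarrow> X\<close>, and \<open>L\<close> is \<open>R\<close> regarded as an
  isomorphism \<open>X \<rightarrow> X\<^sub>1\<close>; \<open>Ji\<close> and \<open>Li\<close> are their inverses. Unlike \<open>is_X1\<close> and \<open>is_Xm\<close>, this
  description is self-dual: adjoints exchange the roles of \<open>J\<close> and \<open>L\<close>.\<close>

locale state_rep =
  fixes S :: "('u::complex_banach, 'x1::complex_banach, 'x::complex_banach,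
    'xm::complex_banach, 'y::complex_banach) node"
    and \<beta> :: complex and R :: "'x \<Rightarrow>\<^sub>C\<^sub>L 'x" and J :: "'xm \<Rightarrow>\<^sub>C\<^sub>L 'x" and Ji :: "'x \<Rightarrow>\<^sub>C\<^sub>L 'xm"
    and L :: "'x \<Rightarrow>\<^sub>C\<^sub>L 'x1" and Li :: "'x1 \<Rightarrow>\<^sub>C\<^sub>L 'x"
  assumes gen: "generates_semigroup (opA S)"
    and res: "is_resolvent (opA S) \<beta> R"
    and J_embm: "cblinfun_apply J (cblinfun_apply (embm S) x) = cblinfun_apply R x"
    and J_Ji: "cblinfun_apply J (cblinfun_apply Ji x) = x"
    and Ji_J: "cblinfun_apply Ji (cblinfun_apply J v) = v"
    and emb1_L: "cblinfun_apply (emb1 S) (cblinfun_apply L x) = cblinfun_apply R x"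
    and L_Li: "cblinfun_apply L (cblinfun_apply Li w) = w"
    and Li_L: "cblinfun_apply Li (cblinfun_apply L x) = x"
begin

abbreviation "T \<equiv> semigroup_of (opA S)"

sublocale c0 "semigroup_of (opA S)"
  by unfold_locales (rule semigroup_of(1)[OF gen])

lemma gen_T: "generator T = opA S"
  by (rule semigroup_of(2)[OF gen])

lemma R_iff: "cblinfun_apply R z = x \<longleftrightarrow> (x, \<beta> *\<^sub>C x - z) \<in> opA S"
  using res by (simp add: is_resolvent_def)

lemma R_inj: "cblinfun_apply R z = cblinfun_apply R z' \<Longrightarrow> z = z'"
  using injD[OF resolvent_inj[unfolded gen_T, OF res]] .

lemma R_T: "0 \<le> t \<Longrightarrow> cblinfun_apply R (cblinfun_apply (T t) x) = cblinfun_apply (T t) (cblinfun_apply R x)"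
  using generator_T[unfolded gen_T, of "cblinfun_apply R x" "\<beta> *\<^sub>C cblinfun_apply R x - x" t]
    R_iff[of x "cblinfun_apply R x"]
  by (simp add: R_iff cbl_diff cblinfun_scaleC)

lemma range_R: "range (cblinfun_apply R) = Domain (opA S)"
  by (rule range_resolvent[OF res])

lemma dense_range_R: "closure (range (cblinfun_apply R)) = UNIV"
  using domain_dense by (simp add: range_R gen_T)

lemma embm_eq: "cblinfun_apply (embm S) x = cblinfun_apply Ji (cblinfun_apply R x)"
  using Ji_J[of "cblinfun_apply (embm S) x"] by (simp add: J_embm)

lemma Ji_inj: "cblinfun_apply Ji x = cblinfun_apply Ji x' \<longleftrightarrow> x = x'"
  by (metis J_Ji)

lemma dense_range_embm: "closure (range (cblinfun_apply (embm S))) = UNIV"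
proof (intro equalityI subset_UNIV subsetI)
  fix v
  have "v \<in> cblinfun_apply Ji ` closure (range (cblinfun_apply R))"
    using dense_range_R Ji_J[of v] by (metis UNIV_I imageI)
  also have "\<dots> \<subseteq> closure (cblinfun_apply Ji ` range (cblinfun_apply R))"
    by (rule closure_bounded_linear_image_subset[OF bounded_linear_cblinfun_apply])
  also have "cblinfun_apply Ji ` range (cblinfun_apply R) = range (cblinfun_apply (embm S))"
    by (auto simp: embm_eq)
  finally show "v \<in> closure (range (cblinfun_apply (embm S)))" .
qed

lemma is_resolvent_a:
  "a \<in> node_half_plane S \<Longrightarrow> is_resolvent (opA S) a (resolvent (opA S) a)"
  using is_resolvent_resolvent[of a] by (simp add: gen_T node_half_plane_def)

text \<open>The first order of the factors extends through \<open>J\<close> to \<open>'xm\<close>;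
  the second shows that the correction lies in the range of \<open>R\<close>.\<close>

lemma resolvent_identity:
  assumes "a \<in> node_half_plane S"
  shows "cblinfun_apply R z + (\<beta> - a) *\<^sub>C cblinfun_apply (resolvent (opA S) a) (cblinfun_apply R z)
      = cblinfun_apply (resolvent (opA S) a) z"
    and "cblinfun_apply R z + (\<beta> - a) *\<^sub>C cblinfun_apply R (cblinfun_apply (resolvent (opA S) a) z)
      = cblinfun_apply (resolvent (opA S) a) z"
proof -
  let ?R = "cblinfun_apply (resolvent (opA S) a)"
  have Ra: "?R z = x \<longleftrightarrow> (x, a *\<^sub>C x - z) \<in> opA S" for x z
    using is_resolvent_a[OF assms] by (simp add: is_resolvent_def)
  define x where "x = cblinfun_apply R z"
  have "(x, \<beta> *\<^sub>C x - z) \<in> opA S" using R_iff[of z x] x_def by simp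
  then have "?R (z - (\<beta> - a) *\<^sub>C x) = x"
    by (simp add: Ra scaleC_diff_left scaleC_diff_right algebra_simps)
  then have "?R z - (\<beta> - a) *\<^sub>C ?R x = x" by (simp only: cbl_diff cblinfun_scaleC)
  then show "cblinfun_apply R z + (\<beta> - a) *\<^sub>C ?R (cblinfun_apply R z) = ?R z"
    by (simp only: diff_eq_eq flip: x_def)
  define y where "y = ?R z"
  have "(y, a *\<^sub>C y - z) \<in> opA S" using Ra[of z y] y_def by simp
  then have "cblinfun_apply R (z + (\<beta> - a) *\<^sub>C y) = y"
    by (simp add: R_iff scaleC_diff_left algebra_simps)
  then show "cblinfun_apply R z + (\<beta> - a) *\<^sub>C cblinfun_apply R (?R z) = ?R z"
    by (simp add: y_def cbl_add cblinfun_scaleC)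
qed

text \<open>The resolvent identity suggests the formula, and density of the range of
  \<open>embm S\<close> identifies it with the operator singled out by \<open>THE\<close>.\<close>

lemma R_ext_eq:
  assumes a: "a \<in> node_half_plane S"
  shows "cblinfun_apply (R_ext S a) v = cblinfun_apply J v
    + (\<beta> - a) *\<^sub>C cblinfun_apply (resolvent (opA S) a) (cblinfun_apply J v)"
proof -
  define F where "F = Abs_cblinfun (\<lambda>v. cblinfun_apply J v
    + (\<beta> - a) *\<^sub>C cblinfun_apply (resolvent (opA S) a) (cblinfun_apply J v))"
  have F: "cblinfun_apply F v = cblinfun_apply J v
      + (\<beta> - a) *\<^sub>C cblinfun_apply (resolvent (opA S) a) (cblinfun_apply J v)" for v
    unfolding F_def
    by (subst Abs_cblinfun_apply) (intro clin_add clin_times_scaleC clin_compose[OF clin_cblinfun] clin_cblinfun, rule refl)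
  have "R_ext S a = F"
    unfolding R_ext_def
  proof (rule the_equality)
    show Fe: "\<forall>x. cblinfun_apply F (cblinfun_apply (embm S) x) = cblinfun_apply (resolvent (opA S) a) x"
      by (simp add: F J_embm resolvent_identity(1)[OF a])
    show "F' = F" if "\<forall>x. cblinfun_apply F' (cblinfun_apply (embm S) x) = cblinfun_apply (resolvent (opA S) a) x" for F'
      using that Fe by (intro cblinfun_dense_eqI[OF dense_range_embm]) auto
  qed
  then show ?thesis by (simp add: F)
qed

lemma T_ext_eq:
  assumes t: "0 \<le> t"
  shows "cblinfun_apply (T_ext S t) v = cblinfun_apply Ji (cblinfun_apply (T t) (cblinfun_apply J v))"
proof -
  define F where "F = Abs_cblinfun (\<lambda>v. cblinfun_apply Ji (cblinfun_apply (T t) (cblinfun_apply J v)))"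
  have F: "cblinfun_apply F v = cblinfun_apply Ji (cblinfun_apply (T t) (cblinfun_apply J v))" for v
    unfolding F_def by (subst Abs_cblinfun_apply) (intro clin_compose[OF clin_cblinfun] clin_cblinfun, rule refl)
  have "T_ext S t = F"
    unfolding T_ext_def
  proof (rule the_equality)
    show Fe: "\<forall>x. cblinfun_apply F (cblinfun_apply (embm S) x) = cblinfun_apply (embm S) (cblinfun_apply (T t) x)"
      by (simp add: F J_Ji embm_eq R_T[OF t])
    show "F' = F" if "\<forall>x. cblinfun_apply F' (cblinfun_apply (embm S) x) = cblinfun_apply (embm S) (cblinfun_apply (T t) x)" for F'
      using that Fe by (intro cblinfun_dense_eqI[OF dense_range_embm]) auto
  qed
  then show ?thesis by (simp add: F)
qed

lemma A_ext_eq: "cblinfun_apply (A_ext S) x = cblinfun_apply Ji (\<beta> *\<^sub>C cblinfun_apply R x - x)"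
proof -
  define F where "F = Abs_cblinfun (\<lambda>x. cblinfun_apply Ji (\<beta> *\<^sub>C cblinfun_apply R x - x))"
  have F: "cblinfun_apply F x = cblinfun_apply Ji (\<beta> *\<^sub>C cblinfun_apply R x - x)" for x
    unfolding F_def
    by (subst Abs_cblinfun_apply)
      (intro clin_compose[OF clin_cblinfun] clin_diff clin_times_scaleC clin_cblinfun clin_ident, rule refl)
  have "A_ext S = F"
    unfolding A_ext_def
  proof (rule the_equality)
    have Fe: "cblinfun_apply F x = cblinfun_apply (embm S) y" if "(x, y) \<in> opA S" for x y
    proof -
      have "cblinfun_apply R (\<beta> *\<^sub>C x - y) = x" using that by (simp add: R_iff)
      then have "cblinfun_apply R y = \<beta> *\<^sub>C cblinfun_apply R x - x"
        by (simp add: cbl_diff cblinfun_scaleC algebra_simps)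
      then show ?thesis by (simp add: F embm_eq)
    qed
    then show "\<forall>(x, y)\<in>opA S. cblinfun_apply F x = cblinfun_apply (embm S) y" by auto
    show "F' = F" if "\<forall>(x, y)\<in>opA S. cblinfun_apply F' x = cblinfun_apply (embm S) y" for F'
    proof (rule cblinfun_dense_eqI[OF dense_range_R])
      fix x assume "x \<in> range (cblinfun_apply R)"
      then obtain y where "(x, y) \<in> opA S" unfolding range_R by blast
      then show "cblinfun_apply F' x = cblinfun_apply F x" using that Fe by auto
    qed
  qed
  then show ?thesis by (simp add: F)
qed

lemma emb1_eq: "cblinfun_apply (emb1 S) w = cblinfun_apply R (cblinfun_apply Li w)"
  using emb1_L[of "cblinfun_apply Li w"] by (simp add: L_Li)

text \<open>Everything but \<open>J w\<close> is \<open>R\<close> of a vector, so the difference of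
  two extended resolvents lies in the range of \<open>emb1 S\<close>.\<close>

lemma R_ext_eq_R:
  assumes "a \<in> node_half_plane S"
  shows "cblinfun_apply (R_ext S a) w = cblinfun_apply J w + cblinfun_apply R ((\<beta> - a) *\<^sub>C (cblinfun_apply J w
    + (\<beta> - a) *\<^sub>C cblinfun_apply (resolvent (opA S) a) (cblinfun_apply J w)))"
  unfolding R_ext_eq[OF assms] cblinfun_scaleC cbl_add
  by (simp only: resolvent_identity(2)[OF assms])

end

text \<open>The assumption is the transfer function identity with \<open>\<beta>\<close> as second
  point, \<open>g\<close> taking the place of the value there.\<close>

locale node_rep = state_rep S \<beta> R J Ji L Li
  for S :: "('u::complex_banach, 'x1::complex_banach, 'x::complex_banach,
    'xm::complex_banach, 'y::complex_banach) node"
    and \<beta> R J Ji L Li +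
  fixes g :: "'u \<Rightarrow>\<^sub>C\<^sub>L 'y"
  assumes tf: "a \<in> node_half_plane S \<Longrightarrow> cblinfun_apply (tfG S a) u = cblinfun_apply g u
      + cblinfun_apply (opC S) (cblinfun_apply L ((\<beta> - a) *\<^sub>C (cblinfun_apply J (cblinfun_apply (opB S) u)
        + (\<beta> - a) *\<^sub>C cblinfun_apply (resolvent (opA S) a) (cblinfun_apply J (cblinfun_apply (opB S) u)))))"
begin

text \<open>Every point of the half-plane gives the same relation: changing the point shifts
  \<open>q\<close> by a change of \<open>M a\<close>, and the transfer function compensates. The
  domain condition is absorbed by \<open>x\<close> minus the input term lying in the range of
  \<open>R\<close>.\<close>

lemma CD_iff:
  "((x, u), y) \<in> CD S \<longleftrightarrow> (\<exists>q. x = cblinfun_apply J (cblinfun_apply (opB S) u) + cblinfun_apply R q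
      \<and> y = cblinfun_apply (opC S) (cblinfun_apply L q) + cblinfun_apply g u)" (is "_ \<longleftrightarrow> ?rhs")
proof -
  define v where "v = cblinfun_apply J (cblinfun_apply (opB S) u)"
  define M where "M a = (\<beta> - a) *\<^sub>C (v + (\<beta> - a) *\<^sub>C cblinfun_apply (resolvent (opA S) a) v)" for a
  have tfM: "cblinfun_apply (tfG S a) u = cblinfun_apply g u + cblinfun_apply (opC S) (cblinfun_apply L (M a))"
    if "a \<in> node_half_plane S" for a using tf[OF that] by (simp add: M_def v_def)
  have R_ext_M: "cblinfun_apply (R_ext S a) (cblinfun_apply (opB S) u) = v + cblinfun_apply R (M a)"
    if "a \<in> node_half_plane S" for a
    unfolding R_ext_eq_R[OF that] v_def M_def ..
  have "?rhs" if CD: "((x, u), y) \<in> CD S"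
  proof -
    from CD obtain a w where a: "a \<in> node_half_plane S"
      and w: "cblinfun_apply (emb1 S) w = x - cblinfun_apply (R_ext S a) (cblinfun_apply (opB S) u)"
      and y: "y = cblinfun_apply (opC S) w + cblinfun_apply (tfG S a) u"
      unfolding CD_def by auto
    have "x = v + cblinfun_apply R (cblinfun_apply Li w + M a)"
      using w by (simp add: emb1_eq R_ext_M[OF a] cbl_add algebra_simps)
    moreover have "y = cblinfun_apply (opC S) (cblinfun_apply L (cblinfun_apply Li w + M a)) + cblinfun_apply g u"
      by (simp add: y tfM[OF a] cbl_add L_Li)
    ultimately show ?thesis unfolding v_def by blast
  qed
  moreover have "((x, u), y) \<in> CD S" if x: "x = v + cblinfun_apply R q"
    and y: "y = cblinfun_apply (opC S) (cblinfun_apply L q) + cblinfun_apply g u" for q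
  proof -
    \<comment> \<open>\<open>CD\<close> asks for some point of the half-plane, so its nonemptiness
      enters here.\<close>
    obtain a where a: "a \<in> node_half_plane S"
      using half_plane_nonempty by (auto simp: node_half_plane_def)
    have "cblinfun_apply (A_ext S) x + cblinfun_apply (opB S) u
        = cblinfun_apply Ji (\<beta> *\<^sub>C cblinfun_apply R x - x) + cblinfun_apply Ji v"
      by (simp add: A_ext_eq v_def Ji_J)
    also have "\<dots> = cblinfun_apply (embm S) (\<beta> *\<^sub>C x - q)"
      by (simp add: embm_eq x cbl_simps scaleC_add_right)
    finally have "cblinfun_apply (A_ext S) x + cblinfun_apply (opB S) u \<in> range (cblinfun_apply (embm S))" by simp
    moreover have "cblinfun_apply (emb1 S) (cblinfun_apply L (q - M a)) = x - cblinfun_apply (R_ext S a) (cblinfun_apply (opB S) u)"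
      by (simp add: emb1_L R_ext_M[OF a] x cbl_diff)
    moreover have "y = cblinfun_apply (opC S) (cblinfun_apply L (q - M a)) + cblinfun_apply (tfG S a) u"
      by (simp add: y tfM[OF a] cbl_diff)
    ultimately show ?thesis using a unfolding CD_def by blast
  qed
  ultimately show ?thesis unfolding v_def by blast
qed

end

lemma is_second_derivative_cong:
  assumes "\<And>t. 0 \<le> t \<Longrightarrow> F t = F' t"
  shows "is_second_derivative y F \<longleftrightarrow> is_second_derivative y F'"
proof -
  have "integral {0..} (\<lambda>t. iter_deriv 2 \<phi> t *\<^sub>C F t) = integral {0..} (\<lambda>t. iter_deriv 2 \<phi> t *\<^sub>C F' t)" for \<phi>
    by (rule Henstock_Kurzweil_Integration.integral_cong) (simp add: assms)
  then show ?thesis by (simp add: is_second_derivative_def)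
qed

lemma regular_iff_vsd: "is_second_derivative y w \<Longrightarrow> is_regular_distribution y f \<longleftrightarrow> vsd w f"
  unfolding is_second_derivative_def is_regular_distribution_def vsd_def by simp

section \<open>Solutions with zero initial state as convolutions with the output kernel\<close>

context node_rep
begin

abbreviation "b v \<equiv> cblinfun_apply J (cblinfun_apply (opB S) v)"
abbreviation "c q \<equiv> cblinfun_apply (opC S) (cblinfun_apply L q)"
abbreviation "\<Psi> \<equiv> output_kernel S \<beta> L J g"

lemma clin_b: "clin b"
  by (intro clin_compose[OF clin_cblinfun] clin_cblinfun)

lemma clin_c: "clin c"
  by (intro clin_compose[OF clin_cblinfun] clin_cblinfun)

lemma strong_kernel_Tb: "strong_kernel (\<lambda>t v. cblinfun_apply (T t) (b v))"
  by (rule strong_kernel_compose[OF clin_b strong_kernel_T])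

lemma strong_kernel_qb: "strong_kernel (\<lambda>t v. qker T \<beta> t (b v))"
  by (rule strong_kernel_compose[OF clin_b strong_kernel_qker])

lemma strong_kernel_output: "strong_kernel (\<lambda>t v. c (qker T \<beta> t (b v)) + t *\<^sub>R cblinfun_apply g v)"
  by (intro strong_kernel_add strong_kernel_times clin_cblinfun strong_kernel_clin[OF clin_c strong_kernel_qb])

lemma output_kernel_eq: "0 \<le> t \<Longrightarrow> \<Psi> t v = c (qker T \<beta> t (b v)) + t *\<^sub>R cblinfun_apply g v"
  by (cases "t = 0") (simp_all add: output_kernel_def qker_0 cbl_0)

lemma kernel_output_kernel: "kernel \<Psi>"
  unfolding kernel_def
proof (intro conjI allI)
  show "clin (\<Psi> t)" for t
  proof (cases "0 \<le> t")
    case True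
    have "\<Psi> t = (\<lambda>v. c (qker T \<beta> t (b v)) + t *\<^sub>R cblinfun_apply g v)"
      by (rule ext) (rule output_kernel_eq[OF True])
    then show ?thesis using strong_kernelD(1)[OF strong_kernel_output True] by simp
  next
    case False
    then show ?thesis by (simp add: output_kernel_def[abs_def] clin_def)
  qed
  show "caus (\<lambda>t. \<Psi> t v)" for v
    unfolding caus_def
  proof (intro conjI allI impI)
    have "continuous_on ({..0} \<union> {0..}) (\<lambda>t. if t \<le> 0 then 0 else c (qker T \<beta> t (b v)) + t *\<^sub>R cblinfun_apply g v)"
      by (rule continuous_on_cases[OF _ _ _ strong_kernelD(2)[OF strong_kernel_output]])
        (auto simp: qker_0 cbl_0)
    moreover have "{..0} \<union> {0..} = (UNIV :: real set)" by auto
    ultimately show "continuous_on UNIV (\<lambda>t. \<Psi> t v)" by (simp add: output_kernel_def)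
  qed (simp add: output_kernel_def)
qed

end

locale node_rep_signal = node_rep S \<beta> R J Ji L Li g + signal I e \<xi> u
  for S :: "('u::complex_banach, 'x1::complex_banach, 'x::complex_banach,
    'xm::complex_banach, 'y::complex_banach) node"
    and \<beta> R J Ji L Li g
    and I :: "'i set" and e :: "'i \<Rightarrow> 'u" and \<xi> u
begin

text \<open>\<open>X\<close> is the state carried from \<open>'xm\<close> to \<open>'x\<close> by
  \<open>J\<close>; \<open>Q\<close> will be the vector \<open>q\<close> of \<open>CD_iff\<close>
  for the integrated state.\<close>

abbreviation "X \<equiv> opconv (\<lambda>t v. cblinfun_apply (T t) (b v)) u"
abbreviation "Q \<equiv> opconv (\<lambda>t v. qker T \<beta> t (b v)) u"
abbreviation "uhat t \<equiv> integral {0..t} (\<lambda>s. (t - s) *\<^sub>R u s)"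

lemma state_eq:
  assumes "0 \<le> t"
  shows "integral {0..t} (\<lambda>s. cblinfun_apply (T_ext S (t - s)) (cblinfun_apply (opB S) (u s))) = cblinfun_apply Ji (X t)"
proof -
  have "integral {0..t} (\<lambda>s. cblinfun_apply (T_ext S (t - s)) (cblinfun_apply (opB S) (u s)))
      = opconv (\<lambda>t v. cblinfun_apply Ji (cblinfun_apply (T t) (b v))) u t"
    unfolding opconv_def by (rule Henstock_Kurzweil_Integration.integral_cong) (simp add: T_ext_eq)
  also have "\<dots> = cblinfun_apply Ji (X t)" by (rule opconv_clin[OF clin_cblinfun strong_kernel_Tb])
  finally show ?thesis .
qed

lemma opconv_times: "opconv (\<lambda>t v. t *\<^sub>R F v) u t = F (uhat t)" if "clin F"
proof -
  have "opconv (\<lambda>t v. F (t *\<^sub>R v)) u t = F (opconv (\<lambda>t v. t *\<^sub>R v) u t)"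
    by (rule opconv_clin[OF that strong_kernel_times[OF clin_ident]])
  moreover have "F (r *\<^sub>R v) = r *\<^sub>R F v" for r v
    using clin_scaleC[OF that, of "of_real r"] by (simp add: scaleC_of_real)
  ultimately show ?thesis by (simp add: opconv_def)
qed

text \<open>The weighted integral is a double primitive, which passes through the convolution onto
  the semigroup. \<open>resolvent_qker\<close> splits it into the two terms that
  \<open>CD_iff\<close> expects.\<close>

lemma integrated_state:
  assumes t: "0 \<le> t"
  shows "integral {0..t} (\<lambda>s. (t - s) *\<^sub>R cblinfun_apply Ji (X s))
    = cblinfun_apply Ji (cblinfun_apply R (b (uhat t) + cblinfun_apply R (Q t)))"
proof -
  have cX: "continuous_on {0..} X" by (rule continuous_on_opconv[OF strong_kernel_Tb])
  have K1: "strong_kernel (\<lambda>t v. int0 (\<lambda>s. cblinfun_apply (T s) (b v)) t)"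
    by (rule strong_kernel_compose[OF clin_b strong_kernel_int0_T])
  have K2: "strong_kernel (\<lambda>t v. int0 (int0 (\<lambda>s. cblinfun_apply (T s) (b v))) t)"
    by (rule strong_kernel_compose[OF clin_b strong_kernel_int0_int0_T])
  have Rb: "clin (\<lambda>v. cblinfun_apply R (b v))" by (rule clin_compose[OF clin_cblinfun clin_b])
  have "integral {0..t} (\<lambda>s. (t - s) *\<^sub>R cblinfun_apply Ji (X s)) = int0 (int0 (\<lambda>s. cblinfun_apply Ji (X s))) t"
    by (rule integral_weighted_int0[OF cbl_continuous[OF cX] t])
  also have "int0 (\<lambda>s. cblinfun_apply Ji (X s)) = (\<lambda>t. cblinfun_apply Ji (int0 X t))"
    by (rule ext, rule int0_bounded_linear[OF bounded_linear_cblinfun_apply cX])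
  also have "int0 (\<lambda>t. cblinfun_apply Ji (int0 X t)) t = cblinfun_apply Ji (int0 (int0 X) t)"
    by (rule int0_bounded_linear[OF bounded_linear_cblinfun_apply continuous_on_int0[OF cX]])
  also have "int0 (int0 X) t = int0 (opconv (\<lambda>t v. int0 (\<lambda>s. cblinfun_apply (T s) (b v)) t) u) t"
    unfolding int0_def[of _ t]
    by (rule Henstock_Kurzweil_Integration.integral_cong) (rule int0_opconv[OF strong_kernel_Tb K1], simp)
  also have "\<dots> = opconv (\<lambda>t v. int0 (int0 (\<lambda>s. cblinfun_apply (T s) (b v))) t) u t"
    using int0_opconv[OF K1 K2 t] .
  also have "\<dots> = cblinfun_apply R (b (uhat t)) + cblinfun_apply R (cblinfun_apply R (Q t))"
  proof -
    have "clin (\<lambda>v. cblinfun_apply R (cblinfun_apply R v))" by (rule clin_compose[OF clin_cblinfun clin_cblinfun])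
    from opconv_clin[OF this strong_kernel_qb, symmetric]
    have "cblinfun_apply R (cblinfun_apply R (Q t))
        = opconv (\<lambda>t v. cblinfun_apply R (cblinfun_apply R (qker T \<beta> t (b v)))) u t" .
    also have "\<dots> = opconv (\<lambda>t v. int0 (int0 (\<lambda>s. cblinfun_apply (T s) (b v))) t - t *\<^sub>R cblinfun_apply R (b v)) u t"
      by (rule opconv_cong) (rule resolvent_qker[unfolded gen_T, OF res])
    also have "\<dots> = opconv (\<lambda>t v. int0 (int0 (\<lambda>s. cblinfun_apply (T s) (b v))) t) u t
        - opconv (\<lambda>t v. t *\<^sub>R cblinfun_apply R (b v)) u t"
      by (rule opconv_diff[OF K2 strong_kernel_times[OF Rb]])
    also have "opconv (\<lambda>t v. t *\<^sub>R cblinfun_apply R (b v)) u t = cblinfun_apply R (b (uhat t))"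
      by (rule opconv_times[OF Rb])
    finally show ?thesis by (simp add: algebra_simps)
  qed
  finally show ?thesis unfolding cbl_add[of R] .
qed

lemma output_eq: "c (Q t) + cblinfun_apply g (uhat t) = opconv \<Psi> u t"
proof -
  have "opconv \<Psi> u t = opconv (\<lambda>t v. c (qker T \<beta> t (b v)) + t *\<^sub>R cblinfun_apply g v) u t"
    by (rule opconv_cong) (rule output_kernel_eq)
  also have "\<dots> = opconv (\<lambda>t v. c (qker T \<beta> t (b v))) u t + opconv (\<lambda>t v. t *\<^sub>R cblinfun_apply g v) u t"
    by (rule opconv_add[OF strong_kernel_clin[OF clin_c strong_kernel_qb] strong_kernel_times[OF clin_cblinfun]])
  also have "opconv (\<lambda>t v. c (qker T \<beta> t (b v))) u t = c (Q t)"
    by (rule opconv_clin[OF clin_c strong_kernel_qb])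
  also have "opconv (\<lambda>t v. t *\<^sub>R cblinfun_apply g v) u t = cblinfun_apply g (uhat t)"
    by (rule opconv_times[OF clin_cblinfun])
  finally show ?thesis by (rule sym)
qed

text \<open>Injectivity of \<open>R\<close> determines \<open>q\<close> in \<open>CD_iff\<close>, so
  the integrated output can only be the convolution with the kernel.\<close>

lemma generalised_solution_output:
  assumes gs: "generalised_solution S u x y" and x0: "x 0 = 0"
  shows "is_second_derivative y (opconv \<Psi> u)"
proof -
  have "\<exists>\<zeta>. \<forall>t\<ge>0. x t = cblinfun_apply (embm S) (cblinfun_apply (T t) \<zeta>) +
      integral {0..t} (\<lambda>s. cblinfun_apply (T_ext S (t - s)) (cblinfun_apply (opB S) (u s)))"
    using gs unfolding generalised_solution_def by (elim conjE)
  then obtain \<zeta> where \<zeta>: "\<forall>t\<ge>0. x t = cblinfun_apply (embm S) (cblinfun_apply (T t) \<zeta>) +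
      integral {0..t} (\<lambda>s. cblinfun_apply (T_ext S (t - s)) (cblinfun_apply (opB S) (u s)))" ..
  have "\<exists>z F. (\<forall>t\<ge>0. cblinfun_apply (embm S) (z t) = integral {0..t} (\<lambda>s. (t - s) *\<^sub>R x s) \<and>
      ((z t, uhat t), F t) \<in> CD S) \<and> is_second_derivative y F"
    using gs unfolding generalised_solution_def by (elim conjE)
  then obtain z F where zF: "(\<forall>t\<ge>0. cblinfun_apply (embm S) (z t) = integral {0..t} (\<lambda>s. (t - s) *\<^sub>R x s) \<and>
      ((z t, uhat t), F t) \<in> CD S) \<and> is_second_derivative y F" by (elim exE)
  then have z: "cblinfun_apply (embm S) (z t) = integral {0..t} (\<lambda>s. (t - s) *\<^sub>R x s)"
    and F: "((z t, uhat t), F t) \<in> CD S" if "0 \<le> t" for t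
    using that by (elim conjE allE[of _ t], simp)+
  from zF have y: "is_second_derivative y F" ..
  \<comment> \<open>\<open>R\<close> and hence the embedding are injective, so the initial vector
    vanishes with \<open>x 0\<close>.\<close>
  have "cblinfun_apply (embm S) \<zeta> = 0" using \<zeta>[rule_format, of 0] x0 by simp
  then have "cblinfun_apply R \<zeta> = 0" using J_embm[of \<zeta>] by (simp add: cbl_0)
  then have "\<zeta> = 0" using R_inj[of \<zeta> 0] by (simp add: cbl_0)
  have x: "x t = cblinfun_apply Ji (X t)" if "0 \<le> t" for t
    using \<zeta>[rule_format, OF that] unfolding state_eq[OF that] \<open>\<zeta> = 0\<close> cbl_0 add_0_left .
  have "F t = opconv \<Psi> u t" if t: "0 \<le> t" for t
  proof -
    have "cblinfun_apply Ji (cblinfun_apply R (z t)) = integral {0..t} (\<lambda>s. (t - s) *\<^sub>R cblinfun_apply Ji (X s))"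
      unfolding embm_eq[symmetric] z[OF t]
      by (rule Henstock_Kurzweil_Integration.integral_cong) (simp add: x)
    then have zt: "z t = b (uhat t) + cblinfun_apply R (Q t)"
      unfolding integrated_state[OF t] Ji_inj by (rule R_inj)
    from F[OF t] obtain q where q: "z t = b (uhat t) + cblinfun_apply R q \<and> F t = c q + cblinfun_apply g (uhat t)"
      unfolding CD_iff by (elim exE)
    then have "cblinfun_apply R q = cblinfun_apply R (Q t)"
      unfolding zt by (elim conjE) (rule add_left_imp_eq, rule sym)
    then have qQ: "q = Q t" by (rule R_inj)
    show ?thesis using conjunct2[OF q] unfolding qQ output_eq .
  qed
  then show ?thesis by (rule iffD1[OF is_second_derivative_cong y])
qed

text \<open>Stability of the node speaks only of inputs that occur in solutions; this makes it speak
  of every locally integrable input.\<close>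

lemma generalised_solution_exists:
  assumes y: "is_second_derivative y (opconv \<Psi> u)"
  shows "\<exists>x. generalised_solution S u x y \<and> x 0 = 0"
proof (intro exI conjI)
  let ?x = "\<lambda>t. cblinfun_apply Ji (X t)"
  show "?x 0 = 0" by (simp add: opconv_def cbl_0)
  show "generalised_solution S u ?x y"
    unfolding generalised_solution_def
  proof (intro conjI)
    show "L1_loc u" by (rule u)
    show "continuous_on {0..} ?x"
      by (rule cbl_continuous[OF continuous_on_opconv[OF strong_kernel_Tb]])
    show "\<exists>x0. \<forall>t\<ge>0. ?x t = cblinfun_apply (embm S) (cblinfun_apply (T t) x0) +
        integral {0..t} (\<lambda>s. cblinfun_apply (T_ext S (t - s)) (cblinfun_apply (opB S) (u s)))"
      by (rule exI[of _ 0]) (simp add: state_eq cbl_0)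
    show "\<exists>z F. (\<forall>t\<ge>0. cblinfun_apply (embm S) (z t) = integral {0..t} (\<lambda>s. (t - s) *\<^sub>R ?x s) \<and>
        ((z t, uhat t), F t) \<in> CD S) \<and> is_second_derivative y F"
    proof (rule exI, rule exI, intro conjI allI impI)
      fix t :: real assume t: "0 \<le> t"
      show "cblinfun_apply (embm S) (b (uhat t) + cblinfun_apply R (Q t)) = integral {0..t} (\<lambda>s. (t - s) *\<^sub>R ?x s)"
        by (simp only: integrated_state[OF t] embm_eq)
      show "((b (uhat t) + cblinfun_apply R (Q t), uhat t), opconv \<Psi> u t) \<in> CD S"
        unfolding CD_iff output_eq[symmetric] by (rule exI[of _ "Q t"]) simp
    qed (rule y)
  qed
qed

end

context node_rep
begin

lemma solution_iff:
  fixes u :: "real \<Rightarrow> 'u"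
  assumes fr: "frame I e (\<xi> :: 'i \<Rightarrow> 'u \<Rightarrow> complex)"
  shows "(\<exists>x. generalised_solution S u x y \<and> x 0 = 0) \<longleftrightarrow> L1_loc u \<and> is_second_derivative y (opconv \<Psi> u)"
proof (cases "L1_loc u")
  case True
  interpret node_rep_signal S \<beta> R J Ji L Li g I e \<xi> u
    by unfold_locales (rule fr, rule True)
  show ?thesis
  proof
    assume "\<exists>x. generalised_solution S u x y \<and> x 0 = 0"
    then obtain x where "generalised_solution S u x y \<and> x 0 = 0" ..
    then show "L1_loc u \<and> is_second_derivative y (opconv \<Psi> u)"
      by (intro conjI True) (elim conjE, rule generalised_solution_output)
  next
    assume "L1_loc u \<and> is_second_derivative y (opconv \<Psi> u)"
    then show "\<exists>x. generalised_solution S u x y \<and> x 0 = 0"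
      by (elim conjE) (rule generalised_solution_exists)
  qed
qed (simp add: generalised_solution_def)

lemma stable_iff:
  assumes fr: "frame I e (\<xi> :: 'i \<Rightarrow> 'u \<Rightarrow> complex)"
  shows "BIBO_stable S \<longleftrightarrow> stab_inf \<Psi>" and "LILO_stable S \<longleftrightarrow> stab_one \<Psi>"
proof -
  \<comment> \<open>Generic in the input class \<open>P\<close> and the estimate \<open>N\<close>,
    so that it serves both notions.\<close>
  have all: "(\<forall>u x y. generalised_solution S u x y \<and> P u \<and> x 0 = 0 \<longrightarrow>
        (\<exists>f. is_regular_distribution y f \<and> N u f))
      \<longleftrightarrow> (\<forall>u. L1_loc u \<and> P u \<longrightarrow> (\<exists>f. vsd (opconv \<Psi> u) f \<and> N u f))" (is "?l \<longleftrightarrow> ?r")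
    for P :: "(real \<Rightarrow> 'u) \<Rightarrow> bool" and N :: "(real \<Rightarrow> 'u) \<Rightarrow> (real \<Rightarrow> 'y) \<Rightarrow> bool"
  proof
    assume l: ?l
    show ?r
    proof (intro allI impI)
      fix u assume u: "L1_loc u \<and> P u"
      \<comment> \<open>A distribution is represented by a plain map, so the required one can be
        defined by its formula.\<close>
      define y where "y \<phi> = integral {0..} (\<lambda>t. iter_deriv 2 \<phi> t *\<^sub>C opconv \<Psi> u t)" for \<phi> :: "real \<Rightarrow> complex"
      have y: "is_second_derivative y (opconv \<Psi> u)" by (simp add: is_second_derivative_def y_def)
      then have "\<exists>x. generalised_solution S u x y \<and> x 0 = 0"
        using solution_iff[OF fr, of u y] u by simp
      then obtain x where "generalised_solution S u x y \<and> x 0 = 0" ..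
      then have "\<exists>f. is_regular_distribution y f \<and> N u f"
        using l[rule_format, of u x y] u by simp
      then show "\<exists>f. vsd (opconv \<Psi> u) f \<and> N u f" by (simp only: regular_iff_vsd[OF y])
    qed
  next
    assume r: ?r
    show ?l
    proof (intro allI impI)
      fix u x y assume a: "generalised_solution S u x y \<and> P u \<and> x 0 = 0"
      then have "\<exists>x. generalised_solution S u x y \<and> x 0 = 0" by (intro exI[of _ x]) simp
      then have u: "L1_loc u" and y: "is_second_derivative y (opconv \<Psi> u)"
        using solution_iff[OF fr, of u y] by simp_all
      then show "\<exists>f. is_regular_distribution y f \<and> N u f"
        using r[rule_format, of u] a by (simp only: regular_iff_vsd[OF y] simp_thms)
    qed
  qed
  show "BIBO_stable S \<longleftrightarrow> stab_inf \<Psi>"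
    unfolding BIBO_stable_def stab_inf_def all ..
  show "LILO_stable S \<longleftrightarrow> stab_one \<Psi>"
    unfolding LILO_stable_def stab_one_def all by simp
qed

end

text \<open>\<open>J\<close> and \<open>Ji\<close> extend isometries between dense ranges;
  \<open>L\<close> and \<open>Li\<close> compare \<open>emb1 S\<close> with \<open>R\<close>, which
  have equal ranges and norms. \<open>g\<close> is computed at one point \<open>a0\<close>, and the
  identity for \<open>tfG\<close> carries it to the whole half-plane.\<close>

lemma system_node_rep:
  fixes S :: "('u::complex_banach, 'x1::complex_banach, 'x::complex_banach,
    'xm::complex_banach, 'y::complex_banach) node"
  assumes S: "system_node S"
  shows "\<exists>\<beta> R J Ji L Li g. node_rep S \<beta> R J Ji L Li g"
proof -
  have gen: "generates_semigroup (opA S)" using S by (simp add: system_node_def)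
  define T where "T = semigroup_of (opA S)"
  interpret T: c0 T unfolding T_def by unfold_locales (rule semigroup_of(1)[OF gen])
  have gT: "generator T = opA S" unfolding T_def by (rule semigroup_of(2)[OF gen])
  from S obtain \<beta> where \<beta>: "\<beta> \<in> resolvent_set (opA S)"
    and X1: "is_X1 (opA S) \<beta> (emb1 S)" and Xm: "is_Xm (opA S) \<beta> (embm S)"
    unfolding system_node_def by blast
  from \<beta> obtain R where R: "is_resolvent (opA S) \<beta> R" by (auto simp: resolvent_set_def)
  have R_iff: "(x, \<beta> *\<^sub>C x - z) \<in> opA S \<longleftrightarrow> cblinfun_apply R z = x" for x z
    using R by (simp add: is_resolvent_def)
  have injR: "inj (cblinfun_apply R)" using T.resolvent_inj R by (simp add: gT)
  have dense_R: "closure (range (cblinfun_apply R)) = UNIV"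
    using T.domain_dense by (simp add: range_resolvent[OF R] gT)
  have dense_embm: "closure (range (cblinfun_apply (embm S))) = UNIV"
    and norm_embm: "\<And>x. norm (cblinfun_apply (embm S) x) = norm (cblinfun_apply R x)"
    using Xm by (simp_all add: is_Xm_def resolvent_eq[OF R])
  obtain J where J: "\<And>x. cblinfun_apply J (cblinfun_apply (embm S) x) = cblinfun_apply R x"
    using extend_isometry[OF dense_embm norm_embm[symmetric]] by auto
  obtain Ji where Ji: "\<And>x. cblinfun_apply Ji (cblinfun_apply R x) = cblinfun_apply (embm S) x"
    using extend_isometry[OF dense_R norm_embm] by auto
  have cont: "continuous_on UNIV (\<lambda>x. cblinfun_apply F (cblinfun_apply G x))"
    for F :: "'a::complex_banach \<Rightarrow>\<^sub>C\<^sub>L 'b::complex_banach" and G :: "'d::complex_banach \<Rightarrow>\<^sub>C\<^sub>L 'a"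
    by (intro cbl_continuous linear_continuous_on bounded_linear_cblinfun_apply)
  have J_Ji: "cblinfun_apply J (cblinfun_apply Ji x) = x" for x
    by (rule dense_eqI[OF dense_R cont continuous_on_id]) (auto simp: J Ji)
  have Ji_J: "cblinfun_apply Ji (cblinfun_apply J v) = v" for v
    by (rule dense_eqI[OF dense_embm cont continuous_on_id]) (auto simp: J Ji)
  have range_emb1: "range (cblinfun_apply (emb1 S)) = range (cblinfun_apply R)"
    using X1 by (simp add: is_X1_def range_resolvent[OF R])
  have norm_emb1: "norm w = norm z" if "cblinfun_apply (emb1 S) w = cblinfun_apply R z" for w z
  proof -
    have "(cblinfun_apply (emb1 S) w, \<beta> *\<^sub>C cblinfun_apply (emb1 S) w - z) \<in> opA S"
      using that by (simp add: R_iff)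
    then have "norm w = norm (\<beta> *\<^sub>C cblinfun_apply (emb1 S) w - (\<beta> *\<^sub>C cblinfun_apply (emb1 S) w - z))"
      using X1 unfolding is_X1_def by blast
    then show ?thesis by simp
  qed
  then have norm_R: "norm z = norm w" if "cblinfun_apply R z = cblinfun_apply (emb1 S) w" for w z
    using that by metis
  have inj_emb1: "inj (cblinfun_apply (emb1 S))"
  proof (rule injI)
    fix w w' assume "cblinfun_apply (emb1 S) w = cblinfun_apply (emb1 S) w'"
    then show "w = w'" using norm_emb1[of "w - w'" 0] by (simp add: cbl_diff cbl_0)
  qed
  have "\<exists>L. \<forall>x. cblinfun_apply (emb1 S) (cblinfun_apply L x) = cblinfun_apply R x"
    by (rule factor_through_injective[OF inj_emb1]) (simp add: range_emb1, rule norm_emb1)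
  then obtain L where L: "\<And>x. cblinfun_apply (emb1 S) (cblinfun_apply L x) = cblinfun_apply R x" by auto
  have "\<exists>Li. \<forall>w. cblinfun_apply R (cblinfun_apply Li w) = cblinfun_apply (emb1 S) w"
    by (rule factor_through_injective[OF injR]) (simp add: range_emb1, rule norm_R)
  then obtain Li where Li: "\<And>w. cblinfun_apply R (cblinfun_apply Li w) = cblinfun_apply (emb1 S) w" by auto
  have L_Li: "cblinfun_apply L (cblinfun_apply Li w) = w" for w
    by (rule injD[OF inj_emb1]) (simp add: L Li)
  have Li_L: "cblinfun_apply Li (cblinfun_apply L x) = x" for x
    by (rule injD[OF injR]) (simp add: L Li)
  interpret state_rep S \<beta> R J Ji L Li
    by unfold_locales (rule gen R J J_Ji Ji_J L L_Li Li_L)+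
  obtain a0 where a0: "a0 \<in> node_half_plane S"
    using half_plane_nonempty by (auto simp: node_half_plane_def)
  define M where "M a u = (\<beta> - a) *\<^sub>C (cblinfun_apply J (cblinfun_apply (opB S) u)
      + (\<beta> - a) *\<^sub>C cblinfun_apply (resolvent (opA S) a) (cblinfun_apply J (cblinfun_apply (opB S) u)))" for a u
  define g where "g = Abs_cblinfun (\<lambda>u. cblinfun_apply (tfG S a0) u
      - cblinfun_apply (opC S) (cblinfun_apply L (M a0 u)))"
  have "clin (M a)" for a
    unfolding M_def by (intro clin_times_scaleC clin_add clin_compose[OF clin_cblinfun] clin_cblinfun)
  then have g: "cblinfun_apply g u = cblinfun_apply (tfG S a0) u - cblinfun_apply (opC S) (cblinfun_apply L (M a0 u))" for u
    unfolding g_def by (subst Abs_cblinfun_apply) (intro clin_diff clin_compose[OF clin_cblinfun] clin_cblinfun | simp)+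
  have tf: "cblinfun_apply (tfG S a) u = cblinfun_apply g u + cblinfun_apply (opC S) (cblinfun_apply L (M a u))"
    if a: "a \<in> node_half_plane S" for a u
  proof -
    obtain w where w: "cblinfun_apply (emb1 S) w = cblinfun_apply (R_ext S a) (cblinfun_apply (opB S) u)
          - cblinfun_apply (R_ext S a0) (cblinfun_apply (opB S) u)"
        "cblinfun_apply (tfG S a) u - cblinfun_apply (tfG S a0) u = cblinfun_apply (opC S) w"
      using S a a0 unfolding system_node_def by blast
    have "cblinfun_apply (emb1 S) w = cblinfun_apply (emb1 S) (cblinfun_apply L (M a u - M a0 u))"
      unfolding w(1) R_ext_eq_R[OF a] R_ext_eq_R[OF a0] L cbl_diff M_def[symmetric] by simp
    then have "w = cblinfun_apply L (M a u - M a0 u)" by (rule injD[OF inj_emb1])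
    then have "cblinfun_apply (tfG S a) u - cblinfun_apply (tfG S a0) u
        = cblinfun_apply (opC S) (cblinfun_apply L (M a u)) - cblinfun_apply (opC S) (cblinfun_apply L (M a0 u))"
      by (simp only: w(2) cbl_diff)
    then show ?thesis unfolding g by (simp add: algebra_simps)
  qed
  have "node_rep S \<beta> R J Ji L Li g"
    by unfold_locales (rule tf[unfolded M_def])
  then show ?thesis by blast
qed

section \<open>The representation of the dual node\<close>

context node_rep
begin

context
  assumes dual: "generates_semigroup (adjoint_op (opA S))"
begin

lemma semigroup_dual: "0 \<le> t \<Longrightarrow> semigroup_of (adjoint_op (opA S)) t = adjoint (T t)"
  by (rule dual_semigroup[OF C0 semigroup_of(1)[OF dual]]) (simp_all add: semigroup_of(2)[OF dual] gen_T)

text \<open>Adjoints reverse the maps, so \<open>adjoint L\<close> acts as the new \<open>J\<close>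
  and \<open>adjoint J\<close> as the new \<open>L\<close>. The transfer function identity is the
  adjoint of the one at \<open>cnj a\<close>, a point of the original half-plane.\<close>

lemma node_rep_dual:
  "node_rep (dual_node S) (cnj \<beta>) (adjoint R) (adjoint L) (adjoint Li) (adjoint J) (adjoint Ji) (adjoint g)"
proof unfold_locales
  show "generates_semigroup (opA (dual_node S))" using dual by (simp add: dual_node_def)
  show "is_resolvent (opA (dual_node S)) (cnj \<beta>) (adjoint R)"
    using is_resolvent_adjoint[OF res] by (simp add: dual_node_def)
  show "cblinfun_apply (adjoint L) (cblinfun_apply (embm (dual_node S)) f) = cblinfun_apply (adjoint R) f" for f
    by (rule antidual_eqI) (simp add: adjoint_apply dual_node_def emb1_L)
  show "cblinfun_apply (adjoint L) (cblinfun_apply (adjoint Li) f) = f" for f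
    by (rule antidual_eqI) (simp add: adjoint_apply Li_L)
  show "cblinfun_apply (adjoint Li) (cblinfun_apply (adjoint L) f) = f" for f
    by (rule antidual_eqI) (simp add: adjoint_apply L_Li)
  show "cblinfun_apply (emb1 (dual_node S)) (cblinfun_apply (adjoint J) f) = cblinfun_apply (adjoint R) f" for f
    by (rule antidual_eqI) (simp add: adjoint_apply dual_node_def J_embm)
  show "cblinfun_apply (adjoint J) (cblinfun_apply (adjoint Ji) f) = f" for f
    by (rule antidual_eqI) (simp add: adjoint_apply Ji_J)
  show "cblinfun_apply (adjoint Ji) (cblinfun_apply (adjoint J) f) = f" for f
    by (rule antidual_eqI) (simp add: adjoint_apply J_Ji)
  fix a f assume a: "a \<in> node_half_plane (dual_node S)"
  have ca: "cnj a \<in> node_half_plane S"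
    using half_plane_dual_semigroup[OF C0 semigroup_of(1)[OF dual], of a] a
    by (simp add: semigroup_of(2)[OF dual] gen_T node_half_plane_def dual_node_def)
  have "is_resolvent (adjoint_op (opA S)) a (adjoint (resolvent (opA S) (cnj a)))"
    using is_resolvent_adjoint[OF is_resolvent_a[OF ca]] by simp
  then have r: "resolvent (adjoint_op (opA S)) a = adjoint (resolvent (opA S) (cnj a))"
    by (rule resolvent_eq)
  show "cblinfun_apply (tfG (dual_node S) a) f = cblinfun_apply (adjoint g) f
      + cblinfun_apply (opC (dual_node S)) (cblinfun_apply (adjoint J) ((cnj \<beta> - a) *\<^sub>C
          (cblinfun_apply (adjoint L) (cblinfun_apply (opB (dual_node S)) f)
        + (cnj \<beta> - a) *\<^sub>C cblinfun_apply (resolvent (opA (dual_node S)) a)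
          (cblinfun_apply (adjoint L) (cblinfun_apply (opB (dual_node S)) f)))))"
    by (rule antidual_eqI)
      (simp add: dual_node_def adjoint_apply r tf[OF ca] plus_antidual.rep_eq scaleC_antidual.rep_eq
        cbl_add cblinfun_scaleC antidual_add antidual_scaleC)
qed

lemma antidual_int0_dual:
  "antidual_apply (int0 (\<lambda>s. cblinfun_apply (semigroup_of (adjoint_op (opA S)) s) f) t) v
    = antidual_apply f (int0 (\<lambda>s. cblinfun_apply (T s) v) t)" (is ?one)
  "antidual_apply (int0 (int0 (\<lambda>s. cblinfun_apply (semigroup_of (adjoint_op (opA S)) s) f)) t) v
    = antidual_apply f (int0 (int0 (\<lambda>s. cblinfun_apply (T s) v)) t)" (is ?two)
proof -
  interpret d: c0 "semigroup_of (adjoint_op (opA S))"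
    by unfold_locales (rule semigroup_of(1)[OF dual])
  have ev: "bounded_linear (\<lambda>f. antidual_apply f v)" by (rule clin_bl[OF clin_evaluation])
  have one: "antidual_apply (int0 (\<lambda>s. cblinfun_apply (semigroup_of (adjoint_op (opA S)) s) f) t) v
    = antidual_apply f (int0 (\<lambda>s. cblinfun_apply (T s) v) t)" for t
  proof -
    have "antidual_apply (int0 (\<lambda>s. cblinfun_apply (semigroup_of (adjoint_op (opA S)) s) f) t) v
        = int0 (\<lambda>s. antidual_apply (cblinfun_apply (semigroup_of (adjoint_op (opA S)) s) f) v) t"
      by (rule int0_bounded_linear[OF ev d.T_continuous, symmetric])
    also have "\<dots> = int0 (\<lambda>s. antidual_apply f (cblinfun_apply (T s) v)) t"
      unfolding int0_def
      by (rule Henstock_Kurzweil_Integration.integral_cong) (simp add: semigroup_dual adjoint_apply)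
    also have "\<dots> = antidual_apply f (int0 (\<lambda>s. cblinfun_apply (T s) v) t)"
      by (rule int0_bounded_linear[OF bounded_linear_antidual_apply T_continuous])
    finally show ?thesis .
  qed
  show ?one by (rule one)
  have "antidual_apply (int0 (int0 (\<lambda>s. cblinfun_apply (semigroup_of (adjoint_op (opA S)) s) f)) t) v
      = int0 (\<lambda>t. antidual_apply (int0 (\<lambda>s. cblinfun_apply (semigroup_of (adjoint_op (opA S)) s) f) t) v) t"
    by (rule int0_bounded_linear[OF ev continuous_on_int0[OF d.T_continuous], symmetric])
  also have "\<dots> = antidual_apply f (int0 (int0 (\<lambda>s. cblinfun_apply (T s) v)) t)"
    unfolding one
    by (rule int0_bounded_linear[OF bounded_linear_antidual_apply continuous_on_int0[OF T_continuous]])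
  finally show ?two .
qed

lemma qker_dual:
  assumes "0 \<le> t"
  shows "antidual_apply (qker (semigroup_of (adjoint_op (opA S))) (cnj \<beta>) t f) v = antidual_apply f (qker T \<beta> t v)"
  using linear_scale[OF bounded_linear.linear[OF bounded_linear_antidual_apply[of f]]]
  by (simp add: qker_def plus_antidual.rep_eq minus_antidual.rep_eq scaleC_antidual.rep_eq scaleR_antidual.rep_eq
      antidual_int0_dual semigroup_dual[OF assms] adjoint_apply antidual_add antidual_diff antidual_scaleC)

text \<open>Adjoining reverses the chain of \<open>opB\<close>, \<open>J\<close>,
  \<open>qker\<close>, \<open>L\<close> and \<open>opC\<close>, and by \<open>qker_dual\<close> the
  middle factor at \<open>cnj \<beta>\<close> is the adjoint of the one at
  \<open>\<beta>\<close>.\<close>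

lemma output_kernel_dual:
  "antidual_apply (output_kernel (dual_node S) (cnj \<beta>) (adjoint J) (adjoint L) (adjoint g) t f) v
    = antidual_apply f (\<Psi> t v)"
proof (cases "t \<le> 0")
  case True
  then show ?thesis
    by (simp add: output_kernel_def zero_antidual.rep_eq linear_0[OF bounded_linear.linear[OF bounded_linear_antidual_apply]])
next
  case False
  then show ?thesis
    using linear_scale[OF bounded_linear.linear[OF bounded_linear_antidual_apply[of f]]]
    by (simp add: output_kernel_def dual_node_def adjoint_apply plus_antidual.rep_eq scaleR_antidual.rep_eq
        qker_dual antidual_add)
qed

end

end

theorem corollary4p4:
  fixes S :: "('u::complex_banach, 'x1::complex_banach, 'x::complex_banach,
               'xm::complex_banach, 'y::complex_banach) node"
  assumes node: "system_node S"
    and U: "finite_dimensional TYPE('u)"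
    and Y: "finite_dimensional TYPE('y)"
  shows "(BIBO_stable S \<longleftrightarrow> LILO_stable S) \<and>
    (generates_semigroup (adjoint_op (opA S)) \<longrightarrow>
       (BIBO_stable S \<longleftrightarrow> BIBO_stable (dual_node S)) \<and>
       (BIBO_stable S \<longleftrightarrow> LILO_stable (dual_node S)))"
proof -
  from system_node_rep[OF node] obtain \<beta> R J Ji L Li g where "node_rep S \<beta> R J Ji L Li g" by (elim exE)
  then interpret node_rep S \<beta> R J Ji L Li g .
  obtain I :: "'u set" and e :: "'u \<Rightarrow> 'u" and \<xi> where fU: "frame I e \<xi>" by (rule finite_dimensional_frame[OF U])
  obtain I' :: "'y set" and e' :: "'y \<Rightarrow> 'y" and \<xi>' where fY: "frame I' e' \<xi>'" by (rule finite_dimensional_frame[OF Y])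
  note S_iff = stable_iff[OF fU]
  have "BIBO_stable S \<longleftrightarrow> LILO_stable S"
    unfolding S_iff by (rule stab_inf_iff_stab_one[OF kernel_output_kernel U Y])
  moreover have "(BIBO_stable S \<longleftrightarrow> BIBO_stable (dual_node S)) \<and> (BIBO_stable S \<longleftrightarrow> LILO_stable (dual_node S))"
    if dual: "generates_semigroup (adjoint_op (opA S))"
  proof -
    interpret d: node_rep "dual_node S" "cnj \<beta>" "adjoint R" "adjoint L" "adjoint Li" "adjoint J" "adjoint Ji" "adjoint g"
      by (rule node_rep_dual[OF dual])
    \<comment> \<open>The inputs of the dual node are functionals on the outputs, hence the frame
      dual to that of \<open>'y\<close>.\<close>
    note d_iff = d.stable_iff[OF frame_antidual[OF fY]]
    show ?thesis
      unfolding S_iff d_iff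
      using stab_adjoint_kernel[OF kernel_output_kernel d.kernel_output_kernel U Y output_kernel_dual[OF dual]]
      by (intro conjI)
  qed
  ultimately show ?thesis by blast
qed

end
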